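(* Let $N\ge1$, let $a\in\mathbb{R}^N$ be a constant vector, and suppose that $F\in C^1(\mathbb{R})$ satisfies $$\lim_{|s|\to0}\frac{F(s)}{|s|^{(N+1)/N}}=0.$$ Let $u_0\in L^1(\mathbb{R}^N)$, $M=\int_{\mathbb{R}^N}u_0(x)\,dx$, and let $u$ be the solution of $$u_t-\Delta u=a\cdot\nabla\bigl(F(u)\bigr)\ \text{ in }\mathbb{R}^N\times(0,\infty),\qquad u(0)=u_0.$$ Then for all $p\in[1,\infty]$, $$t^{\frac N2\left(1-\frac1p\right)}\|u(t)-MG(t)\|_p\to0\quad\text{as }t\to\infty.$$
   Context: $\|\cdot\|_p$ denotes the norm of $L^p(\mathbb{R}^N)$, and $G(x,t)=(4\pi t)^{-N/2}\exp\bigl(-|x|^2/(4t)\bigr)$ is the heat kernel, $G(t)=G(\cdot,t)$. For $F\in C^1(\mathbb{R})$ with $F(0)=0$ and $u_0\in L^1(\mathbb{R}^N)$, "the solution" is the unique solution $u\in C([0,\infty);L^1(\mathbb{R}^N))\cap L^\infty_{\rm loc}(0,\infty;L^\infty(\mathbb{R}^N))$ such that $u\in C((0,\infty);W^{2,p}(\mathbb{R}^N))\cap C^1((0,\infty);L^p(\mathbb{R}^N))$ for all $p\in(1,\infty)$. *)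

theory Defs
  imports "HOL-Analysis.Analysis" "HOL-Probability.Essential_Supremum"
begin

section \<open>Lebesgue spaces\<close>

text \<open>Elements of $L^p$ are represented by functions; all notions below only depend on the
  function up to Lebesgue-null sets.  The norm is extended-valued, so that a limit statement about
  it includes its eventual finiteness.  It is used for $1 \le p \le \infty$ only.\<close>

definition Lp_norm :: "ennreal \<Rightarrow> (real ^ 'n \<Rightarrow> real) \<Rightarrow> ennreal" where
  "Lp_norm p f =
     (if p = \<infinity> then esssup lebesgue (\<lambda>x. ennreal \<bar>f x\<bar>)
      else let I = (\<integral>\<^sup>+ x. ennreal (\<bar>f x\<bar> powr enn2real p) \<partial>lebesgue)
           in if I = \<infinity> then \<infinity> else ennreal (enn2real I powr (1 / enn2real p)))"

definition in_Lp :: "ennreal \<Rightarrow> (real ^ 'n \<Rightarrow> real) \<Rightarrow> bool" where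
  "in_Lp p f \<longleftrightarrow> f \<in> borel_measurable lebesgue \<and> Lp_norm p f < \<infinity>"

section \<open>Weak derivatives and Sobolev spaces\<close>

definition partial_deriv :: "'n \<Rightarrow> (real ^ 'n \<Rightarrow> real) \<Rightarrow> real ^ 'n \<Rightarrow> real" where
  "partial_deriv i f x = frechet_derivative f (at x) (axis i 1)"

text \<open>A list of coordinates $[i_1, \dots, i_k]$ encodes the differential operator
  $\partial_{i_1} \cdots \partial_{i_k}$ of order $k$.\<close>

primrec partial_derivs :: "'n list \<Rightarrow> (real ^ 'n \<Rightarrow> real) \<Rightarrow> real ^ 'n \<Rightarrow> real" where
  "partial_derivs [] f = f"
| "partial_derivs (i # is) f = partial_deriv i (partial_derivs is f)"

text \<open>Since total differentiability implies continuity, the first conjunct says exactly that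
  \<open>\<phi>\<close> is of class $C^\infty$.\<close>

definition test_function :: "(real ^ 'n \<Rightarrow> real) \<Rightarrow> bool" where
  "test_function \<phi> \<longleftrightarrow>
     (\<forall>\<alpha> x. partial_derivs \<alpha> \<phi> differentiable (at x)) \<and> compact (closure {x. \<phi> x \<noteq> 0})"

definition locally_integrable :: "(real ^ 'n \<Rightarrow> real) \<Rightarrow> bool" where
  "locally_integrable f \<longleftrightarrow> (\<forall>K. compact K \<longrightarrow> set_integrable lebesgue K f)"

definition has_weak_deriv :: "'n list \<Rightarrow> (real ^ 'n \<Rightarrow> real) \<Rightarrow> (real ^ 'n \<Rightarrow> real) \<Rightarrow> bool" where
  "has_weak_deriv \<alpha> f g \<longleftrightarrow> locally_integrable f \<and> locally_integrable g \<and>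
     (\<forall>\<phi>. test_function \<phi> \<longrightarrow>
        (LINT x|lebesgue. f x * partial_derivs \<alpha> \<phi> x) =
        (- 1) ^ length \<alpha> * (LINT x|lebesgue. g x * \<phi> x))"

text \<open>A weak derivative is unique up to null sets; this picks a representative and is meaningful
  only if a weak derivative exists.\<close>

definition weak_deriv :: "'n list \<Rightarrow> (real ^ 'n \<Rightarrow> real) \<Rightarrow> real ^ 'n \<Rightarrow> real" where
  "weak_deriv \<alpha> f = (SOME g. has_weak_deriv \<alpha> f g)"

definition in_Sobolev :: "nat \<Rightarrow> ennreal \<Rightarrow> (real ^ 'n \<Rightarrow> real) \<Rightarrow> bool" where
  "in_Sobolev k p f \<longleftrightarrow> in_Lp p f \<and>
     (\<forall>\<alpha>. length \<alpha> \<le> k \<longrightarrow> (\<exists>g. has_weak_deriv \<alpha> f g \<and> in_Lp p g))"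

text \<open>Mixed derivatives are counted once for each order of differentiation, which gives a norm
  equivalent to the one summing over multi-indices.\<close>

definition Sobolev_norm :: "nat \<Rightarrow> ennreal \<Rightarrow> (real ^ 'n \<Rightarrow> real) \<Rightarrow> ennreal" where
  "Sobolev_norm k p f = (\<Sum>\<alpha> | length \<alpha> \<le> k. Lp_norm p (weak_deriv \<alpha> f))"

section \<open>Functions of time with values in function spaces\<close>

text \<open>\<open>u t\<close> is the spatial profile $u(t)$ at time \<open>t\<close>.\<close>

definition norm_continuous_on ::
    "real set \<Rightarrow> ((real ^ 'n \<Rightarrow> real) \<Rightarrow> ennreal) \<Rightarrow> (real \<Rightarrow> real ^ 'n \<Rightarrow> real) \<Rightarrow> bool" where
  "norm_continuous_on T nrm u \<longleftrightarrow>
     (\<forall>s\<in>T. ((\<lambda>t. nrm (\<lambda>x. u t x - u s x)) \<longlongrightarrow> 0) (at s within T))"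

definition C_Lp :: "real set \<Rightarrow> ennreal \<Rightarrow> (real \<Rightarrow> real ^ 'n \<Rightarrow> real) \<Rightarrow> bool" where
  "C_Lp T p u \<longleftrightarrow> (\<forall>t\<in>T. in_Lp p (u t)) \<and> norm_continuous_on T (Lp_norm p) u"

definition C_Sobolev :: "real set \<Rightarrow> nat \<Rightarrow> ennreal \<Rightarrow> (real \<Rightarrow> real ^ 'n \<Rightarrow> real) \<Rightarrow> bool" where
  "C_Sobolev T k p u \<longleftrightarrow>
     (\<forall>t\<in>T. in_Sobolev k p (u t)) \<and> norm_continuous_on T (Sobolev_norm k p) u"

text \<open>\<open>u\<close> belongs to $C^1(T; L^p)$ with time derivative \<open>v\<close>, for an open interval \<open>T\<close>.\<close>

definition C1_Lp ::
    "real set \<Rightarrow> ennreal \<Rightarrow> (real \<Rightarrow> real ^ 'n \<Rightarrow> real) \<Rightarrow> (real \<Rightarrow> real ^ 'n \<Rightarrow> real) \<Rightarrow> bool" where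
  "C1_Lp T p u v \<longleftrightarrow> C_Lp T p u \<and> C_Lp T p v \<and>
     (\<forall>t\<in>T. ((\<lambda>h. Lp_norm p (\<lambda>x. (u (t + h) x - u t x) / h - v t x)) \<longlongrightarrow> 0) (at 0))"

text \<open>The space $L^\infty_{\mathrm{loc}}(0,\infty; L^\infty)$.  Measurability in time is not part of
  this predicate: in \<open>is_solution\<close> it follows from continuity in time with values in $W^{2,p}$
  for large \<open>p\<close>.\<close>

definition Linf_loc_Linf :: "(real \<Rightarrow> real ^ 'n \<Rightarrow> real) \<Rightarrow> bool" where
  "Linf_loc_Linf u \<longleftrightarrow>
     (\<forall>K. compact K \<and> K \<subseteq> {0<..} \<longrightarrow>
        (\<exists>C::real. AE t in lebesgue. t \<in> K \<longrightarrow> in_Lp \<infinity> (u t) \<and> Lp_norm \<infinity> (u t) \<le> ennreal C))"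

section \<open>The convection-diffusion equation\<close>

definition heat_kernel :: "real ^ 'n \<Rightarrow> real \<Rightarrow> real" where
  "heat_kernel x t =
     (4 * pi * t) powr (- real CARD('n) / 2) * exp (- (norm x)\<^sup>2 / (4 * t))"

text \<open>The solution of $u_t - \Delta u = a \cdot \nabla (F(u))$, $u(0) = u_0$.  For each positive
  time the equation holds almost everywhere in space; \<open>v\<close> is the time derivative of \<open>u\<close>, which does
  not depend on \<open>p\<close>, and \<open>g\<close> is the weak gradient of $F(u(t))$.\<close>

definition is_solution ::
    "real ^ 'n \<Rightarrow> (real \<Rightarrow> real) \<Rightarrow> (real ^ 'n \<Rightarrow> real) \<Rightarrow> (real \<Rightarrow> real ^ 'n \<Rightarrow> real) \<Rightarrow> bool" where
  "is_solution a F u0 u \<longleftrightarrow>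
     C_Lp {0..} 1 u \<and> Linf_loc_Linf u \<and>
     (AE x in lebesgue. u 0 x = u0 x) \<and>
     (\<forall>p. 1 < p \<and> p < \<infinity> \<longrightarrow> C_Sobolev {0<..} 2 p u) \<and>
     (\<exists>v. (\<forall>p. 1 < p \<and> p < \<infinity> \<longrightarrow> C1_Lp {0<..} p u v) \<and>
        (\<forall>t>0. \<exists>g. (\<forall>i. has_weak_deriv [i] (\<lambda>x. F (u t x)) (g i)) \<and>
           (AE x in lebesgue.
              v t x - (\<Sum>i\<in>UNIV. weak_deriv [i, i] (u t) x) = (\<Sum>i\<in>UNIV. a $ i * g i x))))"

end

theory Submission
  imports Defs "HOL-Probability.Distributions" "HOL-Computational_Algebra.Polynomial"
begin

text \<open>Write $K_r$ for the heat kernel. Testing the equation with truncated Gaussians gives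
  $K_r * v = \Delta K_r * u + (a \cdot \nabla K_r) * F(u)$ at each fixed time, and this identity is all
  that is used of the notion of solution. Letting $r \to 0$ one obtains
  $\int v \beta(u) \le 0$ for monotone Lipschitz $\beta$: the diffusion contributes a nonpositive
  Dirichlet form and the convection term, whose kernel is odd, vanishes in the limit. Hence the
  $L^1$ and $L^\infty$ norms of $u$ do not increase, and a quantitative version for
  $\beta(u) = u$ shows that the $L^2$ norm tends to 0.

  By Duhamel's formula over a short time interval the sup norm tends to 0 as well, so that eventually
  $|F(u)| \le \epsilon |u|^{1+1/N}$. This nonlinearity is critical for the rate $t^{-N/2}$, and the
  factor $\epsilon$ allows to bootstrap the sup norm to $O(t^{-N/2})$ by doubling the time interval.
  A last application of Duhamel's formula bounds the distance between $u(T+t)$ and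
  $K_t * u(T)$ by $\epsilon$ in $L^1$ and by $\epsilon t^{-N/2}$ in $L^\infty$. All norms of
  convolutions are estimated by duality. The mass of $u(T)$ is $M$, so that $K_t * u(T)$ is close to
  $M K_t$, and the other exponents follow by interpolation.\<close>

text \<open>Solutions have only weak derivatives in space and F is merely C^1, so the chain rule and
  the integration by parts behind the usual estimates are replaced by double integrals of K_r(x - y)
  against differences such as (g(x) - g(y))^2, in which u is never differentiated. The kernel
  parameter r is an auxiliary variable at fixed time: differentiating the pairing of K_r * f with g
  in r produces Delta K_r, which the equation trades for v and F(f). The obstacle is the convection
  term, bounded by r^(-1/2) times the energy: that the energy tends to 0 does not beat this factor,
  and a comparison argument in r must first improve the energy to o(sqrt r). As for the rate, |u| <=
  P s^(-N/2) turns the factor |u|^(1/N) of F(u) into s^(-1/2), which meets (\<tau> - s)^(-1/2) from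
  the gradient of the kernel. The integral of the product over (0, \<tau>) does not depend on
  \<tau>, so waiting gains nothing, and the correction is small only through \<epsilon>. This is why
  the sup norm is first driven below a threshold by L^2 dissipation, without any rate.\<close>

lemma lborel_reflect:
  "distr lborel borel (\<lambda>y. c - y) = (lborel :: 'a::euclidean_space measure)"
  using lborel_affine[of "-1" c] by (simp add: density_1)

lemma nn_integral_lborel_reflect:
  fixes c :: "'a::euclidean_space"
  assumes [measurable]: "f \<in> borel_measurable borel"
  shows "(\<integral>\<^sup>+y. f (c - y) \<partial>lborel) = (\<integral>\<^sup>+y. f y \<partial>lborel)"
  by (subst (2) lborel_reflect[of c, symmetric]) (simp add: nn_integral_distr)

lemma integral_lborel_reflect:
  fixes c :: "'a::euclidean_space" and f :: "'a \<Rightarrow> real"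
  assumes [measurable]: "f \<in> borel_measurable borel"
  shows "(LINT y|lborel. f (c - y)) = (LINT y|lborel. f y)"
  by (subst (2) lborel_reflect[of c, symmetric]) (simp add: integral_distr)

lemma integrable_lborel_reflect:
  fixes c :: "'a::euclidean_space" and f :: "'a \<Rightarrow> real"
  assumes "integrable lborel f"
  shows "integrable lborel (\<lambda>y. f (c - y))"
proof -
  have [measurable]: "f \<in> borel_measurable borel"
    using assms by (auto dest: borel_measurable_integrable)
  show ?thesis
    using assms by (subst (asm) lborel_reflect[of c, symmetric]) (simp add: integrable_distr_eq)
qed

lemma nn_integral_lborel_shift:
  fixes c :: "'a::euclidean_space"
  assumes [measurable]: "f \<in> borel_measurable borel"
  shows "(\<integral>\<^sup>+y. f (y - c) \<partial>lborel) = (\<integral>\<^sup>+y. f y \<partial>lborel)"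
  by (subst (2) lborel_distr_plus[of "-c", symmetric]) (simp add: nn_integral_distr)

lemma integral_lborel_shift:
  fixes c :: "'a::euclidean_space" and f :: "'a \<Rightarrow> real"
  assumes [measurable]: "f \<in> borel_measurable borel"
  shows "(LINT y|lborel. f (y - c)) = (LINT y|lborel. f y)"
  by (subst (2) lborel_distr_plus[of "-c", symmetric]) (simp add: integral_distr)

lemma integrable_lborel_shift:
  fixes c :: "'a::euclidean_space" and f :: "'a \<Rightarrow> real"
  assumes "integrable lborel f"
  shows "integrable lborel (\<lambda>y. f (y - c))"
proof -
  have [measurable]: "f \<in> borel_measurable borel"
    using assms by (auto dest: borel_measurable_integrable)
  show ?thesis
    using assms by (subst (asm) lborel_distr_plus[of "-c", symmetric])
        (simp add: integrable_distr_eq)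
qed

section \<open>The heat kernel\<close>

lemma heat_kernel_pos: "0 < r \<Longrightarrow> 0 < heat_kernel x r"
  by (simp add: heat_kernel_def)

lemma heat_kernel_nonneg [simp]: "0 \<le> heat_kernel x r"
  by (simp add: heat_kernel_def)

lemma heat_kernel_uminus [simp]: "heat_kernel (- x) r = heat_kernel x r"
  by (simp add: heat_kernel_def)

lemma heat_kernel_commute: "heat_kernel (x - y) r = heat_kernel (y - x) r"
  by (simp add: heat_kernel_def norm_minus_commute)

lemma heat_kernel_le:
  assumes "0 < r" shows "heat_kernel (x::real^'n) r \<le> (4 * pi * r) powr (- real CARD('n) / 2)"
  using assms by (simp add: heat_kernel_def mult_left_le)

lemma borel_measurable_heat_kernel [measurable]: "(\<lambda>x. heat_kernel x r) \<in> borel_measurable borel"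
  unfolding heat_kernel_def by measurable

text \<open>K_r is the density of a centred Gaussian vector with independent coordinates of variance
  2 r, so its mass follows from the one-dimensional normal density.\<close>

lemma heat_kernel_eq_prod:
  fixes x :: "real^'n"
  assumes "0 < r"
  shows "heat_kernel x r = (\<Prod>b\<in>Basis. normal_density 0 (sqrt (2 * r)) (x \<bullet> b))"
proof -
  have "(\<Prod>b\<in>(Basis::(real^'n) set). normal_density 0 (sqrt (2 * r)) (x \<bullet> b)) =
    (1 / sqrt (4 * pi * r)) ^ CARD('n) * exp (\<Sum>b\<in>Basis. - (x \<bullet> b)\<^sup>2 / (4 * r))"
    using assms unfolding normal_density_def
    by (simp add: prod.distrib exp_sum prod_dividef algebra_simps power_divide
        prod_constant del: real_sqrt_mult)
  also have "(\<Sum>b\<in>Basis. - (x \<bullet> b)\<^sup>2 / (4 * r)) = - (norm x)\<^sup>2 / (4 * r)"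
    by (subst power2_norm_eq_inner, subst euclidean_inner)
       (simp add: sum_negf sum_divide_distrib[symmetric] power2_eq_square)
  also have "(1 / sqrt (4 * pi * r)) ^ CARD('n) = (4 * pi * r) powr (- real CARD('n) / 2)"
  proof -
    have "1 / sqrt (4 * pi * r) = (4 * pi * r) powr (- 1 / 2)"
      using assms by (simp add: powr_minus_divide powr_half_sqrt)
    then show ?thesis using assms
      by (simp add: powr_realpow[symmetric] powr_powr del: real_sqrt_mult)
  qed
  finally show ?thesis by (simp add: heat_kernel_def)
qed

lemma nn_integral_heat_kernel:
  assumes "0 < r"
  shows "(\<integral>\<^sup>+x. ennreal (heat_kernel (x::real^'n) r) \<partial>lborel) = 1"
proof -
  have "(\<integral>\<^sup>+x. ennreal (heat_kernel (x::real^'n) r) \<partial>lborel) =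
    (\<integral>\<^sup>+x. (\<Prod>b\<in>(Basis::(real^'n) set). ennreal (normal_density 0 (sqrt (2 * r)) (x \<bullet> b))) \<partial>lborel)"
    using assms by (simp add: heat_kernel_eq_prod prod_ennreal)
  also have "\<dots> = (\<Prod>b\<in>(Basis::(real^'n) set). (\<integral>\<^sup>+x. ennreal (normal_density 0 (sqrt (2 * r)) x)
      \<partial>lborel))"
    by (rule nn_integral_lborel_prod) auto
  also have "\<dots> = 1"
    using assms by (simp add: nn_integral_eq_integral)
  finally show ?thesis .
qed

lemma integrable_heat_kernel:
  assumes "0 < r" shows "integrable lborel (\<lambda>x::real^'n. heat_kernel x r)"
  by (rule integrableI_nn_integral_finite[where x=1])
    (use nn_integral_heat_kernel[OF assms, where 'n='n] in auto)

lemma integral_heat_kernel: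
  assumes "0 < r" shows "(LINT x|lborel. heat_kernel (x::real^'n) r) = 1"
  by (rule integral_eq_nn_integral[THEN trans])
    (use nn_integral_heat_kernel[OF assms, where 'n='n] in auto)

text \<open>The derivative of the kernel in r. By the heat equation it is also Delta K_r, and in
  this role it enters the tested equation in \<open>gaussian_weak\<close>.\<close>

definition hk_dt :: "real ^ 'n \<Rightarrow> real \<Rightarrow> real" where
  "hk_dt x r = ((norm x)\<^sup>2 / (4 * r\<^sup>2) - real CARD('n) / (2 * r)) * heat_kernel x r"

definition hk_dtt :: "real ^ 'n \<Rightarrow> real \<Rightarrow> real" where
  "hk_dtt x r = (((norm x)\<^sup>2 / (4 * r\<^sup>2) - real CARD('n) / (2 * r))\<^sup>2
     - (norm x)\<^sup>2 / (2 * r ^ 3) + real CARD('n) / (2 * r\<^sup>2)) * heat_kernel x r"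

text \<open>The directional derivative a . grad K_r. Besides the convection vector, displacements
  and coordinate vectors take the place of \<open>a\<close> when translates and partial derivatives
  are bounded.\<close>

definition hk_grad :: "real ^ 'n \<Rightarrow> real ^ 'n \<Rightarrow> real \<Rightarrow> real" where
  "hk_grad a x r = - (a \<bullet> x) / (2 * r) * heat_kernel x r"

lemma borel_measurable_hk_dt [measurable]: "(\<lambda>x. hk_dt x r) \<in> borel_measurable borel"
  unfolding hk_dt_def by measurable

lemma borel_measurable_hk_grad [measurable]: "(\<lambda>x. hk_grad a x r) \<in> borel_measurable borel"
  unfolding hk_grad_def by measurable

lemma hk_grad_uminus [simp]: "hk_grad a (- x) r = - hk_grad a x r"
  by (simp add: hk_grad_def)

lemma heat_kernel_has_dt:
  fixes x :: "real^'n"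
  assumes "0 < r"
  shows "((\<lambda>r. heat_kernel x r) has_real_derivative hk_dt x r) (at r)"
proof -
  let ?p = "- real CARD('n) / 2"
  have p: "(4 * pi * r) powr (?p - 1) = (4 * pi * r) powr ?p / (4 * pi * r)"
    using assms by (simp add: powr_diff)
  have 1: "((\<lambda>r. (4 * pi * r) powr ?p) has_real_derivative (?p / r) * (4 * pi * r) powr ?p) (at r)"
  proof -
    have "((\<lambda>r. (4 * pi * r) powr ?p) has_real_derivative (?p * (4 * pi * r) powr (?p - 1)) *
        (4 * pi)) (at r)"
      by (rule DERIV_chain2[where f="\<lambda>z. z powr ?p"
          and g="\<lambda>r. 4 * pi * r", OF has_real_derivative_powr])
        (use assms in \<open>auto intro!: derivative_eq_intros\<close>)
    moreover have "(?p * (4 * pi * r) powr (?p - 1)) * (4 * pi) = ?p / r * (4 * pi * r) powr ?p"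
    proof -
      have "(?p * (A / (4 * pi * r))) * (4 * pi) = ?p / r * A" for A
        using assms by (simp add: field_simps)
      then show ?thesis by (simp only: p)
    qed
    ultimately show ?thesis by (simp only:)
  qed
  have 2: "((\<lambda>r. exp (- (norm x)\<^sup>2 / (4 * r))) has_real_derivative
      ((norm x)\<^sup>2 / (4 * r\<^sup>2)) * exp (- (norm x)\<^sup>2 / (4 * r))) (at r)"
    using assms by (auto intro!: derivative_eq_intros simp: field_simps power2_eq_square)
  show ?thesis
    unfolding heat_kernel_def hk_dt_def
    by (rule DERIV_cong[OF DERIV_mult[OF 1 2]]) (simp add: algebra_simps)
qed

lemma hk_dt_has_dt:
  fixes x :: "real^'n"
  assumes "0 < r"
  shows "((\<lambda>r. hk_dt x r) has_real_derivative hk_dtt x r) (at r)"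
  unfolding hk_dt_def hk_dtt_def using assms
  by (auto intro!: derivative_eq_intros heat_kernel_has_dt simp: hk_dt_def)
     (simp add: field_simps power2_eq_square power3_eq_cube power4_eq_xxxx)

text \<open>Half of the Gaussian exponent is split off as exp (-z) with z = |x|^2 / (8 r), ready to
  absorb powers of |x|. What remains is the kernel at 2 r, at the price of 2^(N/2).\<close>

lemma heat_kernel_double:
  fixes x :: "real^'n"
  assumes "0 < r"
  shows "heat_kernel x r = 2 powr (real CARD('n) / 2) * exp (- ((norm x)\<^sup>2 / (8 * r))) *
      heat_kernel x (2 * r)"
proof -
  have "(4 * pi * (2 * r)) powr (- real CARD('n) / 2)
      = 2 powr (- real CARD('n) / 2) * (4 * pi * r) powr (- real CARD('n) / 2)"
    using assms powr_mult[of 2 "4 * pi * r" "- real CARD('n) / 2"] by (simp add: mult_ac)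
  moreover have "exp (- ((norm x)\<^sup>2 / (8 * r))) * exp (- (norm x)\<^sup>2 / (4 * (2 * r)))
      = exp (- (norm x)\<^sup>2 / (4 * r))"
    using assms by (simp add: exp_add[symmetric] field_simps)
  moreover have "2 powr (real CARD('n) / 2) * 2 powr (- real CARD('n) / 2) = (1::real)"
    by (simp add: powr_minus)
  ultimately show ?thesis
    unfolding heat_kernel_def by (simp add: mult_ac)
qed

text \<open>Makes bounds at a variable parameter s uniform, as mean value inequalities in the
  parameter require: 2 s >= r controls the prefactor and 2 s <= 4 r the exponential.\<close>

lemma heat_kernel_widen:
  fixes x :: "real^'n"
  assumes "0 < r" "r / 2 \<le> s" "s \<le> 2 * r"
  shows "heat_kernel x (2 * s) \<le> 4 powr (real CARD('n) / 2) * heat_kernel x (4 * r)"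
proof -
  have "(4 * pi * (2 * s)) powr (- real CARD('n) / 2) \<le> (4 * pi * r) powr (- real CARD('n) / 2)"
    using assms by (intro powr_mono2') (auto simp: field_simps)
  also have "\<dots> = 4 powr (real CARD('n) / 2) * (4 * pi * (4 * r)) powr (- real CARD('n) / 2)"
    using assms powr_mult[of 4 "4 * pi * r" "- real CARD('n) / 2"] by (simp add: mult_ac powr_minus)
  finally have 1: "(4 * pi * (2 * s)) powr (- real CARD('n) / 2)
      \<le> 4 powr (real CARD('n) / 2) * (4 * pi * (4 * r)) powr (- real CARD('n) / 2)" .
  have 2: "exp (- (norm x)\<^sup>2 / (4 * (2 * s))) \<le> exp (- (norm x)\<^sup>2 / (4 * (4 * r)))"
    using assms by (auto intro!: divide_left_mono)
  show ?thesis unfolding heat_kernel_def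
    using mult_mono[OF 1 2] by (simp add: mult_ac)
qed

lemma square_mult_exp_minus_le: "(z::real)\<^sup>2 * exp (- z) \<le> 2" if "0 \<le> z"
  using exp_lower_Taylor_quadratic[OF that] that by (simp add: exp_minus field_simps)

lemma mult_exp_minus_le: "(z::real) * exp (- z) \<le> 1"
proof -
  have "z \<le> exp z" using exp_ge_add_one_self[of z] by linarith
  then show ?thesis by (simp add: exp_minus field_simps)
qed

text \<open>One constant for the three bounds below. The worst polynomial, 8 z^2 + 4 z + (N^2 + N) /
  2, is at most 20 + N^2 after multiplication by exp (-z); the generous choice also covers
  \<open>sqrt 2\<close> from the gradient.\<close>

definition hkC :: "'n::finite itself \<Rightarrow> real" where
  "hkC _ = 2 powr (real CARD('n) / 2) * (50 + 2 * (real CARD('n))\<^sup>2)"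

lemma hkC_pos: "0 < hkC TYPE('n::finite)"
  by (simp add: hkC_def add_pos_nonneg)

lemma hk_grad_bound:
  fixes x a :: "real^'n"
  assumes "0 < r"
  shows "\<bar>hk_grad a x r\<bar> \<le> norm a * hkC TYPE('n) * r powr (- 1 / 2) * heat_kernel x (2 * r)"
proof -
  define z where "z = (norm x)\<^sup>2 / (8 * r)"
  have z: "0 \<le> z" "norm x = sqrt (8 * r * z)"
    using assms by (auto simp: z_def)
  have sz: "sqrt z * exp (- z) \<le> 1"
  proof -
    have "sqrt z \<le> 1 + z"
      using z(1) by (intro real_le_lsqrt) (auto simp: power2_eq_square algebra_simps)
    then have "sqrt z \<le> exp z" using exp_ge_add_one_self[of z] by linarith
    then show ?thesis by (simp add: exp_minus field_simps)
  qed
  have "\<bar>hk_grad a x r\<bar> = \<bar>a \<bullet> x\<bar> / (2 * r) * heat_kernel x r"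
    using assms by (simp add: hk_grad_def abs_mult)
  also have "\<dots> \<le> (norm a * norm x) / (2 * r) * heat_kernel x r"
    using assms by (intro mult_right_mono divide_right_mono) (auto simp: Cauchy_Schwarz_ineq2)
  also have "norm a * norm x / (2 * r) = norm a * (sqrt 2 * sqrt z / sqrt r)"
  proof -
    have "sqrt 8 = 2 * sqrt 2" using real_sqrt_mult[of 4 2] by simp
    then show ?thesis using assms z by (simp add: real_sqrt_mult field_simps)
  qed
  also have "norm a * (sqrt 2 * sqrt z / sqrt r) * heat_kernel x r
     = (norm a * sqrt 2 * 2 powr (real CARD('n) / 2) * (1 / sqrt r) * heat_kernel x (2 * r)) *
         (sqrt z * exp (- z))"
    using assms by (subst heat_kernel_double) (auto simp: z_def)
  also have "\<dots> \<le> norm a * sqrt 2 * 2 powr (real CARD('n) / 2) * (1 / sqrt r) * heat_kernel x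
      (2 * r)"
    by (rule mult_left_le[OF sz]) (use assms in auto)
  also have "1 / sqrt r = r powr (- 1 / 2)"
    using assms by (simp add: powr_minus_divide powr_half_sqrt)
  also have "norm a * sqrt 2 * 2 powr (real CARD('n) / 2) * r powr (- 1 / 2) * heat_kernel x (2 * r)
    \<le> norm a * hkC TYPE('n) * r powr (- 1 / 2) * heat_kernel x (2 * r)"
  proof -
    have "sqrt 2 \<le> 50 + 2 * (real CARD('n))\<^sup>2"
      using sqrt2_less_2 by (smt (verit) zero_le_power2)
    then show ?thesis unfolding hkC_def
      by (intro mult_right_mono) (auto intro!: mult_left_mono simp: mult.assoc)
  qed
  finally show ?thesis .
qed

lemma hk_dt_bound:
  fixes x :: "real^'n"
  assumes "0 < r"
  shows "\<bar>hk_dt x r\<bar> \<le> hkC TYPE('n) / r * heat_kernel x (2 * r)"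
proof -
  define z where "z = (norm x)\<^sup>2 / (8 * r)"
  define N where "N = real CARD('n)"
  have N1: "N \<ge> 1" by (simp add: N_def Suc_leI)
  have z: "0 \<le> z" "(norm x)\<^sup>2 = 8 * r * z"
    using assms by (auto simp: z_def)
  have "\<bar>hk_dt x r\<bar> = \<bar>2 * z - N / 2\<bar> / r * heat_kernel x r"
  proof -
    have "hk_dt x r = (2 * z - N / 2) / r * heat_kernel x r"
      using assms unfolding hk_dt_def z N_def[symmetric] by (simp add: field_simps power2_eq_square)
    then show ?thesis using assms by (simp add: abs_mult)
  qed
  also have "\<dots> \<le> (2 * z + N / 2) / r * heat_kernel x r"
    using assms z N1 by (intro mult_right_mono divide_right_mono) auto
  also have "\<dots> = ((2 * z + N / 2) * exp (- z)) * (2 powr (N / 2) / r * heat_kernel x (2 * r))"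
    using assms by (subst heat_kernel_double) (auto simp: z_def N_def)
  also have "\<dots> \<le> (50 + 2 * N\<^sup>2) * (2 powr (N / 2) / r * heat_kernel x (2 * r))"
  proof (rule mult_right_mono)
    have "N / 2 * exp (- z) \<le> N / 2" using z N1 by (simp add: mult_left_le)
    moreover have "N \<le> N\<^sup>2" using N1 by (simp add: power2_eq_square)
    ultimately show "(2 * z + N / 2) * exp (- z) \<le> 50 + 2 * N\<^sup>2"
      using mult_exp_minus_le[of z] N1 unfolding distrib_right by linarith
  qed (use assms in auto)
  finally show ?thesis by (simp add: hkC_def N_def mult_ac)
qed

lemma hk_dtt_bound:
  fixes x :: "real^'n"
  assumes "0 < r"
  shows "\<bar>hk_dtt x r\<bar> \<le> hkC TYPE('n) / r\<^sup>2 * heat_kernel x (2 * r)"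
proof -
  define z where "z = (norm x)\<^sup>2 / (8 * r)"
  define N where "N = real CARD('n)"
  have N1: "N \<ge> 1" by (simp add: N_def Suc_leI)
  have z: "0 \<le> z" "(norm x)\<^sup>2 = 8 * r * z"
    using assms by (auto simp: z_def)
  have eq: "hk_dtt x r = ((2 * z - N / 2)\<^sup>2 - 4 * z + N / 2) / r\<^sup>2 * heat_kernel x r"
    using assms unfolding hk_dtt_def z N_def[symmetric]
    by (simp add: field_simps power2_eq_square power3_eq_cube)
  have "\<bar>(2 * z - N / 2)\<^sup>2 - 4 * z + N / 2\<bar> \<le> 8 * z\<^sup>2 + N\<^sup>2 / 2 + 4 * z + N / 2"
  proof -
    \<comment> \<open>Adding the square with the opposite sign cancels the mixed term.\<close>
    have "(2 * z - N / 2)\<^sup>2 + (2 * z + N / 2)\<^sup>2 = 8 * z\<^sup>2 + N\<^sup>2 / 2"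
      by (simp add: power2_eq_square algebra_simps)
    then have "(2 * z - N / 2)\<^sup>2 \<le> 8 * z\<^sup>2 + N\<^sup>2 / 2"
      using zero_le_power2[of "2 * z + N / 2"] by linarith
    then show ?thesis using z(1) N1 zero_le_power2[of "2 * z - N / 2"] by linarith
  qed
  then have "\<bar>hk_dtt x r\<bar> \<le> (8 * z\<^sup>2 + N\<^sup>2 / 2 + 4 * z + N / 2) / r\<^sup>2 * heat_kernel x r"
    unfolding eq abs_mult using assms by (auto intro!: mult_right_mono divide_right_mono)
  also have "\<dots> = ((8 * z\<^sup>2 + N\<^sup>2 / 2 + 4 * z + N / 2) * exp (- z)) *
      (2 powr (N / 2) / r\<^sup>2 * heat_kernel x (2 * r))"
    using assms by (subst heat_kernel_double) (auto simp: z_def N_def)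
  also have "\<dots> \<le> (50 + 2 * N\<^sup>2) * (2 powr (N / 2) / r\<^sup>2 * heat_kernel x (2 * r))"
  proof (rule mult_right_mono)
    have "N / 2 * exp (- z) \<le> N / 2" "N\<^sup>2 / 2 * exp (- z) \<le> N\<^sup>2 / 2"
      using z N1 by (auto simp: mult_left_le)
    moreover have "N \<le> N\<^sup>2" using N1 by (simp add: power2_eq_square)
    ultimately show "(8 * z\<^sup>2 + N\<^sup>2 / 2 + 4 * z + N / 2) * exp (- z) \<le> 50 + 2 * N\<^sup>2"
      using mult_exp_minus_le[of z] square_mult_exp_minus_le[OF z(1)] N1
      unfolding distrib_right by linarith
  qed (use assms in auto)
  finally show ?thesis by (simp add: hkC_def N_def mult_ac)
qed

section \<open>Increments of the heat kernel in its parameter\<close>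

definition hkD :: "'n::finite itself \<Rightarrow> real" where
  "hkD _ = 4 * 4 powr (real CARD('n) / 2) * hkC TYPE('n)"

lemma hkD_pos: "0 < hkD TYPE('n::finite)"
  by (simp add: hkD_def hkC_pos)

lemma hk_dtt_bound_near:
  fixes x :: "real^'n"
  assumes "0 < r" "\<bar>s - r\<bar> \<le> r / 2"
  shows "\<bar>hk_dtt x s\<bar> \<le> hkD TYPE('n) / r\<^sup>2 * heat_kernel x (4 * r)"
proof -
  have s: "0 < s" "r / 2 \<le> s" "s \<le> 2 * r" using assms by (auto simp: abs_if split: if_splits)
  have "\<bar>hk_dtt x s\<bar> \<le> hkC TYPE('n) / s\<^sup>2 * heat_kernel x (2 * s)"
    using s by (intro hk_dtt_bound)
  \<comment> \<open>From \<open>s >= r / 2\<close>, the factor 1 / s^2 is at most 4 / r^2; this is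
    the 4 in \<open>hkD\<close>.\<close>
  also have "\<dots> \<le> (hkC TYPE('n) / (r / 2)\<^sup>2) * (4 powr (real CARD('n) / 2) * heat_kernel x (4 * r))"
    using s assms hkC_pos[where 'n='n]
    by (intro mult_mono heat_kernel_widen divide_left_mono power_mono) auto
  finally show ?thesis by (simp add: hkD_def power_divide mult_ac)
qed

lemma hk_dt_bound_near:
  fixes x :: "real^'n"
  assumes "0 < r" "\<bar>s - r\<bar> \<le> r / 2"
  shows "\<bar>hk_dt x s\<bar> \<le> hkD TYPE('n) / r * heat_kernel x (4 * r)"
proof -
  have s: "0 < s" "r / 2 \<le> s" "s \<le> 2 * r" using assms by (auto simp: abs_if split: if_splits)
  have "\<bar>hk_dt x s\<bar> \<le> hkC TYPE('n) / s * heat_kernel x (2 * s)"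
    using s by (intro hk_dt_bound)
  also have "\<dots> \<le> (hkC TYPE('n) / (r / 2)) * (4 powr (real CARD('n) / 2) * heat_kernel x (4 * r))"
    using s assms hkC_pos[where 'n='n]
    by (intro mult_mono heat_kernel_widen divide_left_mono) auto
  also have "\<dots> \<le> hkD TYPE('n) / r * heat_kernel x (4 * r)"
    using assms hkC_pos[where 'n='n] unfolding hkD_def
    by (simp add: divide_right_mono mult_ac mult_right_mono)
  finally show ?thesis .
qed

lemma heat_kernel_diff_bound:
  fixes x :: "real^'n"
  assumes "0 < r" "\<bar>h\<bar> \<le> r / 2"
  shows "\<bar>heat_kernel x (r + h) - heat_kernel x r\<bar>
      \<le> \<bar>h\<bar> * (hkD TYPE('n) / r) * heat_kernel x (4 * r)"
proof -
  have "norm (heat_kernel x (r + h) - heat_kernel x r) \<le>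
    (hkD TYPE('n) / r * heat_kernel x (4 * r)) * norm ((r + h) - r)"
  proof (rule field_differentiable_bound[where S="{r - r / 2..r + r / 2}"])
    fix z assume "z \<in> {r - r / 2..r + r / 2}"
    then show "((\<lambda>r. heat_kernel x r) has_field_derivative hk_dt x z)
        (at z within {r - r / 2..r + r / 2})"
      using assms by (intro DERIV_subset[OF heat_kernel_has_dt]) auto
    from \<open>z \<in> _\<close> show "norm (hk_dt x z) \<le> hkD TYPE('n) / r * heat_kernel x (4 * r)"
      using assms by (subst real_norm_def, intro hk_dt_bound_near) (auto simp: abs_if)
  qed (use assms in auto)
  then show ?thesis by (simp add: mult_ac)
qed

lemma hk_dt_diff_bound:
  fixes x :: "real^'n"
  assumes "0 < r" "\<bar>h\<bar> \<le> r / 2"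
  shows "\<bar>hk_dt x (r + h) - hk_dt x r\<bar> \<le> \<bar>h\<bar> * (hkD TYPE('n) / r\<^sup>2) * heat_kernel x (4 * r)"
proof -
  have "norm (hk_dt x (r + h) - hk_dt x r) \<le>
    (hkD TYPE('n) / r\<^sup>2 * heat_kernel x (4 * r)) * norm ((r + h) - r)"
  proof (rule field_differentiable_bound[where S="{r - r / 2..r + r / 2}"])
    fix z assume "z \<in> {r - r / 2..r + r / 2}"
    then show "((\<lambda>r. hk_dt x r) has_field_derivative hk_dtt x z)
        (at z within {r - r / 2..r + r / 2})"
      using assms by (intro DERIV_subset[OF hk_dt_has_dt]) auto
    from \<open>z \<in> _\<close> show "norm (hk_dtt x z) \<le> hkD TYPE('n) / r\<^sup>2 * heat_kernel x (4 * r)"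
      using assms by (subst real_norm_def, intro hk_dtt_bound_near) (auto simp: abs_if)
  qed (use assms in auto)
  then show ?thesis by (simp add: mult_ac)
qed

text \<open>As a function of h the remainder has the derivative hk_dt(r + h) - hk_dt(r), of order
  |h| by \<open>hk_dt_diff_bound\<close>; a second mean value inequality gives h^2 with the same
  dominating kernel at 4 r.\<close>

lemma heat_kernel_taylor:
  fixes x :: "real^'n"
  assumes "0 < r" "\<bar>h\<bar> \<le> r / 2"
  shows "\<bar>heat_kernel x (r + h) - heat_kernel x r - h * hk_dt x r\<bar>
    \<le> h\<^sup>2 * (hkD TYPE('n) / r\<^sup>2) * heat_kernel x (4 * r)"
proof -
  let ?g = "\<lambda>s. heat_kernel x (r + s) - heat_kernel x r - s * hk_dt x r"
  have "norm (?g h - ?g 0) \<le> (\<bar>h\<bar> * (hkD TYPE('n) / r\<^sup>2) * heat_kernel x (4 * r)) * norm (h - 0)"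
  proof (rule field_differentiable_bound[where S="{-\<bar>h\<bar>..\<bar>h\<bar>}"])
    fix z assume z: "z \<in> {-\<bar>h\<bar>..\<bar>h\<bar>}"
    then have rz: "0 < r + z" using assms by auto
    have "((\<lambda>s. heat_kernel x (r + s)) has_field_derivative hk_dt x (r + z) * 1) (at z)"
      by (rule DERIV_chain2[where f="\<lambda>r. heat_kernel x r" and g="\<lambda>s. r + s"
          and x=z, OF heat_kernel_has_dt[OF rz]]) (auto intro!: derivative_eq_intros)
    then have "(?g has_field_derivative (hk_dt x (r + z) * 1 - 0 - 1 * hk_dt x r)) (at z)"
      by (intro DERIV_diff DERIV_const DERIV_cmult_right DERIV_ident)
    then show "(?g has_field_derivative (hk_dt x (r + z) - hk_dt x r)) (at z within {-\<bar>h\<bar>..\<bar>h\<bar>})"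
      by (auto intro: DERIV_subset)
    have "norm (hk_dt x (r + z) - hk_dt x r) \<le> \<bar>z\<bar> * (hkD TYPE('n) / r\<^sup>2) * heat_kernel x (4 * r)"
      using hk_dt_diff_bound[of r z x] assms z by auto
    also have "\<dots> \<le> \<bar>h\<bar> * (hkD TYPE('n) / r\<^sup>2) * heat_kernel x (4 * r)"
      using z hkD_pos[where 'n='n] assms by (intro mult_right_mono) auto
    finally show "norm (hk_dt x (r + z) - hk_dt x r)
        \<le> \<bar>h\<bar> * (hkD TYPE('n) / r\<^sup>2) * heat_kernel x (4 * r)" .
  qed auto
  moreover have "(\<bar>h\<bar> * c * k) * norm (h - 0) = h\<^sup>2 * c * k" for c k
  proof -
    have "(\<bar>h\<bar> * c * k) * \<bar>h\<bar> = (\<bar>h\<bar> * \<bar>h\<bar>) * (c * k)" by (simp only: mult_ac)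
    then show ?thesis by (simp only: abs_mult_self_eq power2_eq_square mult.assoc real_norm_def
        diff_0_right)
  qed
  ultimately show ?thesis by (simp only:) simp
qed

section \<open>Continuity of translations\<close>

text \<open>Approximation from inside by compact sets is applied to the restriction \<open>M\<close>
  of Lebesgue measure to A, which is a finite measure because A has finite measure.\<close>

lemma finite_measure_regular:
  fixes A :: "'a::euclidean_space set"
  assumes A: "A \<in> sets borel" "emeasure lborel A < \<infinity>" and e: "0 < e"
  obtains K U where "compact K" "open U" "K \<subseteq> A" "A \<subseteq> U"
    "emeasure lborel (A - K) < ennreal e" "emeasure lborel (U - A) < ennreal e"
proof -
  obtain U where U: "open U" "A \<subseteq> U" "emeasure lborel (U - A) < ennreal e"
    using outer_regular_lborel[OF A(1) e] by auto
  define M where "M = density lborel (indicator A)"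
  have M: "emeasure M B = emeasure lborel (A \<inter> B)" if "B \<in> sets borel" for B
    using A that by (simp add: M_def emeasure_restricted)
  have "emeasure M A = (SUP K \<in> {K. K \<subseteq> A \<and> compact K}. emeasure M K)"
    by (rule inner_regular) (use A M[of UNIV] in \<open>auto simp: M_def\<close>)
  moreover have "emeasure M A = emeasure lborel A" using M[OF A(1)] by simp
  moreover have "(SUP K \<in> {K. K \<subseteq> A \<and> compact K}. emeasure M K)
      = (SUP K \<in> {K. K \<subseteq> A \<and> compact K}. emeasure lborel K)"
    by (intro SUP_cong) (auto simp: M Int_absorb1 borel_compact)
  ultimately have sup: "emeasure lborel A = (SUP K \<in> {K. K \<subseteq> A \<and> compact K}. emeasure lborel K)"
    by simp
  have "\<exists>K. K \<subseteq> A \<and> compact K \<and> emeasure lborel A < emeasure lborel K + ennreal e"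
  proof (rule ccontr)
    assume *: "\<nexists>K. K \<subseteq> A \<and> compact K \<and> emeasure lborel A < emeasure lborel K + ennreal e"
    have "(SUP K \<in> {K. K \<subseteq> A \<and> compact K}. emeasure lborel K) \<le> emeasure lborel A - ennreal e"
    proof (rule SUP_least)
      fix K assume "K \<in> {K. K \<subseteq> A \<and> compact K}"
      then have "emeasure lborel K + ennreal e \<le> emeasure lborel A"
        using * by (auto simp: not_less)
      then show "emeasure lborel K \<le> emeasure lborel A - ennreal e"
        by (metis ennreal_add_diff_cancel_right ennreal_minus_mono ennreal_neq_top order_refl)
    qed
    moreover have "emeasure lborel {} + ennreal e \<le> emeasure lborel A" using *
        by (auto simp: not_less)
    then have "emeasure lborel A - ennreal e < emeasure lborel A"
      using A e by (intro ennreal_between) (auto intro: less_le_trans[of 0 "ennreal e"])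
    ultimately show False using sup by simp
  qed
  then obtain K where K: "K \<subseteq> A" "compact K" "emeasure lborel A < emeasure lborel K + ennreal e"
    by auto
  have "emeasure lborel K \<le> emeasure lborel A"
    using A K by (intro emeasure_mono) auto
  then have "emeasure lborel K \<noteq> top" using A(2) by (auto simp: top_unique)
  moreover have "emeasure lborel A = emeasure lborel K + emeasure lborel (A - K)"
  proof -
    have "K \<in> sets borel" using K by (simp add: borel_compact)
    then have "A - K \<in> sets borel" using A by auto
    then show ?thesis
      using A K \<open>K \<in> sets borel\<close> plus_emeasure[of K lborel "A - K"] by (auto simp: Un_absorb1)
  qed
  ultimately have "emeasure lborel (A - K) < ennreal e"
    using K(3) by (auto simp: ennreal_add_left_cancel_less)
  then show ?thesis using that K U by blast
qed

text \<open>The L^1 modulus of continuity at the displacement z.\<close>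

definition translation_diff :: "('a::euclidean_space \<Rightarrow> real) \<Rightarrow> 'a \<Rightarrow> ennreal" where
  "translation_diff f z = (\<integral>\<^sup>+x. ennreal \<bar>f (x - z) - f x\<bar> \<partial>lborel)"

lemma translation_diff_le:
  assumes "integrable lborel f"
  shows "translation_diff f z \<le> 2 * (\<integral>\<^sup>+x. ennreal \<bar>f x\<bar> \<partial>lborel)"
proof -
  have [measurable]: "f \<in> borel_measurable borel"
    using assms by (auto dest: borel_measurable_integrable)
  have "translation_diff f z \<le> (\<integral>\<^sup>+x. ennreal \<bar>f (x - z)\<bar> + ennreal \<bar>f x\<bar> \<partial>lborel)"
    unfolding translation_diff_def
    by (intro nn_integral_mono) (auto simp: ennreal_plus[symmetric] simp del: ennreal_plus intro!:
        ennreal_leI)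
  also have "\<dots> = (\<integral>\<^sup>+x. ennreal \<bar>f (x - z)\<bar> \<partial>lborel) + (\<integral>\<^sup>+x. ennreal \<bar>f x\<bar> \<partial>lborel)"
    by (rule nn_integral_add) auto
  also have "(\<integral>\<^sup>+x. ennreal \<bar>f (x - z)\<bar> \<partial>lborel) = (\<integral>\<^sup>+x. ennreal \<bar>f x\<bar> \<partial>lborel)"
    by (rule nn_integral_lborel_shift[where f="\<lambda>x. ennreal \<bar>f x\<bar>"]) auto
  finally show ?thesis by (simp add: mult_2)
qed

lemma translation_diff_triangle:
  assumes [measurable]: "f \<in> borel_measurable borel" "g \<in> borel_measurable borel"
  shows "translation_diff f z \<le> translation_diff g z + 2 * (\<integral>\<^sup>+x. ennreal \<bar>f x - g x\<bar> \<partial>lborel)"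
proof -
  have "translation_diff f z \<le> (\<integral>\<^sup>+x. ennreal \<bar>g (x - z) - g x\<bar>
      + (ennreal \<bar>f (x - z) - g (x - z)\<bar> + ennreal \<bar>f x - g x\<bar>) \<partial>lborel)"
    unfolding translation_diff_def
    by (intro nn_integral_mono) (auto simp: ennreal_plus[symmetric] simp del: ennreal_plus intro!:
        ennreal_leI)
  also have "\<dots> = translation_diff g z + ((\<integral>\<^sup>+x. ennreal \<bar>f (x - z) - g (x - z)\<bar> \<partial>lborel)
      + (\<integral>\<^sup>+x. ennreal \<bar>f x - g x\<bar> \<partial>lborel))"
    unfolding translation_diff_def by (subst nn_integral_add; (subst nn_integral_add)?) auto
  also have "(\<integral>\<^sup>+x. ennreal \<bar>f (x - z) - g (x - z)\<bar> \<partial>lborel) = (\<integral>\<^sup>+x. ennreal \<bar>f x - g x\<bar> \<partial>lborel)"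
    by (rule nn_integral_lborel_shift[where f="\<lambda>x. ennreal \<bar>f x - g x\<bar>"]) auto
  finally show ?thesis by (simp add: mult_2)
qed

text \<open>Take z shorter than the distance from K to the complement of U. If exactly one of x and
  x - z lies in A, then one of these points lies in A - K or in U - A. This leaves four terms, each
  below e/4.\<close>

lemma translation_diff_indicator_tendsto:
  fixes A :: "'a::euclidean_space set"
  assumes A: "A \<in> sets borel" "emeasure lborel A < \<infinity>" and e: "0 < e"
  shows "\<exists>d>0. \<forall>z. norm z < d \<longrightarrow> translation_diff (indicat_real A) z \<le> ennreal e"
proof -
  obtain K U where KU: "compact K" "open U" "K \<subseteq> A" "A \<subseteq> U"
    "emeasure lborel (A - K) < ennreal (e / 4)" "emeasure lborel (U - A) < ennreal (e / 4)"
    using finite_measure_regular[OF A, of "e / 4"] e by auto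
  have [measurable]: "K \<in> sets borel" "U \<in> sets borel" "A \<in> sets borel"
    using KU A by (auto simp: borel_compact)
  obtain d where d: "d > 0" "\<And>x y. x \<in> K \<Longrightarrow> y \<in> - U \<Longrightarrow> d \<le> dist x y"
    proof -
    have "K \<inter> - U = {}" using KU by auto
    then show ?thesis using separate_compact_closed[of K "- U"] KU that by (auto simp: closed_Compl)
  qed
  have "translation_diff (indicat_real A) z \<le> ennreal e" if z: "norm z < d" for z
  proof -
    let ?D = "A - K" and ?E = "U - A"
    have in1: "x - z \<in> K \<Longrightarrow> x \<in> U" for x
      using d(2)[of "x - z" x] z by (force simp: dist_norm)
    have in2: "x \<in> K \<Longrightarrow> x - z \<in> U" for x
      using d(2)[of x "x - z"] z by (force simp: dist_norm)
    have "translation_diff (indicat_real A) z \<le>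
      (\<integral>\<^sup>+x. (indicator ?D (x - z) + indicator ?E (x - z)) + (indicator ?D x + indicator ?E x)
          \<partial>lborel)"
      unfolding translation_diff_def
    proof (intro nn_integral_mono)
      fix x
      show "ennreal \<bar>indicat_real A (x - z) - indicat_real A x\<bar> \<le>
        (indicator ?D (x - z) + indicator ?E (x - z)) + (indicator ?D x + indicator ?E x)"
        using in1[of x] in2[of x] by (auto split: split_indicator)
    qed
    also have "\<dots> = (emeasure lborel ?D + emeasure lborel ?E)
        + (emeasure lborel ?D + emeasure lborel ?E)"
      by (simp add: nn_integral_add nn_integral_lborel_shift)
    also have "\<dots> \<le> (ennreal (e / 4) + ennreal (e / 4)) + (ennreal (e / 4) + ennreal (e / 4))"
      using KU by (intro add_mono) auto
    also have "\<dots> = ennreal e" using e by (simp add: ennreal_plus[symmetric] del: ennreal_plus)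
    finally show ?thesis .
  qed
  then show ?thesis using d by blast
qed

text \<open>Induction over integrable functions. In the limit case the approximation error is
  uniform in z, because translations preserve Lebesgue measure
  (\<open>translation_diff_triangle\<close>).\<close>

proposition translation_diff_tendsto:
  fixes f :: "'a::euclidean_space \<Rightarrow> real"
  assumes "integrable lborel f"
  shows "\<forall>e>0. \<exists>d>0. \<forall>z. norm z < d \<longrightarrow> translation_diff f z \<le> ennreal e"
  using assms
proof induction
  case (base A c)
  show ?case
  proof (intro allI impI)
    fix e :: real assume e: "0 < e"
    obtain d where d: "d > 0" "\<And>z. norm z < d \<Longrightarrow> translation_diff (indicat_real A) z
        \<le> ennreal (e / (\<bar>c\<bar> + 1))"
      using translation_diff_indicator_tendsto[of A "e / (\<bar>c\<bar> + 1)"] base e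
          by (force simp: add_nonneg_pos)
    have "translation_diff (\<lambda>x. indicat_real A x *\<^sub>R c) z \<le> ennreal e" if "norm z < d" for z
    proof -
      have [measurable]: "A \<in> sets borel" using base by simp
      have "translation_diff (\<lambda>x. indicat_real A x *\<^sub>R c) z
          = ennreal \<bar>c\<bar> * translation_diff (indicat_real A) z"
        unfolding translation_diff_def
        by (subst nn_integral_cmult[symmetric])
           (auto simp: ennreal_mult[symmetric] abs_mult[symmetric] algebra_simps intro!:
               nn_integral_cong)
      also have "\<dots> \<le> ennreal \<bar>c\<bar> * ennreal (e / (\<bar>c\<bar> + 1))"
        using d(2)[OF that] by (intro mult_left_mono) auto
      also have "\<dots> \<le> ennreal e"
        using e by (auto simp: ennreal_mult[symmetric] field_simps intro!: ennreal_leI)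
      finally show ?thesis .
    qed
    then show "\<exists>d>0. \<forall>z. norm z < d \<longrightarrow> translation_diff (\<lambda>x. indicat_real A x *\<^sub>R c) z \<le> ennreal e"
      using d by blast
  qed
next
  case (add f g)
  then have [measurable]: "f \<in> borel_measurable borel" "g \<in> borel_measurable borel"
    by (auto dest: borel_measurable_integrable)
  show ?case
  proof (intro allI impI)
    fix e :: real assume e: "0 < e"
    obtain d1 where d1: "d1 > 0" "\<And>z. norm z < d1 \<Longrightarrow> translation_diff f z \<le> ennreal (e / 2)"
      using add.IH(1) e by (metis half_gt_zero)
    obtain d2 where d2: "d2 > 0" "\<And>z. norm z < d2 \<Longrightarrow> translation_diff g z \<le> ennreal (e / 2)"
      using add.IH(2) e by (metis half_gt_zero)
    have "translation_diff (\<lambda>x. f x + g x) z \<le> ennreal e" if z: "norm z < min d1 d2" for z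
    proof -
      have "translation_diff (\<lambda>x. f x + g x) z
          \<le> (\<integral>\<^sup>+x. ennreal \<bar>f (x - z) - f x\<bar> + ennreal \<bar>g (x - z) - g x\<bar> \<partial>lborel)"
        unfolding translation_diff_def
        by (intro nn_integral_mono) (auto simp: ennreal_plus[symmetric] simp del: ennreal_plus
            intro!: ennreal_leI)
      also have "\<dots> = translation_diff f z + translation_diff g z"
        unfolding translation_diff_def by (intro nn_integral_add) auto
      also have "\<dots> \<le> ennreal (e / 2) + ennreal (e / 2)"
        using d1(2)[of z] d2(2)[of z] z by (intro add_mono) auto
      also have "\<dots> = ennreal e" using e by (simp add: ennreal_plus[symmetric] del: ennreal_plus)
      finally show ?thesis .
    qed
    then show "\<exists>d>0. \<forall>z. norm z < d \<longrightarrow> translation_diff (\<lambda>x. f x + g x) z \<le> ennreal e"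
      using d1 d2 by (intro exI[of _ "min d1 d2"]) auto
  qed
next
  case (lim f s)
  have [measurable]: "f \<in> borel_measurable borel" "\<And>i. s i \<in> borel_measurable borel"
    using lim by (auto dest: borel_measurable_integrable)
  show ?case
  proof (intro allI impI)
    fix e :: real assume e: "0 < e"
    have "(\<lambda>i. \<integral>\<^sup>+x. ennreal \<bar>f x - s i x\<bar> \<partial>lborel) \<longlonglongrightarrow> (\<integral>\<^sup>+x. 0 \<partial>(lborel::'a measure))"
    proof (rule nn_integral_dominated_convergence[where w="\<lambda>x. ennreal (3 * \<bar>f x\<bar>)"])
      \<comment> \<open>The approximants satisfy |s i x| <= 2 |f x|, whence the factor 3.\<close>
      show "AE x in lborel. ennreal \<bar>f x - s i x\<bar> \<le> ennreal (3 * \<bar>f x\<bar>)" for i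
      proof (intro AE_I2 ennreal_leI)
        fix x :: 'a
        show "\<bar>f x - s i x\<bar> \<le> 3 * \<bar>f x\<bar>" using lim.hyps(3)[of x i] by auto
      qed
      show "(\<integral>\<^sup>+x. ennreal (3 * \<bar>f x\<bar>) \<partial>lborel) < \<infinity>"
      proof -
        have "integrable lborel (\<lambda>x. 3 * \<bar>f x\<bar>)" using lim.hyps(4) by simp
        then show ?thesis by (simp add: nn_integral_eq_integral)
      qed
      show "AE x in lborel. (\<lambda>i. ennreal \<bar>f x - s i x\<bar>) \<longlonglongrightarrow> 0"
      proof (intro AE_I2)
        fix x :: 'a
        have "(\<lambda>i. \<bar>f x - s i x\<bar>) \<longlonglongrightarrow> \<bar>f x - f x\<bar>"
          using lim.hyps(2)[of x] by (intro tendsto_intros) auto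
        then show "(\<lambda>i. ennreal \<bar>f x - s i x\<bar>) \<longlonglongrightarrow> 0"
          using tendsto_ennrealI by fastforce
      qed
    qed auto
    then have "\<forall>\<^sub>F i in sequentially. (\<integral>\<^sup>+x. ennreal \<bar>f x - s i x\<bar> \<partial>lborel) < ennreal (e / 4)"
      using e by (intro order_tendstoD) (auto)
    then obtain i where i: "(\<integral>\<^sup>+x. ennreal \<bar>f x - s i x\<bar> \<partial>lborel) < ennreal (e / 4)"
      by (auto dest: eventually_happens)
    obtain d where d: "d > 0" "\<And>z. norm z < d \<Longrightarrow> translation_diff (s i) z \<le> ennreal (e / 2)"
      using lim.IH[of i] e by (metis half_gt_zero)
    have "translation_diff f z \<le> ennreal e" if z: "norm z < d" for z
    proof -
      have "translation_diff f z \<le> translation_diff (s i) z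
          + 2 * (\<integral>\<^sup>+x. ennreal \<bar>f x - s i x\<bar> \<partial>lborel)"
        by (rule translation_diff_triangle) auto
      also have "\<dots> \<le> ennreal (e / 2) + 2 * ennreal (e / 4)"
        using d(2)[OF z] i by (intro add_mono mult_left_mono) auto
      also have "\<dots> = ennreal e" using e by (simp add: mult_2 ennreal_plus[symmetric] del:
          ennreal_plus)
      finally show ?thesis .
    qed
    then show "\<exists>d>0. \<forall>z. norm z < d \<longrightarrow> translation_diff f z \<le> ennreal e" using d by blast
  qed
qed

section \<open>Bilinear forms with a convolution kernel\<close>

definition sqint :: "('a::euclidean_space \<Rightarrow> real) \<Rightarrow> bool" where
  "sqint f \<longleftrightarrow> f \<in> borel_measurable borel \<and> integrable lborel (\<lambda>x. (f x)\<^sup>2)"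

definition l2 :: "('a::euclidean_space \<Rightarrow> real) \<Rightarrow> real" where
  "l2 f = sqrt (LINT x|lborel. (f x)\<^sup>2)"

text \<open>The bound is required at every point, so that F(f x) and other functions of the value
  can be estimated pointwise on a fixed interval.\<close>

definition bint :: "('a::euclidean_space \<Rightarrow> real) \<Rightarrow> bool" where
  "bint f \<longleftrightarrow> integrable lborel f \<and> (\<exists>C. \<forall>x. \<bar>f x\<bar> \<le> C)"

abbreviation l1 :: "('a::euclidean_space \<Rightarrow> real) \<Rightarrow> real" where
  "l1 f \<equiv> (LINT x|lborel. \<bar>f x\<bar>)"

text \<open>Kernel estimates go through this domination: a heat kernel has mass 1 and sup norm at
  most (4 pi \<rho>)^(-N/2), so \<kappa> and \<rho> control both the L^1 and the L^\<infinity> norm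
  of k.\<close>

definition kdom :: "(real^'n \<Rightarrow> real) \<Rightarrow> real \<Rightarrow> real \<Rightarrow> bool" where
  "kdom k \<kappa> \<rho> \<longleftrightarrow> k \<in> borel_measurable borel \<and> 0 < \<rho> \<and> (\<forall>z. \<bar>k z\<bar> \<le> \<kappa> * heat_kernel z \<rho>)"

abbreviation lborel2 :: "('a::euclidean_space \<times> 'a) measure" where
  "lborel2 \<equiv> lborel \<Otimes>\<^sub>M lborel"

text \<open>At the point (x, y) the kernel is evaluated at x - y. Keeping the double integral lets
  convolution pairings and weighted squares of differences share one format.\<close>

definition pint :: "('a::euclidean_space \<Rightarrow> real) \<Rightarrow> ('a \<times> 'a \<Rightarrow> real) \<Rightarrow> real" where
  "pint k h = (LINT z|lborel2. k (fst z - snd z) * h z)"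

text \<open>\<open>Q k f g\<close> is the pairing $\langle k * f, g \rangle$.\<close>

abbreviation Q :: "('a::euclidean_space \<Rightarrow> real) \<Rightarrow> ('a \<Rightarrow> real) \<Rightarrow> ('a \<Rightarrow> real) \<Rightarrow> real" where
  "Q k f g \<equiv> pint k (\<lambda>z. f (snd z) * g (fst z))"

abbreviation pintegrable :: "('a::euclidean_space \<Rightarrow> real) \<Rightarrow> ('a \<times> 'a \<Rightarrow> real) \<Rightarrow> bool" where
  "pintegrable k h \<equiv> integrable lborel2 (\<lambda>z. k (fst z - snd z) * h z)"

section \<open>Square integrable and bounded integrable functions\<close>

lemma borel_integrable [measurable_dest]:
  fixes f :: "'a::euclidean_space \<Rightarrow> real"
  shows "integrable lborel f \<Longrightarrow> f \<in> borel_measurable borel"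
  by (auto dest: borel_measurable_integrable)

lemma sqint_borel [measurable_dest]: "sqint f \<Longrightarrow> f \<in> borel_measurable borel"
  by (simp add: sqint_def)

lemma bint_borel [measurable_dest]: "bint f \<Longrightarrow> f \<in> borel_measurable borel"
  by (auto simp: bint_def dest: borel_measurable_integrable)

lemma bint_integrable: "bint f \<Longrightarrow> integrable lborel f"
  by (simp add: bint_def)

lemma bintE:
  assumes "bint f" obtains C where "0 < C" "\<And>x. \<bar>f x\<bar> \<le> C"
proof -
  obtain C where C: "\<And>x. \<bar>f x\<bar> \<le> C" using assms by (auto simp: bint_def)
  have "\<bar>f x\<bar> \<le> \<bar>C\<bar> + 1" for x using C[of x] by linarith
  then show ?thesis using that[of "\<bar>C\<bar> + 1"] by auto
qed

lemma bint_sqint: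
  assumes "bint f" shows "sqint f"
proof -
  obtain C where C: "0 < C" "\<And>x. \<bar>f x\<bar> \<le> C" using bintE[OF assms] by blast
  have [measurable]: "f \<in> borel_measurable borel" using assms by (rule bint_borel)
  have "integrable lborel (\<lambda>x. (f x)\<^sup>2)"
  proof (rule Bochner_Integration.integrable_bound[where f="\<lambda>x. C * f x"])
    show "integrable lborel (\<lambda>x. C * f x)" using bint_integrable[OF assms] by simp
    show "AE x in lborel. norm ((f x)\<^sup>2) \<le> norm (C * f x)"
    proof (rule AE_I2)
      fix x
      have "\<bar>f x\<bar> * \<bar>f x\<bar> \<le> C * \<bar>f x\<bar>" by (intro mult_right_mono C) simp
      then show "norm ((f x)\<^sup>2) \<le> norm (C * f x)"
        using C(1) by (simp add: power2_eq_square abs_mult)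
    qed
  qed auto
  then show ?thesis by (simp add: sqint_def)
qed

lemma bint_mono:
  assumes "bint f" "g \<in> borel_measurable borel" "\<And>x. \<bar>g x\<bar> \<le> c * \<bar>f x\<bar>"
  shows "bint g"
proof -
  obtain C where C: "0 < C" "\<And>x. \<bar>f x\<bar> \<le> C" using bintE[OF assms(1)] by blast
  have "integrable lborel g"
  proof (rule Bochner_Integration.integrable_bound[where f="\<lambda>x. c * f x"])
    show "AE x in lborel. norm (g x) \<le> norm (c * f x)"
    proof (rule AE_I2)
      fix x
      have "c * \<bar>f x\<bar> \<le> \<bar>c\<bar> * \<bar>f x\<bar>" by (intro mult_right_mono) auto
      then show "norm (g x) \<le> norm (c * f x)" using assms(3)[of x] by (simp add: abs_mult)
    qed
  qed (use assms bint_integrable[OF assms(1)] in auto)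
  moreover have "\<bar>g x\<bar> \<le> \<bar>c\<bar> * C" for x
  proof -
    have "c * \<bar>f x\<bar> \<le> \<bar>c\<bar> * C" using C by (intro mult_mono) auto
    then show ?thesis using assms(3)[of x] by linarith
  qed
  ultimately show ?thesis unfolding bint_def by blast
qed

lemma abs_mult_le_squares: "\<bar>a * b\<bar> \<le> a\<^sup>2 + (b::real)\<^sup>2"
proof -
  have "2 * (\<bar>a\<bar> * \<bar>b\<bar>) \<le> a\<^sup>2 + b\<^sup>2" using sum_squares_bound[of "\<bar>a\<bar>" "\<bar>b\<bar>"] by simp
  moreover have "0 \<le> \<bar>a\<bar> * \<bar>b\<bar>" by simp
  ultimately show ?thesis unfolding abs_mult by linarith
qed

lemma sqint_mult_integrable:
  assumes "sqint f" "sqint g"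
  shows "integrable lborel (\<lambda>x. f x * g x)"
proof (rule Bochner_Integration.integrable_bound[where f="\<lambda>x. (f x)\<^sup>2 + (g x)\<^sup>2"])
  show "AE x in lborel. norm (f x * g x) \<le> norm ((f x)\<^sup>2 + (g x)\<^sup>2)"
  proof (rule AE_I2)
    fix x
    show "norm (f x * g x) \<le> norm ((f x)\<^sup>2 + (g x)\<^sup>2)"
      using abs_mult_le_squares[of "f x" "g x"] by auto
  qed
qed (use assms in \<open>auto simp: sqint_def\<close>)

lemma sqint_add:
  assumes "sqint f" "sqint g" shows "sqint (\<lambda>x. f x + g x)"
proof -
  have "(f x + g x)\<^sup>2 = (f x)\<^sup>2 + (g x)\<^sup>2 + 2 * (f x * g x)" for x
    by (simp add: power2_sum)
  then show ?thesis using assms sqint_mult_integrable[OF assms] by (auto simp: sqint_def)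
qed

lemma sqint_cmult: "sqint f \<Longrightarrow> sqint (\<lambda>x. c * f x)"
  by (auto simp: sqint_def power_mult_distrib)

lemma sqint_diff:
  assumes "sqint f" "sqint g" shows "sqint (\<lambda>x. f x - g x)"
  using sqint_add[OF assms(1) sqint_cmult[OF assms(2), of "-1"]] by simp

lemma l2_nonneg [simp]: "0 \<le> l2 f"
  by (simp add: l2_def)

lemma l2_square: "(l2 f)\<^sup>2 = (LINT x|lborel. (f x)\<^sup>2)"
  by (simp add: l2_def)

text \<open>The quadratic form s, t -> \<integral> (s F + t G)^2 is nonnegative, which forces C^2 <=
  A B; the degenerate case A = 0 is treated separately.\<close>

lemma cauchy_schwarz_integral:
  fixes F G :: "'b \<Rightarrow> real"
  assumes [measurable]: "F \<in> borel_measurable M" "G \<in> borel_measurable M"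
    and F: "integrable M (\<lambda>z. (F z)\<^sup>2)" and G: "integrable M (\<lambda>z. (G z)\<^sup>2)"
  shows "integrable M (\<lambda>z. F z * G z)"
    and "\<bar>LINT z|M. F z * G z\<bar> \<le> sqrt (LINT z|M. (F z)\<^sup>2) * sqrt (LINT z|M. (G z)\<^sup>2)"
proof -
  show int: "integrable M (\<lambda>z. F z * G z)"
  proof (rule Bochner_Integration.integrable_bound[where f="\<lambda>x. (F x)\<^sup>2 + (G x)\<^sup>2"])
    show "AE x in M. norm (F x * G x) \<le> norm ((F x)\<^sup>2 + (G x)\<^sup>2)"
    proof (rule AE_I2)
      fix x
      show "norm (F x * G x) \<le> norm ((F x)\<^sup>2 + (G x)\<^sup>2)"
        using abs_mult_le_squares[of "F x" "G x"] by auto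
    qed
  qed (use F G in auto)
  define A B C where "A = (LINT z|M. (F z)\<^sup>2)" and "B = (LINT z|M. (G z)\<^sup>2)"
      and "C = (LINT z|M. F z * G z)"
  have AB: "0 \<le> A" "0 \<le> B" by (auto simp: A_def B_def)
  have q: "0 \<le> A * s\<^sup>2 + 2 * C * s * t + B * t\<^sup>2" for s t
  proof -
    have "A * s\<^sup>2 + 2 * C * s * t + B * t\<^sup>2 = (LINT z|M. (F z)\<^sup>2 * s\<^sup>2 + (F z * G z) * (2 * s * t)
        + (G z)\<^sup>2 * t\<^sup>2)"
      using int F G by (simp add: A_def B_def C_def)
    also have "\<dots> = (LINT z|M. (F z * s + G z * t)\<^sup>2)"
      by (intro Bochner_Integration.integral_cong) (auto simp: power2_eq_square algebra_simps)
    finally show ?thesis by simp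
  qed
  have "C\<^sup>2 \<le> A * B"
  proof (cases "A = 0")
    case True
    show ?thesis
    proof (cases "C = 0")
      case False
      \<comment> \<open>For A = 0 this value of s makes the form equal to -1 at t = 1.\<close>
      have "0 \<le> 2 * C * (- (B + 1) / (2 * C)) + B" using q[of "- (B + 1) / (2 * C)" 1] True by simp
      then show ?thesis using False by simp
    qed (use True in simp)
  next
    case False
    have "0 \<le> A * C\<^sup>2 - 2 * C * C * A + B * A\<^sup>2" using q[of "- C" A] by (simp add: algebra_simps)
    then have "0 \<le> A * (A * B - C\<^sup>2)" by (simp add: algebra_simps power2_eq_square)
    then show ?thesis using False AB by (simp add: zero_le_mult_iff)
  qed
  then have "sqrt (C\<^sup>2) \<le> sqrt (A * B)" by (rule real_sqrt_le_mono)
  then show "\<bar>LINT z|M. F z * G z\<bar> \<le> sqrt (LINT z|M. (F z)\<^sup>2) * sqrt (LINT z|M. (G z)\<^sup>2)"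
    by (simp add: real_sqrt_mult A_def B_def C_def)
qed

lemma integral_mult_le_l2:
  assumes "sqint f" "sqint g"
  shows "\<bar>LINT x|lborel. f x * g x\<bar> \<le> l2 f * l2 g"
  using assms cauchy_schwarz_integral[of f lborel g] by (auto simp: sqint_def l2_def)

section \<open>Young's inequality in dual form\<close>

lemma pint_fst:
  fixes k \<phi> :: "'a::euclidean_space \<Rightarrow> real"
  assumes k: "integrable lborel k" and \<phi>: "integrable lborel \<phi>"
  shows "pintegrable k (\<lambda>z. \<phi> (fst z))"
    and "pint k (\<lambda>z. \<phi> (fst z)) = (LINT x|lborel. k x) * (LINT x|lborel. \<phi> x)"
proof -
  note [measurable] = borel_integrable[OF k] borel_integrable[OF \<phi>]
  have nk: "(LINT y|lborel. \<bar>k (x - y)\<bar>) = (LINT y|lborel. \<bar>k y\<bar>)" for x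
    by (rule integral_lborel_reflect[where f="\<lambda>y. \<bar>k y\<bar>"]) auto
  show 1: "pintegrable k (\<lambda>z. \<phi> (fst z))"
  proof (rule lborel_pair.Fubini_integrable)
    show "integrable lborel (\<lambda>x. LINT y|lborel. norm
        (k (fst (x, y) - snd (x, y)) * \<phi> (fst (x, y))))"
      using \<phi> by (simp add: abs_mult nk)
    show "AE x in lborel. integrable lborel (\<lambda>y. k (fst (x, y) - snd (x, y)) * \<phi> (fst (x, y)))"
      using integrable_lborel_reflect[OF k] by auto
  qed measurable
  have "pint k (\<lambda>z. \<phi> (fst z)) = (LINT x|lborel. LINT y|lborel. k (x - y) * \<phi> x)"
    unfolding pint_def by (subst lborel_pair.integral_fst'[OF 1, symmetric]) simp
  also have "\<dots> = (LINT x|lborel. k x) * (LINT x|lborel. \<phi> x)"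
    by (simp add: integral_lborel_reflect)
  finally show "pint k (\<lambda>z. \<phi> (fst z)) = (LINT x|lborel. k x) * (LINT x|lborel. \<phi> x)" .
qed

lemma pint_swap:
  fixes k :: "'a::euclidean_space \<Rightarrow> real"
  assumes "pintegrable k h"
  shows "pintegrable (\<lambda>z. k (- z)) (\<lambda>z. h (snd z, fst z))"
    and "pint (\<lambda>z. k (- z)) (\<lambda>z. h (snd z, fst z)) = pint k h"
proof -
  have *: "(\<lambda>(x, y). k (fst (y, x) - snd (y, x)) * h (y, x))
      = (\<lambda>z. k (- (fst z - snd z)) * h (snd z, fst z))"
    by (auto simp: fun_eq_iff)
  show "pintegrable (\<lambda>z. k (- z)) (\<lambda>z. h (snd z, fst z))"
    using lborel_pair.integrable_product_swap[OF assms] unfolding * .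
  show "pint (\<lambda>z. k (- z)) (\<lambda>z. h (snd z, fst z)) = pint k h"
    using lborel_pair.integral_product_swap[OF borel_measurable_integrable[OF assms]]
    unfolding * pint_def .
qed

lemma pint_snd:
  fixes k \<phi> :: "'a::euclidean_space \<Rightarrow> real"
  assumes k: "integrable lborel k" and \<phi>: "integrable lborel \<phi>"
  shows "pintegrable k (\<lambda>z. \<phi> (snd z))"
    and "pint k (\<lambda>z. \<phi> (snd z)) = (LINT x|lborel. k x) * (LINT x|lborel. \<phi> x)"
proof -
  note [measurable] = borel_integrable[OF k] borel_integrable[OF \<phi>]
  have k': "integrable lborel (\<lambda>x. k (- x))" "(LINT x|lborel. k (- x)) = (LINT x|lborel. k x)"
    using integrable_lborel_reflect[OF k, of 0] integral_lborel_reflect[of k 0] by auto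
  show "pintegrable k (\<lambda>z. \<phi> (snd z))"
    using pint_swap(1)[OF pint_fst(1)[OF k'(1) \<phi>]] by simp
  show "pint k (\<lambda>z. \<phi> (snd z)) = (LINT x|lborel. k x) * (LINT x|lborel. \<phi> x)"
    using pint_swap(2)[OF pint_fst(1)[OF k'(1) \<phi>]] pint_fst(2)[OF k'(1) \<phi>] k'(2) by simp
qed

lemma kdom_integrable:
  fixes k :: "real^'n \<Rightarrow> real"
  assumes "kdom k \<kappa> \<rho>"
  shows "integrable lborel k" "(LINT x|lborel. \<bar>k x\<bar>) \<le> \<kappa>" "0 \<le> \<kappa>"
proof -
  have \<rho>: "0 < \<rho>" and k: "\<And>z. \<bar>k z\<bar> \<le> \<kappa> * heat_kernel z \<rho>"
      and [measurable]: "k \<in> borel_measurable borel"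
    using assms by (auto simp: kdom_def)
  have "0 \<le> \<kappa> * heat_kernel (0::real^'n) \<rho>" using k[of 0] by linarith
  then show "0 \<le> \<kappa>" using heat_kernel_pos[OF \<rho>, of "0::real^'n"] by (simp add: zero_le_mult_iff)
  have i: "integrable lborel (\<lambda>z::real^'n. \<kappa> * heat_kernel z \<rho>)"
      using integrable_heat_kernel[OF \<rho>, where 'n='n] by simp
  show 1: "integrable lborel k"
    by (rule Bochner_Integration.integrable_bound[OF i])
       (use k in \<open>auto intro!: AE_I2 order_trans[OF k] abs_ge_self\<close>)
  have "(LINT x|lborel. \<bar>k x\<bar>) \<le> (LINT z|lborel. \<kappa> * heat_kernel (z::real^'n) \<rho>)"
    using 1 i k by (intro integral_mono) auto
  then show "(LINT x|lborel. \<bar>k x\<bar>) \<le> \<kappa>" by (simp add: integral_heat_kernel[OF \<rho>])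
qed

lemma kdom_heat_kernel: "0 < r \<Longrightarrow> kdom (\<lambda>z. heat_kernel z r) 1 r"
  by (simp add: kdom_def)

lemma kdom_hk_dt: "0 < r \<Longrightarrow> kdom (\<lambda>z::real^'n. hk_dt z r) (hkC TYPE('n) / r) (2 * r)"
  using hk_dt_bound[of r, where 'n='n] by (simp add: kdom_def)

lemma kdom_hk_grad:
  "0 < r \<Longrightarrow> kdom (\<lambda>z::real^'n. hk_grad a z r) (norm a * hkC TYPE('n) * r powr (- 1 / 2)) (2 * r)"
  using hk_grad_bound[of r a] by (simp add: kdom_def)

lemma kdom_heat_kernel_diff:
  assumes "0 < r" "\<bar>h\<bar> \<le> r / 2"
  shows "kdom (\<lambda>z::real^'n. heat_kernel z (r + h) - heat_kernel z r) (\<bar>h\<bar> * (hkD TYPE('n) / r))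
      (4 * r)"
  using heat_kernel_diff_bound[OF assms, where 'n='n] assms by (simp add: kdom_def)

lemma kdom_heat_kernel_taylor:
  assumes "0 < r" "\<bar>h\<bar> \<le> r / 2"
  shows "kdom (\<lambda>z::real^'n. heat_kernel z (r + h) - heat_kernel z r - h * hk_dt z r)
     (h\<^sup>2 * (hkD TYPE('n) / r\<^sup>2)) (4 * r)"
  using heat_kernel_taylor[OF assms, where 'n='n] assms by (simp add: kdom_def)

text \<open>Schur's argument: |k| is split into two square roots, one attached to f(y) and one to
  g(x). Cauchy-Schwarz on the product space then leaves the L^1 norm of k, at most \<kappa>.\<close>

lemma
  assumes k: "kdom k \<kappa> \<rho>" and f: "sqint f" and g: "sqint g"
  shows Q_integrable: "pintegrable k (\<lambda>z. f (snd z) * g (fst z))"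
    and Q_l2: "\<bar>Q k f g\<bar> \<le> \<kappa> * l2 f * l2 g"
proof -
  note [measurable] = sqint_borel[OF f] sqint_borel[OF g]
      borel_integrable[OF kdom_integrable(1)[OF k]]
  let ?ak = "\<lambda>x. \<bar>k x\<bar>"
  have ak: "integrable lborel ?ak" using kdom_integrable(1)[OF k] by simp
  have f2: "integrable lborel (\<lambda>x. (f x)\<^sup>2)" and g2: "integrable lborel (\<lambda>x. (g x)\<^sup>2)"
    using f g by (auto simp: sqint_def)
  define F where "F = (\<lambda>z. sqrt \<bar>k (fst z - snd z)\<bar> * f (snd z))"
  define G where "G = (\<lambda>z. sqrt \<bar>k (fst z - snd z)\<bar> * g (fst z))"
  have FG: "F \<in> borel_measurable lborel2" "G \<in> borel_measurable lborel2"
    by (auto simp: F_def G_def)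
  have F2: "(\<lambda>z. (F z)\<^sup>2) = (\<lambda>z. \<bar>k (fst z - snd z)\<bar> * (f (snd z))\<^sup>2)"
    and G2: "(\<lambda>z. (G z)\<^sup>2) = (\<lambda>z. \<bar>k (fst z - snd z)\<bar> * (g (fst z))\<^sup>2)"
    by (auto simp: F_def G_def power_mult_distrib fun_eq_iff)
  have absk: "\<bar>F z * G z\<bar> = \<bar>k (fst z - snd z) * (f (snd z) * g (fst z))\<bar>" for z
    by (simp add: F_def G_def abs_mult)
  have iF: "integrable lborel2 (\<lambda>z. (F z)\<^sup>2)" and iG: "integrable lborel2 (\<lambda>z. (G z)\<^sup>2)"
    unfolding F2 G2 using pint_snd(1)[OF ak f2] pint_fst(1)[OF ak g2] by auto
  have "(LINT z|lborel2. (F z)\<^sup>2) = (LINT x|lborel. \<bar>k x\<bar>) * (l2 f)\<^sup>2"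
    and "(LINT z|lborel2. (G z)\<^sup>2) = (LINT x|lborel. \<bar>k x\<bar>) * (l2 g)\<^sup>2"
    unfolding F2 G2 using pint_snd(2)[OF ak f2] pint_fst(2)[OF ak g2]
        by (auto simp: pint_def l2_square)
  note FG_eq = this
  have iabs: "integrable lborel2 (\<lambda>z. \<bar>F z\<bar> * \<bar>G z\<bar>)"
    and le: "\<bar>LINT z|lborel2. \<bar>F z\<bar> * \<bar>G z\<bar>\<bar> \<le> sqrt (LINT z|lborel2. (F z)\<^sup>2) * sqrt
        (LINT z|lborel2. (G z)\<^sup>2)"
    using cauchy_schwarz_integral[of "\<lambda>z. \<bar>F z\<bar>" "lborel2" "\<lambda>z. \<bar>G z\<bar>"] FG iF iG by auto
  show i: "pintegrable k (\<lambda>z. f (snd z) * g (fst z))"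
    proof (rule Bochner_Integration.integrable_bound[OF iabs])
    show "AE z in lborel2. norm (k (fst z - snd z) * (f (snd z) * g (fst z)))
        \<le> norm (\<bar>F z\<bar> * \<bar>G z\<bar>)"
      using absk by (intro AE_I2) (simp add: abs_mult)
  qed measurable
  have "\<bar>Q k f g\<bar> \<le> (LINT z|lborel2. \<bar>F z\<bar> * \<bar>G z\<bar>)"
    unfolding pint_def using integral_norm_bound[of "lborel2"
        "\<lambda>z. k (fst z - snd z) * (f (snd z) * g (fst z))"]
    by (simp add: absk[symmetric] abs_mult[symmetric])
  also have "\<dots> \<le> (LINT x|lborel. \<bar>k x\<bar>) * l2 f * l2 g"
  proof -
    have "sqrt (LINT z|lborel2. (F z)\<^sup>2) * sqrt (LINT z|lborel2. (G z)\<^sup>2)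
        = (LINT x|lborel. \<bar>k x\<bar>) * l2 f * l2 g"
      unfolding FG_eq by (simp add: real_sqrt_mult)
    then show ?thesis using le by linarith
  qed
  also have "\<dots> \<le> \<kappa> * l2 f * l2 g"
    using kdom_integrable(2)[OF k] by (intro mult_right_mono) auto
  finally show "\<bar>Q k f g\<bar> \<le> \<kappa> * l2 f * l2 g" .
qed

lemma Q_swap:
  assumes "kdom k \<kappa> \<rho>" "sqint f" "sqint g"
  shows "Q (\<lambda>z. k (- z)) g f = Q k f g"
  using pint_swap(2)[OF Q_integrable[OF assms]] by (simp add: mult.commute)

lemma Q_iterated:
  assumes "kdom k \<kappa> \<rho>" "sqint f" "sqint g"
  shows "Q k f g = (LINT x|lborel. g x * (LINT y|lborel. k (x - y) * f y))"
proof -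
  have "Q k f g = (LINT x|lborel. LINT y|lborel. k (x - y) * (f y * g x))"
    unfolding pint_def by (subst lborel_pair.integral_fst'[OF Q_integrable[OF assms], symmetric])
        simp
  also have "\<dots> = (LINT x|lborel. LINT y|lborel. g x * (k (x - y) * f y))"
    by (simp add: mult_ac)
  finally show ?thesis by simp
qed

lemma AE_pair_fst:
  assumes "AE x in lborel. P x" "{x. P x} \<in> sets borel"
  shows "AE z in lborel2. P (fst z)"
proof (rule lborel_pair.AE_pair_measure)
  have "fst -` {x. P x} \<inter> space lborel2 \<in> sets lborel2"
    by (rule measurable_sets[OF measurable_fst]) (use assms in auto)
  moreover have "fst -` {x. P x} \<inter> space lborel2 = {z \<in> space lborel2. P (fst z)}"
    by auto
  ultimately show "{z \<in> space lborel2. P (fst z)} \<in> sets lborel2" by simp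
qed (use assms in auto)

text \<open>Here the kernel enters through its L^1 norm. The bound on g is almost everywhere, the
  form in which sup bounds of the solution propagate in time.\<close>

lemma Q_l1_linf:
  assumes k: "kdom k \<kappa> \<rho>" and f: "integrable lborel f" and g: "g \<in> borel_measurable borel"
    and b: "AE x in lborel. \<bar>g x\<bar> \<le> c" and c: "0 \<le> c"
  shows "\<bar>Q k f g\<bar> \<le> \<kappa> * c * l1 f"
proof -
  note [measurable] = borel_integrable[OF f] g borel_integrable[OF kdom_integrable(1)[OF k]]
  have ak: "integrable lborel (\<lambda>x. \<bar>k x\<bar>)" and fa: "integrable lborel (\<lambda>x. c * \<bar>f x\<bar>)"
    using kdom_integrable(1)[OF k] f by auto
  have AE: "AE z in lborel2. \<bar>g (fst z)\<bar> \<le> c"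
    by (rule AE_pair_fst[OF b]) measurable
  have "\<bar>Q k f g\<bar> \<le> (LINT z|lborel2. norm (k (fst z - snd z) * (f (snd z) * g (fst z))))"
    unfolding pint_def using integral_norm_bound[of "lborel2"
        "\<lambda>z. k (fst z - snd z) * (f (snd z) * g (fst z))"] by simp
  also have "\<dots> \<le> pint (\<lambda>x. \<bar>k x\<bar>) (\<lambda>z. c * \<bar>f (snd z)\<bar>)"
    unfolding pint_def
  proof (rule integral_mono_AE')
    show "AE z in lborel2. norm (k (fst z - snd z) * (f (snd z) * g (fst z)))
        \<le> \<bar>k (fst z - snd z)\<bar> * (c * \<bar>f (snd z)\<bar>)"
      using AE
    proof eventually_elim
      case (elim z)
      have "\<bar>f (snd z)\<bar> * \<bar>g (fst z)\<bar> \<le> \<bar>f (snd z)\<bar> * c" using elim by (intro mult_left_mono) auto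
      then have "\<bar>k (fst z - snd z)\<bar> * (\<bar>f (snd z)\<bar> * \<bar>g (fst z)\<bar>)
          \<le> \<bar>k (fst z - snd z)\<bar> * (\<bar>f (snd z)\<bar> * c)"
        by (rule mult_left_mono) simp
      then show ?case unfolding real_norm_def abs_mult by (simp only: mult.commute[of c])
    qed
  qed (use pint_snd(1)[OF ak fa] c in auto)
  also have "\<dots> = (LINT x|lborel. \<bar>k x\<bar>) * (c * l1 f)"
    using pint_snd(2)[OF ak fa] by simp
  also have "\<dots> \<le> \<kappa> * (c * l1 f)"
    using kdom_integrable(2)[OF k] c by (intro mult_right_mono) auto
  finally show ?thesis by (simp add: mult.assoc)
qed

text \<open>Here the kernel enters through its sup norm. For the heat kernel this is the smoothing
  estimate from L^1 to L^\<infinity>, the source of the rate t^(-N/2).\<close>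

lemma Q_l1_l1:
  fixes f g :: "real^'n \<Rightarrow> real"
  assumes k: "kdom k \<kappa> \<rho>" and f: "integrable lborel f" and g: "integrable lborel g"
  shows "\<bar>Q k f g\<bar> \<le> \<kappa> * (4 * pi * \<rho>) powr (- real CARD('n) / 2) * l1 f * l1 g"
proof -
  let ?c = "\<kappa> * (4 * pi * \<rho>) powr (- real CARD('n) / 2)"
  note [measurable] = borel_integrable[OF f] borel_integrable[OF g]
      borel_integrable[OF kdom_integrable(1)[OF k]]
  have kb: "\<bar>k x\<bar> \<le> ?c" for x
  proof -
    have "\<bar>k x\<bar> \<le> \<kappa> * heat_kernel x \<rho>" using k by (auto simp: kdom_def)
    also have "\<dots> \<le> ?c" using k kdom_integrable(3)[OF k]
        by (intro mult_left_mono heat_kernel_le) (auto simp: kdom_def)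
    finally show ?thesis .
  qed
  have i: "integrable lborel2 (\<lambda>z. ?c * (\<bar>f (snd z)\<bar> * \<bar>g (fst z)\<bar>))" (is "integrable _ ?h")
  proof (rule lborel_pair.Fubini_integrable)
    show "integrable lborel (\<lambda>x. LINT y|lborel. norm (?h (x, y)))" using g by (simp add: abs_mult)
    show "AE x in lborel. integrable lborel (\<lambda>y. ?h (x, y))" using f by simp
  qed measurable
  have "\<bar>Q k f g\<bar> \<le> (LINT z|lborel2. norm (k (fst z - snd z) * (f (snd z) * g (fst z))))"
    unfolding pint_def using integral_norm_bound[of "lborel2"
        "\<lambda>z. k (fst z - snd z) * (f (snd z) * g (fst z))"] by simp
  also have "\<dots> \<le> (LINT z|lborel2. ?h z)"
    proof (rule integral_mono_AE'[OF i])
    have "\<bar>k (fst z - snd z)\<bar> * (\<bar>f (snd z)\<bar> * \<bar>g (fst z)\<bar>) \<le> ?c * (\<bar>f (snd z)\<bar> * \<bar>g (fst z)\<bar>)"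
        for z
      by (intro mult_right_mono kb) auto
    then show "AE z in lborel2. norm (k (fst z - snd z) * (f (snd z) * g (fst z))) \<le> ?h z"
      by (simp add: abs_mult)
    show "AE z in lborel2. 0 \<le> ?h z"
      using kdom_integrable(3)[OF k] by (auto intro!: AE_I2 mult_nonneg_nonneg)
  qed
  also have "\<dots> = ?c * l1 f * l1 g"
    by (subst lborel_pair.integral_fst'[OF i, symmetric]) simp
  finally show ?thesis .
qed

section \<open>The Dirichlet form of the heat semigroup\<close>

text \<open>Since K_r has mass 1, this is |g|^2 - (K_r * g, g) in L^2 (see
  \<open>energy_eq\<close>). Divided by r it is the difference quotient of the heat semigroup, and
  for smooth decaying g it tends to the Dirichlet integral of g as r tends to 0.\<close>

definition energy :: "(real^'n \<Rightarrow> real) \<Rightarrow> real \<Rightarrow> real" where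
  "energy g r = pint (\<lambda>z. heat_kernel z r) (\<lambda>z. (g (fst z) - g (snd z))\<^sup>2) / 2"

lemma kdom_sqint_diff_integrable:
  assumes k: "kdom k \<kappa> \<rho>" and g: "sqint g"
  shows "pintegrable k (\<lambda>z. (g (fst z) - g (snd z))\<^sup>2)"
proof -
  have g2: "integrable lborel (\<lambda>x. (g x)\<^sup>2)" using g by (simp add: sqint_def)
  have "integrable lborel2 (\<lambda>z. k (fst z - snd z) * (g (fst z))\<^sup>2
      + k (fst z - snd z) * (g (snd z))\<^sup>2
    - 2 * (k (fst z - snd z) * (g (snd z) * g (fst z))))"
    by (intro Bochner_Integration.integrable_add Bochner_Integration.integrable_diff
        integrable_mult_right
      pint_fst(1) pint_snd(1) kdom_integrable(1)[OF k] g2 Q_integrable[OF k g g])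
  then show ?thesis by (rule Bochner_Integration.integrable_cong[THEN iffD1, rotated 2])
    (auto simp: power2_eq_square algebra_simps)
qed

lemma pint_square_diff:
  assumes k: "kdom k \<kappa> \<rho>" and g: "sqint g"
  shows "pint k (\<lambda>z. (g (fst z) - g (snd z))\<^sup>2)
      = 2 * ((LINT x|lborel. k x) * (LINT x|lborel. (g x)\<^sup>2) - Q k g g)"
proof -
  have g2: "integrable lborel (\<lambda>x. (g x)\<^sup>2)" using g by (simp add: sqint_def)
  note k1 = kdom_integrable(1)[OF k]
  have "pint k (\<lambda>z. (g (fst z) - g (snd z))\<^sup>2) =
    (LINT z|lborel2. (k (fst z - snd z) * (g (fst z))\<^sup>2 + k (fst z - snd z) * (g (snd z))\<^sup>2)
      - 2 * (k (fst z - snd z) * (g (snd z) * g (fst z))))"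
    unfolding pint_def by (intro Bochner_Integration.integral_cong)
        (auto simp: power2_eq_square algebra_simps)
  also have "\<dots> = (pint k (\<lambda>z. (g (fst z))\<^sup>2) + pint k (\<lambda>z. (g (snd z))\<^sup>2)) - 2 * Q k g g"
    unfolding pint_def
    using pint_fst(1)[OF k1 g2] pint_snd(1)[OF k1 g2] Q_integrable[OF k g g] by simp
  also have "\<dots> = 2 * ((LINT x|lborel. k x) * (LINT x|lborel. (g x)\<^sup>2) - Q k g g)"
    by (simp add: pint_fst(2)[OF k1 g2] pint_snd(2)[OF k1 g2])
  finally show ?thesis .
qed

lemma energy_eq:
  assumes "0 < r" "sqint g"
  shows "energy g r = (LINT x|lborel. (g x)\<^sup>2) - Q (\<lambda>z. heat_kernel z r) g g"
  unfolding energy_def pint_square_diff[OF kdom_heat_kernel[OF assms(1)] assms(2)]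
  by (simp add: integral_heat_kernel[OF assms(1)])

lemma energy_nonneg: "0 \<le> energy g r"
  unfolding energy_def pint_def by (auto intro!: divide_nonneg_pos
      Bochner_Integration.integral_nonneg)

text \<open>The difference is the double integral of K_r(x - y) f(y) (g(x) - g(y)), to which
  Cauchy-Schwarz applies. The smallness rests on the energy of g alone, so f can be any square
  integrable function.\<close>

lemma Q_heat_kernel_approx:
  fixes f g :: "real^'n \<Rightarrow> real"
  assumes r: "0 < r" and f: "sqint f" and g: "sqint g"
  shows "\<bar>Q (\<lambda>z. heat_kernel z r) f g - (LINT x|lborel. f x * g x)\<bar> \<le> l2 f * sqrt (2 * energy g r)"
proof -
  let ?k = "\<lambda>z::real^'n. heat_kernel z r"
  note k = kdom_heat_kernel[OF r, where 'a='n]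
  note k1 = kdom_integrable(1)[OF k]
  note [measurable] = sqint_borel[OF f] sqint_borel[OF g]
  have fg: "integrable lborel (\<lambda>x. f x * g x)" by (rule sqint_mult_integrable[OF f g])
  have f2: "integrable lborel (\<lambda>x. (f x)\<^sup>2)" using f by (simp add: sqint_def)
  have "Q ?k f g - (LINT x|lborel. f x * g x) = Q ?k f g - pint ?k (\<lambda>z. f (snd z) * g (snd z))"
    using pint_snd(2)[OF k1 fg] by (simp add: integral_heat_kernel[OF r])
  also have "\<dots> = (LINT z|lborel2. ?k (fst z - snd z) * (f (snd z) * g (fst z))
      - ?k (fst z - snd z) * (f (snd z) * g (snd z)))"
    unfolding pint_def using Q_integrable[OF k f g] pint_snd(1)[OF k1 fg] by simp
  also have "\<dots> = (LINT z|lborel2. (sqrt (?k (fst z - snd z)) * f (snd z)) *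
      (sqrt (?k (fst z - snd z)) * (g (fst z) - g (snd z))))"
    by (intro Bochner_Integration.integral_cong) (auto simp: algebra_simps)
  also have "\<bar>\<dots>\<bar> \<le> sqrt (LINT z|lborel2. (sqrt (?k (fst z - snd z)) * f (snd z))\<^sup>2) *
      sqrt (LINT z|lborel2. (sqrt (?k (fst z - snd z)) * (g (fst z) - g (snd z)))\<^sup>2)"
    by (rule cauchy_schwarz_integral)
       (use pint_snd(1)[OF k1 f2] kdom_sqint_diff_integrable[OF k g] in
           \<open>auto simp: power_mult_distrib\<close>)
  also have "\<dots> = sqrt (pint ?k (\<lambda>z. (f (snd z))\<^sup>2)) * sqrt
      (pint ?k (\<lambda>z. (g (fst z) - g (snd z))\<^sup>2))"
    by (simp add: pint_def power_mult_distrib)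
  also have "\<dots> = l2 f * sqrt (2 * energy g r)"
    using pint_snd(2)[OF k1 f2] by (simp add: energy_def l2_def integral_heat_kernel[OF r])
  finally show ?thesis .
qed

text \<open>The substitution z = x - y and Tonelli's theorem separate the kernel from the
  increments; the energy becomes an average of squared L^2 increments with weight K_r(z).\<close>

lemma ennreal_pint:
  fixes k :: "'a::euclidean_space \<Rightarrow> real"
  assumes i: "pintegrable k h" and nn: "\<And>x. 0 \<le> k x" "\<And>z. 0 \<le> h z"
    and [measurable]: "k \<in> borel_measurable borel" "h \<in> borel_measurable (borel \<Otimes>\<^sub>M borel)"
  shows "ennreal (pint k h) = (\<integral>\<^sup>+z. ennreal (k z) * (\<integral>\<^sup>+x. ennreal (h (x, x - z)) \<partial>lborel)
      \<partial>lborel)"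
proof -
  have "ennreal (pint k h) = (\<integral>\<^sup>+p. ennreal (k (fst p - snd p) * h p) \<partial>lborel2)"
    unfolding pint_def by (rule nn_integral_eq_integral[symmetric]) (use i nn in auto)
  also have "\<dots> = (\<integral>\<^sup>+x. \<integral>\<^sup>+y. ennreal (k (x - y) * h (x, y)) \<partial>lborel \<partial>lborel)"
    by (subst lborel.nn_integral_fst[symmetric]) auto
  also have "\<dots> = (\<integral>\<^sup>+x. \<integral>\<^sup>+z. ennreal (k z * h (x, x - z)) \<partial>lborel \<partial>lborel)"
  proof (rule nn_integral_cong)
    fix x :: 'a
    have "(\<integral>\<^sup>+z. ennreal (k (x - (x - z)) * h (x, x - z)) \<partial>lborel)
        = (\<integral>\<^sup>+y. ennreal (k (x - y) * h (x, y)) \<partial>lborel)"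
      by (rule nn_integral_lborel_reflect[where f="\<lambda>y. ennreal (k (x - y) * h (x, y))"]) measurable
    then show "(\<integral>\<^sup>+y. ennreal (k (x - y) * h (x, y)) \<partial>lborel)
        = (\<integral>\<^sup>+z. ennreal (k z * h (x, x - z)) \<partial>lborel)"
      by simp
  qed
  also have "\<dots> = (\<integral>\<^sup>+z. \<integral>\<^sup>+x. ennreal (k z * h (x, x - z)) \<partial>lborel \<partial>lborel)"
    by (rule lborel_pair.Fubini'[symmetric]) measurable
  also have "\<dots> = (\<integral>\<^sup>+z. ennreal (k z) * (\<integral>\<^sup>+x. ennreal (h (x, x - z)) \<partial>lborel) \<partial>lborel)"
    using nn by (intro nn_integral_cong) (simp add: ennreal_mult nn_integral_cmult)
  finally show ?thesis .
qed

lemma nn_integral_lborel_scale: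
  fixes f :: "'a::euclidean_space \<Rightarrow> ennreal"
  assumes [measurable]: "f \<in> borel_measurable borel" and c: "0 < c"
  shows "(\<integral>\<^sup>+x. f x \<partial>lborel) = ennreal (c ^ DIM('a)) * (\<integral>\<^sup>+x. f (c *\<^sub>R x) \<partial>lborel)"
proof -
  have "(\<integral>\<^sup>+x. f x \<partial>lborel) = (\<integral>\<^sup>+x. f x \<partial>density (distr lborel borel (\<lambda>x. 0 + c *\<^sub>R x))
      (\<lambda>_. ennreal (\<bar>c\<bar> ^ DIM('a))))"
    using c lborel_affine[of c "0::'a"] by simp
  also have "\<dots> = ennreal (c ^ DIM('a)) * (\<integral>\<^sup>+x. f (c *\<^sub>R x) \<partial>lborel)"
    using c by (simp add: nn_integral_density nn_integral_distr nn_integral_cmult)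
  finally show ?thesis .
qed

lemma heat_kernel_scale:
  fixes z :: "real^'n"
  assumes "0 < r" shows "2 ^ CARD('n) * heat_kernel (2 *\<^sub>R z) (4 * r) = heat_kernel z r"
proof -
  have "(4 * pi * (4 * r)) powr (- real CARD('n) / 2)
      = 4 powr (- real CARD('n) / 2) * (4 * pi * r) powr (- real CARD('n) / 2)"
    using assms powr_mult[of 4 "4 * pi * r" "- real CARD('n) / 2"] by (simp add: mult_ac)
  moreover have "4 powr (- real CARD('n) / 2) = (2::real) powr (- real CARD('n))"
    using powr_powr[of 2 2 "- real CARD('n) / 2"] by simp
  moreover have "(2::real) ^ CARD('n) * 2 powr (- real CARD('n)) = 1"
    by (simp add: powr_minus powr_realpow)
  moreover have "- (norm (2 *\<^sub>R z))\<^sup>2 / (4 * (4 * r)) = - (norm z)\<^sup>2 / (4 * r)"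
    by (simp add: power_mult_distrib)
  ultimately show ?thesis unfolding heat_kernel_def by (simp add: mult.assoc[symmetric])
qed

lemma ennreal_energy:
  fixes g :: "real^'n \<Rightarrow> real"
  assumes "0 < r" "sqint g"
  shows "ennreal (2 * energy g r) =
    (\<integral>\<^sup>+z. ennreal (heat_kernel z r) * (\<integral>\<^sup>+x. ennreal ((g x - g (x - z))\<^sup>2) \<partial>lborel) \<partial>lborel)"
proof -
  note [measurable] = sqint_borel[OF assms(2)]
  show ?thesis
    using ennreal_pint[OF kdom_sqint_diff_integrable[OF kdom_heat_kernel[OF assms(1)] assms(2)]]
    by (simp add: energy_def)
qed

text \<open>The increment $N(z) = \| g(\cdot - z) - g \|_2$ satisfies $N(2z) \le 2 N(z)$, and $K_{4r}$ is $K_r$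
  rescaled by the factor 2.\<close>

lemma energy_quadruple:
  fixes g :: "real^'n \<Rightarrow> real"
  assumes r: "0 < r" and g: "sqint g"
  shows "energy g (4 * r) \<le> 4 * energy g r"
proof -
  note [measurable] = sqint_borel[OF g]
  let ?N = "\<lambda>z. (\<integral>\<^sup>+x. ennreal ((g x - g (x - z))\<^sup>2) \<partial>lborel)"
  have N: "?N (2 *\<^sub>R z) \<le> 4 * ?N z" for z
  proof -
    have "?N (2 *\<^sub>R z) \<le> (\<integral>\<^sup>+x. 2 * ennreal ((g x - g (x - z))\<^sup>2)
        + 2 * ennreal ((g (x - z) - g (x - z - z))\<^sup>2) \<partial>lborel)"
    proof (rule nn_integral_mono)
      fix x
      let ?a = "g x - g (x - z)" and ?b = "g (x - z) - g (x - z - z)"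
      have "(g x - g (x - 2 *\<^sub>R z))\<^sup>2 = (?a + ?b)\<^sup>2" by (simp add: scaleR_2 diff_diff_eq)
      also have "\<dots> \<le> 2 * ?a\<^sup>2 + 2 * ?b\<^sup>2"
        using sum_squares_bound[of ?a ?b] unfolding power2_sum by linarith
      finally show "ennreal ((g x - g (x - 2 *\<^sub>R z))\<^sup>2) \<le> 2 * ennreal (?a\<^sup>2) + 2 * ennreal (?b\<^sup>2)"
        by (simp add: ennreal_plus[symmetric] ennreal_mult'' [symmetric] ennreal_leI
            flip: ennreal_numeral ennreal_mult del: ennreal_plus)
    qed
    also have "\<dots> = 2 * ?N z + 2 * (\<integral>\<^sup>+x. ennreal ((g (x - z) - g (x - z - z))\<^sup>2) \<partial>lborel)"
      by (simp add: nn_integral_add nn_integral_cmult)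
    also have "(\<integral>\<^sup>+x. ennreal ((g (x - z) - g (x - z - z))\<^sup>2) \<partial>lborel) = ?N z"
      by (rule nn_integral_lborel_shift[where f="\<lambda>x. ennreal ((g x - g (x - z))\<^sup>2)"]) measurable
    finally show ?thesis by (simp add: distrib_right[symmetric])
  qed
  have [measurable]: "?N \<in> borel_measurable borel" by measurable
  have "ennreal (2 * energy g (4 * r)) = (\<integral>\<^sup>+z. ennreal (heat_kernel z (4 * r)) * ?N z \<partial>lborel)"
    using ennreal_energy[of "4 * r" g] r g by simp
  also have "\<dots> = ennreal (2 ^ CARD('n)) * (\<integral>\<^sup>+z. ennreal (heat_kernel (2 *\<^sub>R z) (4 * r)) * ?N
      (2 *\<^sub>R z) \<partial>lborel)"
    by (subst nn_integral_lborel_scale[where c=2]) auto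
  also have "\<dots> = (\<integral>\<^sup>+z. ennreal (2 ^ CARD('n)) *
      (ennreal (heat_kernel (2 *\<^sub>R z) (4 * r)) * ?N (2 *\<^sub>R z)) \<partial>lborel)"
    by (rule nn_integral_cmult[symmetric]) measurable
  also have "\<dots> = (\<integral>\<^sup>+z. ennreal (heat_kernel z r) * ?N (2 *\<^sub>R z) \<partial>lborel)"
    by (simp add: mult.assoc[symmetric] ennreal_mult[symmetric] heat_kernel_scale[OF r])
  also have "\<dots> \<le> (\<integral>\<^sup>+z. 4 * (ennreal (heat_kernel z r) * ?N z) \<partial>lborel)"
  proof (rule nn_integral_mono)
    fix z
    show "ennreal (heat_kernel z r) * ?N (2 *\<^sub>R z) \<le> 4 * (ennreal (heat_kernel z r) * ?N z)"
      using mult_left_mono[OF N[of z], of "ennreal (heat_kernel z r)"]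
          by (simp add: mult.left_commute)
  qed
  also have "\<dots> = 4 * (\<integral>\<^sup>+z. ennreal (heat_kernel z r) * ?N z \<partial>lborel)"
    by (rule nn_integral_cmult) measurable
  also have "\<dots> = 4 * ennreal (2 * energy g r)"
    using ennreal_energy[OF r g] by simp
  also have "\<dots> = ennreal (4 * (2 * energy g r))"
    using energy_nonneg[of g r] by (simp add: ennreal_mult)
  finally show ?thesis
    using energy_nonneg[of g r] by (subst (asm) ennreal_le_iff) auto
qed

lemma norm_square_heat_kernel:
  fixes z :: "real^'n"
  assumes "0 < r"
  shows "(norm z)\<^sup>2 * heat_kernel z r \<le> 8 * r * 2 powr (real CARD('n) / 2) * heat_kernel z (2 * r)"
proof -
  define s where "s = (norm z)\<^sup>2 / (8 * r)"
  have "(norm z)\<^sup>2 * heat_kernel z r = (s * exp (- s)) *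
      (8 * r * 2 powr (real CARD('n) / 2) * heat_kernel z (2 * r))"
    using assms by (subst heat_kernel_double) (auto simp: s_def)
  also have "\<dots> \<le> 8 * r * 2 powr (real CARD('n) / 2) * heat_kernel z (2 * r)"
    using assms mult_exp_minus_le[of s] by (intro mult_left_le_one_le) (auto simp: s_def)
  finally show ?thesis .
qed

text \<open>For bounded g a squared increment is at most 2 C times the increment, so continuity of
  translations in L^1 suffices. Large displacements are paid for by the second moment of K_r, which
  is O(r).\<close>

lemma energy_tendsto_0:
  fixes g :: "real^'n \<Rightarrow> real"
  assumes g: "bint g"
  shows "(energy g \<longlongrightarrow> 0) (at_right 0)"
proof (rule tendstoI)
  fix e :: real assume e: "0 < e"
  note [measurable] = bint_borel[OF g]
  obtain C where C: "0 < C" "\<And>x. \<bar>g x\<bar> \<le> C" using bintE[OF g] by blast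
  have gi: "integrable lborel g" by (rule bint_integrable[OF g])
  obtain d where d: "d > 0" "\<And>z. norm z < d \<Longrightarrow> translation_diff g z \<le> ennreal (e / (4 * C))"
    using translation_diff_tendsto[OF gi] e C
        by (metis divide_pos_pos mult_pos_pos zero_less_numeral)
  define L where "L = l1 g"
  have L: "0 \<le> L" "(\<integral>\<^sup>+x. ennreal \<bar>g x\<bar> \<partial>lborel) = ennreal L"
    unfolding L_def using gi by (auto simp: nn_integral_eq_integral)
  let ?c = "8 * 2 powr (real CARD('n) / 2)"
  \<comment> \<open>A single bound for near and far displacements: beyond d the factor |z|^2 / d^2
    is at least 1, as in Chebyshev's inequality.\<close>
  have td: "translation_diff g z \<le> ennreal (e / (4 * C) + 2 * L * (norm z)\<^sup>2 / d\<^sup>2)" for z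
  proof (cases "norm z < d")
    case True
    have "ennreal (e / (4 * C)) \<le> ennreal (e / (4 * C) + 2 * L * (norm z)\<^sup>2 / d\<^sup>2)"
      using L d by (intro ennreal_leI) auto
    then show ?thesis using d(2)[OF True] by (rule order_trans[rotated])
  next
    case False
    then have "d\<^sup>2 \<le> (norm z)\<^sup>2" using d by (intro power_mono) auto
    then have "1 \<le> (norm z)\<^sup>2 / d\<^sup>2" using d by simp
    then have "2 * L * 1 \<le> 2 * L * ((norm z)\<^sup>2 / d\<^sup>2)" using L by (intro mult_left_mono) auto
    moreover have "0 \<le> e / (4 * C)" using e C by simp
    ultimately have "2 * L \<le> e / (4 * C) + 2 * L * (norm z)\<^sup>2 / d\<^sup>2" by simp
    then have "ennreal (2 * L) \<le> ennreal (e / (4 * C) + 2 * L * (norm z)\<^sup>2 / d\<^sup>2)"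
        by (rule ennreal_leI)
    moreover have "translation_diff g z \<le> ennreal (2 * L)"
      using translation_diff_le[OF gi, of z] L by (simp add: ennreal_mult)
    ultimately show ?thesis by (rule order_trans[rotated])
  qed
  have bound: "2 * energy g r \<le> 2 * C * (e / (4 * C) + 2 * L * (?c * r) / d\<^sup>2)" if r: "0 < r" for r
  proof -
    have ik: "integrable lborel (\<lambda>z::real^'n. heat_kernel z r)"
        "integrable lborel (\<lambda>z::real^'n. heat_kernel z (2 * r))"
      using r by (auto intro: integrable_heat_kernel)
    have "ennreal (2 * energy g r) =
      (\<integral>\<^sup>+z. ennreal (heat_kernel z r) * (\<integral>\<^sup>+x. ennreal ((g x - g (x - z))\<^sup>2) \<partial>lborel) \<partial>lborel)"
      using r bint_sqint[OF g] by (rule ennreal_energy)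
    also have "\<dots> \<le> (\<integral>\<^sup>+z. ennreal (2 * C * (e / (4 * C)) * heat_kernel (z::real^'n) r
        + 2 * C * (2 * L * (?c * r) / d\<^sup>2) * heat_kernel z (2 * r)) \<partial>lborel)"
    proof (rule nn_integral_mono)
      fix z :: "real^'n"
      have "(\<integral>\<^sup>+x. ennreal ((g x - g (x - z))\<^sup>2) \<partial>lborel)
          \<le> (\<integral>\<^sup>+x. ennreal (2 * C) * ennreal \<bar>g (x - z) - g x\<bar> \<partial>lborel)"
      proof (rule nn_integral_mono)
        fix x
        have "\<bar>g (x - z) - g x\<bar> \<le> 2 * C" using C(2)[of x] C(2)[of "x - z"] by linarith
        then have "\<bar>g (x - z) - g x\<bar> * \<bar>g (x - z) - g x\<bar> \<le> 2 * C * \<bar>g (x - z) - g x\<bar>"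
          by (intro mult_right_mono) auto
        then have "(g x - g (x - z))\<^sup>2 \<le> 2 * C * \<bar>g (x - z) - g x\<bar>"
          by (simp add: power2_eq_square algebra_simps)
        then show "ennreal ((g x - g (x - z))\<^sup>2) \<le> ennreal (2 * C) * ennreal \<bar>g (x - z) - g x\<bar>"
          using C by (simp add: ennreal_mult[symmetric] ennreal_leI)
      qed
      also have "\<dots> = ennreal (2 * C) * translation_diff g z"
        unfolding translation_diff_def by (rule nn_integral_cmult) measurable
      also have "\<dots> \<le> ennreal (2 * C) * ennreal (e / (4 * C) + 2 * L * (norm z)\<^sup>2 / d\<^sup>2)"
        by (intro mult_left_mono td) simp
      also have "\<dots> = ennreal (2 * C * (e / (4 * C) + 2 * L * (norm z)\<^sup>2 / d\<^sup>2))"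
        using C by (simp add: ennreal_mult')
      finally have "ennreal (heat_kernel z r) * (\<integral>\<^sup>+x. ennreal ((g x - g (x - z))\<^sup>2) \<partial>lborel) \<le>
        ennreal (heat_kernel z r) * ennreal (2 * C * (e / (4 * C) + 2 * L * (norm z)\<^sup>2 / d\<^sup>2))"
        by (intro mult_left_mono) auto
      also have "\<dots> = ennreal (heat_kernel z r * (2 * C * (e / (4 * C) + 2 * L * (norm z)\<^sup>2 / d\<^sup>2)))"
        by (simp add: ennreal_mult')
      also have "\<dots> \<le> ennreal (2 * C * (e / (4 * C)) * heat_kernel z r
          + 2 * C * (2 * L * (?c * r) / d\<^sup>2) * heat_kernel z (2 * r))"
      proof (rule ennreal_leI)
        have "(2 * C * (2 * L) / d\<^sup>2) * ((norm z)\<^sup>2 * heat_kernel z r)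
            \<le> (2 * C * (2 * L) / d\<^sup>2) * (?c * r * heat_kernel z (2 * r))"
          using norm_square_heat_kernel[OF r, of z] C L
              by (intro mult_left_mono) (auto simp: mult_ac)
        then show "heat_kernel z r * (2 * C * (e / (4 * C) + 2 * L * (norm z)\<^sup>2 / d\<^sup>2)) \<le>
          2 * C * (e / (4 * C)) * heat_kernel z r + 2 * C * (2 * L * (?c * r) / d\<^sup>2) * heat_kernel
              z (2 * r)"
          by (simp add: algebra_simps)
      qed
      finally show "ennreal (heat_kernel z r) * (\<integral>\<^sup>+x. ennreal ((g x - g (x - z))\<^sup>2) \<partial>lborel) \<le>
        ennreal (2 * C * (e / (4 * C)) * heat_kernel z r + 2 * C * (2 * L * (?c * r) / d\<^sup>2) *
            heat_kernel z (2 * r))" .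
    qed
    also have "\<dots> = ennreal (LINT z|lborel. 2 * C * (e / (4 * C)) * heat_kernel (z::real^'n) r
        + 2 * C * (2 * L * (?c * r) / d\<^sup>2) * heat_kernel z (2 * r))"
      using ik C L r e by (intro nn_integral_eq_integral)
          (auto intro!: AE_I2 add_nonneg_nonneg mult_nonneg_nonneg divide_nonneg_nonneg)
    also have "(LINT z|lborel. 2 * C * (e / (4 * C)) * heat_kernel (z::real^'n) r
        + 2 * C * (2 * L * (?c * r) / d\<^sup>2) * heat_kernel z (2 * r))
      = 2 * C * (e / (4 * C)) + 2 * C * (2 * L * (?c * r) / d\<^sup>2)"
      using ik integral_heat_kernel[OF r, where 'n='n] integral_heat_kernel[of "2 * r",
          where 'n='n] r by simp
    finally show ?thesis
      using C L e r by (subst (asm) ennreal_le_iff) (auto simp: algebra_simps)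
  qed
  define K where "K = C * (2 * L * ?c / d\<^sup>2)"
  have K: "0 \<le> K" using C L by (auto simp: K_def)
  have "\<forall>\<^sub>F r in at_right 0. (0::real) < r \<and> r < e / (2 * (K + 1))"
    using e K by (intro eventually_conj eventually_at_right_less)
      (auto simp: eventually_at_right[of 0 1] intro!: exI[of _ "e / (2 * (K + 1))"])
  then show "\<forall>\<^sub>F r in at_right 0. dist (energy g r) 0 < e"
  proof eventually_elim
    case (elim r)
    have "energy g r \<le> e / 4 + K * r"
    proof -
      have "2 * C * (e / (4 * C) + X) = e / 2 + 2 * (C * X)" for X
        using C by (simp add: distrib_left)
      moreover have "C * (2 * L * (?c * r) / d\<^sup>2) = K * r" by (simp add: K_def)
      ultimately have "2 * C * (e / (4 * C) + 2 * L * (?c * r) / d\<^sup>2) = e / 2 + 2 * (K * r)" by simp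
      then show ?thesis using bound[of r] elim by simp
    qed
    also have "K * r \<le> (K + 1) * r" using elim by simp
    also have "(K + 1) * r < e / 2" using elim K by (simp add: field_simps)
    finally have "energy g r < e" using e by linarith
    then show ?case using energy_nonneg[of g r] by simp
  qed
qed

section \<open>Dissipation at a fixed time\<close>

lemma has_real_derivative_quadratic:
  fixes A :: "real \<Rightarrow> real"
  assumes d: "0 < d" and bd: "\<And>h. \<bar>h\<bar> \<le> d \<Longrightarrow> \<bar>A (r + h) - A r - h * D\<bar> \<le> C * h\<^sup>2"
  shows "(A has_real_derivative D) (at r)"
  unfolding has_field_derivative_def DERIV_def
proof -
  have "(\<lambda>h. (A (r + h) - A r) / h) \<midarrow>0\<rightarrow> D"
  proof (rule LIM_I)
    fix e :: real assume e: "0 < e"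
    show "\<exists>s>0. \<forall>h. h \<noteq> 0 \<and> norm (h - 0) < s \<longrightarrow> norm ((A (r + h) - A r) / h - D) < e"
    proof (intro exI[of _ "min d (e / (\<bar>C\<bar> + 1))"] conjI allI impI)
      show "0 < min d (e / (\<bar>C\<bar> + 1))" using d e by (auto intro!: divide_pos_pos add_nonneg_pos)
      fix h :: real assume h: "h \<noteq> 0 \<and> norm (h - 0) < min d (e / (\<bar>C\<bar> + 1))"
      have "(A (r + h) - A r) / h - D = (A (r + h) - A r - h * D) / h" using h
          by (simp add: field_simps)
      then have "norm ((A (r + h) - A r) / h - D) = \<bar>A (r + h) - A r - h * D\<bar> / \<bar>h\<bar>" by simp
      also have "\<dots> \<le> C * h\<^sup>2 / \<bar>h\<bar>" using bd[of h] h by (intro divide_right_mono) auto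
      also have "\<dots> = C * \<bar>h\<bar>" 
      proof -
        have "C * h\<^sup>2 / \<bar>h\<bar> = C * (\<bar>h\<bar> * \<bar>h\<bar>) / \<bar>h\<bar>"
          by (simp only: abs_mult_self_eq power2_eq_square)
        also have "\<dots> = C * \<bar>h\<bar>" using h by (simp del: abs_mult_self_eq)
        finally show ?thesis .
      qed
      also have "\<dots> \<le> (\<bar>C\<bar> + 1) * \<bar>h\<bar>" by (intro mult_right_mono) auto
      also have "\<dots> < e"
      proof -
        have "\<bar>h\<bar> < e / (\<bar>C\<bar> + 1)" using h by simp
        then show ?thesis by (simp add: pos_less_divide_eq add_nonneg_pos mult.commute)
      qed
      finally show "norm ((A (r + h) - A r) / h - D) < e" .
    qed
  qed
  then show "(A has_derivative (*) D) (at r)"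
    using DERIV_def[of A D r] by (simp add: has_field_derivative_def)
qed

lemma Q_kernel_diff:
  assumes "kdom k1 c1 \<rho>1" "kdom k2 c2 \<rho>2" "sqint f" "sqint g"
  shows "Q (\<lambda>z. k1 z - k2 z) f g = Q k1 f g - Q k2 f g"
  using Q_integrable[OF assms(1,3,4)] Q_integrable[OF assms(2,3,4)]
  by (simp add: pint_def left_diff_distrib)

lemma Q_kernel_cmult: "Q (\<lambda>z. c * k z) f g = c * Q k f g"
  by (simp add: pint_def mult.assoc)

lemma Q_diff_left:
  assumes "kdom k c \<rho>" "sqint f1" "sqint f2" "sqint g"
  shows "Q k (\<lambda>x. f1 x - f2 x) g = Q k f1 g - Q k f2 g"
  using Q_integrable[OF assms(1,2,4)] Q_integrable[OF assms(1,3,4)]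
  by (simp add: pint_def left_diff_distrib right_diff_distrib)

lemma Q_cmult_left: "Q k (\<lambda>x. c * f x) g = c * Q k f g"
  by (simp add: pint_def mult.assoc mult.left_commute)

lemma kdom_cmult: "kdom k c \<rho> \<Longrightarrow> kdom (\<lambda>z. b * k z) (\<bar>b\<bar> * c) \<rho>"
  by (auto simp: kdom_def abs_mult mult.assoc intro!: mult_left_mono)

lemma Q_heat_kernel_taylor:
  fixes f g :: "real^'n \<Rightarrow> real"
  assumes r: "0 < r" and h: "\<bar>h\<bar> \<le> r / 2" and f: "sqint f" and g: "sqint g"
  shows "\<bar>Q (\<lambda>z. heat_kernel z (r + h)) f g - Q (\<lambda>z. heat_kernel z r) f g
      - h * Q (\<lambda>z. hk_dt z r) f g\<bar>
    \<le> hkD TYPE('n) / r\<^sup>2 * l2 f * l2 g * h\<^sup>2"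
proof -
  have rh: "0 < r + h" using r h by (auto simp: abs_if split: if_splits)
  note k1 = kdom_heat_kernel[OF rh, where 'a='n] and k2 = kdom_heat_kernel[OF r, where 'a='n]
    and k3 = kdom_cmult[OF kdom_hk_dt[OF r, where 'n='n], of h]
    and k12 = kdom_heat_kernel_diff[OF r h, where 'n='n]
    and kt = kdom_heat_kernel_taylor[OF r h, where 'n='n]
  have "Q (\<lambda>z. heat_kernel z (r + h) - heat_kernel z r - h * hk_dt z r) f g
    = Q (\<lambda>z. heat_kernel z (r + h)) f g - Q (\<lambda>z. heat_kernel z r) f g - h * Q (\<lambda>z. hk_dt z r) f g"
    using Q_kernel_diff[OF k12 k3 f g] Q_kernel_diff[OF k1 k2 f g]
        Q_kernel_cmult[of h "\<lambda>z. hk_dt z r" f g] by simp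
  then show ?thesis using Q_l2[OF kt f g] by (simp add: mult_ac)
qed

lemma Q_heat_kernel_has_derivative:
  fixes f g :: "real^'n \<Rightarrow> real"
  assumes r: "0 < r" and f: "sqint f" and g: "sqint g"
  shows "((\<lambda>r. Q (\<lambda>z. heat_kernel z r) f g) has_real_derivative Q (\<lambda>z. hk_dt z r) f g) (at r)"
  by (rule has_real_derivative_quadratic[where d="r / 2", OF _ Q_heat_kernel_taylor[OF r _ f g]])
      (use r in auto)

lemma integral_hk_grad:
  fixes a :: "real^'n"
  assumes "0 < r" shows "(LINT z|lborel. hk_grad a z r) = 0"
  using integral_lborel_reflect[of "\<lambda>z. hk_grad a z r" 0] by simp

lemma continuous_on_lipschitz1:
  fixes \<beta> :: "real \<Rightarrow> real"
  assumes "\<And>s t. \<bar>\<beta> s - \<beta> t\<bar> \<le> \<bar>s - t\<bar>"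
  shows "continuous_on A \<beta>"
proof (rule continuous_onI)
  fix x e :: real assume "0 < e"
  then show "\<exists>d>0. \<forall>x'\<in>A. dist x' x < d \<longrightarrow> dist (\<beta> x') (\<beta> x) \<le> e"
    unfolding dist_real_def
    by (intro exI[of _ e] conjI ballI impI order_trans[OF assms less_imp_le]) auto
qed

lemma antiderivative_on_interval:
  fixes h :: "real \<Rightarrow> real"
  assumes "continuous_on UNIV h" "0 < C"
  obtains \<Phi> where "\<And>s. s \<in> {-C..C} \<Longrightarrow> (\<Phi> has_real_derivative h s) (at s within {-C..C})" "\<Phi> 0 = 0"
proof -
  obtain g where g: "\<And>s. s \<in> {-C..C} \<Longrightarrow> (g has_vector_derivative h s) (at s within {-C..C})"
    using antiderivative_continuous[of "-C" C h] assms continuous_on_subset by blast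
  have "((\<lambda>s. g s - g 0) has_real_derivative h s) (at s within {-C..C})" if "s \<in> {-C..C}" for s
    using g[OF that] by (auto simp: has_real_derivative_iff_has_vector_derivative intro!:
        derivative_eq_intros)
  then show ?thesis using that[of "\<lambda>s. g s - g 0"] by simp
qed

text \<open>One time slice, with f = u(t) and v its time derivative. The assumption
  \<open>weak\<close> is the equation convolved with K_r and paired with w, all space derivatives
  having been moved to the kernel.\<close>

locale stationary_identity =
  fixes a :: "real^'n" and F F' :: "real \<Rightarrow> real" and f v :: "real^'n \<Rightarrow> real"
  assumes F: "\<And>s. (F has_real_derivative F' s) (at s)" and F': "continuous_on UNIV F'"
      and F0: "F 0 = 0"
    and f: "bint f" and v: "sqint v"
    and weak: "\<And>r w. 0 < r \<Longrightarrow> bint w \<Longrightarrow> Q (\<lambda>z. heat_kernel z r) v w =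
      Q (\<lambda>z. hk_dt z r) f w + Q (\<lambda>z. hk_grad a z r) (\<lambda>x. F (f x)) w"
begin

lemma F_borel [measurable]: "F \<in> borel_measurable borel"
  by (rule borel_measurable_continuous_onI)
     (meson F DERIV_isCont continuous_at_imp_continuous_on)

lemma f_sq: "sqint f" by (rule bint_sqint[OF f])

lemma lipschitz_range:
  obtains C L where "0 < C" "\<And>x. \<bar>f x\<bar> \<le> C" "0 < L" "\<And>s. s \<in> {-C..C} \<Longrightarrow> \<bar>F' s\<bar> \<le> L"
    "\<And>s. s \<in> {-C..C} \<Longrightarrow> \<bar>F s\<bar> \<le> L * \<bar>s\<bar>"
proof -
  obtain C where C: "0 < C" "\<And>x. \<bar>f x\<bar> \<le> C" using bintE[OF f] by blast
  have "compact (F' ` {-C..C})"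
    using F' by (intro compact_continuous_image) (auto intro: continuous_on_subset)
  then obtain L where L: "0 < L" "\<And>y. y \<in> F' ` {-C..C} \<Longrightarrow> norm y \<le> L"
    using compact_imp_bounded bounded_pos by metis
  have L': "\<bar>F' s\<bar> \<le> L" if "s \<in> {-C..C}" for s using L(2)[of "F' s"] that by auto
  moreover have "\<bar>F s\<bar> \<le> L * \<bar>s\<bar>" if "s \<in> {-C..C}" for s
  proof -
    have "norm (F s - F 0) \<le> L * norm (s - 0)"
      by (rule field_differentiable_bound[where S="{-C..C}" and f'=F'])
         (use that C L' F in \<open>auto intro: DERIV_subset\<close>)
    then show ?thesis by (simp add: F0)
  qed
  ultimately show ?thesis using that C L by blast
qed

lemma Ff_bint: "bint (\<lambda>x. F (f x))"
proof -
  obtain C L where CL: "0 < C" "\<And>x. \<bar>f x\<bar> \<le> C" "0 < L" "\<And>s. s \<in> {-C..C} \<Longrightarrow> \<bar>F s\<bar> \<le> L * \<bar>s\<bar>"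
    using lipschitz_range by metis
  note [measurable] = bint_borel[OF f]
  show ?thesis
    by (rule bint_mono[OF f, where c=L]) (use CL(4)[of "f _"] CL(2) in
        \<open>auto simp: abs_le_iff minus_le_iff\<close>)
qed

text \<open>A Lipschitz constant of F on an interval containing the range of f. It is fixed once, so
  that \<open>conv_const\<close> depends neither on r nor on \<beta>.\<close>

definition flux_lip :: real where
  "flux_lip = (SOME L. 0 < L \<and> (\<exists>C>0. (\<forall>x. \<bar>f x\<bar> \<le> C) \<and> (\<forall>s\<in>{-C..C}. \<bar>F' s\<bar> \<le> L)))"

lemma flux_lip: "0 < flux_lip" "\<exists>C>0. (\<forall>x. \<bar>f x\<bar> \<le> C) \<and> (\<forall>s\<in>{-C..C}. \<bar>F' s\<bar> \<le> flux_lip)"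
proof -
  have "\<exists>L. 0 < L \<and> (\<exists>C>0. (\<forall>x. \<bar>f x\<bar> \<le> C) \<and> (\<forall>s\<in>{-C..C}. \<bar>F' s\<bar> \<le> L))"
    using lipschitz_range by metis
  from someI_ex[OF this] show "0 < flux_lip" "\<exists>C>0. (\<forall>x. \<bar>f x\<bar> \<le> C)
      \<and> (\<forall>s\<in>{-C..C}. \<bar>F' s\<bar> \<le> flux_lip)"
    unfolding flux_lip_def by auto
qed

text \<open>The factor 2 undoes the division by 2 in \<open>energy\<close>.\<close>

definition conv_const :: real where
  "conv_const = norm a * hkC TYPE('n) * flux_lip * 2"

lemma conv_const_nonneg: "0 \<le> conv_const"
  using flux_lip(1) hkC_pos[where 'n='n] by (simp add: conv_const_def)

text \<open>With \<open>\<Phi>' = \<beta> F'\<close>, the integrand \<open>\<beta>(f(x)) (F(f(y)) - F(f(x))) - (\<Phi>(f(y)) - \<Phi>(f(x)))\<close> is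
  quadratically small in \<open>f(x) - f(y)\<close>, and the remaining terms vanish because the kernel is odd.\<close>

lemma convection_bound:
  assumes r: "0 < r" and lip: "\<And>s t. \<bar>\<beta> s - \<beta> t\<bar> \<le> \<bar>s - t\<bar>" and \<beta>0: "\<beta> 0 = 0"
  shows "\<bar>Q (\<lambda>z. hk_grad a z r) (\<lambda>x. F (f x)) (\<lambda>x. \<beta> (f x))\<bar>
      \<le> conv_const * r powr (- 1 / 2) * energy f (2 * r)"
proof -
  obtain C where C: "0 < C" "\<And>x. \<bar>f x\<bar> \<le> C" and L: "\<And>s. s \<in> {-C..C} \<Longrightarrow> \<bar>F' s\<bar> \<le> flux_lip"
    using flux_lip by blast
  define L where "L = flux_lip"
  have L0: "0 < L" by (simp add: L_def flux_lip)
  have fC: "f x \<in> {-C..C}" for x using C(2)[of x] by (auto simp: abs_le_iff)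
  have c\<beta>: "continuous_on UNIV \<beta>"
    using lip by (rule continuous_on_lipschitz1)
  note [measurable] = bint_borel[OF f] borel_measurable_continuous_onI[OF c\<beta>]
  have g: "bint (\<lambda>x. \<beta> (f x))"
    using lip[of _ 0] \<beta>0 by (intro bint_mono[OF f, where c=1]) auto
  have gH: "integrable lborel (\<lambda>x. F (f x) * \<beta> (f x))"
    by (rule sqint_mult_integrable[OF bint_sqint[OF Ff_bint] bint_sqint[OF g]])
  have cont: "continuous_on UNIV (\<lambda>s. \<beta> s * F' s)" by (intro continuous_on_mult c\<beta> F')
  obtain \<Phi> where \<Phi>: "\<And>s. s \<in> {-C..C} \<Longrightarrow> (\<Phi> has_real_derivative \<beta> s * F' s) (at s within {-C..C})"
      "\<Phi> 0 = 0"
    using antiderivative_on_interval[OF cont C(1)] by blast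
  have rem: "\<bar>\<beta> s * (F t - F s) - (\<Phi> t - \<Phi> s)\<bar> \<le> L * (s - t)\<^sup>2" if "s \<in> {-C..C}" "t \<in> {-C..C}"
      for s t
  proof -
    let ?S = "{min s t..max s t}"
    have S: "?S \<subseteq> {-C..C}" using that by auto
    have "norm ((\<beta> s * F t - \<Phi> t) - (\<beta> s * F s - \<Phi> s)) \<le> (\<bar>s - t\<bar> * L) * norm (t - s)"
    proof (rule field_differentiable_bound[where S="?S"])
      fix z assume z: "z \<in> ?S"
      then have zC: "z \<in> {-C..C}" using S by auto
      show "((\<lambda>z. \<beta> s * F z - \<Phi> z) has_field_derivative \<beta> s * F' z - \<beta> z * F' z) (at z within ?S)"
        using DERIV_subset[OF \<Phi>(1)[OF zC] S]
        by (intro DERIV_diff DERIV_cmult) (auto intro: DERIV_subset[OF F])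
      have "\<bar>\<beta> s - \<beta> z\<bar> * \<bar>F' z\<bar> \<le> \<bar>s - t\<bar> * L"
        using lip[of s z] z L[OF zC] by (intro mult_mono) (auto simp: L_def)
      then show "norm (\<beta> s * F' z - \<beta> z * F' z) \<le> \<bar>s - t\<bar> * L"
        by (simp add: left_diff_distrib[symmetric] abs_mult)
    qed auto
    moreover have "(\<bar>s - t\<bar> * L) * norm (t - s) = L * (s - t)\<^sup>2"
    proof -
      have "(\<bar>s - t\<bar> * L) * norm (t - s) = L * (\<bar>s - t\<bar> * \<bar>s - t\<bar>)"
        by (simp only: real_norm_def abs_minus_commute[of t s] mult_ac)
      then show ?thesis by (simp only: abs_mult_self_eq power2_eq_square)
    qed
    moreover have "(\<beta> s * F t - \<Phi> t) - (\<beta> s * F s - \<Phi> s) = \<beta> s * (F t - F s) - (\<Phi> t - \<Phi> s)"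
      by (simp add: right_diff_distrib)
    ultimately show ?thesis by (simp only: real_norm_def)
  qed
  define \<Psi> where "\<Psi> x = \<Phi> (f x)" for x
  have \<Psi>: "bint \<Psi>"
  proof -
    \<comment> \<open>\<Phi> is controlled only on [-C, C]. Composition with the clamp gives a
      function continuous on the whole line that agrees with \<Phi> at all values of f; this yields
      measurability.\<close>
    let ?cl = "\<lambda>s. max (-C) (min C s)"
    have "continuous_on {-C..C} \<Phi>" by (rule DERIV_continuous_on[OF \<Phi>(1)])
    then have "continuous_on UNIV (\<lambda>s. \<Phi> (?cl s))"
      by (rule continuous_on_compose2) (use C in \<open>auto intro!: continuous_intros\<close>)
    then have "(\<lambda>s. \<Phi> (?cl s)) \<in> borel_measurable borel" by (rule borel_measurable_continuous_onI)
    then have "(\<lambda>x. \<Phi> (?cl (f x))) \<in> borel_measurable borel" by measurable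
    moreover have "?cl (f x) = f x" for x using fC[of x] by auto
    ultimately have m: "\<Psi> \<in> borel_measurable borel" by (simp add: \<Psi>_def[abs_def])
    have \<Phi>_le: "\<bar>\<Phi> s\<bar> \<le> (C * L) * \<bar>s\<bar>" if s: "s \<in> {-C..C}" for s
    proof -
      have "norm (\<Phi> s - \<Phi> 0) \<le> (C * L) * norm (s - 0)"
      proof (rule field_differentiable_bound[where S="{-C..C}"])
        fix z assume z: "z \<in> {-C..C}"
        have "\<bar>\<beta> z\<bar> * \<bar>F' z\<bar> \<le> C * L"
          using lip[of z 0] \<beta>0 z L[OF z] by (intro mult_mono) (auto simp: L_def abs_le_iff)
        then show "norm (\<beta> z * F' z) \<le> C * L" by (simp add: abs_mult)
      qed (use \<Phi> s C in auto)
      then show ?thesis using \<Phi>(2) by simp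
    qed
    show ?thesis by (rule bint_mono[OF f m]) (unfold \<Psi>_def, rule \<Phi>_le[OF fC])
  qed
  let ?k = "\<lambda>z. hk_grad a z r" and ?\<kappa> = "norm a * hkC TYPE('n) * r powr (- 1 / 2)"
  note k = kdom_hk_grad[OF r, of a]
  note k1 = kdom_integrable(1)[OF k]
  let ?R = "\<lambda>z. \<beta> (f (fst z)) * (F (f (snd z)) - F (f (fst z))) - (\<Psi> (snd z) - \<Psi> (fst z))"
  have i1: "pintegrable ?k (\<lambda>z. F (f (snd z)) * \<beta> (f (fst z)))"
    by (rule Q_integrable[OF k bint_sqint[OF Ff_bint] bint_sqint[OF g]])
  note i2 = pint_fst(1)[OF k1 gH] and i3 = pint_fst(1)[OF k1 bint_integrable[OF \<Psi>]]
    and i4 = pint_snd(1)[OF k1 bint_integrable[OF \<Psi>]]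
  have "pint ?k ?R = (LINT z|lborel2. ((?k (fst z - snd z) * (F (f (snd z)) * \<beta> (f (fst z)))
      - ?k (fst z - snd z) * (F (f (fst z)) * \<beta> (f (fst z))))
      - ?k (fst z - snd z) * \<Psi> (snd z)) + ?k (fst z - snd z) * \<Psi> (fst z))"
    unfolding pint_def by (intro Bochner_Integration.integral_cong) (auto simp: algebra_simps)
  also have "\<dots> = Q ?k (\<lambda>x. F (f x)) (\<lambda>x. \<beta> (f x)) - pint ?k (\<lambda>z. F (f (fst z)) * \<beta> (f (fst z)))
      - pint ?k (\<lambda>z. \<Psi> (snd z)) + pint ?k (\<lambda>z. \<Psi> (fst z))"
    unfolding pint_def using i1 i2 i3 i4 by simp
  also have "\<dots> = Q ?k (\<lambda>x. F (f x)) (\<lambda>x. \<beta> (f x))"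
    using pint_fst(2)[OF k1 gH] pint_fst(2)[OF k1 bint_integrable[OF \<Psi>]]
        pint_snd(2)[OF k1 bint_integrable[OF \<Psi>]]
    by (simp add: integral_hk_grad[OF r])
  finally have eq: "Q ?k (\<lambda>x. F (f x)) (\<lambda>x. \<beta> (f x)) = pint ?k ?R" by simp
  have r2: "0 < 2 * r" using r by simp
  note iE = kdom_sqint_diff_integrable[OF kdom_heat_kernel[OF r2, where 'a='n] f_sq]
  have "\<bar>pint ?k ?R\<bar> \<le> (LINT z|lborel2. norm (?k (fst z - snd z) * ?R z))"
    unfolding pint_def using integral_norm_bound[of lborel2 "\<lambda>z. ?k (fst z - snd z) * ?R z"] by simp
  also have "\<dots> \<le> (LINT z|lborel2. (?\<kappa> * L) * (heat_kernel (fst z - snd z) (2 * r) *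
      (f (fst z) - f (snd z))\<^sup>2))"
  proof (rule integral_mono_AE')
    have "norm (?k (fst z - snd z) * ?R z) \<le> (?\<kappa> * L) *
        (heat_kernel (fst z - snd z) (2 * r) * (f (fst z) - f (snd z))\<^sup>2)" for z
    proof -
      have "\<bar>?k (fst z - snd z)\<bar> * \<bar>?R z\<bar> \<le> (?\<kappa> * heat_kernel (fst z - snd z) (2 * r)) *
          (L * (f (fst z) - f (snd z))\<^sup>2)"
        using k rem[OF fC fC, of "fst z" "snd z"] r hkC_pos[where 'n='n]
        by (intro mult_mono) (auto simp: kdom_def \<Psi>_def)
      then show ?thesis by (simp add: abs_mult mult_ac)
    qed
    then show "AE z in lborel2. norm (?k (fst z - snd z) * ?R z)
        \<le> (?\<kappa> * L) * (heat_kernel (fst z - snd z) (2 * r) * (f (fst z) - f (snd z))\<^sup>2)"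
      by simp
    show "AE z in lborel2. 0 \<le> (?\<kappa> * L) * (heat_kernel (fst z - snd z) (2 * r) *
        (f (fst z) - f (snd z))\<^sup>2)"
      using L0 hkC_pos[where 'n='n] by (intro AE_I2) (auto intro!: mult_nonneg_nonneg)
  qed (use iE in auto)
  also have "\<dots> = (?\<kappa> * L) * pint (\<lambda>z. heat_kernel z (2 * r)) (\<lambda>z. (f (fst z) - f (snd z))\<^sup>2)"
    by (simp add: pint_def)
  finally show ?thesis unfolding eq by (simp add: energy_def conv_const_def L_def mult_ac)
qed

lemma l2_prod_bound:
  assumes "0 < r" "sqint g"
  shows "\<bar>Q (\<lambda>z. heat_kernel z r) v g\<bar> \<le> l2 v * l2 g"
  using Q_l2[OF kdom_heat_kernel[OF assms(1)] v assms(2)] by simp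

text \<open>Differentiating K_r in r gives \<open>hk_dt\<close>, that is Delta K_r, and
  \<open>weak\<close> with w = f replaces it by v and the convection term. The energy thus satisfies
  a differential relation in r without any derivative of f.\<close>

lemma energy_has_derivative:
  assumes r: "0 < r"
  shows "(energy f has_real_derivative
     Q (\<lambda>z. hk_grad a z r) (\<lambda>x. F (f x)) f - Q (\<lambda>z. heat_kernel z r) v f) (at r)"
proof -
  have "((\<lambda>r. (LINT x|lborel. (f x)\<^sup>2) - Q (\<lambda>z. heat_kernel z r) f f) has_real_derivative
      0 - Q (\<lambda>z. hk_dt z r) f f) (at r)"
    by (intro DERIV_diff DERIV_const Q_heat_kernel_has_derivative[OF r f_sq f_sq])
  then have "(energy f has_real_derivative 0 - Q (\<lambda>z. hk_dt z r) f f) (at r)"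
  proof (rule has_field_derivative_transform_within_open[where S="{0<..}"])
    fix x :: real assume "x \<in> {0<..}"
    then show "(LINT x|lborel. (f x)\<^sup>2) - Q (\<lambda>z. heat_kernel z x) f f = energy f x"
      using energy_eq[OF _ f_sq] by simp
  qed (use r in auto)
  then show ?thesis using weak[OF r f] by simp
qed

text \<open>A priori the convection term is only $O(r^{-1/2})$ times the energy; the energy itself
  has to be $o(\sqrt r)$ for the term to disappear in the limit.\<close>

lemma energy_sqrt_bound:
  assumes \<eta>: "0 < \<eta>"
  shows "\<forall>\<^sub>F r in at_right 0. energy f r \<le> l2 v * l2 f * r + 2 * conv_const * \<eta> * sqrt r"
proof -
  have "\<forall>\<^sub>F r in at_right 0. energy f r < \<eta>"
    using energy_tendsto_0[OF f] \<eta> by (rule order_tendstoD)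
  then obtain d where d: "0 < d" "\<And>r. 0 < r \<Longrightarrow> r < d \<Longrightarrow> energy f r < \<eta>"
    by (auto simp: eventually_at_right[of 0 1])
  \<comment> \<open>By \<open>convection_bound\<close> the derivative of the energy at x is at most
    \<open>l2 v * l2 f\<close> plus \<open>conv_const\<close> \<eta> x^(-1/2), as long as energy(2
    x) < \<eta>; hence the range up to d / 2 and, after integration, 2 sqrt r.\<close>
  let ?\<phi> = "\<lambda>r. l2 v * l2 f * r + 2 * conv_const * \<eta> * sqrt r - energy f r"
  have mono: "?\<phi> s \<le> ?\<phi> r" if "0 < s" "s \<le> r" "r < d / 2" for s r
  proof (rule DERIV_nonneg_imp_nondecreasing[OF that(2)])
    fix x assume x: "s \<le> x" "x \<le> r"
    then have x0: "0 < x" "2 * x < d" using that by auto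
    let ?D = "l2 v * l2 f + 2 * conv_const * \<eta> * (inverse (sqrt x) / 2) -
      (Q (\<lambda>z. hk_grad a z x) (\<lambda>x. F (f x)) f - Q (\<lambda>z. heat_kernel z x) v f)"
    have "(?\<phi> has_real_derivative ?D) (at x)"
      using x0 by (intro DERIV_diff DERIV_add energy_has_derivative DERIV_cmult DERIV_real_sqrt
          DERIV_cmult_Id)
    moreover have "0 \<le> ?D"
    proof -
      have "\<bar>Q (\<lambda>z. hk_grad a z x) (\<lambda>x. F (f x)) f\<bar>
          \<le> conv_const * x powr (- 1 / 2) * energy f (2 * x)"
        using convection_bound[of x "\<lambda>s. s"] x0 by simp
      also have "\<dots> \<le> conv_const * x powr (- 1 / 2) * \<eta>"
        using d(2)[of "2 * x"] x0 conv_const_nonneg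
            by (intro mult_left_mono mult_nonneg_nonneg) auto
      also have "x powr (- 1 / 2) = inverse (sqrt x)"
        using x0 by (simp add: powr_minus powr_half_sqrt)
      finally show ?thesis using l2_prod_bound[OF x0(1) f_sq] by (simp add: mult_ac)
    qed
    ultimately show "\<exists>y. (?\<phi> has_real_derivative y) (at x) \<and> 0 \<le> y" by blast
  qed
  have lim: "(?\<phi> \<longlongrightarrow> l2 v * l2 f * 0 + 2 * conv_const * \<eta> * sqrt 0 - 0) (at_right 0)"
    by (intro tendsto_intros energy_tendsto_0[OF f])
  have "\<forall>\<^sub>F r in at_right 0. (0::real) < r \<and> r < d / 2"
    using d by (auto simp: eventually_at_right[of 0 1] intro!: exI[of _ "d / 2"])
  then show ?thesis
  proof eventually_elim
    case (elim r)
    have "\<forall>\<^sub>F s in at_right 0. ?\<phi> s \<le> ?\<phi> r"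
      using elim mono by (auto simp: eventually_at_right[of 0 1] intro!: exI[of _ r])
    then have "l2 v * l2 f * 0 + 2 * conv_const * \<eta> * sqrt 0 - 0 \<le> ?\<phi> r"
      by (intro tendsto_upperbound[OF lim]) auto
    then show ?case by simp
  qed
qed

text \<open>Inserting \<open>energy_sqrt_bound\<close> at 2 r into \<open>convection_bound\<close>
  leaves a term O(sqrt r) and a constant multiple of \<eta>, which is arbitrary.\<close>

lemma convection_tendsto_0:
  assumes lip: "\<And>s t. \<bar>\<beta> s - \<beta> t\<bar> \<le> \<bar>s - t\<bar>" and \<beta>0: "\<beta> 0 = 0"
  shows "((\<lambda>r. Q (\<lambda>z. hk_grad a z r) (\<lambda>x. F (f x)) (\<lambda>x. \<beta> (f x))) \<longlongrightarrow> 0) (at_right 0)"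
proof (rule tendstoI)
  fix e :: real assume e: "0 < e"
  define c1 c2 where "c1 = l2 v * l2 f" and "c2 = conv_const"
  have c: "0 \<le> c1" "0 \<le> c2" by (auto simp: c1_def c2_def conv_const_nonneg)
  \<comment> \<open>The second term is at most 4 c2^2 \<eta>, hence at most e / 2; adding 1 covers
    c2 = 0.\<close>
  define \<eta> where "\<eta> = e / (8 * (c2\<^sup>2 + 1))"
  have \<eta>: "0 < \<eta>" using e by (simp add: \<eta>_def add_nonneg_pos)
  obtain d where d: "0 < d" "\<And>r. 0 < r \<Longrightarrow> r < d \<Longrightarrow> energy f r \<le> c1 * r + 2 * c2 * \<eta> * sqrt r"
    using energy_sqrt_bound[OF \<eta>] by (auto simp: eventually_at_right[of 0 1] c1_def c2_def)
  have lim: "((\<lambda>r. 2 * c1 * c2 * sqrt r) \<longlongrightarrow> 2 * c1 * c2 * sqrt 0) (at_right 0)"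
    by (intro tendsto_intros)
  have "\<forall>\<^sub>F r in at_right 0. 2 * c1 * c2 * sqrt r < e / 2"
    using lim e by (intro order_tendstoD) auto
  moreover have "\<forall>\<^sub>F r in at_right 0. (0::real) < r \<and> r < d / 2"
    using d by (auto simp: eventually_at_right[of 0 1] intro!: exI[of _ "d / 2"])
  ultimately show "\<forall>\<^sub>F r in at_right 0. dist (Q (\<lambda>z. hk_grad a z r) (\<lambda>x. F (f x)) (\<lambda>x. \<beta> (f x))) 0
      < e"
  proof eventually_elim
    case (elim r)
    then have r: "0 < r" "2 * r < d" by auto
    have "\<bar>Q (\<lambda>z. hk_grad a z r) (\<lambda>x. F (f x)) (\<lambda>x. \<beta> (f x))\<bar>
        \<le> c2 * r powr (- 1 / 2) * energy f (2 * r)"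
      unfolding c2_def by (rule convection_bound[OF r(1) lip \<beta>0])
    also have "\<dots> \<le> c2 * r powr (- 1 / 2) * (c1 * (2 * r) + 2 * c2 * \<eta> * sqrt (2 * r))"
      using d(2)[of "2 * r"] r c by (intro mult_left_mono) auto
    also have "\<dots> = 2 * c1 * c2 * sqrt r + 2 * c2\<^sup>2 * \<eta> * sqrt 2"
    proof -
      have p: "r powr (- 1 / 2) = inverse (sqrt r)" using r by (simp add: powr_minus powr_half_sqrt)
      have "sqrt r * sqrt r = r" "sqrt r \<noteq> 0" using r by auto
      then have "inverse (sqrt r) * r = sqrt r" "inverse (sqrt r) * sqrt r = 1"
        by (auto simp: field_simps)
      moreover have "c2 * inverse (sqrt r) * (c1 * (2 * r) + 2 * c2 * \<eta> * sqrt (2 * r)) =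
        2 * c1 * c2 * (inverse (sqrt r) * r) + 2 * c2\<^sup>2 * \<eta> * sqrt 2 * (inverse (sqrt r) * sqrt r)"
        by (simp add: algebra_simps power2_eq_square real_sqrt_mult)
      ultimately show ?thesis unfolding p by simp
    qed
    also have "2 * c2\<^sup>2 * \<eta> * sqrt 2 \<le> 2 * c2\<^sup>2 * \<eta> * 2"
      using \<eta> sqrt2_less_2 by (intro mult_left_mono) auto
    also have "2 * c2\<^sup>2 * \<eta> * 2 \<le> e / 2"
    proof -
      have "c2\<^sup>2 + 1 \<noteq> 0" using zero_le_power2[of c2] by linarith
      then have "8 * \<eta> * (c2\<^sup>2 + 1) = e" by (simp add: \<eta>_def field_simps)
      then show ?thesis using \<eta> by (simp add: algebra_simps)
    qed
    finally show ?case using elim by simp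
  qed
qed

text \<open>L'Hospital's rule in r: by \<open>weak\<close> the derivative of the numerator is the
  pairing of K_r * v with \<beta>(f) minus the convection term. The former converges to the claimed
  limit and the latter vanishes.\<close>

lemma
  assumes lip: "\<And>s t. \<bar>\<beta> s - \<beta> t\<bar> \<le> \<bar>s - t\<bar>" and \<beta>0: "\<beta> 0 = 0"
  shows flow_difference_quotient:
    "((\<lambda>r. (Q (\<lambda>z. heat_kernel z r) f (\<lambda>x. \<beta> (f x)) - (LINT x|lborel. f x * \<beta> (f x))) / r)
      \<longlongrightarrow> (LINT x|lborel. v x * \<beta> (f x))) (at_right 0)"
    and \<beta>f_bint: "bint (\<lambda>x. \<beta> (f x))"
proof -
  let ?g = "\<lambda>x. \<beta> (f x)"
  have c\<beta>: "continuous_on UNIV \<beta>"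
    using lip by (rule continuous_on_lipschitz1)
  note [measurable] = bint_borel[OF f] borel_measurable_continuous_onI[OF c\<beta>]
  show g: "bint ?g"
    using lip[of _ 0] \<beta>0 by (intro bint_mono[OF f, where c=1]) auto
  note gs = bint_sqint[OF g]
  have approx: "((\<lambda>r. Q (\<lambda>z. heat_kernel z r) w ?g) \<longlongrightarrow> (LINT x|lborel. w x * ?g x)) (at_right 0)"
      if w: "sqint w" for w
  proof (rule Lim_transform2[OF tendsto_const])
    have "((\<lambda>r. l2 w * sqrt (2 * energy ?g r)) \<longlongrightarrow> l2 w * sqrt (2 * 0)) (at_right 0)"
      by (intro tendsto_intros energy_tendsto_0[OF g])
    then have t: "((\<lambda>r. l2 w * sqrt (2 * energy ?g r)) \<longlongrightarrow> 0) (at_right 0)" by simp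
    have "\<forall>\<^sub>F r in at_right 0. norm ((LINT x|lborel. w x * ?g x) - Q (\<lambda>z. heat_kernel z r) w ?g)
        \<le> l2 w * sqrt (2 * energy ?g r)"
      using eventually_at_right_less[of "0::real"]
      by eventually_elim (use Q_heat_kernel_approx[OF _ w gs] in \<open>auto simp: abs_minus_commute\<close>)
    then show "((\<lambda>r. (LINT x|lborel. w x * ?g x) - Q (\<lambda>z. heat_kernel z r) w ?g) \<longlongrightarrow> 0) (at_right 0)"
      by (rule Lim_null_comparison[OF _ t])
  qed
  let ?A = "\<lambda>r. Q (\<lambda>z. heat_kernel z r) f ?g - (LINT x|lborel. f x * ?g x)"
  let ?A' = "\<lambda>r. Q (\<lambda>z. heat_kernel z r) v ?g - Q (\<lambda>z. hk_grad a z r) (\<lambda>x. F (f x)) ?g"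
  show "((\<lambda>r. ?A r / r) \<longlongrightarrow> (LINT x|lborel. v x * ?g x)) (at_right 0)"
  proof (rule lhopital_right_0[where f'="?A'" and g'="\<lambda>_. 1"])
    show "(?A \<longlongrightarrow> 0) (at_right 0)"
      using tendsto_diff[OF approx[OF f_sq] tendsto_const[of "LINT x|lborel. f x * ?g x"]] by simp
    show "((\<lambda>r::real. r) \<longlongrightarrow> 0) (at_right 0)" by (rule tendsto_ident_at)
    show "\<forall>\<^sub>F r in at_right 0. (?A has_real_derivative ?A' r) (at r)"
      using eventually_at_right_less[of "0::real"]
    proof eventually_elim
      case (elim r)
      have "(?A has_real_derivative Q (\<lambda>z. hk_dt z r) f ?g - 0) (at r)"
        by (intro DERIV_diff DERIV_const Q_heat_kernel_has_derivative[OF elim f_sq gs])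
      then show ?case using weak[OF elim g] by simp
    qed
    show "((\<lambda>r. ?A' r / 1) \<longlongrightarrow> (LINT x|lborel. v x * ?g x)) (at_right 0)"
      using tendsto_diff[OF approx[OF v] convection_tendsto_0[OF lip \<beta>0]] by simp
  qed (use eventually_at_right_less[of "0::real"] in \<open>auto elim!: eventually_mono\<close>)
qed

text \<open>K_r is even and has mass 1, so the numerator of the difference quotient is minus one
  half of the double integral of K_r(x - y) (f(x) - f(y)) (\<beta>(f(x)) - \<beta>(f(y))), whose
  integrand is nonnegative for monotone \<beta>.\<close>

proposition dissipation_monotone:
  assumes lip: "\<And>s t. \<bar>\<beta> s - \<beta> t\<bar> \<le> \<bar>s - t\<bar>" and \<beta>0: "\<beta> 0 = 0" and mono: "mono \<beta>"
  shows "(LINT x|lborel. v x * \<beta> (f x)) \<le> 0"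
proof (rule tendsto_upperbound[OF flow_difference_quotient[OF lip \<beta>0]])
  let ?g = "\<lambda>x. \<beta> (f x)"
  have g: "sqint ?g" by (rule bint_sqint[OF \<beta>f_bint[OF lip \<beta>0]])
  have fg: "integrable lborel (\<lambda>x. f x * ?g x)" by (rule sqint_mult_integrable[OF f_sq g])
  show "\<forall>\<^sub>F r in at_right 0. (Q (\<lambda>z. heat_kernel z r) f ?g - (LINT x|lborel. f x * ?g x)) / r \<le> 0"
    using eventually_at_right_less[of "0::real"]
  proof eventually_elim
    case (elim r)
    let ?k = "\<lambda>z::real^'n. heat_kernel z r"
    note k = kdom_heat_kernel[OF elim, where 'a='n]
    note k1 = kdom_integrable(1)[OF k]
    have "0 \<le> (f x - f y) * (?g x - ?g y)" for x y
      using monoD[OF mono, of "f x" "f y"] monoD[OF mono, of "f y" "f x"]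
      by (cases "f x \<le> f y") (auto simp: mult_nonneg_nonneg mult_nonpos_nonpos)
    then have "0 \<le> pint ?k (\<lambda>z. (f (fst z) - f (snd z)) * (?g (fst z) - ?g (snd z)))"
      unfolding pint_def by (intro Bochner_Integration.integral_nonneg
          mult_nonneg_nonneg[OF heat_kernel_nonneg]) auto
    also have "\<dots> = (LINT z|lborel2. ((?k (fst z - snd z) * (f (fst z) * ?g (fst z))
        + ?k (fst z - snd z) * (f (snd z) * ?g (snd z)))
      - ?k (fst z - snd z) * (f (snd z) * ?g (fst z))) - ?k (fst z - snd z) *
          (?g (snd z) * f (fst z)))"
      unfolding pint_def by (intro Bochner_Integration.integral_cong) (auto simp: algebra_simps)
    also have "\<dots> = pint ?k (\<lambda>z. f (fst z) * ?g (fst z)) + pint ?k (\<lambda>z. f (snd z) * ?g (snd z))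
        - Q ?k f ?g - Q ?k ?g f"
      unfolding pint_def
      using pint_fst(1)[OF k1 fg] pint_snd(1)[OF k1 fg] Q_integrable[OF k f_sq g]
          Q_integrable[OF k g f_sq] by simp
    also have "\<dots> = 2 * ((LINT x|lborel. f x * ?g x) - Q ?k f ?g)"
      using Q_swap[OF k f_sq g] pint_fst(2)[OF k1 fg] pint_snd(2)[OF k1 fg]
          by (simp add: integral_heat_kernel[OF elim])
    finally show ?case using elim by (simp add: divide_nonpos_pos)
  qed
qed simp

text \<open>As \<open>energy f (4 r) \<le> 4 energy f r\<close>, the quotient of the energy by \<open>r\<close> is largest in the limit
  \<open>r \<rightarrow> 0\<close>, where it is the derivative computed above.\<close>

proposition dissipation_energy:
  assumes r: "0 < r"
  shows "(LINT x|lborel. v x * f x) \<le> - energy f r / r"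
proof -
  let ?q = "\<lambda>r. - energy f r / r"
  have "((\<lambda>r. (Q (\<lambda>z. heat_kernel z r) f f - (LINT x|lborel. f x * f x)) / r)
      \<longlongrightarrow> (LINT x|lborel. v x * f x)) (at_right 0)"
    using flow_difference_quotient[of "\<lambda>s. s"] by simp
  then have lim: "(?q \<longlongrightarrow> (LINT x|lborel. v x * f x)) (at_right 0)"
  proof (rule Lim_transform_eventually)
    show "\<forall>\<^sub>F r in at_right 0. (Q (\<lambda>z. heat_kernel z r) f f - (LINT x|lborel. f x * f x)) / r
        = ?q r"
      using eventually_at_right_less[of "0::real"]
      by eventually_elim (use energy_eq[OF _ f_sq] in \<open>simp add: power2_eq_square\<close>)
  qed
  have step: "?q (s / 4) \<le> ?q s" if "0 < s" for s
    using energy_quadruple[of "s / 4" f] that f_sq by (simp add: field_simps)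
  have iter: "?q (r / 4 ^ n) \<le> ?q r" for n
  proof (induction n)
    case (Suc n)
    have "?q ((r / 4 ^ n) / 4) \<le> ?q (r / 4 ^ n)" using r by (intro step) simp
    then show ?case using Suc by (simp add: mult.commute)
  qed simp
  have "(\<lambda>n. r / 4 ^ n) \<longlonglongrightarrow> 0"
    using LIMSEQ_divide_realpow_zero[of 4 r] by simp
  then have "filterlim (\<lambda>n. r / 4 ^ n) (at_right 0) sequentially"
    using r by (auto simp: filterlim_at)
  from filterlim_compose[OF lim this]
  show ?thesis by (rule LIMSEQ_le_const2) (use iter in auto)
qed

end

section \<open>Monotone quantities along the flow\<close>

lemma Q_iterated_integrable:
  assumes "kdom k \<kappa> \<rho>" "sqint f" "sqint g"
  shows "integrable lborel (\<lambda>x. g x * (LINT y|lborel. k (x - y) * f y))"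
proof -
  have "integrable lborel (\<lambda>x. LINT y|lborel. g x * (k (x - y) * f y))"
    using lborel_pair.integrable_fst'[OF Q_integrable[OF assms]] by (simp add: mult_ac)
  then show ?thesis by simp
qed

lemma l2_cmult: "l2 (\<lambda>x. c * f x) = \<bar>c\<bar> * l2 f"
  by (simp add: l2_def power_mult_distrib real_sqrt_mult)

lemma l2_add_square:
  assumes f: "sqint f" and g: "sqint g"
  shows "(l2 (\<lambda>x. f x + g x))\<^sup>2 \<le> 2 * (l2 f)\<^sup>2 + 2 * (l2 g)\<^sup>2"
proof -
  have i: "integrable lborel (\<lambda>x. (f x)\<^sup>2)" "integrable lborel (\<lambda>x. (g x)\<^sup>2)"
      "integrable lborel (\<lambda>x. (f x + g x)\<^sup>2)"
    using f g sqint_add[OF f g] by (auto simp: sqint_def)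
  have "(l2 (\<lambda>x. f x + g x))\<^sup>2 \<le> (LINT x|lborel. 2 * (f x)\<^sup>2 + 2 * (g x)\<^sup>2)"
    unfolding l2_square
  proof (rule integral_mono)
    fix x show "(f x + g x)\<^sup>2 \<le> 2 * (f x)\<^sup>2 + 2 * (g x)\<^sup>2"
      using sum_squares_bound[of "f x" "g x"] unfolding power2_sum by linarith
  qed (use i in auto)
  also have "\<dots> = 2 * (l2 f)\<^sup>2 + 2 * (l2 g)\<^sup>2" using i by (simp add: l2_square)
  finally show ?thesis .
qed

lemma has_real_derivative_little_o:
  fixes A :: "real \<Rightarrow> real"
  assumes ev: "\<forall>\<^sub>F h in at 0. \<bar>A (r + h) - A r - h * D\<bar> \<le> \<bar>h\<bar> * G h" and G: "(G \<longlongrightarrow> 0) (at 0)"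
  shows "(A has_real_derivative D) (at r)"
proof -
  have "((\<lambda>h. (A (r + h) - A r) / h - D) \<longlongrightarrow> 0) (at 0)"
  proof (rule Lim_null_comparison[OF _ G])
    show "\<forall>\<^sub>F h in at 0. norm ((A (r + h) - A r) / h - D) \<le> G h"
      using ev eventually_neq_at_within[of 0 0 UNIV]
    proof eventually_elim
      case (elim h)
      then have h: "h \<noteq> 0" by auto
      have "(A (r + h) - A r) / h - D = (A (r + h) - A r - h * D) / h" using h
          by (simp add: field_simps)
      then have "norm ((A (r + h) - A r) / h - D) = \<bar>A (r + h) - A r - h * D\<bar> / \<bar>h\<bar>" by simp
      also have "\<dots> \<le> G h" using elim h by (simp add: pos_divide_le_eq mult.commute)
      finally show ?case .
    qed
  qed
  then show ?thesis unfolding DERIV_def by (simp add: LIM_zero_iff)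
qed

lemma convex_remainder:
  fixes j \<beta> :: "real \<Rightarrow> real"
  assumes j: "\<And>s. (j has_real_derivative \<beta> s) (at s)" and lip: "\<And>s t. \<bar>\<beta> s - \<beta> t\<bar> \<le> \<bar>s - t\<bar>"
  shows "\<bar>j t - j s - \<beta> s * (t - s)\<bar> \<le> (t - s)\<^sup>2"
proof -
  have "norm ((j t - \<beta> s * t) - (j s - \<beta> s * s)) \<le> \<bar>t - s\<bar> * norm (t - s)"
  proof (rule field_differentiable_bound[where S="{min s t..max s t}"])
    fix z assume z: "z \<in> {min s t..max s t}"
    show "((\<lambda>z. j z - \<beta> s * z) has_field_derivative \<beta> z - \<beta> s) (at z within {min s t..max s t})"
      by (intro DERIV_diff DERIV_cmult_Id DERIV_subset[OF j]) auto
    show "norm (\<beta> z - \<beta> s) \<le> \<bar>t - s\<bar>" using lip[of z s] z by auto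
  qed auto
  also have "\<bar>t - s\<bar> * norm (t - s) = (t - s)\<^sup>2" by (simp add: power2_eq_square)
  finally show ?thesis by (simp add: algebra_simps)
qed

text \<open>For k >= 0 this is s minus its truncation to [-k, k]. It and the truncation are both
  monotone and 1-Lipschitz: the former is used for the sup norm and the latter for the L^1
  norm.\<close>

definition soft_excess :: "real \<Rightarrow> real \<Rightarrow> real" where
  "soft_excess k s = max 0 (s - k) - max 0 (- s - k)"

lemma has_derivative_max_square: "((\<lambda>s::real. (max 0 s)\<^sup>2 / 2) has_real_derivative max 0 s) (at s)"
proof -
  have "\<bar>(max 0 (s + h))\<^sup>2 / 2 - (max 0 s)\<^sup>2 / 2 - h * max 0 s\<bar> \<le> 1 * h\<^sup>2" for h :: real
  proof (cases "0 \<le> s"; cases "0 \<le> s + h")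
    assume *: "0 \<le> s" "0 \<le> s + h"
    then have eq: "(max 0 (s + h))\<^sup>2 / 2 - (max 0 s)\<^sup>2 / 2 - h * max 0 s = h\<^sup>2 / 2"
      by (simp add: power2_eq_square field_simps)
    show ?thesis unfolding eq by simp
  next
    assume *: "0 \<le> s" "\<not> 0 \<le> s + h"
    then have eq: "(max 0 (s + h))\<^sup>2 / 2 - (max 0 s)\<^sup>2 / 2 - h * max 0 s = h\<^sup>2 / 2 - (s + h)\<^sup>2 / 2"
      by (simp add: power2_eq_square field_simps)
    have "(s + h)\<^sup>2 \<le> h\<^sup>2" using * by (subst abs_le_square_iff[symmetric]) auto
    moreover have "0 \<le> (s + h)\<^sup>2" by simp
    ultimately show ?thesis unfolding eq abs_le_iff using zero_le_power2[of h] by linarith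
  next
    assume *: "\<not> 0 \<le> s" "0 \<le> s + h"
    then have "(s + h)\<^sup>2 \<le> h\<^sup>2" by (subst abs_le_square_iff[symmetric]) auto
    moreover have "0 \<le> (s + h)\<^sup>2" by simp
    moreover have eq: "(max 0 (s + h))\<^sup>2 / 2 - (max 0 s)\<^sup>2 / 2 - h * max 0 s = (s + h)\<^sup>2 / 2"
        using * by simp
    ultimately show ?thesis unfolding eq abs_le_iff using zero_le_power2[of h] by linarith
  qed auto
  then show ?thesis by (intro has_real_derivative_quadratic[where d=1 and C=1]) auto
qed

definition soft_excess_int :: "real \<Rightarrow> real \<Rightarrow> real" where
  "soft_excess_int k s = (max 0 (s - k))\<^sup>2 / 2 + (max 0 (- s - k))\<^sup>2 / 2"

lemma soft_excess_int_has_derivative: "(soft_excess_int k has_real_derivative soft_excess k s)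
    (at s)"
proof -
  have 1: "((\<lambda>s. (max 0 (s - k))\<^sup>2 / 2) has_real_derivative max 0 (s - k) * 1) (at s)"
    by (rule DERIV_chain2[where f="\<lambda>s. (max 0 s)\<^sup>2 / 2"
        and g="\<lambda>s. s - k", OF has_derivative_max_square])
       (auto intro!: derivative_eq_intros)
  have 2: "((\<lambda>s. (max 0 (- s - k))\<^sup>2 / 2) has_real_derivative max 0 (- s - k) * (- 1)) (at s)"
    by (rule DERIV_chain2[where f="\<lambda>s. (max 0 s)\<^sup>2 / 2"
        and g="\<lambda>s. - s - k", OF has_derivative_max_square])
       (auto intro!: derivative_eq_intros)
  show ?thesis
    using DERIV_add[OF 1 2] unfolding soft_excess_int_def[abs_def] soft_excess_def by simp
qed

lemma soft_excess_lip:
  assumes "0 \<le> k" shows "\<bar>soft_excess k s - soft_excess k t\<bar> \<le> \<bar>s - t\<bar>"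
  using assms by (auto simp: soft_excess_def max_def abs_if)

lemma soft_excess_lip':
  assumes "0 \<le> k" shows "\<bar>(s - soft_excess k s) - (t - soft_excess k t)\<bar> \<le> \<bar>s - t\<bar>"
  using assms by (auto simp: soft_excess_def max_def abs_if)

lemma mono_soft_excess: "0 \<le> k \<Longrightarrow> mono (soft_excess k)" "0 \<le> k \<Longrightarrow> mono (\<lambda>s. s - soft_excess k s)"
  by (auto simp: soft_excess_def max_def mono_def)

text \<open>\<open>s\<^sup>2 / 2 - soft_excess_int k s\<close> is Huber's function, a smoothing of \<open>k \<bar>s\<bar>\<close>.\<close>

lemma huber_bounds:
  assumes "0 < k"
  shows "0 \<le> (s\<^sup>2 / 2 - soft_excess_int k s) / k" "(s\<^sup>2 / 2 - soft_excess_int k s) / k \<le> \<bar>s\<bar>"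
    "\<bar>s\<bar> - k \<le> (s\<^sup>2 / 2 - soft_excess_int k s) / k"
proof -
  let ?j = "s\<^sup>2 / 2 - soft_excess_int k s"
  have "0 \<le> ?j \<and> ?j \<le> \<bar>s\<bar> * k \<and> (\<bar>s\<bar> - k) * k \<le> ?j"
  proof (cases "\<bar>s\<bar> \<le> k")
    case True
    then have "?j = s\<^sup>2 / 2" by (auto simp: soft_excess_int_def max_def abs_if split: if_splits)
    moreover have "\<bar>s\<bar> * \<bar>s\<bar> \<le> \<bar>s\<bar> * k" using True by (intro mult_left_mono) auto
    then have "s\<^sup>2 \<le> \<bar>s\<bar> * k" by (simp add: power2_eq_square)
    moreover have "(\<bar>s\<bar> - k) * k \<le> 0" using True assms by (simp add: mult_nonpos_nonneg)
    ultimately show ?thesis using zero_le_power2[of s] by linarith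
  next
    case False
    then have "?j = \<bar>s\<bar> * k - k\<^sup>2 / 2"
      using assms by (cases "0 \<le> s") (auto simp: soft_excess_int_def max_def abs_if
          power2_eq_square field_simps split: if_splits)
    moreover have "k * k \<le> \<bar>s\<bar> * k" using False assms by (intro mult_right_mono) auto
    then have "k\<^sup>2 \<le> \<bar>s\<bar> * k" by (simp only: power2_eq_square)
    moreover have "(\<bar>s\<bar> - k) * k = \<bar>s\<bar> * k - k\<^sup>2" by (simp only: left_diff_distrib power2_eq_square)
    ultimately show ?thesis using zero_le_power2[of k] by linarith
  qed
  then show "0 \<le> ?j / k" "?j / k \<le> \<bar>s\<bar>" "\<bar>s\<bar> - k \<le> ?j / k"
    using assms by (auto simp: field_simps)
qed

text \<open>Split off from \<open>diffusion_flow\<close> because the integrability of F(U t) already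
  serves to verify the assumption \<open>weak\<close> of that locale.\<close>

locale bounded_flux =
  fixes F F' :: "real \<Rightarrow> real" and U :: "real \<Rightarrow> real^'n \<Rightarrow> real"
  assumes F: "\<And>s. (F has_real_derivative F' s) (at s)" and F': "continuous_on UNIV F'"
    and F_small: "((\<lambda>s. F s / \<bar>s\<bar> powr ((real CARD('n) + 1) / real CARD('n))) \<longlongrightarrow> 0) (at 0)"
    and U: "\<And>t. 0 < t \<Longrightarrow> bint (U t)"
begin

lemma F_isCont: "isCont F s" by (rule DERIV_isCont[OF F])

lemma F0: "F 0 = 0"
proof -
  let ?q = "(real CARD('n) + 1) / real CARD('n)"
  have "((\<lambda>s. F s / \<bar>s\<bar> powr ?q * \<bar>s\<bar> powr ?q) \<longlongrightarrow> 0 * \<bar>0\<bar> powr ?q) (at 0)"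
    by (intro tendsto_mult F_small tendsto_powr' tendsto_rabs tendsto_ident_at tendsto_const) auto
  then have "(F \<longlongrightarrow> 0 * \<bar>0\<bar> powr ?q) (at 0)"
    by (rule Lim_transform_eventually) (auto simp: eventually_at_filter)
  then have "(F \<longlongrightarrow> 0) (at 0)" by simp
  with F_isCont[of 0] show ?thesis unfolding isCont_def by (rule LIM_unique)
qed

lemma F_borel [measurable]: "F \<in> borel_measurable borel"
  by (rule borel_measurable_continuous_onI) (meson F_isCont continuous_at_imp_continuous_on)

lemma F_small_near_0:
  assumes "0 < \<epsilon>"
  obtains s0 where "0 < s0" "\<And>s. \<bar>s\<bar> \<le> s0 \<Longrightarrow> \<bar>F s\<bar>
      \<le> \<epsilon> * \<bar>s\<bar> powr ((real CARD('n) + 1) / real CARD('n))"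
proof -
  let ?q = "(real CARD('n) + 1) / real CARD('n)"
  obtain d where d: "0 < d" "\<And>s. s \<noteq> 0 \<Longrightarrow> \<bar>s\<bar> < d \<Longrightarrow> \<bar>F s / \<bar>s\<bar> powr ?q\<bar> < \<epsilon>"
    using tendstoD[OF F_small assms] by (auto simp: eventually_at dist_real_def)
  have "\<bar>F s\<bar> \<le> \<epsilon> * \<bar>s\<bar> powr ?q" if "\<bar>s\<bar> \<le> d / 2" for s
  proof (cases "s = 0")
    case False
    then have "\<bar>F s\<bar> / \<bar>s\<bar> powr ?q < \<epsilon>" using d(2)[of s] d(1) that by simp
    then show ?thesis using False by (simp add: pos_divide_less_eq less_imp_le)
  qed (simp add: F0)
  then show ?thesis using that[of "d / 2"] d by simp
qed

lemma lipschitz_on_bounded: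
  assumes "0 < C" obtains L where "0 < L" "\<And>s. \<bar>s\<bar> \<le> C \<Longrightarrow> \<bar>F s\<bar> \<le> L * \<bar>s\<bar>"
proof -
  have "compact (F' ` {-C..C})"
    using F' by (intro compact_continuous_image) (auto intro: continuous_on_subset)
  then obtain L where L: "0 < L" "\<And>y. y \<in> F' ` {-C..C} \<Longrightarrow> norm y \<le> L"
    using compact_imp_bounded bounded_pos by metis
  have "\<bar>F s\<bar> \<le> L * \<bar>s\<bar>" if "\<bar>s\<bar> \<le> C" for s
  proof -
    have "norm (F s - F 0) \<le> L * norm (s - 0)"
      by (rule field_differentiable_bound[where S="{-C..C}" and f'=F'])
         (use that assms L F in \<open>auto intro: DERIV_subset\<close>)
    then show ?thesis by (simp add: F0)
  qed
  then show ?thesis using that L by blast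
qed

lemma FU_bint:
  assumes "0 < t" shows "bint (\<lambda>x. F (U t x))"
proof -
  obtain C where C: "0 < C" "\<And>x. \<bar>U t x\<bar> \<le> C" using bintE[OF U[OF assms]] by blast
  obtain L where L: "0 < L" "\<And>s. \<bar>s\<bar> \<le> C \<Longrightarrow> \<bar>F s\<bar> \<le> L * \<bar>s\<bar>" using lipschitz_on_bounded[OF C(1)]
      by blast
  note [measurable] = bint_borel[OF U[OF assms]]
  show ?thesis by (rule bint_mono[OF U[OF assms] _ L(2)[OF C(2)]]) measurable
qed

end

text \<open>\<open>U\<close> and \<open>V\<close> stand for Borel representatives of u and its time
  derivative. The initial datum is present through the limit \<open>M\<close> of the masses, and
  \<open>weak\<close> is the equation convolved with K_r, at every point x.\<close>

locale diffusion_flow = bounded_flux F F' U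
  for F F' :: "real \<Rightarrow> real" and U :: "real \<Rightarrow> real^'n \<Rightarrow> real" +
  fixes a :: "real^'n" and V :: "real \<Rightarrow> real^'n \<Rightarrow> real" and M :: real
  assumes V: "\<And>t. 0 < t \<Longrightarrow> sqint (V t)"
    and UV: "\<And>t. 0 < t \<Longrightarrow> ((\<lambda>h. l2 (\<lambda>x. (U (t + h) x - U t x) / h - V t x)) \<longlongrightarrow> 0) (at 0)"
    and weak: "\<And>t r x. 0 < t \<Longrightarrow> 0 < r \<Longrightarrow>
      (LINT y|lborel. heat_kernel (x - y) r * V t y) =
      (LINT y|lborel. hk_dt (x - y) r * U t y) + (LINT y|lborel. hk_grad a (x - y) r * F (U t y))"
    and mass: "((\<lambda>t. LINT x|lborel. U t x) \<longlongrightarrow> M) (at_right 0)"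
begin

lemma weak_Q:
  assumes t: "0 < t" and r: "0 < r" and w: "bint w"
  shows "Q (\<lambda>z. heat_kernel z r) (V t) w =
      Q (\<lambda>z. hk_dt z r) (U t) w + Q (\<lambda>z. hk_grad a z r) (\<lambda>x. F (U t x)) w"
proof -
  note ws = bint_sqint[OF w] and Us = bint_sqint[OF U[OF t]] and Fs = bint_sqint[OF FU_bint[OF t]]
  note k1 = kdom_heat_kernel[OF r, where 'a='n] and k2 = kdom_hk_dt[OF r, where 'n='n]
    and k3 = kdom_hk_grad[OF r, of a]
  note i2 = Q_iterated_integrable[OF k2 Us ws]
  note i3 = Q_iterated_integrable[OF k3 Fs ws]
  show ?thesis
    using i2 i3 by (simp add: Q_iterated[OF k1 V[OF t] ws] Q_iterated[OF k2 Us ws]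
        Q_iterated[OF k3 Fs ws]
        weak[OF t r] distrib_left)
qed

lemma stationary:
  assumes "0 < t" shows "stationary_identity a F F' (U t) (V t)"
  by unfold_locales (use F F' F0 U V weak_Q assms in auto)

lemma U_sq: "0 < t \<Longrightarrow> sqint (U t)"
  by (rule bint_sqint[OF U])

lemma quotient_sq:
  assumes "0 < t" "0 < t + h"
  shows "sqint (\<lambda>x. (U (t + h) x - U t x) / h - V t x)"
  using sqint_diff[OF sqint_cmult[OF sqint_diff[OF U_sq[OF assms(2)] U_sq[OF assms(1)]], of
      "1 / h"] V[OF assms(1)]]
  by simp

lemma l2_increment:
  assumes t: "0 < t" and h: "0 < t + h" "h \<noteq> 0"
  defines "e \<equiv> l2 (\<lambda>x. (U (t + h) x - U t x) / h - V t x)"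
  shows "l2 (\<lambda>x. U (t + h) x - U t x - h * V t x) = \<bar>h\<bar> * e"
    and "(l2 (\<lambda>x. U (t + h) x - U t x))\<^sup>2 \<le> h\<^sup>2 * (2 * e\<^sup>2 + 2 * (l2 (V t))\<^sup>2)"
proof -
  let ?q = "\<lambda>x. (U (t + h) x - U t x) / h - V t x"
  have "(\<lambda>x. U (t + h) x - U t x - h * V t x) = (\<lambda>x. h * ?q x)" using h
      by (simp add: fun_eq_iff field_simps)
  then show "l2 (\<lambda>x. U (t + h) x - U t x - h * V t x) = \<bar>h\<bar> * e" by (simp only: l2_cmult e_def)
  have "(\<lambda>x. U (t + h) x - U t x) = (\<lambda>x. h * (?q x + V t x))" using h by (simp add: fun_eq_iff)
  then have "l2 (\<lambda>x. U (t + h) x - U t x) = \<bar>h\<bar> * l2 (\<lambda>x. ?q x + V t x)" by (simp only: l2_cmult)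
  then have "(l2 (\<lambda>x. U (t + h) x - U t x))\<^sup>2 = h\<^sup>2 * (l2 (\<lambda>x. ?q x + V t x))\<^sup>2"
      by (simp add: power_mult_distrib)
  also have "\<dots> \<le> h\<^sup>2 * (2 * e\<^sup>2 + 2 * (l2 (V t))\<^sup>2)"
    unfolding e_def by (intro mult_left_mono l2_add_square quotient_sq t h V) auto
  finally show "(l2 (\<lambda>x. U (t + h) x - U t x))\<^sup>2 \<le> h\<^sup>2 * (2 * e\<^sup>2 + 2 * (l2 (V t))\<^sup>2)" .
qed

lemma eventually_time_pos: "0 < t \<Longrightarrow> \<forall>\<^sub>F h in at 0. 0 < t + h \<and> h \<noteq> (0::real)"
  by (auto simp: eventually_at dist_real_def intro!: exI[of _ t])

lemma U_l2_continuous: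
  assumes t: "0 < t"
  shows "((\<lambda>h. l2 (\<lambda>x. U (t + h) x - U t x)) \<longlongrightarrow> 0) (at 0)"
proof -
  let ?e = "\<lambda>h. l2 (\<lambda>x. (U (t + h) x - U t x) / h - V t x)"
  have "((\<lambda>h. sqrt (h\<^sup>2 * (2 * (?e h)\<^sup>2 + 2 * (l2 (V t))\<^sup>2)))
      \<longlongrightarrow> sqrt (0\<^sup>2 * (2 * 0\<^sup>2 + 2 * (l2 (V t))\<^sup>2))) (at 0)"
    by (intro tendsto_intros UV[OF t])
  then have lim: "((\<lambda>h. sqrt (h\<^sup>2 * (2 * (?e h)\<^sup>2 + 2 * (l2 (V t))\<^sup>2))) \<longlongrightarrow> 0) (at 0)" by simp
  show ?thesis
  proof (rule Lim_null_comparison[OF _ lim])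
    show "\<forall>\<^sub>F h in at 0. norm (l2 (\<lambda>x. U (t + h) x - U t x))
        \<le> sqrt (h\<^sup>2 * (2 * (?e h)\<^sup>2 + 2 * (l2 (V t))\<^sup>2))"
      using eventually_time_pos[OF t]
      by eventually_elim (use l2_increment(2)[OF t] in \<open>auto intro!: real_le_rsqrt\<close>)
  qed
qed

text \<open>The Taylor remainder of j at U t is at most the squared increment, hence O(h^2) in L^1.
  The linear part is compared with h V by Cauchy-Schwarz and the L^2 error of the difference
  quotient, so differentiability in L^2 suffices for j of quadratic growth.\<close>

lemma functional_has_derivative:
  assumes t: "0 < t" and j: "\<And>s. (j has_real_derivative \<beta> s) (at s)" and j0: "j 0 = 0"
      and \<beta>0: "\<beta> 0 = 0"
    and lip: "\<And>s t. \<bar>\<beta> s - \<beta> t\<bar> \<le> \<bar>s - t\<bar>"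
  shows "((\<lambda>t. LINT x|lborel. j (U t x)) has_real_derivative (LINT x|lborel. V t x * \<beta> (U t x)))
      (at t)"
    and "\<And>t. 0 < t \<Longrightarrow> integrable lborel (\<lambda>x. j (U t x))"
proof -
  have "continuous_on UNIV j" by (meson j DERIV_isCont continuous_at_imp_continuous_on)
  note [measurable] = borel_measurable_continuous_onI[OF this]
    borel_measurable_continuous_onI[OF continuous_on_lipschitz1[OF lip]]
  note jr = convex_remainder[OF j lip]
  show ji: "integrable lborel (\<lambda>x. j (U t x))" if "0 < t" for t
  proof (rule Bochner_Integration.integrable_bound[where f="\<lambda>x. (U t x)\<^sup>2"])
    show "integrable lborel (\<lambda>x. (U t x)\<^sup>2)" using U_sq[OF that] by (simp add: sqint_def)
    note [measurable] = bint_borel[OF U[OF that]]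
    show "(\<lambda>x. j (U t x)) \<in> borel_measurable lborel" by measurable
    show "AE x in lborel. norm (j (U t x)) \<le> norm ((U t x)\<^sup>2)"
      using jr[of _ 0] by (simp add: j0 \<beta>0)
  qed
  have bU: "sqint (\<lambda>x. \<beta> (U t x))"
    using stationary_identity.\<beta>f_bint[OF stationary[OF t] lip \<beta>0] by (rule bint_sqint)
  let ?e = "\<lambda>h. l2 (\<lambda>x. (U (t + h) x - U t x) / h - V t x)"
  let ?G = "\<lambda>h. \<bar>h\<bar> * (2 * (?e h)\<^sup>2 + 2 * (l2 (V t))\<^sup>2) + l2 (\<lambda>x. \<beta> (U t x)) * ?e h"
  have "(?G \<longlongrightarrow> \<bar>0\<bar> * (2 * 0\<^sup>2 + 2 * (l2 (V t))\<^sup>2) + l2 (\<lambda>x. \<beta> (U t x)) * 0) (at 0)"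
    by (intro tendsto_intros UV[OF t])
  then have G: "(?G \<longlongrightarrow> 0) (at 0)" by simp
  show "((\<lambda>t. LINT x|lborel. j (U t x)) has_real_derivative (LINT x|lborel. V t x * \<beta> (U t x)))
      (at t)"
  proof (rule has_real_derivative_little_o[OF _ G])
    show "\<forall>\<^sub>F h in at 0. \<bar>(LINT x|lborel. j (U (t + h) x)) - (LINT x|lborel. j (U t x))
        - h * (LINT x|lborel. V t x * \<beta> (U t x))\<bar> \<le> \<bar>h\<bar> * ?G h"
      using eventually_time_pos[OF t]
    proof eventually_elim
      case (elim h)
      then have h: "0 < t + h" "h \<noteq> 0" by auto
      let ?u = "U (t + h)"
      have D: "sqint (\<lambda>x. ?u x - U t x)" by (intro sqint_diff U_sq t h)
      have Dh: "sqint (\<lambda>x. ?u x - U t x - h * V t x)" by (intro sqint_diff sqint_cmult D V t)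
      have i1: "integrable lborel (\<lambda>x. j (?u x) - j (U t x) - \<beta> (U t x) * (?u x - U t x))"
        by (intro Bochner_Integration.integrable_diff ji t h sqint_mult_integrable bU D)
      have i2: "integrable lborel (\<lambda>x. \<beta> (U t x) * (?u x - U t x - h * V t x))"
        by (intro sqint_mult_integrable bU Dh)
      have "(LINT x|lborel. j (?u x)) - (LINT x|lborel. j (U t x))
          - h * (LINT x|lborel. V t x * \<beta> (U t x))
        = (LINT x|lborel. j (?u x) - j (U t x) - h * (V t x * \<beta> (U t x)))"
        using ji[OF t] ji[OF h(1)] sqint_mult_integrable[OF V[OF t] bU] by simp
      also have "\<dots> = (LINT x|lborel. (j (?u x) - j (U t x) - \<beta> (U t x) * (?u x - U t x))
          + \<beta> (U t x) * (?u x - U t x - h * V t x))"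
        by (intro Bochner_Integration.integral_cong) (auto simp: algebra_simps)
      also have "\<dots> = (LINT x|lborel. j (?u x) - j (U t x) - \<beta> (U t x) * (?u x - U t x))
          + (LINT x|lborel. \<beta> (U t x) * (?u x - U t x - h * V t x))"
        by (rule Bochner_Integration.integral_add[OF i1 i2])
      finally have eq: "(LINT x|lborel. j (?u x)) - (LINT x|lborel. j (U t x))
          - h * (LINT x|lborel. V t x * \<beta> (U t x)) = \<dots>" .
      have "\<bar>LINT x|lborel. j (?u x) - j (U t x) - \<beta> (U t x) * (?u x - U t x)\<bar>
          \<le> (LINT x|lborel. (?u x - U t x)\<^sup>2)"
        using D jr by (intro order_trans[OF integral_abs_bound] integral_mono
            integrable_abs[OF i1]) (auto simp: sqint_def)
      also have "\<dots> = (l2 (\<lambda>x. ?u x - U t x))\<^sup>2" by (simp add: l2_square)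
      also have "\<dots> \<le> h\<^sup>2 * (2 * (?e h)\<^sup>2 + 2 * (l2 (V t))\<^sup>2)" by (rule l2_increment(2)[OF t h])
      also have "h\<^sup>2 = \<bar>h\<bar> * \<bar>h\<bar>" by (simp add: power2_eq_square)
      finally have 1: "\<bar>LINT x|lborel. j (?u x) - j (U t x) - \<beta> (U t x) * (?u x - U t x)\<bar>
        \<le> \<bar>h\<bar> * (\<bar>h\<bar> * (2 * (?e h)\<^sup>2 + 2 * (l2 (V t))\<^sup>2))" by (simp only: mult.assoc)
      have "\<bar>LINT x|lborel. \<beta> (U t x) * (?u x - U t x - h * V t x)\<bar>
          \<le> l2 (\<lambda>x. \<beta> (U t x)) * l2 (\<lambda>x. ?u x - U t x - h * V t x)"
        by (rule integral_mult_le_l2[OF bU Dh])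
      also have "\<dots> = \<bar>h\<bar> * (l2 (\<lambda>x. \<beta> (U t x)) * ?e h)"
        unfolding l2_increment(1)[OF t h] by (rule mult.left_commute)
      finally have 2: "\<bar>LINT x|lborel. \<beta> (U t x) * (?u x - U t x - h * V t x)\<bar>
          \<le> \<bar>h\<bar> * (l2 (\<lambda>x. \<beta> (U t x)) * ?e h)" .
      show ?case unfolding eq using 1 2 abs_triangle_ineq[of
          "LINT x|lborel. j (?u x) - j (U t x) - \<beta> (U t x) * (?u x - U t x)"
          "LINT x|lborel. \<beta> (U t x) * (?u x - U t x - h * V t x)"]
        unfolding distrib_left by linarith
    qed
  qed
qed

section \<open>Decay of the L^\<infinity>, L^1 and L^2 norms\<close>

lemma functional_decreasing:
  assumes "0 < s" "s \<le> t" and j: "\<And>s. (j has_real_derivative \<beta> s) (at s)" and j0: "j 0 = 0"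
      and \<beta>0: "\<beta> 0 = 0"
    and lip: "\<And>s t. \<bar>\<beta> s - \<beta> t\<bar> \<le> \<bar>s - t\<bar>" and mono: "mono \<beta>"
  shows "(LINT x|lborel. j (U t x)) \<le> (LINT x|lborel. j (U s x))"
proof (rule DERIV_nonpos_imp_nonincreasing[OF assms(2)])
  fix r assume "s \<le> r" "r \<le> t"
  then have r: "0 < r" using assms by simp
  show "\<exists>y. ((\<lambda>t. LINT x|lborel. j (U t x)) has_real_derivative y) (at r) \<and> y \<le> 0"
    using functional_has_derivative(1)[OF r j j0 \<beta>0 lip]
      stationary_identity.dissipation_monotone[OF stationary[OF r] lip \<beta>0 mono] by blast
qed

text \<open>Truncation argument for the maximum principle: the integral of
  \<open>soft_excess_int k\<close> is nonnegative, nonincreasing in time, and zero exactly when |U|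
  <= k almost everywhere.\<close>

lemma linf_decreasing:
  assumes "0 < s" "s \<le> t" "0 \<le> k" and b: "AE x in lborel. \<bar>U s x\<bar> \<le> k"
  shows "AE x in lborel. \<bar>U t x\<bar> \<le> k"
proof -
  have t: "0 < t" using assms by simp
  let ?j = "soft_excess_int k"
  have j0: "?j 0 = 0" "soft_excess k 0 = 0" using assms
      by (auto simp: soft_excess_int_def soft_excess_def)
  note [measurable] = bint_borel[OF U[OF t]] bint_borel[OF U[OF assms(1)]]
  have [measurable]: "soft_excess_int k \<in> borel_measurable borel" unfolding soft_excess_int_def
      by measurable
  have nn: "0 \<le> ?j y" for y by (simp add: soft_excess_int_def)
  have "(LINT x|lborel. ?j (U t x)) \<le> (LINT x|lborel. ?j (U s x))"
    by (rule functional_decreasing[OF assms(1,2) soft_excess_int_has_derivative j0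
        soft_excess_lip[OF assms(3)] mono_soft_excess(1)[OF assms(3)]])
  also have "\<dots> = 0"
  proof -
    have "AE x in lborel. ?j (U s x) = 0"
      using b by eventually_elim (auto simp: soft_excess_int_def max_def abs_le_iff)
    then show ?thesis by (rule integral_eq_zero_AE)
  qed
  finally have "(LINT x|lborel. ?j (U t x)) = 0"
    using nn by (intro antisym Bochner_Integration.integral_nonneg) auto
  moreover have "integrable lborel (\<lambda>x. ?j (U t x))"
    by (rule functional_has_derivative(2)[OF t soft_excess_int_has_derivative j0
        soft_excess_lip[OF assms(3)] t])
  ultimately have "AE x in lborel. ?j (U t x) = 0"
    using nn by (subst (asm) integral_nonneg_eq_0_iff_AE) auto
  then show ?thesis
  proof eventually_elim
    case (elim x)
    then have "(max 0 (U t x - k))\<^sup>2 / 2 + (max 0 (- U t x - k))\<^sup>2 / 2 = 0"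
        by (simp add: soft_excess_int_def)
    then have "(max 0 (U t x - k))\<^sup>2 / 2 = 0" "(max 0 (- U t x - k))\<^sup>2 / 2 = 0"
      using add_nonneg_eq_0_iff[of "(max 0 (U t x - k))\<^sup>2 / 2" "(max 0 (- U t x - k))\<^sup>2 / 2"]
          by auto
    then have "max 0 (U t x - k) = 0" "max 0 (- U t x - k) = 0" by auto
    then show ?case by (auto simp: max_def split: if_splits)
  qed
qed

text \<open>The modulus is not differentiable at 0. Huber's functions divided by k = 1/(n + 1)
  increase to it within an error k, each has a nonincreasing integral, and the limit is taken by
  dominated convergence.\<close>

lemma l1_decreasing:
  assumes "0 < s" "s \<le> t"
  shows "l1 (U t) \<le> l1 (U s)"
proof -
  have t: "0 < t" using assms by simp
  note [measurable] = bint_borel[OF U[OF t]] bint_borel[OF U[OF assms(1)]]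
  have si: "integrable lborel (\<lambda>x. \<bar>U s x\<bar>)" "integrable lborel (\<lambda>x. \<bar>U t x\<bar>)"
    using U[OF t] U[OF assms(1)] by (auto simp: bint_def)
  let ?k = "\<lambda>n. 1 / real (Suc n)"
  let ?j = "\<lambda>n y. y\<^sup>2 / 2 - soft_excess_int (?k n) y"
  have [measurable]: "soft_excess_int k \<in> borel_measurable borel" for k
      unfolding soft_excess_int_def by measurable
  have dj: "(?j n has_real_derivative y - soft_excess (?k n) y) (at y)" for n y
    by (intro DERIV_diff soft_excess_int_has_derivative) (auto intro!: derivative_eq_intros)
  have j0: "?j n 0 = 0" "0 - soft_excess (?k n) 0 = 0" for n
      by (auto simp: soft_excess_int_def soft_excess_def)
  have "(LINT x|lborel. ?j n (U t x) / ?k n) \<le> l1 (U s)" for n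
  proof -
    have k: "0 < ?k n" "0 \<le> ?k n" by auto
    have "(LINT x|lborel. ?j n (U t x)) \<le> (LINT x|lborel. ?j n (U s x))"
      by (rule functional_decreasing[OF assms(1,2) dj j0 soft_excess_lip'[OF k(2)]
          mono_soft_excess(2)[OF k(2)]])
    then have "(LINT x|lborel. ?j n (U t x) / ?k n) \<le> (LINT x|lborel. ?j n (U s x) / ?k n)"
      using k by (simp add: mult_right_mono)
    also have "\<dots> \<le> l1 (U s)"
    proof (rule integral_mono)
      show "integrable lborel (\<lambda>x. ?j n (U s x) / ?k n)"
        by (intro integrable_divide functional_has_derivative(2)[OF t dj j0
            soft_excess_lip'[OF k(2)] assms(1)])
      show "?j n (U s x) / ?k n \<le> \<bar>U s x\<bar>" for x by (rule huber_bounds(2)[OF k(1)])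
    qed (use si in auto)
    finally show ?thesis .
  qed
  moreover have "(\<lambda>n. LINT x|lborel. ?j n (U t x) / ?k n) \<longlonglongrightarrow> l1 (U t)"
  proof (rule integral_dominated_convergence[where w="\<lambda>x. \<bar>U t x\<bar>"])
    have k0: "?k \<longlonglongrightarrow> 0" using LIMSEQ_Suc[OF lim_1_over_n] by simp
    show "AE x in lborel. (\<lambda>n. ?j n (U t x) / ?k n) \<longlonglongrightarrow> \<bar>U t x\<bar>"
    proof (rule AE_I2)
      fix x
      have lower: "\<forall>\<^sub>F n in sequentially. \<bar>U t x\<bar> - ?k n \<le> ?j n (U t x) / ?k n"
        by (rule always_eventually, rule allI, rule huber_bounds(3)) simp
      have upper: "\<forall>\<^sub>F n in sequentially. ?j n (U t x) / ?k n \<le> \<bar>U t x\<bar>"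
        by (rule always_eventually, rule allI, rule huber_bounds(2)) simp
      have "(\<lambda>n. \<bar>U t x\<bar> - ?k n) \<longlonglongrightarrow> \<bar>U t x\<bar>"
        using tendsto_diff[OF tendsto_const k0] by simp
      then show "(\<lambda>n. ?j n (U t x) / ?k n) \<longlonglongrightarrow> \<bar>U t x\<bar>"
        by (rule tendsto_sandwich[OF lower upper _ tendsto_const])
    qed
    show "AE x in lborel. norm (?j n (U t x) / ?k n) \<le> \<bar>U t x\<bar>" for n
      using huber_bounds(1,2)[of "?k n"] by (intro AE_I2)
          (simp only: real_norm_def abs_of_nonneg, simp)
  qed (use si in auto)
  ultimately show ?thesis by (intro LIMSEQ_le_const2) auto
qed

lemma l2_decreasing:
  assumes "0 < s" "s \<le> t"
  shows "(l2 (U t))\<^sup>2 \<le> (l2 (U s))\<^sup>2"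
proof -
  have d: "((\<lambda>s. s\<^sup>2 / 2) has_real_derivative s) (at s)" for s :: real
      by (auto intro!: derivative_eq_intros)
  have "(LINT x|lborel. (U t x)\<^sup>2 / 2) \<le> (LINT x|lborel. (U s x)\<^sup>2 / 2)"
    by (rule functional_decreasing[OF assms d]) (auto simp: mono_def)
  then show ?thesis by (simp add: l2_square)
qed

text \<open>The L^1 norm stays below m, so for r large the pairing of K_r * U with U is below
  \<delta>/2. While the squared L^2 norm is at least \<delta>, the energy at r is at least
  \<delta>/2, and half the squared norm decreases at speed \<delta>/(2 r) or more; this cannot go on
  forever.\<close>

lemma l2_eventually_small:
  assumes "0 < \<delta>" obtains T where "1 \<le> T" "\<And>t. T \<le> t \<Longrightarrow> (l2 (U t))\<^sup>2 < \<delta>"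
proof -
  define m where "m = l1 (U 1)"
  have m0: "0 \<le> m" by (simp add: m_def)
  have "((\<lambda>r. (4 * pi * r) powr (- real CARD('n) / 2) * m * m) \<longlongrightarrow> 0 * m * m) at_top"
    by (intro tendsto_intros tendsto_neg_powr filterlim_tendsto_pos_mult_at_top[OF tendsto_const])
        (auto simp: filterlim_ident)
  then have "\<forall>\<^sub>F r in at_top. (4 * pi * r) powr (- real CARD('n) / 2) * m * m < \<delta> / 2"
    using assms by (intro order_tendstoD) auto
  then have "\<forall>\<^sub>F r in at_top. (4 * pi * r) powr (- real CARD('n) / 2) * m * m < \<delta> / 2 \<and> 0 < r"
    using eventually_gt_at_top[of 0] by eventually_elim auto
  then obtain r where r: "0 < r" "(4 * pi * r) powr (- real CARD('n) / 2) * m * m < \<delta> / 2"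
    by (auto dest: eventually_happens)
  have "\<exists>T\<ge>1. (l2 (U T))\<^sup>2 < \<delta>"
  proof (rule ccontr)
    assume "\<not> ?thesis"
    then have big: "\<And>t. 1 \<le> t \<Longrightarrow> \<delta> \<le> (l2 (U t))\<^sup>2" by (auto simp: not_less)
    let ?J = "\<lambda>t. (LINT x|lborel. (U t x)\<^sup>2 / 2) + t * (\<delta> / (2 * r))"
    have d: "((\<lambda>s. s\<^sup>2 / 2) has_real_derivative s) (at s)" for s :: real
        by (auto intro!: derivative_eq_intros)
    have "?J t \<le> ?J 1" if "1 \<le> t" for t
    proof (rule DERIV_nonpos_imp_nonincreasing[OF that])
      fix s :: real assume s: "1 \<le> s" "s \<le> t"
      then have s0: "0 < s" by simp
      have "(?J has_real_derivative (LINT x|lborel. V s x * U s x) + \<delta> / (2 * r)) (at s)"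
        by (intro DERIV_add functional_has_derivative(1)[OF s0 d]
            DERIV_cmult_right[OF DERIV_ident, THEN DERIV_cong]) auto
      moreover have "(LINT x|lborel. V s x * U s x) + \<delta> / (2 * r) \<le> 0"
      proof -
        have ms: "l1 (U s) \<le> m" unfolding m_def using s by (intro l1_decreasing) auto
        have "\<bar>Q (\<lambda>z. heat_kernel z r) (U s) (U s)\<bar>
            \<le> 1 * (4 * pi * r) powr (- real CARD('n) / 2) * l1 (U s) * l1 (U s)"
          by (intro Q_l1_l1 kdom_heat_kernel r bint_integrable U s0)
        also have "\<dots> \<le> (4 * pi * r) powr (- real CARD('n) / 2) * m * m"
          using ms by (simp add: mult.assoc) (intro mult_left_mono mult_mono, auto simp: m0)
        finally have "\<delta> / 2 \<le> energy (U s) r"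
          using r(2) big[OF s(1)] energy_eq[OF r(1) U_sq[OF s0]] by (simp add: l2_square)
        then have "\<delta> / 2 / r \<le> energy (U s) r / r" using r by (intro divide_right_mono) auto
        then show ?thesis
          using stationary_identity.dissipation_energy[OF stationary[OF s0] r(1)] by simp
      qed
      ultimately show "\<exists>y. (?J has_real_derivative y) (at s) \<and> y \<le> 0" by blast
    qed
    moreover have "0 \<le> (LINT x|lborel. (U t x)\<^sup>2 / 2)" for t
        by (intro Bochner_Integration.integral_nonneg) simp
    ultimately have *: "t * (\<delta> / (2 * r)) \<le> ?J 1" if "1 \<le> t" for t using that by (smt (verit))
    \<comment> \<open>A time at which the linear term alone exceeds the initial value of ?J.\<close>
    let ?t = "max 1 ((?J 1 + 1) / (\<delta> / (2 * r)))"
    have "(?J 1 + 1) / (\<delta> / (2 * r)) * (\<delta> / (2 * r)) \<le> ?t * (\<delta> / (2 * r))"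
      using assms r by (intro mult_right_mono) auto
    moreover have "(?J 1 + 1) / (\<delta> / (2 * r)) * (\<delta> / (2 * r)) = ?J 1 + 1" using assms r by simp
    ultimately show False using *[of ?t] by linarith
  qed
  then obtain T where "1 \<le> T" "(l2 (U T))\<^sup>2 < \<delta>" by blast
  then show ?thesis using that[of T] l2_decreasing[of T]
      by (meson le_less_trans less_le_trans zero_less_one)
qed

end

section \<open>Duhamel estimates\<close>

text \<open>Tested with the sign of D on the set where |D| > b, the hypothesis says that the
  integral of |D| - b over this set is at most 0. Cutting with balls gives the set finite measure
  and makes the test function admissible.\<close>

lemma linf_dual:
  fixes D :: "'a::euclidean_space \<Rightarrow> real"
  assumes D: "integrable lborel D" and b: "\<And>w. bint w \<Longrightarrow> \<bar>LINT x|lborel. D x * w x\<bar> \<le> b * l1 w"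
    and b0: "0 \<le> b"
  shows "AE x in lborel. \<bar>D x\<bar> \<le> b"
proof -
  note [measurable] = borel_integrable[OF D]
  have "AE x in lborel. \<not> (norm x \<le> real n \<and> b < \<bar>D x\<bar>)" for n :: nat
  proof -
    let ?S = "{x. norm x \<le> real n \<and> b < \<bar>D x\<bar>}"
    have S: "?S \<in> sets lborel" by measurable
    have "emeasure lborel ?S \<le> emeasure lborel (cball (0::'a) (real n))"
      by (rule emeasure_mono) (auto simp: dist_norm)
    also have "\<dots> < \<infinity>" by (rule emeasure_compact_finite) simp
    finally have Sfin: "emeasure lborel ?S < \<infinity>" .
    let ?w = "\<lambda>x. indicat_real ?S x * sgn (D x)"
    have iS: "integrable lborel (indicat_real ?S)" using S Sfin by simp
    have w: "bint ?w"
    proof (rule bint_mono[where c=1])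
      show "bint (indicat_real ?S)" using iS by
          (auto simp: bint_def intro!: exI[of _ 1] split: split_indicator)
      show "?w \<in> borel_measurable borel" using S by measurable
    qed (auto simp: abs_mult sgn_real_def)
    have iD: "integrable lborel (\<lambda>x. indicat_real ?S x * \<bar>D x\<bar>)"
      using integrable_mult_indicator[OF S integrable_abs[OF D]] by simp
    have iw: "integrable lborel (\<lambda>x. \<bar>?w x\<bar>)" using bint_integrable[OF w] by simp
    have "(LINT x|lborel. indicat_real ?S x * \<bar>D x\<bar>) = (LINT x|lborel. D x * ?w x)"
      by (intro Bochner_Integration.integral_cong) (auto simp: mult.left_commute[of "D _"] abs_sgn)
    also have "\<dots> \<le> b * l1 ?w" using b[OF w] by simp
    finally have le: "(LINT x|lborel. indicat_real ?S x * \<bar>D x\<bar> - b * \<bar>?w x\<bar>) \<le> 0"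
      using iD iw by simp
    have nn: "0 \<le> indicat_real ?S x * \<bar>D x\<bar> - b * \<bar>?w x\<bar>" for x
      by (cases "D x = 0") (auto simp: abs_mult sgn_real_def split: split_indicator)
    have ii: "integrable lborel (\<lambda>x. indicat_real ?S x * \<bar>D x\<bar> - b * \<bar>?w x\<bar>)"
      using iD iw by simp
    have "(LINT x|lborel. indicat_real ?S x * \<bar>D x\<bar> - b * \<bar>?w x\<bar>) = 0"
      using le nn by (intro antisym Bochner_Integration.integral_nonneg) auto
    then have "AE x in lborel. indicat_real ?S x * \<bar>D x\<bar> - b * \<bar>?w x\<bar> = 0"
      using integral_nonneg_eq_0_iff_AE[OF ii] nn by simp
    then show ?thesis
    proof eventually_elim
      case (elim x)
      show ?case
      proof
        assume x: "norm x \<le> real n \<and> b < \<bar>D x\<bar>"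
        then have "D x \<noteq> 0" using b0 by auto
        then have "\<bar>D x\<bar> - b = 0" using elim x by (simp add: abs_mult sgn_real_def split: if_splits)
        then show False using x by simp
      qed
    qed
  qed
  then have "AE x in lborel. \<forall>n::nat. \<not> (norm x \<le> real n \<and> b < \<bar>D x\<bar>)"
      by (simp only: AE_all_countable) simp
  then show ?thesis
  proof eventually_elim
    case (elim x)
    obtain n :: nat where "norm x \<le> real n" using real_arch_simple by blast
    then show ?case using elim by (auto simp: not_less)
  qed
qed

text \<open>The sign of D is cut to balls, since by itself it need not be integrable; the balls then
  exhaust the space.\<close>

lemma l1_dual:
  fixes D :: "'a::euclidean_space \<Rightarrow> real"
  assumes D: "integrable lborel D" and b: "\<And>w. bint w \<Longrightarrow> (\<And>x. \<bar>w x\<bar> \<le> 1)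
      \<Longrightarrow> \<bar>LINT x|lborel. D x * w x\<bar> \<le> b"
  shows "l1 D \<le> b"
proof -
  note [measurable] = borel_integrable[OF D]
  let ?B = "\<lambda>n::nat. cball (0::'a) (real n)"
  have [measurable]: "?B n \<in> sets borel" for n by simp
  have "(LINT x|lborel. indicat_real (?B n) x * \<bar>D x\<bar>) \<le> b" for n
  proof -
    let ?w = "\<lambda>x. indicat_real (?B n) x * sgn (D x)"
    have "emeasure lborel (?B n) < \<infinity>" by (rule emeasure_compact_finite) simp
    then have iB: "bint (indicat_real (?B n))"
        by (auto simp: bint_def intro!: exI[of _ 1] split: split_indicator)
    have w: "bint ?w"
      by (rule bint_mono[OF iB, where c=1]) (measurable, auto simp: abs_mult sgn_real_def)
    have "(LINT x|lborel. indicat_real (?B n) x * \<bar>D x\<bar>) = (LINT x|lborel. D x * ?w x)"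
      by (intro Bochner_Integration.integral_cong) (auto simp: mult.left_commute[of "D _"] abs_sgn)
    also have "\<dots> \<le> b" using b[OF w] by (simp add: abs_mult sgn_real_def split: split_indicator)
    finally show ?thesis .
  qed
  moreover have "(\<lambda>n. LINT x|lborel. indicat_real (?B n) x * \<bar>D x\<bar>) \<longlonglongrightarrow> l1 D"
  proof (rule integral_dominated_convergence[where w="\<lambda>x. \<bar>D x\<bar>"])
    show "AE x in lborel. (\<lambda>n. indicat_real (?B n) x * \<bar>D x\<bar>) \<longlonglongrightarrow> \<bar>D x\<bar>"
    proof (rule AE_I2)
      fix x :: 'a
      obtain m :: nat where m: "norm x \<le> real m" using real_arch_simple by blast
      have "\<forall>\<^sub>F n in sequentially. indicat_real (?B n) x * \<bar>D x\<bar> = \<bar>D x\<bar>"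
        using eventually_ge_at_top[of m] by eventually_elim (use m in \<open>auto simp: indicator_def\<close>)
      then show "(\<lambda>n. indicat_real (?B n) x * \<bar>D x\<bar>) \<longlonglongrightarrow> \<bar>D x\<bar>" by (rule tendsto_eventually)
    qed
  qed (use D in \<open>auto split: split_indicator\<close>)
  ultimately show ?thesis by (intro LIMSEQ_le_const2) auto
qed

lemma kdom_minus:
  assumes "kdom k c \<rho>" shows "kdom (\<lambda>z. k (- z)) c \<rho>"
proof -
  have [measurable]: "k \<in> borel_measurable borel" using assms by (simp add: kdom_def)
  have "\<bar>k (- z)\<bar> \<le> c * heat_kernel z \<rho>" for z
    using assms heat_kernel_uminus[of z \<rho>] by (metis kdom_def)
  then show ?thesis using assms by (simp add: kdom_def)
qed

lemma Q_linf_l1: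
  assumes k: "kdom k \<kappa> \<rho>" and f: "sqint f" and b: "AE x in lborel. \<bar>f x\<bar> \<le> c" and c: "0 \<le> c"
      and g: "bint g"
  shows "\<bar>Q k f g\<bar> \<le> \<kappa> * c * l1 g"
  using Q_l1_linf[OF kdom_minus[OF k] bint_integrable[OF g] sqint_borel[OF f] b c]
      Q_swap[OF k f bint_sqint[OF g]] by simp

section \<open>Duhamel's formula along the flow\<close>

context diffusion_flow
begin

text \<open>The motion of U contributes V and the shrinking parameter contributes minus
  \<open>hk_dt\<close>; by \<open>weak_Q\<close> only the convection term survives. The error has
  three parts: K_r against the increment minus h V, the change of the kernel against the increment
  of U, and the Taylor remainder of the kernel against U at the fixed time.\<close>

lemma duhamel_derivative:
  assumes t: "0 < t0" and s: "0 \<le> s" "s < \<tau>" and w: "bint w"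
  shows "((\<lambda>s. Q (\<lambda>z. heat_kernel z (\<tau> - s)) (U (t0 + s)) w) has_real_derivative
    Q (\<lambda>z. hk_grad a z (\<tau> - s)) (\<lambda>x. F (U (t0 + s) x)) w) (at s)"
proof -
  define t r where "t = t0 + s" and "r = \<tau> - s"
  have tp: "0 < t" and r: "0 < r" using t s by (auto simp: t_def r_def)
  note ws = bint_sqint[OF w]
  let ?e = "\<lambda>h. l2 (\<lambda>x. (U (t + h) x - U t x) / h - V t x)"
  let ?G = "\<lambda>h. ?e h * l2 w + hkD TYPE('n) / r * l2 (\<lambda>x. U (t + h) x - U t x) * l2 w
     + \<bar>h\<bar> * (hkD TYPE('n) / r\<^sup>2 * l2 (U t) * l2 w)"
  have "(?G \<longlongrightarrow> 0 * l2 w + hkD TYPE('n) / r * 0 * l2 w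
      + \<bar>0\<bar> * (hkD TYPE('n) / r\<^sup>2 * l2 (U t) * l2 w)) (at 0)"
    by (intro tendsto_intros UV[OF tp] U_l2_continuous[OF tp])
  then have G: "(?G \<longlongrightarrow> 0) (at 0)" by simp
  let ?K = "\<lambda>r z::real^'n. heat_kernel z r"
  note kr = kdom_heat_kernel[OF r, where 'a='n]
  show ?thesis
  proof (rule has_real_derivative_little_o[OF _ G])
    have "\<forall>\<^sub>F h in at (0::real). \<bar>h\<bar> \<le> r / 2"
      using r by (auto simp: eventually_at dist_real_def intro!: exI[of _ "r / 2"])
    then show "\<forall>\<^sub>F h in at 0. \<bar>Q (?K (\<tau> - (s + h))) (U (t0 + (s + h))) w
        - Q (?K (\<tau> - s)) (U (t0 + s)) w
       - h * Q (\<lambda>z. hk_grad a z (\<tau> - s)) (\<lambda>x. F (U (t0 + s) x)) w\<bar> \<le> \<bar>h\<bar> * ?G h"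
      using eventually_time_pos[OF tp]
    proof eventually_elim
      case (elim h)
      then have th: "0 < t + h" and h0: "h \<noteq> 0" and h: "\<bar>- h\<bar> \<le> r / 2" by auto
      have rh: "0 < r + - h" using h r by auto
      let ?u = "U (t + h)" and ?D = "\<lambda>x. U (t + h) x - U t x"
      note us = U_sq[OF th] and Us = U_sq[OF tp] and Vs = V[OF tp]
      have Ds: "sqint ?D" by (intro sqint_diff us Us)
      note krh = kdom_heat_kernel[OF rh, where 'a='n]
          and kd = kdom_heat_kernel_diff[OF r h, where 'n='n]
      have e1: "Q (?K r) (\<lambda>x. ?D x - h * V t x) w
          = Q (?K r) ?u w - Q (?K r) (U t) w - h * Q (?K r) (V t) w"
        by (simp add: Q_diff_left[OF kr Ds sqint_cmult[OF Vs] ws] Q_diff_left[OF kr us Us ws]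
            Q_cmult_left)
      have e2: "Q (\<lambda>z. heat_kernel z (r + - h) - heat_kernel z r) ?D w =
        (Q (?K (r + - h)) ?u w - Q (?K (r + - h)) (U t) w) - (Q (?K r) ?u w - Q (?K r) (U t) w)"
        by (simp only: Q_kernel_diff[OF krh kr Ds ws] Q_diff_left[OF krh us Us ws]
            Q_diff_left[OF kr us Us ws])
      have "Q (?K (\<tau> - (s + h))) (U (t0 + (s + h))) w - Q (?K (\<tau> - s)) (U (t0 + s)) w
         - h * Q (\<lambda>z. hk_grad a z (\<tau> - s)) (\<lambda>x. F (U (t0 + s) x)) w
        = Q (?K (r + - h)) ?u w - Q (?K r) (U t) w - h *
            (Q (?K r) (V t) w - Q (\<lambda>z. hk_dt z r) (U t) w)"
        using weak_Q[OF tp r w] by (simp add: t_def r_def algebra_simps)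
      also have "\<dots> = Q (?K r) (\<lambda>x. ?D x - h * V t x) w
          + Q (\<lambda>z. heat_kernel z (r + - h) - heat_kernel z r) ?D w
        + (Q (?K (r + - h)) (U t) w - Q (?K r) (U t) w - (- h) * Q (\<lambda>z. hk_dt z r) (U t) w)"
        unfolding e1 e2 by (simp add: algebra_simps)
      finally have eq: "Q (?K (\<tau> - (s + h))) (U (t0 + (s + h))) w - Q (?K (\<tau> - s)) (U (t0 + s)) w
         - h * Q (\<lambda>z. hk_grad a z (\<tau> - s)) (\<lambda>x. F (U (t0 + s) x)) w = \<dots>" .
      have b1: "\<bar>Q (?K r) (\<lambda>x. ?D x - h * V t x) w\<bar> \<le> \<bar>h\<bar> * (?e h * l2 w)"
        using Q_l2[OF kr sqint_diff[OF Ds sqint_cmult[OF Vs, of h]] ws]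
            l2_increment(1)[OF tp th h0] by (simp add: mult.assoc)
      have b2: "\<bar>Q (\<lambda>z. heat_kernel z (r + - h) - heat_kernel z r) ?D w\<bar>
          \<le> \<bar>h\<bar> * (hkD TYPE('n) / r * l2 ?D * l2 w)"
        using Q_l2[OF kd Ds ws] by (simp add: mult.assoc)
      have b3: "\<bar>Q (?K (r + - h)) (U t) w - Q (?K r) (U t) w - (- h) * Q (\<lambda>z. hk_dt z r) (U t) w\<bar>
        \<le> \<bar>h\<bar> * (\<bar>h\<bar> * (hkD TYPE('n) / r\<^sup>2 * l2 (U t) * l2 w))"
      proof -
        have "\<bar>Q (?K (r + - h)) (U t) w - Q (?K r) (U t) w - (- h) * Q (\<lambda>z. hk_dt z r) (U t) w\<bar>
          \<le> (hkD TYPE('n) / r\<^sup>2 * l2 (U t) * l2 w) * (\<bar>h\<bar> * \<bar>h\<bar>)"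
          using Q_heat_kernel_taylor[OF r h Us ws] by (simp add: power2_eq_square)
        then show ?thesis by (simp only: mult_ac)
      qed
      show ?case unfolding eq distrib_left using b1 b2 b3 by linarith
    qed
  qed
qed

lemma Q_heat_kernel_approx_bint:
  assumes w: "bint w"
  shows "((\<lambda>r. sqrt (2 * energy w r)) \<longlongrightarrow> 0) (at_right 0)"
proof -
  have "((\<lambda>r. sqrt (2 * energy w r)) \<longlongrightarrow> sqrt (2 * 0)) (at_right 0)"
    by (intro tendsto_intros energy_tendsto_0[OF w])
  then show ?thesis by simp
qed

text \<open>At s = \<tau> the kernel degenerates to a point mass, beyond the reach of
  \<open>duhamel_derivative\<close>. The limit combines continuity of U in L^2 with
  \<open>Q_heat_kernel_approx\<close>, where the energy of w tends to 0.\<close>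

lemma duhamel_endpoint:
  assumes t: "0 < t0" and \<tau>: "0 < \<tau>" and w: "bint w"
  shows "((\<lambda>h. Q (\<lambda>z. heat_kernel z h) (U (t0 + (\<tau> - h))) w)
      \<longlongrightarrow> (LINT x|lborel. U (t0 + \<tau>) x * w x)) (at_right 0)"
proof (rule Lim_transform2[OF tendsto_const])
  note ws = bint_sqint[OF w]
  have tp: "0 < t0 + \<tau>" using t \<tau> by simp
  let ?u = "U (t0 + \<tau>)"
  let ?G = "\<lambda>h. l2 (\<lambda>x. U (t0 + \<tau> + - h) x - ?u x) * l2 w + l2 ?u * sqrt (2 * energy w h)"
  have "filterlim (\<lambda>h::real. - h) (at 0) (at_right 0)"
    by (auto simp: filterlim_at eventually_at_filter intro!: tendsto_eq_intros)
  from filterlim_compose[OF U_l2_continuous[OF tp] this]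
  have "(?G \<longlongrightarrow> 0 * l2 w + l2 ?u * 0) (at_right 0)"
    by (intro tendsto_intros Q_heat_kernel_approx_bint[OF w])
  then have G: "(?G \<longlongrightarrow> 0) (at_right 0)" by simp
  show "((\<lambda>h. (LINT x|lborel. ?u x * w x) - Q (\<lambda>z. heat_kernel z h) (U (t0 + (\<tau> - h))) w) \<longlongrightarrow> 0)
      (at_right 0)"
  proof (rule Lim_null_comparison[OF _ G])
    have "\<forall>\<^sub>F h in at_right 0. (0::real) < h \<and> h < \<tau>"
      using \<tau> by (auto simp: eventually_at_right[of 0 1] intro!: exI[of _ \<tau>])
    then show "\<forall>\<^sub>F h in at_right 0. norm ((LINT x|lborel. ?u x * w x)
        - Q (\<lambda>z. heat_kernel z h) (U (t0 + (\<tau> - h))) w) \<le> ?G h"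
    proof eventually_elim
      case (elim h)
      then have h: "0 < h" "0 < t0 + \<tau> + - h" using t by auto
      note us = U_sq[OF tp] and uh = U_sq[OF h(2)] and k = kdom_heat_kernel[OF h(1), where 'a='n]
      have "\<bar>Q (\<lambda>z. heat_kernel z h) (\<lambda>x. U (t0 + \<tau> + - h) x - ?u x) w\<bar>
          \<le> l2 (\<lambda>x. U (t0 + \<tau> + - h) x - ?u x) * l2 w"
        using Q_l2[OF k sqint_diff[OF uh us] ws] by simp
      moreover have "Q (\<lambda>z. heat_kernel z h) (\<lambda>x. U (t0 + \<tau> + - h) x - ?u x) w =
        Q (\<lambda>z. heat_kernel z h) (U (t0 + (\<tau> - h))) w - Q (\<lambda>z. heat_kernel z h) ?u w"
        using Q_diff_left[OF k uh us ws] by (simp add: algebra_simps)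
      ultimately show ?case using Q_heat_kernel_approx[OF h(1) us ws] by simp
    qed
  qed
qed

text \<open>Duhamel's formula, tested against \<open>w\<close> and estimated through the derivative of
  $s \mapsto \langle e^{(\tau - s) \Delta} U(t_0 + s), w \rangle$; this avoids integrals with
  respect to time.\<close>

lemma duhamel_bound:
  assumes t: "0 < t0" and \<tau>: "0 < \<tau>" and w: "bint w" and c: "0 \<le> c"
    and b: "\<And>s. 0 < s \<Longrightarrow> s < \<tau> \<Longrightarrow>
      \<bar>Q (\<lambda>z. hk_grad a z (\<tau> - s)) (\<lambda>x. F (U (t0 + s) x)) w\<bar> \<le> c *
          (s powr (- 1 / 2) + (\<tau> - s) powr (- 1 / 2))"
  shows "\<bar>(LINT x|lborel. U (t0 + \<tau>) x * w x) - Q (\<lambda>z. heat_kernel z \<tau>) (U t0) w\<bar> \<le> 4 * c * sqrt \<tau>"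
proof -
  let ?B = "\<lambda>s. Q (\<lambda>z. heat_kernel z (\<tau> - s)) (U (t0 + s)) w"
  \<comment> \<open>An antiderivative of the assumed bound on the derivative. Both endpoint
    singularities are integrable, and its total increment is at most 4 c sqrt \<tau>.\<close>
  let ?h = "\<lambda>s. 2 * c * sqrt s - 2 * c * sqrt (\<tau> - s)"
  have hd: "(?h has_real_derivative c * (s powr (- 1 / 2) + (\<tau> - s) powr (- 1 / 2))) (at s)"
      if "0 < s" "s < \<tau>" for s
  proof -
    have "((\<lambda>s. sqrt (\<tau> - s)) has_real_derivative (inverse (sqrt (\<tau> - s)) / 2) * (0 - 1)) (at s)"
      using that by (intro DERIV_chain2[where f=sqrt and g="\<lambda>s. \<tau> - s"] DERIV_real_sqrt DERIV_diff
          DERIV_const DERIV_ident) auto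
    then have "(?h has_real_derivative 2 * c * (inverse (sqrt s) / 2)
        - 2 * c * ((inverse (sqrt (\<tau> - s)) / 2) * (0 - 1))) (at s)"
      using that by (intro DERIV_diff DERIV_cmult DERIV_real_sqrt)
    moreover have "s powr (- 1 / 2) = inverse (sqrt s)"
        "(\<tau> - s) powr (- 1 / 2) = inverse (sqrt (\<tau> - s))"
      using that by (auto simp: powr_minus powr_half_sqrt)
    ultimately show ?thesis by (simp add: algebra_simps)
  qed
  have comp: "\<bar>?B s2 - ?B s1\<bar> \<le> ?h s2 - ?h s1" if s: "0 < s1" "s1 \<le> s2" "s2 < \<tau>" for s1 s2
  proof -
    let ?b = "\<lambda>s. Q (\<lambda>z. hk_grad a z (\<tau> - s)) (\<lambda>x. F (U (t0 + s) x)) w"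
    have "?h s1 - ?B s1 \<le> ?h s2 - ?B s2"
    proof (rule DERIV_nonneg_imp_nondecreasing[OF s(2)])
      fix x assume "s1 \<le> x" "x \<le> s2"
      then have x: "0 < x" "x < \<tau>" using s by auto
      show "\<exists>y. ((\<lambda>s. ?h s - ?B s) has_real_derivative y) (at x) \<and> 0 \<le> y"
        using DERIV_diff[OF hd[OF x] duhamel_derivative[OF t less_imp_le[OF x(1)] x(2) w]] b[OF x]
            by (intro exI conjI) auto
    qed
    moreover have "?h s1 + ?B s1 \<le> ?h s2 + ?B s2"
    proof (rule DERIV_nonneg_imp_nondecreasing[OF s(2)])
      fix x assume "s1 \<le> x" "x \<le> s2"
      then have x: "0 < x" "x < \<tau>" using s by auto
      show "\<exists>y. ((\<lambda>s. ?h s + ?B s) has_real_derivative y) (at x) \<and> 0 \<le> y"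
        using DERIV_add[OF hd[OF x] duhamel_derivative[OF t less_imp_le[OF x(1)] x(2) w]] b[OF x]
            by (intro exI conjI) auto
    qed
    ultimately show ?thesis by (simp only: abs_le_iff) (intro conjI; linarith)
  qed
  have hb: "?h s2 - ?h s1 \<le> 4 * c * sqrt \<tau>" if "0 < s1" "s1 \<le> s2" "s2 < \<tau>" for s1 s2
  proof -
    have "c * sqrt s2 \<le> c * sqrt \<tau>" "c * sqrt (\<tau> - s1) \<le> c * sqrt \<tau>"
      using that c by (auto intro!: mult_left_mono)
    moreover have "0 \<le> c * sqrt s1" "0 \<le> c * sqrt (\<tau> - s2)" using that c by auto
    ultimately show ?thesis by simp
  qed
  have l0: "((\<lambda>h. ?B h) \<longlongrightarrow> ?B 0) (at_right 0)"
  proof -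
    have "isCont ?B 0" by (rule DERIV_isCont[OF duhamel_derivative[OF t order_refl \<tau> w]])
    then show ?thesis by (auto simp: isCont_def intro: tendsto_mono[OF at_le])
  qed
  have l1: "((\<lambda>h. ?B (\<tau> - h)) \<longlongrightarrow> (LINT x|lborel. U (t0 + \<tau>) x * w x)) (at_right 0)"
    using duhamel_endpoint[OF t \<tau> w] by simp
  have "((\<lambda>h. \<bar>?B (\<tau> - h) - ?B h\<bar>) \<longlongrightarrow> \<bar>(LINT x|lborel. U (t0 + \<tau>) x * w x) - ?B 0\<bar>) (at_right 0)"
    by (intro tendsto_intros l0 l1)
  moreover have "\<forall>\<^sub>F h in at_right 0. \<bar>?B (\<tau> - h) - ?B h\<bar> \<le> 4 * c * sqrt \<tau>"
  proof -
    have "\<forall>\<^sub>F h in at_right 0. (0::real) < h \<and> h < \<tau> / 2"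
      using \<tau> by (auto simp: eventually_at_right[of 0 1] intro!: exI[of _ "\<tau> / 2"])
    then show ?thesis
    proof eventually_elim
      case (elim h)
      then show ?case using comp[of h "\<tau> - h"] hb[of h "\<tau> - h"]
          by (intro order_trans[OF comp hb]) auto
    qed
  qed
  ultimately have "\<bar>(LINT x|lborel. U (t0 + \<tau>) x * w x) - ?B 0\<bar> \<le> 4 * c * sqrt \<tau>"
    by (rule tendsto_upperbound) simp
  then show ?thesis by simp
qed

definition gradC :: real where "gradC = norm a * hkC TYPE('n)"

lemma gradC_nonneg: "0 \<le> gradC"
  using hkC_pos[where 'n='n] by (simp add: gradC_def)

lemma kdom_grad: "0 < r \<Longrightarrow> kdom (\<lambda>z::real^'n. hk_grad a z r) (gradC * r powr (- 1 / 2)) (2 * r)"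
  using kdom_hk_grad[of r a] by (simp add: gradC_def)

lemma grad_linf:
  assumes "0 < r" "0 < t" "bint w" "0 \<le> c" "AE x in lborel. \<bar>F (U t x)\<bar> \<le> c"
  shows "\<bar>Q (\<lambda>z. hk_grad a z r) (\<lambda>x. F (U t x)) w\<bar> \<le> gradC * r powr (- 1 / 2) * c * l1 w"
  by (rule Q_linf_l1[OF kdom_grad[OF assms(1)] bint_sqint[OF FU_bint[OF assms(2)]] assms(5,4,3)])

text \<open>After a time t with small L^2 norm the flow runs for a short \<tau>. The target
  \<epsilon> is shared by the Duhamel term, the heat flow of U t truncated at \<epsilon>/3, and the
  heat flow of the excess, whose L^1 norm is controlled by the L^2 norm.\<close>

lemma uniform_decay:
  assumes \<epsilon>: "0 < \<epsilon>"
  obtains T where "1 \<le> T" "AE x in lborel. \<bar>U T x\<bar> \<le> \<epsilon>"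
proof -
  obtain C where C: "0 < C" "\<And>x. \<bar>U 1 x\<bar> \<le> C" using bintE[OF U[of 1]] by auto
  obtain L where L: "0 < L" "\<And>s. \<bar>s\<bar> \<le> C \<Longrightarrow> \<bar>F s\<bar> \<le> L * \<bar>s\<bar>" using lipschitz_on_bounded[OF C(1)]
      by blast
  have UC: "AE x in lborel. \<bar>U t x\<bar> \<le> C" if "1 \<le> t" for t
    by (rule linf_decreasing[of 1]) (use that C in auto)
  define c where "c = gradC * (L * C)"
  have c: "0 \<le> c" using gradC_nonneg L C by (simp add: c_def)
  \<comment> \<open>Makes 4 c sqrt \<tau> at most \<epsilon>/3. It depends on the sup bound at time
    1 and not on t, so t may still be chosen according to \<tau>.\<close>
  define \<tau> where "\<tau> = (\<epsilon> / (12 * (c + 1)))\<^sup>2"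
  have \<tau>: "0 < \<tau>" using \<epsilon> c by (simp add: \<tau>_def)
  have s\<tau>: "4 * c * sqrt \<tau> \<le> \<epsilon> / 3"
  proof -
    have "sqrt \<tau> = \<epsilon> / (12 * (c + 1))" using \<epsilon> c by (simp add: \<tau>_def)
    then have "sqrt \<tau> * (12 * (c + 1)) = \<epsilon>" using c by simp
    moreover have "0 \<le> sqrt \<tau>" using \<tau> by simp
    moreover have "sqrt \<tau> * (12 * (c + 1)) = 3 * (4 * c * sqrt \<tau>) + 12 * sqrt \<tau>"
        by (simp add: algebra_simps)
    ultimately show ?thesis by linarith
  qed
  let ?p = "(4 * pi * \<tau>) powr (- real CARD('n) / 2)"
  \<comment> \<open>The excess has L^1 norm at most \<delta>/(\<epsilon>/3), and smoothing over the
    time \<tau> costs the factor ?p; the result is at most \<epsilon>/3.\<close>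
  define \<delta> where "\<delta> = (\<epsilon> / 3)\<^sup>2 / (?p + 1)"
  have p: "0 < ?p + 1" by (simp add: add_nonneg_pos)
  have \<delta>: "0 < \<delta>" using \<epsilon> p by (simp add: \<delta>_def)
  obtain t where t: "1 \<le> t" "(l2 (U t))\<^sup>2 < \<delta>" using l2_eventually_small[OF \<delta>] by blast
  have t0: "0 < t" using t by simp
  have "\<bar>LINT x|lborel. U (t + \<tau>) x * w x\<bar> \<le> \<epsilon> * l1 w" if w: "bint w" for w
  proof -
    have lw: "0 \<le> l1 w" by simp
    have "\<bar>(LINT x|lborel. U (t + \<tau>) x * w x) - Q (\<lambda>z. heat_kernel z \<tau>) (U t) w\<bar>
        \<le> 4 * (c * l1 w) * sqrt \<tau>"
    proof (rule duhamel_bound[OF t0 \<tau> w])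
      show "0 \<le> c * l1 w" using c by simp
      fix s assume s: "0 < s" "s < \<tau>"
      have "AE x in lborel. \<bar>F (U (t + s) x)\<bar> \<le> L * C"
      proof -
        have "1 \<le> t + s" using t s by simp
        from UC[OF this] show ?thesis
      proof eventually_elim
        case (elim x)
        then have "L * \<bar>U (t + s) x\<bar> \<le> L * C" using L(1) by simp
        then show ?case using L(2)[OF elim] by linarith
      qed
      qed
      then have "\<bar>Q (\<lambda>z. hk_grad a z (\<tau> - s)) (\<lambda>x. F (U (t + s) x)) w\<bar>
          \<le> gradC * (\<tau> - s) powr (- 1 / 2) * (L * C) * l1 w"
        using s t0 L C w by (intro grad_linf) auto
      also have "\<dots> = c * l1 w * (\<tau> - s) powr (- 1 / 2)" by (simp add: c_def)
      also have "\<dots> \<le> c * l1 w * (s powr (- 1 / 2) + (\<tau> - s) powr (- 1 / 2))"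
        using c by (intro mult_left_mono) auto
      finally show "\<bar>Q (\<lambda>z. hk_grad a z (\<tau> - s)) (\<lambda>x. F (U (t + s) x)) w\<bar>
          \<le> c * l1 w * (s powr (- 1 / 2) + (\<tau> - s) powr (- 1 / 2))" .
    qed
    also have "4 * (c * l1 w) * sqrt \<tau> = (4 * c * sqrt \<tau>) * l1 w" by simp
    also have "\<dots> \<le> \<epsilon> / 3 * l1 w" by (rule mult_right_mono[OF s\<tau> lw])
    finally have 1: "\<bar>(LINT x|lborel. U (t + \<tau>) x * w x) - Q (\<lambda>z. heat_kernel z \<tau>) (U t) w\<bar>
        \<le> \<epsilon> / 3 * l1 w" .
    define U1 where "U1 = (\<lambda>x. max (- (\<epsilon> / 3)) (min (\<epsilon> / 3) (U t x)))"
    define U2 where "U2 = (\<lambda>x. U t x - U1 x)"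
    note [measurable] = bint_borel[OF U[OF t0]]
    have U1: "bint U1" by (rule bint_mono[OF U[OF t0], where c=1])
        (use \<epsilon> in \<open>auto simp: U1_def max_def min_def\<close>)
    have U2: "bint U2" by (rule bint_mono[OF U[OF t0], where c=1])
        (use \<epsilon> in \<open>auto simp: U1_def U2_def max_def min_def\<close>)
    note k = kdom_heat_kernel[OF \<tau>, where 'a='n]
    have "\<bar>Q (\<lambda>z. heat_kernel z \<tau>) U1 w\<bar> \<le> 1 * (\<epsilon> / 3) * l1 w"
      by (rule Q_linf_l1[OF k bint_sqint[OF U1] _ _ w])
          (use \<epsilon> in \<open>auto simp: U1_def max_def min_def\<close>)
    moreover have "\<bar>Q (\<lambda>z. heat_kernel z \<tau>) U2 w\<bar> \<le> \<epsilon> / 3 * l1 w"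
    proof -
      \<comment> \<open>The excess vanishes unless |U| > \<epsilon>/3, and there |U| <= U^2 /
        (\<epsilon>/3).\<close>
      have "\<bar>U2 x\<bar> \<le> (U t x)\<^sup>2 / (\<epsilon> / 3)" for x
      proof (cases "\<bar>U t x\<bar> \<le> \<epsilon> / 3")
        case True
        then have "U2 x = 0" by (auto simp: U2_def U1_def max_def min_def)
        then show ?thesis using \<epsilon> by simp
      next
        case False
        then have "\<bar>U2 x\<bar> \<le> \<bar>U t x\<bar>" using \<epsilon> by (auto simp: U2_def U1_def max_def min_def abs_if)
        also have "\<bar>U t x\<bar> * (\<epsilon> / 3) \<le> \<bar>U t x\<bar> * \<bar>U t x\<bar>" using False by (intro mult_left_mono) auto
        then have "\<bar>U t x\<bar> \<le> (U t x)\<^sup>2 / (\<epsilon> / 3)" using \<epsilon>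
            by (simp add: power2_eq_square field_simps)
        finally show ?thesis .
      qed
      then have "l1 U2 \<le> (LINT x|lborel. (U t x)\<^sup>2 / (\<epsilon> / 3))"
        using U2 U_sq[OF t0] by (intro integral_mono) (auto simp: bint_def sqint_def)
      also have "\<dots> = (l2 (U t))\<^sup>2 / (\<epsilon> / 3)" by (simp add: l2_square)
      also have "\<dots> \<le> \<delta> / (\<epsilon> / 3)" using t(2) \<epsilon> by (intro divide_right_mono) auto
      finally have l1U2: "l1 U2 \<le> \<delta> / (\<epsilon> / 3)" .
      have "\<bar>Q (\<lambda>z. heat_kernel z \<tau>) U2 w\<bar> \<le> 1 * ?p * l1 U2 * l1 w"
        by (rule Q_l1_l1[OF k bint_integrable[OF U2] bint_integrable[OF w]])
      also have "\<dots> \<le> (\<epsilon> / 3) * l1 w"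
      proof (rule mult_right_mono[OF _ lw])
        have "1 * ?p * l1 U2 \<le> (?p + 1) * (\<delta> / (\<epsilon> / 3))"
          using l1U2 p by (intro mult_mono) auto
        also have "\<dots> = \<epsilon> / 3"
        proof -
          have "X * ((\<epsilon> / 3)\<^sup>2 / X / (\<epsilon> / 3)) = \<epsilon> / 3" if "0 < X" for X :: real
            using that \<epsilon> by (simp add: power2_eq_square)
          from this[OF p] show ?thesis unfolding \<delta>_def .
        qed
        finally show "1 * ?p * l1 U2 \<le> \<epsilon> / 3" .
      qed
      finally show ?thesis .
    qed
    moreover have "Q (\<lambda>z. heat_kernel z \<tau>) U2 w
        = Q (\<lambda>z. heat_kernel z \<tau>) (U t) w - Q (\<lambda>z. heat_kernel z \<tau>) U1 w"
      unfolding U2_def by (rule Q_diff_left[OF k U_sq[OF t0] bint_sqint[OF U1] bint_sqint[OF w]])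
    ultimately have "\<bar>Q (\<lambda>z. heat_kernel z \<tau>) (U t) w\<bar> \<le> \<epsilon> / 3 * l1 w + \<epsilon> / 3 * l1 w" by linarith
    moreover have "\<epsilon> / 3 * l1 w + \<epsilon> / 3 * l1 w + \<epsilon> / 3 * l1 w = \<epsilon> * l1 w" by (simp add: field_simps)
    ultimately show ?thesis using 1 by linarith
  qed
  then have "AE x in lborel. \<bar>U (t + \<tau>) x\<bar> \<le> \<epsilon>"
    using t0 \<tau> using \<epsilon> by (intro linf_dual bint_integrable U) auto
  then show ?thesis using that[of "t + \<tau>"] t \<tau> by simp
qed

end

section \<open>Decay rate\<close>

lemma powr_neg_mono:
  fixes x y :: real assumes "0 < x" "x \<le> y" "0 \<le> p" shows "y powr - p \<le> x powr - p"
  using assms by (intro powr_mono2') auto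

lemma powr_neg_half_mult: "x powr (- 1 / 2) * x powr - p = x powr - (p + 1 / 2)" for x p :: real
  by (subst powr_add[symmetric]) (simp add: add.commute)

context diffusion_flow
begin

lemma heat_sup_le: "0 < r \<Longrightarrow> (4 * pi * r) powr (- real CARD('n) / 2) \<le> r powr - (real CARD('n) / 2)"
proof -
  assume r: "0 < r"
  have "1 * r \<le> 4 * pi * r" using r pi_ge_two by (intro mult_right_mono) auto
  then show ?thesis using powr_neg_mono[of r "4 * pi * r" "real CARD('n) / 2"] r by simp
qed

text \<open>The 4 comes from \<open>duhamel_bound\<close>, the power of 2 from evaluating at
  \<tau>/2, P^(1/N) from the nonlinearity. The factor m + P serves both halves of the time interval,
  one producing m and the other P.\<close>

definition duhamelC :: "real \<Rightarrow> real \<Rightarrow> real" where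
  "duhamelC P m = 4 * gradC * (2 powr ((real CARD('n) / 2) + 1 / 2)) * P powr (1 / real CARD('n))
      * (m + P)"

lemma duhamelC_nonneg: "0 < P \<Longrightarrow> 0 \<le> m \<Longrightarrow> 0 \<le> duhamelC P m"
  using gradC_nonneg by (simp add: duhamelC_def)

text \<open>If $|U(T+s)| \le P s^{-N/2}$, then both $\|F(U(T+s))\|_1$ and
  $s^{N/2} \|F(U(T+s))\|_\infty$ are $O(\epsilon s^{-1/2})$; the first half of the time interval is
  estimated with the former and the second half with the latter.\<close>

lemma
  assumes T: "0 < T" and \<tau>: "0 < \<tau>" and P: "0 < P" and m: "l1 (U T) \<le> m" and \<epsilon>: "0 \<le> \<epsilon>"
    and F\<epsilon>: "\<And>s. \<bar>s\<bar> \<le> s0 \<Longrightarrow> \<bar>F s\<bar> \<le> \<epsilon> * \<bar>s\<bar> powr ((real CARD('n) + 1) / real CARD('n))"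
    and s0: "0 < s0" "AE x in lborel. \<bar>U T x\<bar> \<le> s0"
    and dec: "\<And>s. 0 < s \<Longrightarrow> s \<le> \<tau> \<Longrightarrow> AE x in lborel. \<bar>U (T + s) x\<bar> \<le> P * s powr - (real CARD('n) / 2)"
    and w: "bint w"
  shows decay_step_linf: "\<bar>(LINT x|lborel. U (T + \<tau>) x * w x) - Q (\<lambda>z. heat_kernel z \<tau>) (U T) w\<bar>
      \<le> \<epsilon> * duhamelC P m * \<tau> powr - (real CARD('n) / 2) * l1 w"
    and decay_step_l1: "(\<And>x. \<bar>w x\<bar> \<le> 1) \<Longrightarrow>
      \<bar>(LINT x|lborel. U (T + \<tau>) x * w x) - Q (\<lambda>z. heat_kernel z \<tau>) (U T) w\<bar> \<le> \<epsilon> * duhamelC P m"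
proof -
  define N where "N = real CARD('n)"
  have N: "1 \<le> N" by (simp add: N_def Suc_leI)
  have m0: "0 \<le> m" using m by (meson Bochner_Integration.integral_nonneg abs_ge_zero order_trans)
  have lw: "0 \<le> l1 w" by simp
  have hinf: "AE x in lborel. \<bar>F (U (T + s) x)\<bar>
      \<le> \<epsilon> * (P powr (1 / N) * P) * s powr - ((real CARD('n) / 2) + 1 / 2)"
    and h1: "l1 (\<lambda>x. F (U (T + s) x)) \<le> \<epsilon> * P powr (1 / N) * s powr (- 1 / 2) * m"
        if s: "0 < s" "s \<le> \<tau>" for s
  proof -
    let ?u = "U (T + s)" and ?b = "P * s powr - (real CARD('n) / 2)"
    have ts: "0 < T + s" using T s by simp
    have b0: "0 \<le> ?b" using P by simp
    \<comment> \<open>This is where the exponent 1 + 1/N is critical: the decay s^(-N/2) makes the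
      extra factor |U|^(1/N) of order exactly s^(-1/2).\<close>
    have bp: "?b powr (1 / N) = P powr (1 / N) * s powr (- 1 / 2)"
      using P s N by (simp add: powr_mult powr_powr N_def)
    have F1: "AE x in lborel. \<bar>F (?u x)\<bar> \<le> \<epsilon> * (?b powr (1 / N) * \<bar>?u x\<bar>)"
    proof -
      have "T \<le> T + s" using s by simp
      from linf_decreasing[OF T this less_imp_le[OF s0(1)] s0(2)] dec[OF s] show ?thesis
    proof eventually_elim
      case (elim x)
      have "\<bar>?u x\<bar> powr ((N + 1) / N) = \<bar>?u x\<bar> powr (1 / N + 1)" using N
          by (simp add: add_divide_distrib add.commute)
      also have "\<dots> = \<bar>?u x\<bar> powr (1 / N) * \<bar>?u x\<bar>" by (cases "?u x = 0") (simp_all add: powr_add)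
      finally have eq: "\<bar>?u x\<bar> powr ((N + 1) / N) = \<bar>?u x\<bar> powr (1 / N) * \<bar>?u x\<bar>" .
      have "\<bar>F (?u x)\<bar> \<le> \<epsilon> * (\<bar>?u x\<bar> powr (1 / N) * \<bar>?u x\<bar>)"
        using F\<epsilon>[of "?u x"] elim unfolding N_def[symmetric] eq by simp
      also have "\<dots> \<le> \<epsilon> * (?b powr (1 / N) * \<bar>?u x\<bar>)"
        using elim N \<epsilon> by (intro mult_left_mono mult_right_mono powr_mono2) auto
      finally show ?case .
    qed
    qed
    from F1 dec[OF s] show "AE x in lborel. \<bar>F (?u x)\<bar>
        \<le> \<epsilon> * (P powr (1 / N) * P) * s powr - ((real CARD('n) / 2) + 1 / 2)"
    proof eventually_elim
      case (elim x)
      have "\<epsilon> * (?b powr (1 / N) * \<bar>?u x\<bar>) \<le> \<epsilon> * (?b powr (1 / N) * ?b)"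
        using elim(2) \<epsilon> by (intro mult_left_mono) auto
      also have "\<dots> = \<epsilon> * (P powr (1 / N) * P) * s powr - ((real CARD('n) / 2) + 1 / 2)"
        unfolding bp powr_neg_half_mult[symmetric] by (simp only: mult_ac)
      finally show ?case using elim(1) by linarith
    qed
    have "l1 (\<lambda>x. F (?u x)) \<le> (LINT x|lborel. \<epsilon> * (?b powr (1 / N) * \<bar>?u x\<bar>))"
      using F1 FU_bint[OF ts] U[OF ts] by (intro integral_mono_AE) (auto simp: bint_def)
    also have "\<dots> = \<epsilon> * (?b powr (1 / N) * l1 ?u)" by simp
    also have "\<dots> \<le> \<epsilon> * (?b powr (1 / N) * m)"
      using l1_decreasing[OF T, of "T + s"] s m \<epsilon> by (intro mult_left_mono) auto
    finally show "l1 (\<lambda>x. F (?u x)) \<le> \<epsilon> * P powr (1 / N) * s powr (- 1 / 2) * m"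
      unfolding bp by (simp add: mult_ac)
  qed
  let ?H = "\<lambda>s x. F (U (T + s) x)" and ?Q = "\<lambda>s. Q (\<lambda>z. hk_grad a z (\<tau> - s)) (\<lambda>x. F (U (T + s) x))
      w"
  \<comment> \<open>One of s and \<tau> - s is at least \<tau>/2. It carries the power -(N/2 + 1/2),
    while the other keeps its integrable singularity -1/2.\<close>
  define c where "c = gradC * \<epsilon> * P powr (1 / N) * (m + P) * (\<tau> / 2) powr
      - ((real CARD('n) / 2) + 1 / 2) * l1 w"
  have c0: "0 \<le> c" using gradC_nonneg \<epsilon> m0 P by (simp add: c_def)
  have Pm: "0 \<le> gradC * \<epsilon> * P powr (1 / N)" using gradC_nonneg \<epsilon> by simp
  have "\<bar>?Q s\<bar> \<le> c * (s powr (- 1 / 2) + (\<tau> - s) powr (- 1 / 2))" if s: "0 < s" "s < \<tau>" for s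
  proof (cases "s \<le> \<tau> / 2")
    case True
    let ?r = "\<tau> - s"
    have r: "0 < ?r" "\<tau> / 2 \<le> ?r" using s True by auto
    have ts: "0 < T + s" using T s by simp
    have "\<bar>?Q s\<bar> \<le> (gradC * ?r powr (- 1 / 2)) * (4 * pi * (2 * ?r)) powr (- real CARD('n) / 2) *
        l1 (?H s) * l1 w"
      by (rule Q_l1_l1[OF kdom_grad[OF r(1)] bint_integrable[OF FU_bint[OF ts]]
          bint_integrable[OF w]])
    also have "\<dots> \<le> (gradC * ?r powr (- 1 / 2)) * ?r powr
        - (real CARD('n) / 2) * (\<epsilon> * P powr (1 / N) * s powr (- 1 / 2) * m) * l1 w"
    proof -
      have "(4 * pi * (2 * ?r)) powr (- real CARD('n) / 2) \<le> (2 * ?r) powr - (real CARD('n) / 2)"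
        using r by (intro heat_sup_le) simp
      also have "\<dots> \<le> ?r powr - (real CARD('n) / 2)" using r by (intro powr_neg_mono) auto
      finally have "(4 * pi * (2 * ?r)) powr (- real CARD('n) / 2)
          \<le> ?r powr - (real CARD('n) / 2)" .
      then show ?thesis using h1[of s] s gradC_nonneg \<epsilon> m0
        by (intro mult_right_mono mult_mono mult_nonneg_nonneg) auto
    qed
    also have "\<dots> = (gradC * \<epsilon> * P powr (1 / N)) * (m * (?r powr - ((real CARD('n) / 2) + 1 / 2)))
        * l1 w * s powr (- 1 / 2)"
      unfolding powr_neg_half_mult[symmetric] by (simp only: mult_ac)
    also have "\<dots> \<le> (gradC * \<epsilon> * P powr (1 / N)) *
        ((m + P) * ((\<tau> / 2) powr - ((real CARD('n) / 2) + 1 / 2))) * l1 w * s powr (- 1 / 2)"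
      using Pm m0 P \<tau> r by (intro mult_right_mono mult_left_mono mult_mono powr_neg_mono) auto
    also have "\<dots> = c * s powr (- 1 / 2)" by (simp add: c_def mult_ac)
    also have "\<dots> \<le> c * (s powr (- 1 / 2) + (\<tau> - s) powr (- 1 / 2))" using c0
        by (intro mult_left_mono) auto
    finally show ?thesis .
  next
    case False
    let ?r = "\<tau> - s"
    have r: "0 < ?r" using s by auto
    have ts: "0 < T + s" using T s by simp
    have "\<bar>?Q s\<bar> \<le> gradC * ?r powr (- 1 / 2) *
        (\<epsilon> * (P powr (1 / N) * P) * s powr - ((real CARD('n) / 2) + 1 / 2)) * l1 w"
      by (rule grad_linf[OF r ts w _ hinf]) (use s \<epsilon> P in auto)
    also have "\<dots> = (gradC * \<epsilon> * P powr (1 / N)) * (P * s powr - ((real CARD('n) / 2) + 1 / 2)) *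
        l1 w * ?r powr (- 1 / 2)"
      by (simp add: mult_ac)
    also have "\<dots> \<le> (gradC * \<epsilon> * P powr (1 / N)) *
        ((m + P) * ((\<tau> / 2) powr - ((real CARD('n) / 2) + 1 / 2))) * l1 w * ?r powr (- 1 / 2)"
      using Pm m0 P \<tau> False by (intro mult_right_mono mult_left_mono mult_mono powr_neg_mono) auto
    also have "\<dots> = c * ?r powr (- 1 / 2)" by (simp add: c_def mult_ac)
    also have "\<dots> \<le> c * (s powr (- 1 / 2) + (\<tau> - s) powr (- 1 / 2))" using c0
        by (intro mult_left_mono) auto
    finally show ?thesis .
  qed
  from duhamel_bound[OF T \<tau> w c0 this]
  have "\<bar>(LINT x|lborel. U (T + \<tau>) x * w x) - Q (\<lambda>z. heat_kernel z \<tau>) (U T) w\<bar> \<le> 4 * c * sqrt \<tau>" .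
  also have "4 * c * sqrt \<tau> = \<epsilon> * duhamelC P m * \<tau> powr - (real CARD('n) / 2) * l1 w"
  proof -
    have "(\<tau> / 2) powr - ((real CARD('n) / 2) + 1 / 2) * sqrt \<tau>
        = 2 powr ((real CARD('n) / 2) + 1 / 2) * \<tau> powr - (real CARD('n) / 2)"
    proof -
      have "(\<tau> / 2) powr - ((real CARD('n) / 2) + 1 / 2)
          = \<tau> powr - ((real CARD('n) / 2) + 1 / 2) * 2 powr ((real CARD('n) / 2) + 1 / 2)"
        using \<tau> powr_minus_divide[of "2::real" "(real CARD('n) / 2) + 1 / 2"]
            powr_divide[of \<tau> 2 "- ((real CARD('n) / 2) + 1 / 2)"] by simp
      moreover have "\<tau> powr - ((real CARD('n) / 2) + 1 / 2) * sqrt \<tau> = \<tau> powr - (real CARD('n) / 2)"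
        using \<tau> by (simp add: powr_half_sqrt[symmetric] powr_add[symmetric])
      ultimately show ?thesis by (simp add: mult_ac)
    qed
    then show ?thesis by (simp add: c_def duhamelC_def N_def mult_ac)
  qed
  finally show "\<bar>(LINT x|lborel. U (T + \<tau>) x * w x) - Q (\<lambda>z. heat_kernel z \<tau>) (U T) w\<bar>
      \<le> \<epsilon> * duhamelC P m * \<tau> powr - (real CARD('n) / 2) * l1 w" .
  assume w1: "\<And>x. \<bar>w x\<bar> \<le> 1"
  define d where "d = gradC * \<epsilon> * P powr (1 / N) * (m + P) * (\<tau> / 2) powr (- 1 / 2)"
  have d0: "0 \<le> d" using gradC_nonneg \<epsilon> m0 P by (simp add: d_def)
  have "\<bar>?Q s\<bar> \<le> d * (s powr (- 1 / 2) + (\<tau> - s) powr (- 1 / 2))" if s: "0 < s" "s < \<tau>" for s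
  proof -
    let ?r = "\<tau> - s"
    have r: "0 < ?r" using s by auto
    have ts: "0 < T + s" using T s by simp
    have "\<bar>?Q s\<bar> \<le> (gradC * ?r powr (- 1 / 2)) * 1 * l1 (?H s)"
      by (rule Q_l1_linf[OF kdom_grad[OF r] bint_integrable[OF FU_bint[OF ts]] bint_borel[OF w]])
          (use w1 in auto)
    also have "\<dots> \<le> (gradC * ?r powr (- 1 / 2)) * 1 * (\<epsilon> * P powr (1 / N) * s powr (- 1 / 2) * m)"
      using h1[of s] s gradC_nonneg by (intro mult_left_mono) auto
    also have "\<dots> \<le> (gradC * ?r powr (- 1 / 2)) * 1 *
        (\<epsilon> * P powr (1 / N) * s powr (- 1 / 2) * (m + P))"
      using gradC_nonneg \<epsilon> P by (intro mult_left_mono) auto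
    also have "\<dots> = gradC * \<epsilon> * P powr (1 / N) * (m + P) * (s powr (- 1 / 2) * ?r powr (- 1 / 2))"
        by (simp add: mult_ac)
    also have "\<dots> \<le> gradC * \<epsilon> * P powr (1 / N) * (m + P) *
        ((\<tau> / 2) powr (- 1 / 2) * (s powr (- 1 / 2) + ?r powr (- 1 / 2)))"
    proof (rule mult_left_mono)
      \<comment> \<open>Of the two factors, the one whose base is at least \<tau>/2 is bounded by
        its value at \<tau>/2.\<close>
      show "s powr (- 1 / 2) * ?r powr (- 1 / 2)
          \<le> (\<tau> / 2) powr (- 1 / 2) * (s powr (- 1 / 2) + ?r powr (- 1 / 2))"
      proof (cases "s \<le> \<tau> / 2")
        case True
        then have "?r powr (- (1 / 2)) \<le> (\<tau> / 2) powr (- (1 / 2))" using \<tau>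
            by (intro powr_neg_mono) auto
        then have "s powr (- 1 / 2) * ?r powr (- 1 / 2)
            \<le> s powr (- 1 / 2) * (\<tau> / 2) powr (- 1 / 2)" by (intro mult_left_mono) auto
        also have "\<dots> \<le> (\<tau> / 2) powr (- 1 / 2) * (s powr (- 1 / 2) + ?r powr (- 1 / 2))"
            by (simp add: algebra_simps)
        finally show ?thesis .
      next
        case False
        then have "s powr (- (1 / 2)) \<le> (\<tau> / 2) powr (- (1 / 2))" using \<tau>
            by (intro powr_neg_mono) auto
        then have "s powr (- 1 / 2) * ?r powr (- 1 / 2)
            \<le> (\<tau> / 2) powr (- 1 / 2) * ?r powr (- 1 / 2)" by (intro mult_right_mono) auto
        also have "\<dots> \<le> (\<tau> / 2) powr (- 1 / 2) * (s powr (- 1 / 2) + ?r powr (- 1 / 2))"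
            by (simp add: algebra_simps)
        finally show ?thesis .
      qed
    qed (use gradC_nonneg \<epsilon> m0 P in auto)
    also have "\<dots> = d * (s powr (- 1 / 2) + ?r powr (- 1 / 2))" by (simp add: d_def mult_ac)
    finally show ?thesis .
  qed
  from duhamel_bound[OF T \<tau> w d0 this]
  have "\<bar>(LINT x|lborel. U (T + \<tau>) x * w x) - Q (\<lambda>z. heat_kernel z \<tau>) (U T) w\<bar> \<le> 4 * d * sqrt \<tau>" .
  also have "\<dots> \<le> \<epsilon> * duhamelC P m"
  proof -
    have "(\<tau> / 2) powr (- 1 / 2) * sqrt \<tau> = 2 powr (1 / 2)"
    proof -
      have "(\<tau> / 2) powr (- 1 / 2) = \<tau> powr (- 1 / 2) * 2 powr (1 / 2)"
        using \<tau> powr_minus_divide[of "2::real" "1 / 2"] powr_divide[of \<tau> 2 "- 1 / 2"] by simp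
      moreover have "\<tau> powr (- 1 / 2) * sqrt \<tau> = 1"
        using \<tau> by (simp add: powr_half_sqrt[symmetric] powr_add[symmetric])
      ultimately show ?thesis by (simp add: mult_ac)
    qed
    also have "\<dots> \<le> 2 powr ((real CARD('n) / 2) + 1 / 2)" by (intro powr_mono) auto
    finally have "(4 * gradC * \<epsilon> * P powr (1 / N) * (m + P)) * ((\<tau> / 2) powr (- 1 / 2) * sqrt \<tau>)
      \<le> (4 * gradC * \<epsilon> * P powr (1 / N) * (m + P)) * 2 powr ((real CARD('n) / 2) + 1 / 2)"
      using gradC_nonneg \<epsilon> m0 P by (intro mult_left_mono) auto
    then show ?thesis by (simp add: d_def duhamelC_def N_def mult_ac)
  qed
  finally show "\<bar>(LINT x|lborel. U (T + \<tau>) x * w x) - Q (\<lambda>z. heat_kernel z \<tau>) (U T) w\<bar>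
      \<le> \<epsilon> * duhamelC P m" .
qed

text \<open>The decay on $(0, \tau]$ with constant $K$ gives the decay on $(0, 2 \tau]$ with the constant
  $2^{N/2} K$, since the sup norm is nonincreasing; for small $\epsilon$ Duhamel's formula improves
  the constant to $K$ again.\<close>

lemma decay_bootstrap:
  assumes m: "m = l1 (U 1)" and K: "K = 2 * m + 1" and P: "P = 2 powr (real CARD('n) / 2) * K"
    and \<epsilon>: "0 \<le> \<epsilon>" "\<epsilon> * duhamelC P m \<le> 1 / 2"
    and F\<epsilon>: "\<And>s. \<bar>s\<bar> \<le> s0 \<Longrightarrow> \<bar>F s\<bar> \<le> \<epsilon> * \<bar>s\<bar> powr ((real CARD('n) + 1) / real CARD('n))"
    and T: "1 \<le> T" and s0: "0 < s0" "AE x in lborel. \<bar>U T x\<bar> \<le> s0"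
    and s: "0 < s"
  shows "AE x in lborel. \<bar>U (T + s) x\<bar> \<le> K * s powr - (real CARD('n) / 2)"
proof -
  have T0: "0 < T" using T by simp
  have m0: "0 \<le> m" by (simp add: m)
  have K0: "0 < K" using m0 by (simp add: K)
  have P0: "0 < P" using K0 by (simp add: P)
  have lT: "l1 (U T) \<le> m" unfolding m using T by (intro l1_decreasing) auto
  define R where "R \<tau> \<longleftrightarrow> (\<forall>s. 0 < s \<longrightarrow> s \<le> \<tau> \<longrightarrow> (AE x in lborel. \<bar>U (T + s) x\<bar>
      \<le> K * s powr - (real CARD('n) / 2)))" for \<tau>
  \<comment> \<open>The time at which the bound K s^(-N/2) equals \<open>s0\<close>; before it the
    sup bound s0 is the stronger one, which starts the induction.\<close>
  define \<tau>0 where "\<tau>0 = (s0 / K) powr (- 1 / (real CARD('n) / 2))"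
  have \<tau>0: "0 < \<tau>0" "K * \<tau>0 powr - (real CARD('n) / 2) = s0"
    using s0 K0 by (auto simp: \<tau>0_def powr_powr)
  have base: "R \<tau>0"
    unfolding R_def
  proof (intro allI impI)
    fix s assume s: "0 < s" "s \<le> \<tau>0"
    have "AE x in lborel. \<bar>U (T + s) x\<bar> \<le> s0"
      by (rule linf_decreasing[OF T0 _ _ s0(2)]) (use s s0 in auto)
    moreover have "s0 \<le> K * s powr - (real CARD('n) / 2)"
      unfolding \<tau>0(2)[symmetric] using s K0 by (intro mult_left_mono powr_neg_mono) auto
    ultimately show "AE x in lborel. \<bar>U (T + s) x\<bar> \<le> K * s powr - (real CARD('n) / 2)"
        by (auto elim: eventually_mono)
  qed
  have step: "R (2 * \<tau>)" if R\<tau>: "R \<tau>" and \<tau>: "0 < \<tau>" for \<tau>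
  proof -
    have wide: "AE x in lborel. \<bar>U (T + s) x\<bar> \<le> P * s powr - (real CARD('n) / 2)"
        if s: "0 < s" "s \<le> 2 * \<tau>" for s
    proof (cases "s \<le> \<tau>")
      case True
      then have "AE x in lborel. \<bar>U (T + s) x\<bar> \<le> K * s powr - (real CARD('n) / 2)" using R\<tau> s
          by (auto simp: R_def)
      moreover have "K * s powr - (real CARD('n) / 2) \<le> P * s powr - (real CARD('n) / 2)"
      proof (rule mult_right_mono)
        have "1 \<le> 2 powr (real CARD('n) / 2)" by (intro ge_one_powr_ge_zero) auto
        then show "K \<le> P" unfolding P using K0 by simp
      qed simp
      ultimately show ?thesis by (auto elim: eventually_mono)
    next
      case False
      have "AE x in lborel. \<bar>U (T + \<tau>) x\<bar> \<le> K * \<tau> powr - (real CARD('n) / 2)" using R\<tau> \<tau>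
          by (auto simp: R_def)
      from linf_decreasing[OF _ _ _ this, of "T + s"]
      have "AE x in lborel. \<bar>U (T + s) x\<bar> \<le> K * \<tau> powr - (real CARD('n) / 2)" using T0 \<tau> False K0
          by auto
      moreover have "K * \<tau> powr - (real CARD('n) / 2) \<le> P * s powr - (real CARD('n) / 2)"
      proof -
        have "\<tau> powr - (real CARD('n) / 2) \<le> (s / 2) powr - (real CARD('n) / 2)" using s
            by (intro powr_neg_mono) auto
        also have "\<dots> = 2 powr (real CARD('n) / 2) * s powr - (real CARD('n) / 2)"
          using s powr_divide[of s 2 "- (real CARD('n) / 2)"]
              powr_minus_divide[of "2::real" "real CARD('n) / 2"] by simp
        finally show ?thesis unfolding P using K0 by (simp add: mult_ac)
      qed
      ultimately show ?thesis by (auto elim: eventually_mono)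
    qed
    show ?thesis unfolding R_def
    proof (intro allI impI)
      fix s assume s: "0 < s" "s \<le> 2 * \<tau>"
      have "\<bar>LINT x|lborel. U (T + s) x * w x\<bar> \<le> (K * s powr - (real CARD('n) / 2)) * l1 w"
          if w: "bint w" for w
      proof -
        have "\<bar>(LINT x|lborel. U (T + s) x * w x) - Q (\<lambda>z. heat_kernel z s) (U T) w\<bar>
            \<le> \<epsilon> * duhamelC P m * s powr - (real CARD('n) / 2) * l1 w"
          by (rule decay_step_linf[OF T0 s(1) P0 lT \<epsilon>(1) F\<epsilon> s0 wide w]) (use s in auto)
        also have "\<dots> \<le> 1 / 2 * s powr - (real CARD('n) / 2) * l1 w" using \<epsilon>(2)
            by (intro mult_right_mono) auto
        finally have 1: "\<bar>(LINT x|lborel. U (T + s) x * w x) - Q (\<lambda>z. heat_kernel z s) (U T) w\<bar>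
            \<le> 1 / 2 * s powr - (real CARD('n) / 2) * l1 w" .
        have "\<bar>Q (\<lambda>z. heat_kernel z s) (U T) w\<bar>
            \<le> 1 * (4 * pi * s) powr (- real CARD('n) / 2) * l1 (U T) * l1 w"
          by (rule Q_l1_l1[OF kdom_heat_kernel[OF s(1)] bint_integrable[OF U[OF T0]]
              bint_integrable[OF w]])
        also have "\<dots> \<le> 1 * s powr - (real CARD('n) / 2) * m * l1 w"
          using heat_sup_le[OF s(1)] lT by (intro mult_right_mono mult_mono) auto
        finally have "\<bar>LINT x|lborel. U (T + s) x * w x\<bar>
            \<le> 1 / 2 * s powr - (real CARD('n) / 2) * l1 w + 1 * s powr - (real CARD('n) / 2) * m *
            l1 w"
          using 1 by linarith
        \<comment> \<open>The heat flow contributes m and the Duhamel term 1/2. Their sum is below K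
          = 2 m + 1, so the factor 2^(N/2) lost on doubling the interval is recovered.\<close>
        also have "\<dots> = (m + 1 / 2) * (s powr - (real CARD('n) / 2) * l1 w)"
            by (simp add: algebra_simps)
        also have "\<dots> \<le> K * (s powr - (real CARD('n) / 2) * l1 w)" using m0 unfolding K
            by (intro mult_right_mono) auto
        finally show ?thesis by (simp add: mult.assoc)
      qed
      then show "AE x in lborel. \<bar>U (T + s) x\<bar> \<le> K * s powr - (real CARD('n) / 2)"
        using K0 T0 s by (intro linf_dual bint_integrable U) auto
    qed
  qed
  have "R (2 ^ n * \<tau>0)" for n
  proof (induction n)
    case (Suc n)
    from step[OF Suc.IH] \<tau>0(1) show ?case by (simp add: mult.assoc)
  qed (use base in simp)
  moreover obtain n :: nat where "s / \<tau>0 < 2 ^ n" using real_arch_pow[of 2 "s / \<tau>0"] by auto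
  then have "s \<le> 2 ^ n * \<tau>0" using \<tau>0 by (simp add: field_simps)
  ultimately show ?thesis using s unfolding R_def by blast
qed

text \<open>The choices are not circular: K and P depend on the L^1 norm at time 1 alone, then
  \<epsilon> on them and \<eta>, then the threshold \<open>s0\<close> on \<epsilon>, and finally T
  on \<open>s0\<close>. The bootstrap uses \<open>duhamelC P m\<close>, the final comparison
  \<open>duhamelC K m\<close>; \<epsilon> serves both.\<close>

lemma flow_close_to_heat:
  assumes \<eta>: "0 < \<eta>"
  obtains T where "1 \<le> T"
    "\<And>\<tau> w. 0 < \<tau> \<Longrightarrow> bint w \<Longrightarrow> \<bar>(LINT x|lborel. U (T + \<tau>) x * w x) - Q (\<lambda>z. heat_kernel z \<tau>) (U T) w\<bar>
        \<le> \<eta> * \<tau> powr - (real CARD('n) / 2) * l1 w"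
    "\<And>\<tau> w. 0 < \<tau> \<Longrightarrow> bint w \<Longrightarrow> (\<And>x. \<bar>w x\<bar> \<le> 1) \<Longrightarrow> \<bar>(LINT x|lborel. U (T + \<tau>) x * w x)
        - Q (\<lambda>z. heat_kernel z \<tau>) (U T) w\<bar> \<le> \<eta>"
proof -
  define m K P where "m = l1 (U 1)" and "K = 2 * m + 1" and "P = 2 powr (real CARD('n) / 2) * K"
  have m0: "0 \<le> m" by (simp add: m_def)
  have K0: "0 < K" using m0 by (simp add: K_def)
  have P0: "0 < P" using K0 by (simp add: P_def)
  let ?C = "duhamelC P m + duhamelC K m + 1"
  have C: "0 \<le> duhamelC P m" "0 \<le> duhamelC K m" using duhamelC_nonneg P0 K0 m0 by auto
  define \<epsilon> where "\<epsilon> = min (1 / 2) \<eta> / ?C"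
  have \<epsilon>: "0 < \<epsilon>" using \<eta> C by (simp add: \<epsilon>_def)
  have \<epsilon>C: "\<epsilon> * ?C = min (1 / 2) \<eta>" using C by (simp add: \<epsilon>_def)
  have "\<epsilon> * duhamelC P m \<le> \<epsilon> * ?C" "\<epsilon> * duhamelC K m \<le> \<epsilon> * ?C" using \<epsilon> C
      by (auto intro!: mult_left_mono)
  then have \<epsilon>': "\<epsilon> * duhamelC P m \<le> 1 / 2" "\<epsilon> * duhamelC K m \<le> \<eta>" unfolding \<epsilon>C by auto
  obtain s0 where s0: "0 < s0" "\<And>s. \<bar>s\<bar> \<le> s0 \<Longrightarrow> \<bar>F s\<bar>
      \<le> \<epsilon> * \<bar>s\<bar> powr ((real CARD('n) + 1) / real CARD('n))"
    using F_small_near_0[OF \<epsilon>] by blast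
  obtain T where T: "1 \<le> T" "AE x in lborel. \<bar>U T x\<bar> \<le> s0" using uniform_decay[OF s0(1)] by blast
  have T0: "0 < T" using T by simp
  have lT: "l1 (U T) \<le> m" unfolding m_def using T by (intro l1_decreasing) auto
  have dec: "AE x in lborel. \<bar>U (T + s) x\<bar> \<le> K * s powr - (real CARD('n) / 2)" if "0 < s" for s
    by (rule decay_bootstrap[OF m_def K_def P_def less_imp_le[OF \<epsilon>] \<epsilon>'(1) s0(2) T(1) s0(1) T(2)
        that])
  show ?thesis
  proof (rule that[OF T(1)])
    fix \<tau> :: real and w :: "real^'n \<Rightarrow> real" assume \<tau>: "0 < \<tau>" and w: "bint w"
    have "\<bar>(LINT x|lborel. U (T + \<tau>) x * w x) - Q (\<lambda>z. heat_kernel z \<tau>) (U T) w\<bar>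
        \<le> \<epsilon> * duhamelC K m * \<tau> powr - (real CARD('n) / 2) * l1 w"
      by (rule decay_step_linf[OF T0 \<tau> K0 lT less_imp_le[OF \<epsilon>] s0(2) s0(1) T(2) dec w])
    also have "\<dots> \<le> \<eta> * \<tau> powr - (real CARD('n) / 2) * l1 w" using \<epsilon>'(2)
        by (intro mult_right_mono) auto
    finally show "\<bar>(LINT x|lborel. U (T + \<tau>) x * w x) - Q (\<lambda>z. heat_kernel z \<tau>) (U T) w\<bar>
        \<le> \<eta> * \<tau> powr - (real CARD('n) / 2) * l1 w" .
  next
    fix \<tau> :: real and w :: "real^'n \<Rightarrow> real" assume \<tau>: "0 < \<tau>" and w: "bint w"
        and w1: "\<And>x. \<bar>w x\<bar> \<le> 1"
    have "\<bar>(LINT x|lborel. U (T + \<tau>) x * w x) - Q (\<lambda>z. heat_kernel z \<tau>) (U T) w\<bar> \<le> \<epsilon> * duhamelC K m"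
      by (rule decay_step_l1[OF T0 \<tau> K0 lT less_imp_le[OF \<epsilon>] s0(2) s0(1) T(2) dec w w1])
    then show "\<bar>(LINT x|lborel. U (T + \<tau>) x * w x) - Q (\<lambda>z. heat_kernel z \<tau>) (U T) w\<bar> \<le> \<eta>"
        using \<epsilon>'(2) by linarith
  qed
qed

end

section \<open>Comparison with the heat kernel\<close>

lemma heat_kernel_directional:
  fixes x y :: "real^'n"
  assumes "0 < r"
  shows "((\<lambda>\<theta>. heat_kernel (x - \<theta> *\<^sub>R y) r) has_real_derivative hk_grad (- y) (x - \<theta> *\<^sub>R y) r)
      (at \<theta>)"
proof -
  have n: "(norm (x - \<theta> *\<^sub>R y))\<^sup>2 = (norm x)\<^sup>2 - 2 * \<theta> * (x \<bullet> y) + \<theta>\<^sup>2 * (norm y)\<^sup>2" for \<theta>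
    unfolding power2_norm_eq_inner
    by (simp add: inner_diff_left inner_diff_right inner_commute power2_eq_square algebra_simps)
  have "((\<lambda>\<theta>. exp (- ((norm x)\<^sup>2 - 2 * \<theta> * (x \<bullet> y) + \<theta>\<^sup>2 * (norm y)\<^sup>2) / (4 * r)))
      has_real_derivative
     exp (- ((norm x)\<^sup>2 - 2 * \<theta> * (x \<bullet> y) + \<theta>\<^sup>2 * (norm y)\<^sup>2) / (4 * r)) *
         ((y \<bullet> (x - \<theta> *\<^sub>R y)) / (2 * r))) (at \<theta>)"
    using assms by (auto intro!: derivative_eq_intros simp: inner_diff_right inner_commute
        power2_norm_eq_inner field_simps)
  from DERIV_cmult[OF this, of "(4 * pi * r) powr (- real CARD('n) / 2)"] show ?thesis
    unfolding hk_grad_def heat_kernel_def n by (simp add: mult_ac)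
qed

definition shiftC :: "'n::finite itself \<Rightarrow> real" where
  "shiftC _ = hkC TYPE('n) * (exp 1 * 2 powr (real CARD('n) / 2))"

lemma shiftC_pos: "0 < shiftC TYPE('n::finite)"
  using hkC_pos[where 'n='n] by (simp add: shiftC_def)

text \<open>With z = x - \<theta> y one has |x|^2 <= 2 |z|^2 + 2 r, so the exponent at z for the
  parameter 2 r exceeds the one at x for 4 r by at most 1/8; \<open>exp 1\<close> is a generous
  bound.\<close>

lemma heat_kernel_shift_widen:
  fixes x y :: "real^'n"
  assumes r: "0 < r" and y: "(norm y)\<^sup>2 \<le> r" and \<theta>: "0 \<le> \<theta>" "\<theta> \<le> 1"
  shows "heat_kernel (x - \<theta> *\<^sub>R y) (2 * r) \<le> exp 1 * 2 powr (real CARD('n) / 2) * heat_kernel x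
      (4 * r)"
proof -
  let ?z = "x - \<theta> *\<^sub>R y"
  have "norm x \<le> norm ?z + norm (\<theta> *\<^sub>R y)" by (metis diff_add_cancel norm_triangle_ineq)
  then have "(norm x)\<^sup>2 \<le> (norm ?z + norm (\<theta> *\<^sub>R y))\<^sup>2" by (intro power_mono) auto
  also have "\<dots> \<le> 2 * (norm ?z)\<^sup>2 + 2 * (norm (\<theta> *\<^sub>R y))\<^sup>2"
    using sum_squares_bound[of "norm ?z" "norm (\<theta> *\<^sub>R y)"] unfolding power2_sum by linarith
  also have "(norm (\<theta> *\<^sub>R y))\<^sup>2 \<le> r"
  proof -
    have "\<theta>\<^sup>2 * (norm y)\<^sup>2 \<le> 1 * r" using \<theta> y by (intro mult_mono) (auto simp: power_le_one)
    then show ?thesis by (simp add: power_mult_distrib)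
  qed
  finally have le: "(norm x)\<^sup>2 \<le> 2 * (norm ?z)\<^sup>2 + 2 * r" by simp
  have "- (norm ?z)\<^sup>2 / (4 * (2 * r)) \<le> 1 + - (norm x)\<^sup>2 / (4 * (4 * r))"
    using le r by (simp add: field_simps)
  then have e: "exp (- (norm ?z)\<^sup>2 / (4 * (2 * r))) \<le> exp 1 * exp (- (norm x)\<^sup>2 / (4 * (4 * r)))"
    by (simp only: exp_add[symmetric] exp_le_cancel_iff)
  have "(4 * pi * (4 * r)) powr (- real CARD('n) / 2)
      = 2 powr (- real CARD('n) / 2) * (4 * pi * (2 * r)) powr (- real CARD('n) / 2)"
    using r powr_mult[of 2 "4 * pi * (2 * r)" "- real CARD('n) / 2"] by (simp add: mult_ac)
  moreover have "2 powr (real CARD('n) / 2) * 2 powr (- real CARD('n) / 2) = (1::real)"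
      by (simp add: powr_minus)
  ultimately have p: "(4 * pi * (2 * r)) powr (- real CARD('n) / 2)
      = 2 powr (real CARD('n) / 2) * (4 * pi * (4 * r)) powr (- real CARD('n) / 2)"
    by (simp add: mult.assoc[symmetric])
  show ?thesis
    unfolding heat_kernel_def p using mult_left_mono[OF e, of
        "2 powr (real CARD('n) / 2) * (4 * pi * (4 * r)) powr (- real CARD('n) / 2)"]
    by (simp add: mult_ac)
qed

lemma heat_kernel_shift:
  fixes x y :: "real^'n"
  assumes r: "0 < r" and y: "(norm y)\<^sup>2 \<le> r"
  shows "\<bar>heat_kernel (x - y) r - heat_kernel x r\<bar>
      \<le> shiftC TYPE('n) * norm y * r powr (- 1 / 2) * heat_kernel x (4 * r)"
proof -
  let ?b = "shiftC TYPE('n) * norm y * r powr (- 1 / 2) * heat_kernel x (4 * r)"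
  have "norm (heat_kernel (x - 1 *\<^sub>R y) r - heat_kernel (x - 0 *\<^sub>R y) r) \<le> ?b * norm (1 - 0::real)"
  proof (rule field_differentiable_bound[where S="{0..1}"])
    fix \<theta> :: real assume \<theta>: "\<theta> \<in> {0..1}"
    show "((\<lambda>\<theta>. heat_kernel (x - \<theta> *\<^sub>R y) r) has_field_derivative hk_grad (- y) (x - \<theta> *\<^sub>R y) r)
        (at \<theta> within {0..1})"
      by (rule DERIV_subset[OF heat_kernel_directional[OF r]]) simp
    have "\<bar>hk_grad (- y) (x - \<theta> *\<^sub>R y) r\<bar> \<le> norm (- y) * hkC TYPE('n) * r powr (- 1 / 2) *
        heat_kernel (x - \<theta> *\<^sub>R y) (2 * r)"
      by (rule hk_grad_bound[OF r])
    also have "\<dots> \<le> norm (- y) * hkC TYPE('n) * r powr (- 1 / 2) *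
        (exp 1 * 2 powr (real CARD('n) / 2) * heat_kernel x (4 * r))"
      using \<theta> hkC_pos[where 'n='n] by (intro mult_left_mono heat_kernel_shift_widen r y) auto
    finally show "norm (hk_grad (- y) (x - \<theta> *\<^sub>R y) r) \<le> ?b" by (simp add: shiftC_def mult_ac)
  qed auto
  then show ?thesis by simp
qed

text \<open>A bound for the distance from K_r(. - y) to K_(r+T), in L^1 and, up to r^(-N/2), in sup
  norm. For |y|^2 <= r the first term accounts for the translation and the second for the change of
  parameter; otherwise 2 is the sum of the masses.\<close>

definition shift_weight :: "real \<Rightarrow> real \<Rightarrow> real^'n \<Rightarrow> real" where
  "shift_weight T r y = (if (norm y)\<^sup>2 \<le> r then shiftC TYPE('n) * norm y * r powr (- 1 / 2)
      + T * (hkD TYPE('n) / r) else 2)"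

lemma shift_weight_borel [measurable]: "(\<lambda>y. shift_weight T r y) \<in> borel_measurable borel"
  unfolding shift_weight_def by measurable

lemma shift_weight_nonneg: "0 < r \<Longrightarrow> 0 \<le> T \<Longrightarrow> 0 \<le> shift_weight T r (y::real^'n)"
  using shiftC_pos[where 'n='n] hkD_pos[where 'n='n] by (simp add: shift_weight_def)

text \<open>Both bounds come from one majorant \<open>k\<close> of the difference: its integral is
  the weight, and its sup norm is at most the weight times r^(-N/2).\<close>

lemma heat_kernel_compare:
  fixes y :: "real^'n" and w :: "real^'n \<Rightarrow> real"
  assumes r: "0 < r" and T: "0 \<le> T" "T \<le> r / 2" and w: "bint w"
  shows "\<bar>LINT x|lborel. (heat_kernel (x - y) r - heat_kernel x (r + T)) * w x\<bar>
      \<le> shift_weight T r y * (r powr - (real CARD('n) / 2) * l1 w)"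
    and "(\<And>x. \<bar>w x\<bar> \<le> 1) \<Longrightarrow> \<bar>LINT x|lborel. (heat_kernel (x - y) r - heat_kernel x (r + T)) * w x\<bar>
        \<le> shift_weight T r y"
proof -
  note [measurable] = bint_borel[OF w]
  let ?d = "\<lambda>x. heat_kernel (x - y) r - heat_kernel x (r + T)"
  have rT: "0 < r + T" "0 < 4 * r" using r T by auto
  define k where "k = (\<lambda>x::real^'n. if (norm y)\<^sup>2
      \<le> r then shift_weight T r y * heat_kernel x (4 * r)
    else heat_kernel (x - y) r + heat_kernel x (r + T))"
  have dk: "\<bar>?d x\<bar> \<le> k x" for x
  proof (cases "(norm y)\<^sup>2 \<le> r")
    case True
    have "\<bar>?d x\<bar> \<le> \<bar>heat_kernel (x - y) r - heat_kernel x r\<bar> + \<bar>heat_kernel x (r + T)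
        - heat_kernel x r\<bar>" by linarith
    also have "\<dots> \<le> shiftC TYPE('n) * norm y * r powr (- 1 / 2) * heat_kernel x (4 * r)
        + \<bar>T\<bar> * (hkD TYPE('n) / r) * heat_kernel x (4 * r)"
      using r T True by (intro add_mono heat_kernel_shift heat_kernel_diff_bound) auto
    also have "\<dots> = k x" using True T by (simp add: k_def shift_weight_def distrib_right)
    finally show ?thesis .
  next
    case False
    then show ?thesis using heat_kernel_nonneg[of "x - y" r] heat_kernel_nonneg[of x "r + T"]
      by (simp add: k_def abs_le_iff)
  qed
  have ih: "integrable lborel (\<lambda>x::real^'n. heat_kernel x s)" if "0 < s" for s
      using integrable_heat_kernel[OF that] .
  have ish: "integrable lborel (\<lambda>x. heat_kernel (x - y) r)"
      by (rule integrable_lborel_shift[OF ih[OF r]])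
  have intsh: "(LINT x|lborel. heat_kernel (x - y) r) = 1"
    using integral_lborel_shift[of "\<lambda>x. heat_kernel x r" y] integral_heat_kernel[OF r,
        where 'n='n] by simp
  have ik: "integrable lborel k" unfolding k_def using ih rT ish by (cases "(norm y)\<^sup>2 \<le> r") auto
  have k1: "(LINT x|lborel. k x) = shift_weight T r y"
    unfolding k_def using ih rT ish intsh integral_heat_kernel[OF rT(1),
        where 'n='n] integral_heat_kernel[OF rT(2), where 'n='n]
    by (cases "(norm y)\<^sup>2 \<le> r") (auto simp: shift_weight_def)
  have sup: "heat_kernel (x::real^'n) s \<le> r powr - (real CARD('n) / 2)" if "r \<le> s" for x s
  proof -
    have "heat_kernel x s \<le> (4 * pi * s) powr (- real CARD('n) / 2)" using that r
        by (intro heat_kernel_le) auto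
    also have "\<dots> \<le> r powr - (real CARD('n) / 2)"
    proof -
      have "1 * r \<le> (4 * pi) * s" using that r pi_ge_two by (intro mult_mono) auto
      then show ?thesis using powr_neg_mono[of r "4 * pi * s" "real CARD('n) / 2"] r by simp
    qed
    finally show ?thesis .
  qed
  have ksup: "k x \<le> shift_weight T r y * r powr - (real CARD('n) / 2)" for x
  proof (cases "(norm y)\<^sup>2 \<le> r")
    case True
    have "shift_weight T r y * heat_kernel x (4 * r)
        \<le> shift_weight T r y * r powr - (real CARD('n) / 2)"
      using r T by (intro mult_left_mono sup shift_weight_nonneg) auto
    then show ?thesis using True by (simp add: k_def)
  next
    case False
    then show ?thesis using sup[of r "x - y"] sup[of "r + T" x] T
        by (simp add: k_def shift_weight_def)
  qed
  have kn: "0 \<le> k x" for x using dk[of x] by linarith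
  have wi: "integrable lborel (\<lambda>x. \<bar>w x\<bar>)" using bint_integrable[OF w] by simp
  have [measurable]: "k \<in> borel_measurable borel" using ik by (rule borel_integrable)
  have b: "\<bar>LINT x|lborel. ?d x * w x\<bar> \<le> (LINT x|lborel. B x)"
    if B: "integrable lborel B" "\<And>x. k x * \<bar>w x\<bar> \<le> B x" for B
  proof -
    have "\<bar>LINT x|lborel. ?d x * w x\<bar> \<le> (LINT x|lborel. \<bar>?d x * w x\<bar>)" by (rule integral_abs_bound)
    also have "\<dots> \<le> (LINT x|lborel. B x)"
    proof (rule integral_mono')
      fix x
      have "\<bar>?d x\<bar> * \<bar>w x\<bar> \<le> k x * \<bar>w x\<bar>" by (intro mult_right_mono dk) simp
      then show "\<bar>?d x * w x\<bar> \<le> B x" using B(2)[of x] by (simp add: abs_mult)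
      have "0 \<le> k x * \<bar>w x\<bar>" using kn by simp
      then show "0 \<le> B x" using B(2)[of x] by linarith
    qed (rule B)
    finally show ?thesis .
  qed
  have "\<bar>LINT x|lborel. ?d x * w x\<bar> \<le> (LINT x|lborel.
      (shift_weight T r y * r powr - (real CARD('n) / 2)) * \<bar>w x\<bar>)"
    by (rule b) (use wi ksup in \<open>auto intro!: mult_right_mono\<close>)
  then show "\<bar>LINT x|lborel. ?d x * w x\<bar> \<le> shift_weight T r y *
      (r powr - (real CARD('n) / 2) * l1 w)" by simp
  assume w1: "\<And>x. \<bar>w x\<bar> \<le> 1"
  have "\<bar>LINT x|lborel. ?d x * w x\<bar> \<le> (LINT x|lborel. k x)"
    by (rule b[OF ik]) (use w1 kn in \<open>auto intro!: mult_left_le\<close>)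
  then show "\<bar>LINT x|lborel. ?d x * w x\<bar> \<le> shift_weight T r y" unfolding k1 .
qed

text \<open>Here the shape of the profile is forgotten. The weight tends to 0 at each y and is
  bounded for r >= 1, so dominated convergence applies to integrable f without a moment condition,
  but it yields no rate.\<close>

lemma shift_weight_integral_tendsto_0:
  fixes f :: "real^'n \<Rightarrow> real"
  assumes f: "integrable lborel f" and T: "0 \<le> T"
  shows "((\<lambda>r. LINT y|lborel. shift_weight T r y * \<bar>f y\<bar>) \<longlongrightarrow> 0) at_top"
proof -
  note [measurable] = borel_integrable[OF f]
  let ?C = "shiftC TYPE('n) + T * hkD TYPE('n) + 2"
  have Cp: "0 < shiftC TYPE('n)" "0 < hkD TYPE('n)" by (rule shiftC_pos hkD_pos)+
  have lim: "((\<lambda>r. shift_weight T r y) \<longlongrightarrow> 0) at_top" for y :: "real^'n"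
  proof -
    have "((\<lambda>r. shiftC TYPE('n) * norm y * r powr (- 1 / 2) + T * (hkD TYPE('n) / r)) \<longlongrightarrow>
      shiftC TYPE('n) * norm y * 0 + T * 0) at_top"
      by (intro tendsto_intros tendsto_neg_powr tendsto_divide_0[OF tendsto_const]
          filterlim_at_top_imp_at_infinity filterlim_ident) auto
    then have "((\<lambda>r. shiftC TYPE('n) * norm y * r powr (- 1 / 2) + T * (hkD TYPE('n) / r)) \<longlongrightarrow> 0)
        at_top" by simp
    then show ?thesis
    proof (rule Lim_transform_eventually)
      show "\<forall>\<^sub>F r in at_top. shiftC TYPE('n) * norm y * r powr (- 1 / 2) + T * (hkD TYPE('n) / r)
          = shift_weight T r y"
        using eventually_ge_at_top[of "(norm y)\<^sup>2"] by eventually_elim (simp add: shift_weight_def)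
    qed
  qed
  have "((\<lambda>r. LINT y|lborel. shift_weight T r y * \<bar>f y\<bar>)
      \<longlongrightarrow> (LINT y|(lborel::(real^'n) measure). 0)) at_top"
  proof (rule integral_dominated_convergence_at_top[where w="\<lambda>y. ?C * \<bar>f y\<bar>"])
    show "\<forall>\<^sub>F r in at_top. AE y in lborel. norm (shift_weight T r y * \<bar>f y\<bar>) \<le> ?C * \<bar>f y\<bar>"
      using eventually_ge_at_top[of 1]
    proof eventually_elim
      case (elim r)
      have "\<bar>shift_weight T r y\<bar> \<le> ?C" for y :: "real^'n"
      proof (cases "(norm y)\<^sup>2 \<le> r")
        case True
        then have "norm y \<le> sqrt r" by (rule real_le_rsqrt)
        then have "norm y * r powr (- 1 / 2) \<le> sqrt r * r powr (- 1 / 2)"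
            by (intro mult_right_mono) auto
        also have "\<dots> = 1" using elim by (simp add: powr_half_sqrt[symmetric] powr_add[symmetric])
        finally have "shiftC TYPE('n) * (norm y * r powr (- 1 / 2)) \<le> shiftC TYPE('n) * 1"
          using Cp by (intro mult_left_mono) auto
        moreover have "T * (hkD TYPE('n) / r) \<le> T * hkD TYPE('n)"
          using elim T Cp by (intro mult_left_mono) (auto simp: divide_le_eq mult_le_cancel_left1)
        ultimately have "shift_weight T r y \<le> ?C" using True
            by (simp add: shift_weight_def mult.assoc)
        then show ?thesis using shift_weight_nonneg[of r T y] elim T by simp
      next
        case False
        then show ?thesis using Cp T by (simp add: shift_weight_def)
      qed
      then show ?case by (auto simp: abs_mult intro!: AE_I2 mult_right_mono)
    qed
    show "AE y in lborel. ((\<lambda>r. shift_weight T r y * \<bar>f y\<bar>) \<longlongrightarrow> 0) at_top"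
      using tendsto_mult[OF lim tendsto_const] by (intro AE_I2) auto
  qed (use f in auto)
  then show ?thesis by simp
qed

section \<open>Conservation of mass and the asymptotic profile\<close>

context diffusion_flow
begin

lemma gaussian_functional_derivative:
  assumes t: "0 < t" and R: "0 < R"
  shows "((\<lambda>t. LINT y|lborel. heat_kernel (- y) R * U t y) has_real_derivative
      (LINT y|lborel. heat_kernel (- y) R * V t y)) (at t)"
proof -
  let ?k = "\<lambda>y::real^'n. heat_kernel (- y) R"
  have "bint (\<lambda>y::real^'n. heat_kernel y R)"
    using integrable_heat_kernel[OF R] heat_kernel_le[OF R] by (auto simp: bint_def)
  then have k: "sqint ?k" using bint_sqint by simp
  let ?e = "\<lambda>h. l2 (\<lambda>x. (U (t + h) x - U t x) / h - V t x)"
  have "((\<lambda>h. l2 ?k * ?e h) \<longlongrightarrow> l2 ?k * 0) (at 0)" by (intro tendsto_intros UV[OF t])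
  then have G: "((\<lambda>h. l2 ?k * ?e h) \<longlongrightarrow> 0) (at 0)" by simp
  show ?thesis
  proof (rule has_real_derivative_little_o[OF _ G])
    show "\<forall>\<^sub>F h in at 0. \<bar>(LINT y|lborel. ?k y * U (t + h) y) - (LINT y|lborel. ?k y * U t y)
        - h * (LINT y|lborel. ?k y * V t y)\<bar> \<le> \<bar>h\<bar> * (l2 ?k * ?e h)"
      using eventually_time_pos[OF t]
    proof eventually_elim
      case (elim h)
      then have th: "0 < t + h" "h \<noteq> 0" by auto
      note i = sqint_mult_integrable[OF k U_sq[OF th(1)]] sqint_mult_integrable[OF k U_sq[OF t]]
          sqint_mult_integrable[OF k V[OF t]]
      have "(LINT y|lborel. ?k y * U (t + h) y) - (LINT y|lborel. ?k y * U t y)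
          - h * (LINT y|lborel. ?k y * V t y)
        = (LINT y|lborel. ?k y * U (t + h) y - ?k y * U t y - h * (?k y * V t y))"
        using i by simp
      also have "\<dots> = (LINT y|lborel. ?k y * (U (t + h) y - U t y - h * V t y))"
        by (intro Bochner_Integration.integral_cong) (auto simp: algebra_simps)
      also have "\<bar>\<dots>\<bar> \<le> l2 ?k * l2 (\<lambda>y. U (t + h) y - U t y - h * V t y)"
        by (intro integral_mult_le_l2 k sqint_diff sqint_cmult U_sq V t th)
      also have "\<dots> = \<bar>h\<bar> * (l2 ?k * ?e h)"
        unfolding l2_increment(1)[OF t th] by (rule mult.left_commute)
      finally show ?case .
    qed
  qed
qed

text \<open>Integrating the equation against $e^{-|x|^2/(4R)}$ leaves terms that vanish as
  $R \to \infty$.\<close>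

lemma mass_constant:
  assumes s: "0 < s" "s \<le> t"
  shows "(LINT x|lborel. U t x) = (LINT x|lborel. U s x)"
proof -
  obtain C where C: "0 < C" "\<And>x. \<bar>U s x\<bar> \<le> C" using bintE[OF U[OF s(1)]] by auto
  obtain L where L: "0 < L" "\<And>y. \<bar>y\<bar> \<le> C \<Longrightarrow> \<bar>F y\<bar> \<le> L * \<bar>y\<bar>" using lipschitz_on_bounded[OF C(1)]
      by blast
  define m where "m = l1 (U s)"
  have m0: "0 \<le> m" by (simp add: m_def)
  \<comment> \<open>The Gaussian without its prefactor, which would tend to 0 while
    \<open>?w R\<close> tends to 1. The two terms of \<open>?c\<close> below bound diffusion and
    convection per unit of time, the prefactor being cancelled on both sides.\<close>
  let ?w = "\<lambda>R (y::real^'n). exp (- (norm y)\<^sup>2 / (4 * R))"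
  let ?c = "\<lambda>R. hkC TYPE('n) / R * m + gradC * R powr (- 1 / 2) * (L * m)"
  have bound: "\<bar>(LINT y|lborel. ?w R y * U t y) - (LINT y|lborel. ?w R y * U s y)\<bar>
      \<le> ?c R * (t - s)" if R: "0 < R" for R
  proof -
    let ?p = "(4 * pi * R) powr (- real CARD('n) / 2)"
    have p: "0 < ?p" using R by simp
    let ?q = "(4 * pi * (2 * R)) powr (- real CARD('n) / 2)"
    have qp: "?q \<le> ?p" using R powr_neg_mono[of "4 * pi * R" "4 * pi * (2 * R)"
        "real CARD('n) / 2"] by simp
    have "norm ((LINT y|lborel. heat_kernel (- y) R * U t y)
        - (LINT y|lborel. heat_kernel (- y) R * U s y)) \<le> (?p * ?c R) * norm (t - s)"
    proof (rule field_differentiable_bound[where S="{s..t}"])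
      fix z assume z: "z \<in> {s..t}"
      then have z0: "0 < z" using s by auto
      show "((\<lambda>t. LINT y|lborel. heat_kernel (- y) R * U t y) has_field_derivative
          (LINT y|lborel. heat_kernel (- y) R * V z y)) (at z within {s..t})"
        by (rule DERIV_subset[OF gaussian_functional_derivative[OF z0 R]]) simp
      have eq: "(LINT y|lborel. heat_kernel (- y) R * V z y) =
        (LINT y|lborel. hk_dt (- y) R * U z y) + (LINT y|lborel. hk_grad a (- y) R * F (U z y))"
        using weak[OF z0 R, of 0] by simp
      have mz: "l1 (U z) \<le> m" unfolding m_def using s z by (intro l1_decreasing) auto
      have Uz: "integrable lborel (\<lambda>y. \<bar>U z y\<bar>)" using U[OF z0] by (simp add: bint_def)
      note [measurable] = bint_borel[OF U[OF z0]]
      have b1: "\<bar>LINT y|lborel. hk_dt (- y) R * U z y\<bar> \<le> hkC TYPE('n) / R * ?p * m"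
      proof -
        have kb: "\<bar>hk_dt (y::real^'n) R\<bar> \<le> hkC TYPE('n) / R * ?p" for y
        proof -
          have "\<bar>hk_dt y R\<bar> \<le> hkC TYPE('n) / R * heat_kernel y (2 * R)" by (rule hk_dt_bound[OF R])
          also have "\<dots> \<le> hkC TYPE('n) / R * ?p"
            using R hkC_pos[where 'n='n] heat_kernel_le[of "2 * R" y] qp
                by (intro mult_left_mono) auto
          finally show ?thesis .
        qed
        have "\<bar>LINT y|lborel. hk_dt (- y) R * U z y\<bar> \<le> (LINT y|lborel. \<bar>hk_dt (- y) R * U z y\<bar>)"
            by (rule integral_abs_bound)
        also have "\<dots> \<le> (LINT y|lborel. (hkC TYPE('n) / R * ?p) * \<bar>U z y\<bar>)"
        proof (rule integral_mono')
          fix y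
          show "\<bar>hk_dt (- y) R * U z y\<bar> \<le> (hkC TYPE('n) / R * ?p) * \<bar>U z y\<bar>"
            unfolding abs_mult by (intro mult_right_mono kb) simp
          show "0 \<le> (hkC TYPE('n) / R * ?p) * \<bar>U z y\<bar>" using R hkC_pos[where 'n='n] by simp
        qed (use Uz in simp)
        also have "\<dots> = (hkC TYPE('n) / R * ?p) * l1 (U z)" by simp
        also have "\<dots> \<le> (hkC TYPE('n) / R * ?p) * m" using mz R hkC_pos[where 'n='n]
            by (intro mult_left_mono) auto
        finally show ?thesis .
      qed
      have b2: "\<bar>LINT y|lborel. hk_grad a (- y) R * F (U z y)\<bar>
          \<le> gradC * R powr (- 1 / 2) * ?p * (L * m)"
      proof -
        have kb: "\<bar>hk_grad a (y::real^'n) R\<bar> \<le> gradC * R powr (- 1 / 2) * ?p" for y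
        proof -
          have "\<bar>hk_grad a y R\<bar> \<le> gradC * R powr (- 1 / 2) * heat_kernel y (2 * R)"
            using hk_grad_bound[OF R, of a y] by (simp add: gradC_def)
          also have "\<dots> \<le> gradC * R powr (- 1 / 2) * ?p"
            using R gradC_nonneg heat_kernel_le[of "2 * R" y] qp by (intro mult_left_mono) auto
          finally show ?thesis .
        qed
        have UC: "AE y in lborel. \<bar>U z y\<bar> \<le> C"
          by (rule linf_decreasing[OF s(1)]) (use z C in auto)
        have "\<bar>LINT y|lborel. hk_grad a (- y) R * F (U z y)\<bar>
            \<le> (LINT y|lborel. \<bar>hk_grad a (- y) R * F (U z y)\<bar>)" by (rule integral_abs_bound)
        also have "\<dots> \<le> (LINT y|lborel. (gradC * R powr (- 1 / 2) * ?p) * (L * \<bar>U z y\<bar>))"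
        proof (rule integral_mono_AE')
          show "AE y in lborel. \<bar>hk_grad a (- y) R * F (U z y)\<bar>
              \<le> (gradC * R powr (- 1 / 2) * ?p) * (L * \<bar>U z y\<bar>)"
            using UC
          proof eventually_elim
            case (elim y)
            show ?case unfolding abs_mult using L(2)[OF elim] gradC_nonneg
                by (intro mult_mono kb) auto
          qed
          show "AE y in lborel. 0 \<le> (gradC * R powr (- 1 / 2) * ?p) * (L * \<bar>U z y\<bar>)"
              using gradC_nonneg L by simp
        qed (use Uz in simp)
        also have "\<dots> = (gradC * R powr (- 1 / 2) * ?p) * (L * l1 (U z))" by simp
        also have "\<dots> \<le> (gradC * R powr (- 1 / 2) * ?p) * (L * m)" using mz L gradC_nonneg
            by (intro mult_left_mono) auto
        finally show ?thesis .
      qed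
      have "?p * ?c R = hkC TYPE('n) / R * ?p * m + gradC * R powr (- 1 / 2) * ?p * (L * m)"
          by (simp add: algebra_simps)
      then show "norm (LINT y|lborel. heat_kernel (- y) R * V z y) \<le> ?p * ?c R"
        unfolding eq using b1 b2 by (simp only: real_norm_def)
    qed (use s in auto)
    moreover have "(LINT y|lborel. heat_kernel (- y) R * U z y)
        = ?p * (LINT y|lborel. ?w R y * U z y)" for z
      by (simp add: heat_kernel_def mult.assoc)
    ultimately have "?p * \<bar>(LINT y|lborel. ?w R y * U t y) - (LINT y|lborel. ?w R y * U s y)\<bar>
        \<le> ?p * (?c R * (t - s))"
      using s p by (simp add: right_diff_distrib[symmetric] abs_mult mult.assoc)
    then show ?thesis using p by (simp only: mult_le_cancel_left_pos)
  qed
  have lim: "((\<lambda>R. LINT y|lborel. ?w R y * U z y) \<longlongrightarrow> (LINT y|lborel. U z y)) at_top" if z: "0 < z"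
      for z
  proof (rule integral_dominated_convergence_at_top[where w="\<lambda>y. \<bar>U z y\<bar>"])
    note [measurable] = bint_borel[OF U[OF z]]
    show "U z \<in> borel_measurable lborel" "\<And>R. (\<lambda>y. ?w R y * U z y) \<in> borel_measurable lborel"
        by measurable
    show "integrable lborel (\<lambda>y. \<bar>U z y\<bar>)" using U[OF z] by (simp add: bint_def)
    show "\<forall>\<^sub>F R in at_top. AE y in lborel. norm (?w R y * U z y) \<le> \<bar>U z y\<bar>"
      using eventually_gt_at_top[of 0] by eventually_elim
          (auto simp: abs_mult intro!: AE_I2 mult_left_le_one_le)
    show "AE y in lborel. ((\<lambda>R. ?w R y * U z y) \<longlongrightarrow> U z y) at_top"
    proof (rule AE_I2)
      fix y :: "real^'n"
      have "((\<lambda>R. - (norm y)\<^sup>2 / (4 * R)) \<longlongrightarrow> 0) at_top"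
        by (intro tendsto_divide_0[OF tendsto_const] filterlim_at_top_imp_at_infinity
            filterlim_tendsto_pos_mult_at_top[OF tendsto_const] filterlim_ident) auto
      then have "((\<lambda>R. ?w R y * U z y) \<longlongrightarrow> exp 0 * U z y) at_top" by (intro tendsto_intros)
      then show "((\<lambda>R. ?w R y * U z y) \<longlongrightarrow> U z y) at_top" by simp
    qed
  qed
  have "((\<lambda>R. ?c R * (t - s)) \<longlongrightarrow> (0 * m + gradC * 0 * (L * m)) * (t - s)) at_top"
    by (intro tendsto_intros tendsto_neg_powr tendsto_divide_0[OF tendsto_const]
        filterlim_at_top_imp_at_infinity filterlim_ident) auto
  then have c0: "((\<lambda>R. ?c R * (t - s)) \<longlongrightarrow> 0) at_top" by simp
  have "((\<lambda>R. \<bar>(LINT y|lborel. ?w R y * U t y) - (LINT y|lborel. ?w R y * U s y)\<bar>)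
      \<longlongrightarrow> \<bar>(LINT y|lborel. U t y) - (LINT y|lborel. U s y)\<bar>) at_top"
    using s by (intro tendsto_intros lim) auto
  then have "\<bar>(LINT y|lborel. U t y) - (LINT y|lborel. U s y)\<bar> \<le> 0"
  proof (rule tendsto_le[OF _ c0, rotated])
    show "\<forall>\<^sub>F R in at_top. \<bar>(LINT y|lborel. ?w R y * U t y) - (LINT y|lborel. ?w R y * U s y)\<bar>
        \<le> ?c R * (t - s)"
      using eventually_gt_at_top[of 0] by eventually_elim (rule bound)
  qed simp
  then show ?thesis by simp
qed

lemma mass_eq:
  assumes "0 < t" shows "(LINT x|lborel. U t x) = M"
proof (rule tendsto_unique[OF _ _ mass])
  have "\<forall>\<^sub>F s in at_right 0. (0::real) < s \<and> s < t"
    using assms by (auto simp: eventually_at_right[of 0 1] intro!: exI[of _ t])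
  then have "\<forall>\<^sub>F s in at_right 0. (LINT x|lborel. U t x) = (LINT x|lborel. U s x)"
    by eventually_elim (auto intro: mass_constant)
  then show "((\<lambda>s. LINT x|lborel. U s x) \<longlongrightarrow> (LINT x|lborel. U t x)) (at_right 0)"
    by (intro tendsto_eventually) (auto elim: eventually_mono)
qed simp

text \<open>As U T has integral M, the difference is the integral over y of U T y times K_r(. - y) -
  K_(r+T), which \<open>heat_kernel_compare\<close> estimates for each y. The comparison kernel has
  parameter r + T because r is counted from the time T.\<close>

lemma heat_flow_compare:
  assumes T: "0 < T" and r: "0 < r" "T \<le> r / 2" and w: "bint w"
  defines "g \<equiv> (LINT y|lborel. shift_weight T r y * \<bar>U T y\<bar>)"
  shows "\<bar>Q (\<lambda>z. heat_kernel z r) (U T) w - M * (LINT x|lborel. heat_kernel x (r + T) * w x)\<bar>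
      \<le> g * (r powr - (real CARD('n) / 2) * l1 w)"
    and "(\<And>x. \<bar>w x\<bar> \<le> 1) \<Longrightarrow> \<bar>Q (\<lambda>z. heat_kernel z r) (U T) w
        - M * (LINT x|lborel. heat_kernel x (r + T) * w x)\<bar> \<le> g"
proof -
  let ?f = "U T"
  have rT: "0 < r + T" using r T by simp
  note f = U[OF T] and ws = bint_sqint[OF w] and k = kdom_heat_kernel[OF r(1), where 'a='n]
  note [measurable] = bint_borel[OF f] bint_borel[OF w]
  obtain C where C: "0 < C" "\<And>x. \<bar>w x\<bar> \<le> C" using bintE[OF w] by blast
  have wk: "integrable lborel (\<lambda>x. heat_kernel (x - y) s * w x)" if "0 < s" for s y
  proof (rule Bochner_Integration.integrable_bound[where f="\<lambda>x. C * heat_kernel (x - y) s"])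
    show "integrable lborel (\<lambda>x. C * heat_kernel (x - y) s)"
      using integrable_lborel_shift[OF integrable_heat_kernel[OF that, where 'n='n], of y] by simp
    show "AE x in lborel. norm (heat_kernel (x - y) s * w x) \<le> norm (C * heat_kernel (x - y) s)"
      using C by (intro AE_I2) (auto simp: abs_mult mult.commute[of C] intro!: mult_left_mono)
  qed auto
  have wk0: "integrable lborel (\<lambda>x. heat_kernel x (r + T) * w x)" using wk[OF rT, of 0] by simp
  define I where "I = (\<lambda>y. LINT x|lborel. (heat_kernel (x - y) r - heat_kernel x (r + T)) * w x)"
  have I: "I y = (LINT x|lborel. heat_kernel (y - x) r * w x)
      - (LINT x|lborel. heat_kernel x (r + T) * w x)" for y
    unfolding I_def heat_kernel_commute[of y] left_diff_distrib
    by (rule Bochner_Integration.integral_diff[OF wk[OF r(1)] wk0])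
  have "Q (\<lambda>z. heat_kernel z r) ?f w = Q (\<lambda>z. heat_kernel z r) w ?f"
    using Q_swap[OF k U_sq[OF T] ws] by simp
  also have "\<dots> = (LINT y|lborel. ?f y * (LINT x|lborel. heat_kernel (y - x) r * w x))"
    by (rule Q_iterated[OF k ws U_sq[OF T]])
  finally have Q: "Q (\<lambda>z. heat_kernel z r) ?f w = \<dots>" .
  note iQ = Q_iterated_integrable[OF k ws U_sq[OF T]]
  have if2: "integrable lborel (\<lambda>y. ?f y * (LINT x|lborel. heat_kernel x (r + T) * w x))"
      using bint_integrable[OF f] by simp
  have "Q (\<lambda>z. heat_kernel z r) ?f w - M * (LINT x|lborel. heat_kernel x (r + T) * w x)
      = (LINT y|lborel. ?f y * I y)"
    unfolding Q I right_diff_distrib mass_eq[OF T, symmetric]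
    by (subst Bochner_Integration.integral_diff[OF iQ if2]) simp
  note eq = this
  have iI: "integrable lborel (\<lambda>y. ?f y * I y)"
    unfolding I right_diff_distrib by (rule Bochner_Integration.integrable_diff[OF iQ if2])
  have isw: "integrable lborel (\<lambda>y. shift_weight T r y * \<bar>?f y\<bar>)"
  proof (rule Bochner_Integration.integrable_bound[where
      f="\<lambda>y. (shiftC TYPE('n) * sqrt r * r powr (- 1 / 2) + T * (hkD TYPE('n) / r) + 2) * \<bar>?f y\<bar>"])
    have "shift_weight T r y \<le> shiftC TYPE('n) * sqrt r * r powr (- 1 / 2)
        + T * (hkD TYPE('n) / r) + 2" for y :: "real^'n"
    proof (cases "(norm y)\<^sup>2 \<le> r")
      case True
      then have "norm y \<le> sqrt r" by (rule real_le_rsqrt)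
      then have "shiftC TYPE('n) * norm y * r powr (- 1 / 2)
          \<le> shiftC TYPE('n) * sqrt r * r powr (- 1 / 2)"
        using shiftC_pos[where 'n='n] by (intro mult_right_mono mult_left_mono) auto
      then show ?thesis using True by (simp add: shift_weight_def)
    next
      case False
      then show ?thesis using shiftC_pos[where 'n='n] hkD_pos[where 'n='n] r T
          by (simp add: shift_weight_def)
    qed
    then have "\<bar>shift_weight T r y\<bar> \<le> \<bar>shiftC TYPE('n) * sqrt r * r powr (- 1 / 2)
        + T * (hkD TYPE('n) / r) + 2\<bar>" for y :: "real^'n"
      using shift_weight_nonneg[OF r(1) less_imp_le[OF T], of y] by (smt (verit))
    then show "AE y in lborel. norm (shift_weight T r y * \<bar>?f y\<bar>)
        \<le> norm ((shiftC TYPE('n) * sqrt r * r powr (- 1 / 2) + T * (hkD TYPE('n) / r) + 2) * \<bar>?f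
        y\<bar>)"
      by (intro AE_I2) (simp only: real_norm_def abs_mult abs_abs mult_right_mono abs_ge_zero)
  qed (use f in \<open>auto simp: bint_def\<close>)
  have b: "\<bar>LINT y|lborel. ?f y * I y\<bar> \<le> g * c" if c: "\<And>y. \<bar>I y\<bar> \<le> shift_weight T r y * c" for c
  proof -
    have "\<bar>LINT y|lborel. ?f y * I y\<bar> \<le> (LINT y|lborel. \<bar>?f y * I y\<bar>)" by (rule integral_abs_bound)
    also have "\<dots> \<le> (LINT y|lborel. (shift_weight T r y * \<bar>?f y\<bar>) * c)"
    proof (rule integral_mono)
      fix y
      have "\<bar>?f y\<bar> * \<bar>I y\<bar> \<le> \<bar>?f y\<bar> * (shift_weight T r y * c)" by (intro mult_left_mono c) simp
      then show "\<bar>?f y * I y\<bar> \<le> (shift_weight T r y * \<bar>?f y\<bar>) * c" by (simp add: abs_mult mult_ac)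
    qed (use iI isw in auto)
    also have "\<dots> = g * c" by (simp add: g_def)
    finally show ?thesis .
  qed
  show "\<bar>Q (\<lambda>z. heat_kernel z r) ?f w - M * (LINT x|lborel. heat_kernel x (r + T) * w x)\<bar>
      \<le> g * (r powr - (real CARD('n) / 2) * l1 w)"
    unfolding eq by (rule b) (use heat_kernel_compare(1)[OF r(1) less_imp_le[OF T] r(2) w] in
        \<open>simp add: I_def\<close>)
  assume "\<And>x. \<bar>w x\<bar> \<le> 1"
  then show "\<bar>Q (\<lambda>z. heat_kernel z r) ?f w - M * (LINT x|lborel. heat_kernel x (r + T) * w x)\<bar> \<le> g"
    unfolding eq using b[of 1] heat_kernel_compare(2)[OF r(1) less_imp_le[OF T] r(2) w]
        by (simp add: I_def)
qed

theorem asymptotic_profile: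
  assumes \<delta>: "0 < \<delta>"
  shows "\<forall>\<^sub>F t in at_top. (AE x in lborel. \<bar>U t x - M * heat_kernel x t\<bar>
      \<le> \<delta> * t powr - (real CARD('n) / 2)) \<and>
    l1 (\<lambda>x. U t x - M * heat_kernel x t) \<le> \<delta>"
proof -
  let ?N = "real CARD('n) / 2"
  \<comment> \<open>Two errors of size \<eta> are added, and replacing r by t costs 2^(N/2) because
    r >= t/2.\<close>
  define \<eta> where "\<eta> = \<delta> / (2 * 2 powr ?N)"
  have \<eta>: "0 < \<eta>" using \<delta> by (simp add: \<eta>_def)
  have p1: "1 \<le> 2 powr ?N" by (intro ge_one_powr_ge_zero) auto
  have \<eta>\<delta>: "2 * \<eta> * 2 powr ?N = \<delta>" by (simp add: \<eta>_def)
  have "2 * \<eta> * 1 \<le> 2 * \<eta> * 2 powr ?N" using \<eta> p1 by (intro mult_left_mono) auto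
  then have \<eta>2: "2 * \<eta> \<le> \<delta>" unfolding \<eta>\<delta> by simp
  obtain T where T: "1 \<le> T"
    and close: "\<And>\<tau> w. 0 < \<tau> \<Longrightarrow> bint w \<Longrightarrow> \<bar>(LINT x|lborel. U (T + \<tau>) x * w x)
        - Q (\<lambda>z. heat_kernel z \<tau>) (U T) w\<bar> \<le> \<eta> * \<tau> powr - ?N * l1 w"
    "\<And>\<tau> w. 0 < \<tau> \<Longrightarrow> bint w \<Longrightarrow> (\<And>x. \<bar>w x\<bar> \<le> 1) \<Longrightarrow> \<bar>(LINT x|lborel. U (T + \<tau>) x * w x)
        - Q (\<lambda>z. heat_kernel z \<tau>) (U T) w\<bar> \<le> \<eta>"
    using flow_close_to_heat[OF \<eta>] by blast
  have T0: "0 < T" using T by simp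
  let ?g = "\<lambda>r. LINT y|lborel. shift_weight T r y * \<bar>U T y\<bar>"
  have "(?g \<longlongrightarrow> 0) at_top" by (rule shift_weight_integral_tendsto_0[OF bint_integrable[OF U[OF T0]]
      less_imp_le[OF T0]])
  then have "\<forall>\<^sub>F r in at_top. ?g r < \<eta>" using \<eta> by (rule order_tendstoD)
  then obtain r0 where r0: "\<And>r. r0 \<le> r \<Longrightarrow> ?g r < \<eta>" by (auto simp: eventually_at_top_linorder)
  show ?thesis
    \<comment> \<open>With r = t - T this gives r >= r0 for the weight and r >= 2 T for the kernel
      comparison.\<close>
    using eventually_ge_at_top[of "T + max r0 (2 * T)"]
  proof eventually_elim
    case (elim t)
    define r where "r = t - T"
    have r: "0 < r" "r0 \<le> r" "T \<le> r / 2" "t = T + r" "T \<le> r" using elim T0 by (auto simp: r_def)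
    have t0: "0 < t" using r T0 by simp
    let ?D = "\<lambda>x. U t x - M * heat_kernel x t"
    have kt: "bint (\<lambda>x::real^'n. heat_kernel x t)"
      using integrable_heat_kernel[OF t0] heat_kernel_le[OF t0] by (auto simp: bint_def)
    have D: "integrable lborel ?D" using U[OF t0] kt by (auto simp: bint_def)
    have split: "(LINT x|lborel. ?D x * w x) =
        ((LINT x|lborel. U (T + r) x * w x) - Q (\<lambda>z. heat_kernel z r) (U T) w)
       + (Q (\<lambda>z. heat_kernel z r) (U T) w - M * (LINT x|lborel. heat_kernel x (r + T) * w x))" if
           w: "bint w" for w
    proof -
      have i: "integrable lborel (\<lambda>x. U t x * w x)" "integrable lborel (\<lambda>x. heat_kernel x t * w x)"
        using sqint_mult_integrable bint_sqint w kt U[OF t0] by blast+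
      have "(LINT x|lborel. ?D x * w x) = (LINT x|lborel. U t x * w x
          - M * (heat_kernel x t * w x))"
        by (intro Bochner_Integration.integral_cong) (auto simp: algebra_simps)
      also have "\<dots> = (LINT x|lborel. U t x * w x) - M * (LINT x|lborel. heat_kernel x t * w x)"
          using i by simp
      finally show ?thesis by (simp add: r(4) add.commute)
    qed
    have g: "?g r \<le> \<eta>" using r0[OF r(2)] by simp
    have rt: "r powr - ?N \<le> 2 powr ?N * t powr - ?N"
    proof -
      have "r powr - ?N \<le> (t / 2) powr - ?N" using r t0 by (intro powr_neg_mono) auto
      also have "\<dots> = 2 powr ?N * t powr - ?N"
        using t0 powr_divide[of t 2 "- ?N"] powr_minus_divide[of "2::real" ?N] by simp
      finally show ?thesis .
    qed
    have "AE x in lborel. \<bar>?D x\<bar> \<le> \<delta> * t powr - ?N"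
    proof (rule linf_dual[OF D])
      fix w :: "real^'n \<Rightarrow> real" assume w: "bint w"
      have lw: "0 \<le> l1 w" by simp
      have "\<bar>Q (\<lambda>z. heat_kernel z r) (U T) w - M * (LINT x|lborel. heat_kernel x (r + T) * w x)\<bar>
          \<le> ?g r * (r powr - ?N * l1 w)"
        by (rule heat_flow_compare(1)[OF T0 r(1) r(3) w])
      also have "\<dots> \<le> \<eta> * (r powr - ?N * l1 w)" using g by (intro mult_right_mono) auto
      finally have "\<bar>LINT x|lborel. ?D x * w x\<bar> \<le> \<eta> * r powr - ?N * l1 w + \<eta> * (r powr - ?N * l1 w)"
        unfolding split[OF w] using close(1)[OF r(1) w] by linarith
      also have "\<dots> = 2 * \<eta> * r powr - ?N * l1 w" by simp
      also have "\<dots> \<le> 2 * \<eta> * (2 powr ?N * t powr - ?N) * l1 w"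
        using rt \<eta> by (intro mult_right_mono mult_left_mono) auto
      also have "\<dots> = \<delta> * t powr - ?N * l1 w" unfolding \<eta>\<delta>[symmetric] by (simp only: mult.assoc)
      finally show "\<bar>LINT x|lborel. ?D x * w x\<bar> \<le> \<delta> * t powr - ?N * l1 w" .
    qed (use \<delta> in simp)
    moreover have "l1 ?D \<le> \<delta>"
    proof (rule l1_dual[OF D])
      fix w :: "real^'n \<Rightarrow> real" assume w: "bint w" "\<And>x. \<bar>w x\<bar> \<le> 1"
      have "\<bar>Q (\<lambda>z. heat_kernel z r) (U T) w - M * (LINT x|lborel. heat_kernel x (r + T) * w x)\<bar>
          \<le> ?g r"
        by (rule heat_flow_compare(2)[OF T0 r(1) r(3) w])
      then show "\<bar>LINT x|lborel. ?D x * w x\<bar> \<le> \<delta>"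
        unfolding split[OF w(1)] using close(2)[OF r(1) w] g \<eta>2 by linarith
    qed
    ultimately show ?case by blast
  qed
qed

end

section \<open>Gaussians as test functions\<close>

text \<open>The functions \<open>bump p\<close> are closed under differentiation.\<close>

definition bump :: "real poly \<Rightarrow> real \<Rightarrow> real" where
  "bump p s = (if 0 < s then poly p (inverse s) * exp (- inverse s) else 0)"

text \<open>The derivative of p(1/s) exp (-1/s) is s^(-2) (p - p')(1/s) exp (-1/s), and
  multiplication by the polynomial \<open>[:0, 0, 1:]\<close> is the factor s^(-2).\<close>

definition bump_deriv :: "real poly \<Rightarrow> real poly" where
  "bump_deriv p = [:0, 0, 1:] * (p - pderiv p)"

lemma poly_times_exp_minus_tendsto_0: "((\<lambda>y::real. poly p y * exp (- y)) \<longlongrightarrow> 0) at_top"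
proof -
  have "((\<lambda>y::real. \<Sum>i\<le>degree p. coeff p i * (y ^ i / exp y)) \<longlongrightarrow> (\<Sum>i\<le>degree p. coeff p i * 0))
      at_top"
    by (intro tendsto_intros tendsto_power_div_exp_0)
  then show ?thesis
    by (simp add: poly_altdef sum_distrib_right exp_minus field_simps sum_divide_distrib)
qed

lemma bump_has_derivative: "(bump p has_real_derivative bump (bump_deriv p) s) (at s)"
proof (cases "0 < s")
  case True
  have "((\<lambda>s. poly p (inverse s) * exp (- inverse s)) has_real_derivative bump (bump_deriv p) s)
      (at s)"
    using True
    by (auto intro!: derivative_eq_intros poly_DERIV[THEN DERIV_chain2]
      simp: bump_def bump_deriv_def field_simps power2_eq_square)
  then show ?thesis
    by (rule has_field_derivative_transform_within_open[where S="{0<..}"])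
        (use True in \<open>auto simp: bump_def\<close>)
next
  case False
  show ?thesis
  proof (cases "s = 0")
    case True
    \<comment> \<open>With y = 1/h the right difference quotient at 0 is y p(y) exp (-y).\<close>
    have "((\<lambda>y::real. poly ([:0, 1:] * p) y * exp (- y)) \<longlongrightarrow> 0) at_top"
        by (rule poly_times_exp_minus_tendsto_0)
    then have "((\<lambda>h::real. poly ([:0, 1:] * p) (inverse h) * exp (- inverse h)) \<longlongrightarrow> 0) (at_right 0)"
      by (rule filterlim_compose[OF _ filterlim_inverse_at_top_right])
    then have r: "((\<lambda>h. bump p h / h) \<longlongrightarrow> 0) (at_right 0)"
    proof (rule Lim_transform_eventually)
      show "\<forall>\<^sub>F h in at_right 0. poly ([:0, 1:] * p) (inverse h) * exp (- inverse h) = bump p h / h"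
        using eventually_at_right_less[of "0::real"]
            by eventually_elim (simp add: bump_def field_simps)
    qed
    have l: "((\<lambda>h. bump p h / h) \<longlongrightarrow> 0) (at_left 0)"
    proof (rule tendsto_eventually)
      show "\<forall>\<^sub>F h in at_left 0. bump p h / h = 0"
        by (auto simp: eventually_at_filter bump_def)
    qed
    have "((\<lambda>h. bump p h / h) \<longlongrightarrow> 0) (at 0)" using l r by (rule filterlim_split_at)
    then show ?thesis unfolding DERIV_def True by (simp add: bump_def)
  next
    case s: False
    then have "s \<in> {..<0}" using False by simp
    have "((\<lambda>s. 0) has_real_derivative 0) (at s)" by simp
    then have "(bump p has_real_derivative 0) (at s)"
      by (rule has_field_derivative_transform_within_open[where S="{..<0}"])
          (use \<open>s \<in> {..<0}\<close> in \<open>auto simp: bump_def\<close>)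
    then show ?thesis using False by (simp add: bump_def)
  qed
qed

lemma continuous_on_bump: "continuous_on A (bump p)"
  by (meson bump_has_derivative DERIV_isCont continuous_at_imp_continuous_on)

lemma bump_bounded:
  obtains B where "0 < B" "\<And>s. s \<le> 1 \<Longrightarrow> \<bar>bump p s\<bar> \<le> B"
proof -
  have "compact (bump p ` {0..1})" by (intro compact_continuous_image continuous_on_bump) simp
  then obtain B where B: "0 < B" "\<And>y. y \<in> bump p ` {0..1} \<Longrightarrow> norm y \<le> B"
    using compact_imp_bounded bounded_pos by metis
  have "\<bar>bump p s\<bar> \<le> B" if "s \<le> 1" for s
    using B(2)[of "bump p s"] B(1) that by (cases "0 \<le> s") (auto simp: bump_def)
  then show ?thesis using that B by blast
qed

text \<open>This class is closed under partial derivatives, so its members are of class $C^\infty$.\<close>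

inductive smooth :: "(real^'n \<Rightarrow> real) \<Rightarrow> bool" where
  smooth_const: "smooth (\<lambda>x. c)"
| smooth_coord: "smooth (\<lambda>x. x $ i)"
| smooth_add: "smooth f \<Longrightarrow> smooth g \<Longrightarrow> smooth (\<lambda>x. f x + g x)"
| smooth_mult: "smooth f \<Longrightarrow> smooth g \<Longrightarrow> smooth (\<lambda>x. f x * g x)"
| smooth_exp: "smooth f \<Longrightarrow> smooth (\<lambda>x. exp (f x))"
| smooth_bump: "smooth f \<Longrightarrow> smooth (\<lambda>x. bump p (f x))"

text \<open>Total differentiability and membership of the coordinate derivatives in the class are
  proved by one induction: the product rule needs both for each factor.\<close>

lemma smooth_has_derivative:
  assumes "smooth f"
  shows "\<exists>D. (\<forall>x. (f has_derivative D x) (at x)) \<and> (\<forall>i. smooth (\<lambda>x. D x (axis i 1)))"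
  using assms
proof induction
  case (smooth_const c)
  show ?case by (rule exI[of _ "\<lambda>x h. 0"]) (auto intro: smooth.intros)
next
  case (smooth_coord i)
  show ?case
    by (rule exI[of _ "\<lambda>x h. h $ i"]) (auto intro: smooth.intros bounded_linear_imp_has_derivative
        bounded_linear_vec_nth)
next
  case (smooth_add f g)
  then obtain D E where D: "\<forall>x. (f has_derivative D x) (at x)" "\<forall>i. smooth (\<lambda>x. D x (axis i 1))"
    and E: "\<forall>x. (g has_derivative E x) (at x)" "\<forall>i. smooth (\<lambda>x. E x (axis i 1))" by blast
  show ?case by (rule exI[of _ "\<lambda>x h. D x h + E x h"])
      (use D E in \<open>auto intro: smooth.intros has_derivative_add\<close>)
next
  case (smooth_mult f g)
  then obtain D E where D: "\<forall>x. (f has_derivative D x) (at x)" "\<forall>i. smooth (\<lambda>x. D x (axis i 1))"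
    and E: "\<forall>x. (g has_derivative E x) (at x)" "\<forall>i. smooth (\<lambda>x. E x (axis i 1))" by blast
  show ?case
    by (rule exI[of _ "\<lambda>x h. f x * E x h + D x h * g x"])
       (use D E smooth_mult.hyps in \<open>auto intro!: smooth.intros has_derivative_mult\<close>)
next
  case (smooth_exp f)
  then obtain D where D: "\<forall>x. (f has_derivative D x) (at x)" "\<forall>i. smooth (\<lambda>x. D x (axis i 1))"
      by blast
  have "((\<lambda>x. exp (f x)) has_derivative (\<lambda>h. D x h * exp (f x))) (at x)" for x
    using D by (auto intro: has_derivative_exp)
  then show ?case
    by (intro exI[of _ "\<lambda>x h. D x h * exp (f x)"])
        (use D smooth_exp.hyps in \<open>auto intro: smooth.intros\<close>)
next
  case (smooth_bump f p)
  then obtain D where D: "\<forall>x. (f has_derivative D x) (at x)" "\<forall>i. smooth (\<lambda>x. D x (axis i 1))"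
      by blast
  have "((\<lambda>x. bump p (f x)) has_derivative (\<lambda>h. bump (bump_deriv p) (f x) * D x h)) (at x)" for x
    using has_derivative_compose[of f "D x" x UNIV
        "bump p", OF _ bump_has_derivative[unfolded has_field_derivative_def]] D by simp
  then show ?case
    by (intro exI[of _ "\<lambda>x h. bump (bump_deriv p) (f x) * D x h"])
        (use D smooth_bump.hyps in \<open>auto intro: smooth.intros\<close>)
qed

lemma partial_deriv_eq:
  assumes "\<And>x. (f has_derivative D x) (at x)"
  shows "partial_deriv i f = (\<lambda>x. D x (axis i 1))"
  unfolding partial_deriv_def using frechet_derivative_at[OF assms] by (simp add: fun_eq_iff)

lemma smooth_differentiable: "smooth f \<Longrightarrow> f differentiable (at x)"
  using smooth_has_derivative differentiable_def by blast

lemma smooth_partial_deriv: "smooth f \<Longrightarrow> smooth (partial_deriv i f)"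
  using smooth_has_derivative[of f] partial_deriv_eq[of f] by metis

lemma smooth_partial_derivs: "smooth f \<Longrightarrow> smooth (partial_derivs \<alpha> f)"
  by (induction \<alpha>) (auto intro: smooth_partial_deriv)

lemma smooth_continuous_on: "smooth f \<Longrightarrow> continuous_on A f"
  by (meson smooth_differentiable differentiable_imp_continuous_within
      continuous_at_imp_continuous_on)

lemma smooth_borel: "smooth f \<Longrightarrow> f \<in> borel_measurable borel"
  by (intro borel_measurable_continuous_onI smooth_continuous_on)

lemma smooth_sum: "finite A \<Longrightarrow> (\<And>i. i \<in> A \<Longrightarrow> smooth (f i)) \<Longrightarrow> smooth (\<lambda>x. \<Sum>i\<in>A. f i x)"
  by (induction A rule: finite_induct) (auto intro: smooth.intros)

lemma partial_deriv_mult: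
  assumes "smooth f" "smooth g"
  shows "partial_deriv i (\<lambda>x. f x * g x) = (\<lambda>x. f x * partial_deriv i g x
      + partial_deriv i f x * g x)"
proof -
  obtain D E where D: "\<And>x. (f has_derivative D x) (at x)" and E: "\<And>x. (g has_derivative E x) (at x)"
    using smooth_has_derivative[OF assms(1)] smooth_has_derivative[OF assms(2)] by blast
  have "((\<lambda>x. f x * g x) has_derivative (\<lambda>h. f x * E x h + D x h * g x)) (at x)" for x
    by (rule has_derivative_mult[OF D E])
  from partial_deriv_eq[OF this] show ?thesis
      by (simp add: partial_deriv_eq[OF D] partial_deriv_eq[OF E])
qed

lemma partial_deriv_add:
  assumes "smooth f" "smooth g"
  shows "partial_deriv i (\<lambda>x. f x + g x) = (\<lambda>x. partial_deriv i f x + partial_deriv i g x)"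
proof -
  obtain D E where D: "\<And>x. (f has_derivative D x) (at x)" and E: "\<And>x. (g has_derivative E x) (at x)"
    using smooth_has_derivative[OF assms(1)] smooth_has_derivative[OF assms(2)] by blast
  from partial_deriv_eq[OF has_derivative_add[OF D E]]
  show ?thesis by (simp add: partial_deriv_eq[OF D] partial_deriv_eq[OF E])
qed

section \<open>Gaussians, cutoffs and their derivatives\<close>

definition gauss :: "real^'n \<Rightarrow> real \<Rightarrow> real^'n \<Rightarrow> real" where
  "gauss x r y = heat_kernel (x - y) r"

text \<open>For \<open>p = 1\<close> the factor \<open>exp 1\<close> normalises the value at the origin to 1.\<close>

definition cutoff :: "real poly \<Rightarrow> real \<Rightarrow> real^'n \<Rightarrow> real" where
  "cutoff p R y = exp 1 * bump p (1 - (norm y)\<^sup>2 / R\<^sup>2)"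

lemma norm_square_coords: "(norm (y::real^'n))\<^sup>2 = (\<Sum>i\<in>UNIV. y $ i * y $ i)"
  by (simp add: power2_norm_eq_inner inner_vec_def)

lemma smooth_gauss: "smooth (gauss x r)"
proof -
  have eq: "gauss x r = (\<lambda>y. (4 * pi * r) powr (- real CARD('a) / 2) *
    exp ((- 1 / (4 * r)) * (\<Sum>i\<in>UNIV. (x $ i + (- 1) * y $ i) * (x $ i + (- 1) * y $ i))))"
    by (simp add: gauss_def heat_kernel_def norm_square_coords fun_eq_iff)
  show ?thesis unfolding eq by (intro smooth.intros smooth_sum) auto
qed

lemma smooth_cutoff: "smooth (cutoff p R)"
proof -
  have eq: "cutoff p R = (\<lambda>y. exp 1 * bump p (1 + (- 1 / R\<^sup>2) * (\<Sum>i\<in>UNIV. y $ i * y $ i)))"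
    by (simp add: cutoff_def norm_square_coords fun_eq_iff)
  show ?thesis unfolding eq by (intro smooth.intros smooth_sum) auto
qed

lemma test_function_cutoff:
  fixes g :: "real^'n \<Rightarrow> real"
  assumes g: "smooth g" and R: "0 < R"
  shows "test_function (\<lambda>y. g y * cutoff p R y)"
  unfolding test_function_def
proof (intro conjI allI)
  have s: "smooth (\<lambda>y. g y * cutoff p R y)" by (intro smooth_mult g smooth_cutoff)
  show "partial_derivs \<alpha> (\<lambda>y. g y * cutoff p R y) differentiable (at x)" for \<alpha> x
    by (rule smooth_differentiable[OF smooth_partial_derivs[OF s]])
  have "{y. g y * cutoff p R y \<noteq> 0} \<subseteq> cball 0 R"
  proof
    fix y assume "y \<in> {y. g y * cutoff p R y \<noteq> 0}"
    then have "0 < 1 - (norm y)\<^sup>2 / R\<^sup>2" by (auto simp: cutoff_def bump_def split: if_splits)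
    then have "(norm y)\<^sup>2 < R\<^sup>2" using R by (simp add: field_simps)
    then have "norm y < R" using R by (simp add: power_less_imp_less_base)
    then show "y \<in> cball 0 R" by simp
  qed
  then show "compact (closure {y. g y * cutoff p R y \<noteq> 0})"
    using bounded_subset[OF bounded_cball] by (simp add: compact_closure)
qed

lemma partial_deriv_gauss:
  fixes x :: "real^'n"
  assumes r: "0 < r"
  shows "partial_deriv i (gauss x r) = (\<lambda>y. (x $ i - y $ i) / (2 * r) * gauss x r y)"
proof -
  have n: "((\<lambda>y. (norm (x - y))\<^sup>2) has_derivative (\<lambda>h. - 2 * ((x - y) \<bullet> h))) (at y)" for y
    unfolding power2_norm_eq_inner
    by (auto intro!: derivative_eq_intros simp: inner_diff_left inner_diff_right inner_commute
        algebra_simps fun_eq_iff)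
  have "((\<lambda>y. - (norm (x - y))\<^sup>2 / (4 * r)) has_derivative
      (\<lambda>h. - (- 2 * ((x - y) \<bullet> h)) / (4 * r))) (at y)" for y
    using has_derivative_mult_right[OF n, of "- 1 / (4 * r)" y] by simp
  from has_derivative_mult_right[OF has_derivative_exp[OF this], of
      "(4 * pi * r) powr (- real CARD('n) / 2)"]
  have "(gauss x r has_derivative (\<lambda>h. ((x - y) \<bullet> h) / (2 * r) * gauss x r y)) (at y)" for y
    unfolding gauss_def[abs_def] heat_kernel_def by (simp add: mult_ac)
  from partial_deriv_eq[OF this] show ?thesis by (simp add: inner_axis)
qed

lemma smooth_gauss_factor: "smooth (\<lambda>y. (x $ i - y $ i) / (2 * r))"
proof -
  have eq: "(\<lambda>y::real^'a. (x $ i - y $ i) / (2 * r))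
      = (\<lambda>y. x $ i / (2 * r) + (- 1 / (2 * r)) * y $ i)"
    by (simp add: fun_eq_iff diff_divide_distrib)
  show ?thesis unfolding eq by (intro smooth.intros)
qed

lemma partial_deriv2_gauss:
  fixes x :: "real^'n"
  assumes r: "0 < r"
  shows "partial_deriv i (partial_deriv i (gauss x r)) =
    (\<lambda>y. ((x $ i - y $ i)\<^sup>2 / (4 * r\<^sup>2) - 1 / (2 * r)) * gauss x r y)"
proof -
  have "((\<lambda>y. (x $ i - y $ i) / (2 * r)) has_derivative (\<lambda>h. - (h $ i) / (2 * r))) (at y)" for y
    using has_derivative_mult_right[OF has_derivative_diff[OF has_derivative_const
        bounded_linear_imp_has_derivative[OF bounded_linear_vec_nth]], of "1 / (2 * r)"]
    by simp
  from partial_deriv_eq[OF this]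
  have f: "partial_deriv i (\<lambda>y. (x $ i - y $ i) / (2 * r)) = (\<lambda>y. - 1 / (2 * r))" by simp
  show ?thesis
    unfolding partial_deriv_gauss[OF r] partial_deriv_mult[OF smooth_gauss_factor smooth_gauss] f
    using r by (simp add: fun_eq_iff power2_eq_square field_simps)
qed

lemma partial_deriv_cutoff:
  assumes R: "0 < R"
  shows "partial_deriv i (cutoff p R) = (\<lambda>y::real^'n. (- 2 / R\<^sup>2) * y $ i * cutoff (bump_deriv p)
      R y)"
proof -
  have n: "((\<lambda>y::real^'n. 1 - (norm y)\<^sup>2 / R\<^sup>2) has_derivative (\<lambda>h. - (2 * (y \<bullet> h)) / R\<^sup>2))
      (at y)" for y
  proof -
    have "((\<lambda>y::real^'n. y \<bullet> y) has_derivative (\<lambda>h. 2 * (y \<bullet> h))) (at y)"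
      by (auto intro!: derivative_eq_intros simp: inner_commute)
    from has_derivative_diff[OF has_derivative_const
        has_derivative_mult_right[OF this, of "1 / R\<^sup>2"], of 1]
    show ?thesis unfolding power2_norm_eq_inner by simp
  qed
  have "((\<lambda>y::real^'n. bump p (1 - (norm y)\<^sup>2 / R\<^sup>2)) has_derivative
     (\<lambda>h. bump (bump_deriv p) (1 - (norm y)\<^sup>2 / R\<^sup>2) * (- (2 * (y \<bullet> h)) / R\<^sup>2))) (at y)" for y
    using has_derivative_compose[OF n bump_has_derivative[unfolded has_field_derivative_def]]
        by simp
  from has_derivative_mult_right[OF this, of "exp 1"]
  have "(cutoff p R has_derivative (\<lambda>h. exp 1 *
      (bump (bump_deriv p) (1 - (norm y)\<^sup>2 / R\<^sup>2) * (- (2 * (y \<bullet> h)) / R\<^sup>2))))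
      (at y)" for y :: "real^'n"
    unfolding cutoff_def[abs_def] .
  from partial_deriv_eq[OF this] show ?thesis by (simp add: inner_axis cutoff_def mult_ac)
qed

lemma partial_deriv2_cutoff:
  assumes R: "0 < R"
  shows "partial_deriv i (partial_deriv i (cutoff p R)) =
    (\<lambda>y::real^'n. (- 2 / R\<^sup>2) * y $ i * ((- 2 / R\<^sup>2) * y $ i * cutoff (bump_deriv (bump_deriv p))
        R y) + (- 2 / R\<^sup>2) * cutoff (bump_deriv p) R y)"
proof -
  have s: "smooth (\<lambda>y::real^'n. (- 2 / R\<^sup>2) * y $ i)" by (intro smooth.intros)
  have "((\<lambda>y::real^'n. (- 2 / R\<^sup>2) * y $ i) has_derivative (\<lambda>h. (- 2 / R\<^sup>2) * h $ i)) (at y)" for y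
    by (intro has_derivative_mult_right bounded_linear_imp_has_derivative bounded_linear_vec_nth)
  from partial_deriv_eq[OF this]
  have f: "partial_deriv i (\<lambda>y::real^'n. (- 2 / R\<^sup>2) * y $ i) = (\<lambda>y. - 2 / R\<^sup>2)" by simp
  show ?thesis
    unfolding partial_deriv_cutoff[OF R] partial_deriv_mult[OF s smooth_cutoff] f
        partial_deriv_cutoff[OF R] ..
qed

text \<open>Each derivative produces a factor 2 y_i / R^2, at most 2 / R on the support. Second
  derivatives are even O(1/R^2), weakened so that one constant B serves all bounds.\<close>

lemma cutoff_estimates:
  obtains B where "0 < B"
    "\<And>R (y::real^'n). 1 \<le> R \<Longrightarrow> \<bar>cutoff 1 R y\<bar> \<le> B"
    "\<And>R (y::real^'n) i. 1 \<le> R \<Longrightarrow> \<bar>partial_deriv i (cutoff 1 R) y\<bar> \<le> B / R"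
    "\<And>R (y::real^'n) i. 1 \<le> R \<Longrightarrow> \<bar>partial_deriv i (partial_deriv i (cutoff 1 R)) y\<bar> \<le> B / R"
proof -
  let ?p1 = "bump_deriv 1" and ?p2 = "bump_deriv (bump_deriv 1)"
  obtain B0 where B0: "0 < B0" "\<And>s. s \<le> 1 \<Longrightarrow> \<bar>bump 1 s\<bar> \<le> B0" using bump_bounded by blast
  obtain B1 where B1: "0 < B1" "\<And>s. s \<le> 1 \<Longrightarrow> \<bar>bump ?p1 s\<bar> \<le> B1" using bump_bounded by blast
  obtain B2 where B2: "0 < B2" "\<And>s. s \<le> 1 \<Longrightarrow> \<bar>bump ?p2 s\<bar> \<le> B2" using bump_bounded by blast
  define B where "B = exp 1 * (B0 + 2 * B1 + 4 * B2)"
  have arg: "1 - (norm y)\<^sup>2 / R\<^sup>2 \<le> 1" for y :: "real^'n" and R :: real by simp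
  have c: "\<bar>cutoff p R y\<bar> \<le> exp 1 * b" if "\<And>s. s \<le> 1 \<Longrightarrow> \<bar>bump p s\<bar> \<le> b" for p R b and y :: "real^'n"
    using that[OF arg[of y R]] by (simp add: cutoff_def abs_mult)
  \<comment> \<open>Inside the support |y| < R; outside both sides vanish.\<close>
  have yc: "\<bar>y $ i\<bar> * \<bar>cutoff p R y\<bar> \<le> R * \<bar>cutoff p R y\<bar>" if R: "1 \<le> R" for p R i
      and y :: "real^'n"
  proof (cases "0 < 1 - (norm y)\<^sup>2 / R\<^sup>2")
    case True
    then have "(norm y)\<^sup>2 < R\<^sup>2" using R by (simp add: field_simps)
    then have "norm y < R" using R by (simp add: power_less_imp_less_base)
    then have "\<bar>y $ i\<bar> \<le> R" using component_le_norm_cart[of y i] by linarith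
    then show ?thesis by (intro mult_right_mono) auto
  qed (simp add: cutoff_def bump_def)
  show ?thesis
  proof (rule that[of B])
    show "0 < B" using B0 B1 B2 by (simp add: B_def)
    fix R :: real and y :: "real^'n" and i assume R: "1 \<le> R"
    have "\<bar>cutoff 1 R y\<bar> \<le> exp 1 * B0" by (rule c[OF B0(2)])
    also have "\<dots> \<le> B" unfolding B_def using B1 B2 by (intro mult_left_mono) auto
    finally show "\<bar>cutoff 1 R y\<bar> \<le> B" .
    have R1: "1 / R\<^sup>2 \<le> 1 / R" using R by (simp add: power2_eq_square divide_simps)
    have "\<bar>partial_deriv i (cutoff 1 R) y\<bar> = 2 / R\<^sup>2 * (\<bar>y $ i\<bar> * \<bar>cutoff ?p1 R y\<bar>)"
      using R by (simp add: partial_deriv_cutoff abs_mult)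
    also have "\<dots> \<le> 2 / R\<^sup>2 * (R * (exp 1 * B1))"
      using R by (intro mult_left_mono order_trans[OF yc[OF R]] c[OF B1(2)]) auto
    also have "\<dots> = exp 1 * (2 * B1) / R" using R by (simp add: power2_eq_square)
    also have "\<dots> \<le> B / R" unfolding B_def using R B0 B2
        by (intro divide_right_mono mult_left_mono) auto
    finally show "\<bar>partial_deriv i (cutoff 1 R) y\<bar> \<le> B / R" .
    have "\<bar>partial_deriv i (partial_deriv i (cutoff 1 R)) y\<bar> \<le>
      2 / R\<^sup>2 * (2 / R\<^sup>2 * (\<bar>y $ i\<bar> * (\<bar>y $ i\<bar> * \<bar>cutoff ?p2 R y\<bar>))) + 2 / R\<^sup>2 * \<bar>cutoff ?p1 R y\<bar>"
      unfolding partial_deriv2_cutoff[OF less_le_trans[OF zero_less_one R]]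
      using R by (intro order_trans[OF abs_triangle_ineq]) (simp add: abs_mult)
    also have "\<dots> \<le> 2 / R\<^sup>2 * (2 / R\<^sup>2 * (R * (R * (exp 1 * B2)))) + 2 / R\<^sup>2 * (exp 1 * B1)"
    proof -
      have "\<bar>y $ i\<bar> * (\<bar>y $ i\<bar> * \<bar>cutoff ?p2 R y\<bar>) \<le> \<bar>y $ i\<bar> * (R * \<bar>cutoff ?p2 R y\<bar>)"
        by (intro mult_left_mono yc R) simp
      also have "\<dots> = R * (\<bar>y $ i\<bar> * \<bar>cutoff ?p2 R y\<bar>)" by simp
      also have "\<dots> \<le> R * (R * (exp 1 * B2))"
        using R by (intro mult_left_mono order_trans[OF yc[OF R]] c[OF B2(2)]) auto
      finally show ?thesis using R by (intro add_mono mult_left_mono c[OF B1(2)]) auto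
    qed
    also have "\<dots> = 1 / R\<^sup>2 * (exp 1 * (2 * B1 + 4 * B2))" using R
        by (simp add: power2_eq_square field_simps)
    also have "\<dots> \<le> 1 / R * B" unfolding B_def using R1 R B0 B1 B2 by (intro mult_mono) auto
    finally show "\<bar>partial_deriv i (partial_deriv i (cutoff 1 R)) y\<bar> \<le> B / R" by simp
  qed
qed

lemma cutoff_tendsto: "(\<lambda>n. cutoff 1 (real (Suc n)) y) \<longlonglongrightarrow> 1"
proof -
  have "(\<lambda>n. 1 - (norm y)\<^sup>2 * (1 / real (Suc n))\<^sup>2) \<longlonglongrightarrow> 1 - (norm y)\<^sup>2 * 0\<^sup>2"
    by (intro tendsto_intros LIMSEQ_Suc[OF lim_1_over_n])
  then have lim: "(\<lambda>n. 1 - (norm y)\<^sup>2 / (real (Suc n))\<^sup>2) \<longlonglongrightarrow> 1"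
    by (simp add: power_divide)
  have "isCont (bump 1) 1" by (rule DERIV_isCont[OF bump_has_derivative])
  from isCont_tendsto_compose[OF this lim] have
      "(\<lambda>n. bump 1 (1 - (norm y)\<^sup>2 / (real (Suc n))\<^sup>2)) \<longlonglongrightarrow> bump 1 1" .
  then have "(\<lambda>n. exp 1 * bump 1 (1 - (norm y)\<^sup>2 / (real (Suc n))\<^sup>2)) \<longlonglongrightarrow> exp 1 * bump 1 1"
    by (rule tendsto_mult_left)
  moreover have "exp 1 * bump 1 1 = (1::real)" by (simp add: bump_def exp_minus)
  ultimately show ?thesis by (simp only: cutoff_def)
qed

section \<open>From test functions to Gaussians\<close>

lemma borel_lebesgue: "\<phi> \<in> borel_measurable borel \<Longrightarrow> \<phi> \<in> borel_measurable lebesgue"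
  by (rule measurable_completion) simp

lemma test_function_borel: "test_function \<phi> \<Longrightarrow> partial_derivs \<alpha> \<phi> \<in> borel_measurable borel"
  unfolding test_function_def
  by (intro borel_measurable_continuous_onI continuous_at_imp_continuous_on ballI
      differentiable_imp_continuous_within) auto

lemma locally_integrable_mult_test:
  fixes d \<phi> :: "real^'n \<Rightarrow> real"
  assumes d: "locally_integrable d" and \<phi>: "test_function \<phi>"
  shows "integrable lebesgue (\<lambda>x. d x * \<phi> x)"
proof -
  let ?K = "closure {x. \<phi> x \<noteq> 0}"
  have K: "compact ?K" using \<phi> by (simp add: test_function_def)
  have [measurable]: "\<phi> \<in> borel_measurable lebesgue"
    using borel_lebesgue[OF test_function_borel[OF \<phi>, of "[]"]] by simp
  have "continuous_on ?K \<phi>"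
    using \<phi> partial_derivs.simps(1)[of \<phi>] unfolding test_function_def
    by (metis continuous_at_imp_continuous_on differentiable_imp_continuous_within)
  then have "compact (\<phi> ` ?K)" using K by (rule compact_continuous_image)
  then obtain B where B: "0 < B" "\<And>y. y \<in> \<phi> ` ?K \<Longrightarrow> norm y \<le> B"
    using compact_imp_bounded bounded_pos by metis
  have i: "integrable lebesgue (\<lambda>x. indicat_real ?K x * d x)"
    using d K by (auto simp: locally_integrable_def set_integrable_def)
  have eq: "d x * \<phi> x = (indicat_real ?K x * d x) * \<phi> x" for x
    using closure_subset[of "{x. \<phi> x \<noteq> 0}"] by (auto split: split_indicator)
  have [measurable]: "(\<lambda>x. indicat_real ?K x * d x) \<in> borel_measurable lebesgue"
    using i by (rule borel_measurable_integrable)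
  show ?thesis
    unfolding eq
  proof (rule Bochner_Integration.integrable_bound[where f="\<lambda>x. B * (indicat_real ?K x * d x)"])
    show "AE x in lebesgue. norm ((indicat_real ?K x * d x) * \<phi> x)
        \<le> norm (B * (indicat_real ?K x * d x))"
      using B by (intro AE_I2) (auto simp: abs_mult mult.commute[of B] intro!: mult_left_mono
          split: split_indicator)
  qed (use i in auto)
qed

text \<open>Moving two derivatives onto \<phi> preserves the sign and moving one reverses it, whence
  the minus in front of the convection sum.\<close>

lemma weak_tested:
  fixes f H v :: "real^'n \<Rightarrow> real" and a :: "real^'n"
  assumes f: "\<And>i. has_weak_deriv [i, i] f (d i)" and H: "\<And>i. has_weak_deriv [i] H (g i)"
    and eq: "AE x in lebesgue. v x - (\<Sum>i\<in>UNIV. d i x) = (\<Sum>i\<in>UNIV. a $ i * g i x)"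
    and v: "v \<in> borel_measurable lebesgue" and \<phi>: "test_function \<phi>"
  shows "(LINT x|lebesgue. v x * \<phi> x) =
    (\<Sum>i\<in>UNIV. LINT x|lebesgue. f x * partial_derivs [i, i] \<phi> x)
        - (\<Sum>i\<in>UNIV. a $ i * (LINT x|lebesgue. H x * partial_derivs [i] \<phi> x))"
proof -
  have id: "integrable lebesgue (\<lambda>x. d i x * \<phi> x)" and ig: "integrable lebesgue (\<lambda>x. g i x * \<phi> x)"
      for i
    using f[of i] H[of i] \<phi> locally_integrable_mult_test by (auto simp: has_weak_deriv_def)
  have [measurable]: "\<phi> \<in> borel_measurable lebesgue"
    using borel_lebesgue[OF test_function_borel[OF \<phi>, of "[]"]] by simp
  note [measurable] = v borel_measurable_integrable[OF id] borel_measurable_integrable[OF ig]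
  have "(LINT x|lebesgue. v x * \<phi> x) = (LINT x|lebesgue. (\<Sum>i\<in>UNIV. d i x * \<phi> x)
      + (\<Sum>i\<in>UNIV. a $ i * (g i x * \<phi> x)))"
  proof (rule integral_cong_AE)
    show "AE x in lebesgue. v x * \<phi> x = (\<Sum>i\<in>UNIV. d i x * \<phi> x) + (\<Sum>i\<in>UNIV. a $ i * (g i x * \<phi> x))"
      using eq
    proof eventually_elim
      case (elim x)
      then have "v x = (\<Sum>i\<in>UNIV. d i x) + (\<Sum>i\<in>UNIV. a $ i * g i x)" by linarith
      then show ?case by (simp add: distrib_right sum_distrib_right mult.assoc)
    qed
  qed measurable
  also have "\<dots> = (\<Sum>i\<in>UNIV. LINT x|lebesgue. d i x * \<phi> x)
      + (\<Sum>i\<in>UNIV. a $ i * (LINT x|lebesgue. g i x * \<phi> x))"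
    using id ig by simp
  finally have 1: "(LINT x|lebesgue. v x * \<phi> x) = \<dots>" .
  have 2: "(LINT x|lebesgue. d i x * \<phi> x) = (LINT x|lebesgue. f x * partial_derivs [i, i] \<phi> x)"
      for i
    using f[of i] \<phi> unfolding has_weak_deriv_def by (auto simp del: partial_derivs.simps)
  have 3: "(LINT x|lebesgue. g i x * \<phi> x) = - (LINT x|lebesgue. H x * partial_derivs [i] \<phi> x)" for i
    using H[of i] \<phi> unfolding has_weak_deriv_def by (auto simp del: partial_derivs.simps)
  show ?thesis unfolding 1 2 3 by (simp add: sum_negf)
qed

lemma gauss_bounds:
  fixes x :: "real^'n"
  assumes r: "0 < r"
  obtains C where "0 < C" "\<And>y. \<bar>gauss x r y\<bar> \<le> C" "\<And>y i. \<bar>partial_deriv i (gauss x r) y\<bar> \<le> C"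
    "\<And>y i. \<bar>partial_deriv i (partial_deriv i (gauss x r)) y\<bar> \<le> C"
proof -
  define k where "k = (4 * pi * r) powr (- real CARD('n) / 2)
      + (4 * pi * (2 * r)) powr (- real CARD('n) / 2)"
  have k0: "0 \<le> k" by (simp add: k_def)
  have k1: "heat_kernel (z::real^'n) r \<le> k" and k2: "heat_kernel z (2 * r) \<le> k" for z
    using heat_kernel_le[OF r, of z] heat_kernel_le[of "2 * r" z] r
        by (auto simp: k_def intro: add_increasing add_increasing2)
  define C1 where "C1 = hkC TYPE('n) * r powr (- 1 / 2) * k"
  define C2 where "C2 = (8 * r * 2 powr (real CARD('n) / 2) * k) / (4 * r\<^sup>2) + k / (2 * r)"
  have C0: "0 \<le> C1" "0 \<le> C2" using k0 r hkC_pos[where 'n='n] by (auto simp: C1_def C2_def)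
  show ?thesis
  proof (rule that[of "k + C1 + C2 + 1"])
    show "0 < k + C1 + C2 + 1" using k0 C0 by simp
    fix y :: "real^'n" and i
    show "\<bar>gauss x r y\<bar> \<le> k + C1 + C2 + 1" using k1[of "x - y"] C0 by (simp add: gauss_def)
    have "partial_deriv i (gauss x r) y = hk_grad (- axis i 1) (x - y) r"
      unfolding partial_deriv_gauss[OF r] by (simp add: hk_grad_def gauss_def inner_axis
          inner_commute[of "axis i 1"])
    then have "\<bar>partial_deriv i (gauss x r) y\<bar>
        \<le> norm (- axis i (1::real)) * hkC TYPE('n) * r powr (- 1 / 2) * heat_kernel (x - y) (2 * r)"
      using hk_grad_bound[OF r, of "- axis i 1" "x - y"] by simp
    also have "\<dots> \<le> C1" unfolding C1_def using hkC_pos[where 'n='n]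
        by (simp add: norm_axis_1 mult_left_mono k2)
    finally show "\<bar>partial_deriv i (gauss x r) y\<bar> \<le> k + C1 + C2 + 1" using k0 C0 by simp
    let ?z = "x - y"
    have "\<bar>?z $ i\<bar> \<le> norm ?z" by (rule component_le_norm_cart)
    then have zi: "(?z $ i)\<^sup>2 \<le> (norm ?z)\<^sup>2" by (metis abs_le_square_iff abs_norm_cancel)
    have "\<bar>partial_deriv i (partial_deriv i (gauss x r)) y\<bar>
        = \<bar>(?z $ i)\<^sup>2 / (4 * r\<^sup>2) - 1 / (2 * r)\<bar> * heat_kernel ?z r"
      unfolding partial_deriv2_gauss[OF r] by (simp add: gauss_def abs_mult)
    also have "\<dots> \<le> ((norm ?z)\<^sup>2 / (4 * r\<^sup>2) + 1 / (2 * r)) * heat_kernel ?z r"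
    proof (rule mult_right_mono)
      have "0 \<le> (?z $ i)\<^sup>2 / (4 * r\<^sup>2)" "0 \<le> 1 / (2 * r)" using r by auto
      moreover have "(?z $ i)\<^sup>2 / (4 * r\<^sup>2) \<le> (norm ?z)\<^sup>2 / (4 * r\<^sup>2)" using zi
          by (rule divide_right_mono) simp
      ultimately show "\<bar>(?z $ i)\<^sup>2 / (4 * r\<^sup>2) - 1 / (2 * r)\<bar>
          \<le> (norm ?z)\<^sup>2 / (4 * r\<^sup>2) + 1 / (2 * r)" by linarith
    qed simp
    also have "\<dots> = ((norm ?z)\<^sup>2 * heat_kernel ?z r) / (4 * r\<^sup>2) + heat_kernel ?z r / (2 * r)"
        by (simp add: distrib_right)
    also have "\<dots> \<le> C2" unfolding C2_def
    proof (intro add_mono divide_right_mono)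
      have "8 * r * 2 powr (real CARD('n) / 2) * heat_kernel ?z (2 * r)
          \<le> 8 * r * 2 powr (real CARD('n) / 2) * k"
        using r k2 by (intro mult_left_mono) auto
      then show "(norm ?z)\<^sup>2 * heat_kernel ?z r \<le> 8 * r * 2 powr (real CARD('n) / 2) * k"
        using norm_square_heat_kernel[OF r, of ?z] by linarith
    qed (use r k1 in auto)
    finally show "\<bar>partial_deriv i (partial_deriv i (gauss x r)) y\<bar> \<le> k + C1 + C2 + 1" using k0 C0
        by simp
  qed
qed

lemma integral_bounded_convergence:
  fixes h :: "'a::euclidean_space \<Rightarrow> real"
  assumes h: "integrable lborel h" and m: "\<And>n. \<psi> n \<in> borel_measurable borel"
      "\<psi>' \<in> borel_measurable borel"
    and b: "\<And>n y. \<bar>\<psi> n y\<bar> \<le> B" and lim: "\<And>y. (\<lambda>n. \<psi> n y) \<longlonglongrightarrow> \<psi>' y"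
  shows "(\<lambda>n. LINT y|lborel. h y * \<psi> n y) \<longlonglongrightarrow> (LINT y|lborel. h y * \<psi>' y)"
proof (rule integral_dominated_convergence[where w="\<lambda>y. \<bar>h y\<bar> * B"])
  note [measurable] = borel_integrable[OF h] m
  show "(\<lambda>y. h y * \<psi>' y) \<in> borel_measurable lborel"
      "\<And>n. (\<lambda>y. h y * \<psi> n y) \<in> borel_measurable lborel" by measurable
  show "AE y in lborel. (\<lambda>n. h y * \<psi> n y) \<longlonglongrightarrow> h y * \<psi>' y" by (intro AE_I2 tendsto_mult_left lim)
  show "AE y in lborel. norm (h y * \<psi> n y) \<le> \<bar>h y\<bar> * B" for n
    using b by (intro AE_I2) (auto simp: abs_mult intro!: mult_left_mono)
qed (use h in auto)

text \<open>The equation is tested with the Gaussian times cutoffs of radius n + 1. Derivatives of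
  the cutoff vanish in the limit and all factors are bounded, so dominated convergence applies to U
  and H in L^1; for V, merely in L^2, the product with the Gaussian serves as integrable
  function.\<close>

lemma gaussian_weak:
  fixes U H V :: "real^'n \<Rightarrow> real" and a x :: "real^'n"
  assumes U: "integrable lborel U" and H: "integrable lborel H" and V: "sqint V" and r: "0 < r"
    and tested: "\<And>\<phi>. test_function \<phi> \<Longrightarrow> (LINT x|lborel. V x * \<phi> x) =
      (\<Sum>i\<in>UNIV. LINT x|lborel. U x * partial_derivs [i, i] \<phi> x)
          - (\<Sum>i\<in>UNIV. a $ i * (LINT x|lborel. H x * partial_derivs [i] \<phi> x))"
  shows "(LINT y|lborel. heat_kernel (x - y) r * V y) =
    (LINT y|lborel. hk_dt (x - y) r * U y) + (LINT y|lborel. hk_grad a (x - y) r * H y)"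
proof -
  obtain B where B: "0 < B" "\<And>R (y::real^'n). 1 \<le> R \<Longrightarrow> \<bar>cutoff 1 R y\<bar> \<le> B"
    "\<And>R (y::real^'n) i. 1 \<le> R \<Longrightarrow> \<bar>partial_deriv i (cutoff 1 R) y\<bar> \<le> B / R"
    "\<And>R (y::real^'n) i. 1 \<le> R \<Longrightarrow> \<bar>partial_deriv i (partial_deriv i (cutoff 1 R)) y\<bar> \<le> B / R"
    using cutoff_estimates by blast
  obtain C where C: "0 < C" "\<And>y. \<bar>gauss x r y\<bar> \<le> C" "\<And>y i. \<bar>partial_deriv i (gauss x r) y\<bar> \<le> C"
    "\<And>y i. \<bar>partial_deriv i (partial_deriv i (gauss x r)) y\<bar> \<le> C"
    using gauss_bounds[OF r] by blast
  let ?R = "\<lambda>n. real (Suc n)"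
  define G where "G = gauss x r"
  define \<zeta> where "\<zeta> = (\<lambda>n (y::real^'n). cutoff 1 (?R n) y)"
  define \<phi> where "\<phi> = (\<lambda>n y. G y * \<zeta> n y)"
  have s: "smooth G" "smooth (\<zeta> n)" "smooth (partial_deriv i G)" "smooth (partial_deriv i (\<zeta> n))"
      for n i
    by (auto simp: G_def \<zeta>_def intro: smooth_gauss smooth_cutoff smooth_partial_deriv)
  have t: "test_function (\<phi> n)" for n
    unfolding \<phi>_def \<zeta>_def by (rule test_function_cutoff[OF s(1)]) simp
  have d1: "partial_derivs [i] (\<phi> n) = (\<lambda>y. G y * partial_deriv i (\<zeta> n) y
      + partial_deriv i G y * \<zeta> n y)" for i n
    by (simp add: \<phi>_def partial_deriv_mult[OF s(1,2)])
  have "partial_derivs [i, i] (\<phi> n) = partial_deriv i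
      (\<lambda>y. G y * partial_deriv i (\<zeta> n) y + partial_deriv i G y * \<zeta> n y)" for i n
    using d1[of i n] by simp
  then have d2: "partial_derivs [i, i] (\<phi> n) =
      (\<lambda>y. (G y * partial_deriv i (partial_deriv i (\<zeta> n)) y + partial_deriv i G y * partial_deriv
      i (\<zeta> n) y)
      + (partial_deriv i G y * partial_deriv i (\<zeta> n) y + partial_deriv i (partial_deriv i G) y * \<zeta>
          n y))" for i n
    by (simp add: partial_deriv_add[OF smooth_mult[OF s(1) s(4)] smooth_mult[OF s(3) s(2)]]
        partial_deriv_mult[OF s(1) s(4)] partial_deriv_mult[OF s(3) s(2)])
  have \<zeta>0: "\<bar>\<zeta> n y\<bar> \<le> B" for n y unfolding \<zeta>_def by (rule B(2)) simp
  have \<zeta>1: "\<bar>partial_deriv i (\<zeta> n) y\<bar> \<le> B / ?R n"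
      and \<zeta>2: "\<bar>partial_deriv i (partial_deriv i (\<zeta> n)) y\<bar> \<le> B / ?R n" for i n y
    unfolding \<zeta>_def by (rule B(3) B(4); simp)+
  have BR: "B / ?R n \<le> B" for n using B(1) by (simp add: divide_le_eq mult_le_cancel_left1)
  have \<zeta>1': "\<bar>partial_deriv i (\<zeta> n) y\<bar> \<le> B" and \<zeta>2':
      "\<bar>partial_deriv i (partial_deriv i (\<zeta> n)) y\<bar> \<le> B" for i n y
    using \<zeta>1 \<zeta>2 BR order_trans by blast+
  have BR0: "(\<lambda>n. B / ?R n) \<longlonglongrightarrow> 0"
    using tendsto_mult_left[OF LIMSEQ_Suc[OF lim_1_over_n], of B] by simp
  have l0: "(\<lambda>n. \<zeta> n y) \<longlonglongrightarrow> 1" for y unfolding \<zeta>_def by (rule cutoff_tendsto)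
  have l1: "(\<lambda>n. partial_deriv i (\<zeta> n) y) \<longlonglongrightarrow> 0" for i y
    by (rule Lim_null_comparison[OF _ BR0]) (simp only: real_norm_def \<zeta>1 eventually_True)
  have l2: "(\<lambda>n. partial_deriv i (partial_deriv i (\<zeta> n)) y) \<longlonglongrightarrow> 0" for i y
    by (rule Lim_null_comparison[OF _ BR0]) (simp only: real_norm_def \<zeta>2 eventually_True)
  have pb: "\<bar>p * q\<bar> \<le> C * B" if "\<bar>p\<bar> \<le> C" "\<bar>q\<bar> \<le> B" for p q
    unfolding abs_mult using that C(1) by (intro mult_mono) auto
  note C' = C(2-4)[folded G_def]
  have b1: "\<bar>partial_derivs [i] (\<phi> n) y\<bar> \<le> 2 * (C * B)" for i n y
    unfolding d1 using pb[OF C'(1) \<zeta>1', of y i n y] pb[OF C'(2) \<zeta>0, of i y n y] by linarith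
  have b2: "\<bar>partial_derivs [i, i] (\<phi> n) y\<bar> \<le> 4 * (C * B)" for i n y
    unfolding d2 using pb[OF C'(1) \<zeta>2', of y i n y] pb[OF C'(2) \<zeta>1', of i y i n y]
        pb[OF C'(3) \<zeta>0, of i y n y] by linarith
  have lim1: "(\<lambda>n. partial_derivs [i] (\<phi> n) y) \<longlonglongrightarrow> partial_deriv i G y" for i y
    unfolding d1 using tendsto_add[OF tendsto_mult_left[OF l1] tendsto_mult_left[OF l0], of
        "G y" i y "partial_deriv i G y" y] by simp
  have lim2: "(\<lambda>n. partial_derivs [i, i] (\<phi> n) y) \<longlonglongrightarrow> partial_deriv i (partial_deriv i G) y" for i y
  proof -
    have "(\<lambda>n. partial_derivs [i, i] (\<phi> n) y) \<longlonglongrightarrow> (G y * 0 + partial_deriv i G y * 0)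
        + (partial_deriv i G y * 0 + partial_deriv i (partial_deriv i G) y * 1)"
      unfolding d2 by (intro tendsto_intros l0 l1 l2)
    then show ?thesis by simp
  qed
  have m1: "partial_derivs \<alpha> (\<phi> n) \<in> borel_measurable borel" for \<alpha> n
      by (rule test_function_borel[OF t])
  have m2: "partial_deriv i G \<in> borel_measurable borel"
      "partial_deriv i (partial_deriv i G) \<in> borel_measurable borel" for i
    using s(3) by (auto intro: smooth_borel smooth_partial_deriv)
  note [measurable] = smooth_borel[OF s(1)] smooth_borel[OF s(2)]
  have Gs: "sqint G"
  proof -
    have "integrable lborel G" unfolding G_def gauss_def[abs_def]
        by (intro integrable_lborel_reflect integrable_heat_kernel r)
    then have "bint G" using C'(1) by (auto simp: bint_def)
    then show ?thesis by (rule bint_sqint)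
  qed
  have "(\<lambda>n. LINT y|lborel. (V y * G y) * \<zeta> n y) \<longlonglongrightarrow> (LINT y|lborel. (V y * G y) * 1)"
    by (rule integral_bounded_convergence[OF sqint_mult_integrable[OF V Gs] _ _ \<zeta>0 l0]) auto
  then have L: "(\<lambda>n. LINT y|lborel. V y * \<phi> n y) \<longlonglongrightarrow> (LINT y|lborel. V y * G y)"
    by (simp add: \<phi>_def mult.assoc)
  have "(\<lambda>n. (\<Sum>i\<in>UNIV. LINT y|lborel. U y * partial_derivs [i, i] (\<phi> n) y)
      - (\<Sum>i\<in>UNIV. a $ i * (LINT y|lborel. H y * partial_derivs [i] (\<phi> n) y)))
    \<longlonglongrightarrow> (\<Sum>i\<in>UNIV. LINT y|lborel. U y * partial_deriv i (partial_deriv i G) y)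
        - (\<Sum>i\<in>UNIV. a $ i * (LINT y|lborel. H y * partial_deriv i G y))"
    by (intro tendsto_diff tendsto_sum tendsto_mult_left
        integral_bounded_convergence[OF U m1 m2(2) b2 lim2]
        integral_bounded_convergence[OF H m1 m2(1) b1 lim1])
  then have Rl: "(\<lambda>n. LINT y|lborel. V y * \<phi> n y)
      \<longlonglongrightarrow> (\<Sum>i\<in>UNIV. LINT y|lborel. U y * partial_deriv i (partial_deriv i G) y)
      - (\<Sum>i\<in>UNIV. a $ i * (LINT y|lborel. H y * partial_deriv i G y))"
    by (simp only: tested[OF t])
  have iU: "integrable lborel (\<lambda>y. U y * partial_deriv i (partial_deriv i G) y)" for i
  proof (rule Bochner_Integration.integrable_bound[where f="\<lambda>y. C * U y"])
    note [measurable] = m2 borel_integrable[OF U]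
    show "(\<lambda>y. U y * partial_deriv i (partial_deriv i G) y) \<in> borel_measurable lborel" by measurable
    show "AE y in lborel. norm (U y * partial_deriv i (partial_deriv i G) y) \<le> norm (C * U y)"
      using C'(3) C(1) by (intro AE_I2) (auto simp: abs_mult mult.commute[of C] intro!:
          mult_left_mono)
  qed (use U in auto)
  have iH: "integrable lborel (\<lambda>y. H y * partial_deriv i G y)" for i
  proof (rule Bochner_Integration.integrable_bound[where f="\<lambda>y. C * H y"])
    note [measurable] = m2 borel_integrable[OF H]
    show "(\<lambda>y. H y * partial_deriv i G y) \<in> borel_measurable lborel" by measurable
    show "AE y in lborel. norm (H y * partial_deriv i G y) \<le> norm (C * H y)"
      using C'(2) C(1) by (intro AE_I2) (auto simp: abs_mult mult.commute[of C] intro!: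
          mult_left_mono)
  qed (use H in auto)
  have "(\<Sum>i\<in>UNIV. LINT y|lborel. U y * partial_deriv i (partial_deriv i G) y)
      = (LINT y|lborel. (\<Sum>i\<in>UNIV. U y * partial_deriv i (partial_deriv i G) y))"
    using iU by simp
  also have "\<dots> = (LINT y|lborel. hk_dt (x - y) r * U y)"
  proof (intro Bochner_Integration.integral_cong refl)
    fix y
    \<comment> \<open>The heat equation for the kernel: the sum of its pure second derivatives is
      \<open>hk_dt\<close>.\<close>
    have "(\<Sum>i\<in>UNIV. partial_deriv i (partial_deriv i G) y)
        = (\<Sum>i\<in>UNIV. ((x - y) $ i)\<^sup>2 / (4 * r\<^sup>2) - 1 / (2 * r)) * heat_kernel (x - y) r"
      unfolding G_def partial_deriv2_gauss[OF r] by (simp add: gauss_def sum_distrib_right)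
    also have "(\<Sum>i\<in>UNIV. ((x - y) $ i)\<^sup>2 / (4 * r\<^sup>2) - 1 / (2 * r))
        = (norm (x - y))\<^sup>2 / (4 * r\<^sup>2) - real CARD('n) / (2 * r)"
      unfolding norm_square_coords by (simp add: sum_subtractf sum_divide_distrib power2_eq_square)
    finally show "(\<Sum>i\<in>UNIV. U y * partial_deriv i (partial_deriv i G) y) = hk_dt (x - y) r * U y"
      by (simp add: hk_dt_def sum_distrib_left[symmetric])
  qed
  finally have eU: "(\<Sum>i\<in>UNIV. LINT y|lborel. U y * partial_deriv i (partial_deriv i G) y)
      = (LINT y|lborel. hk_dt (x - y) r * U y)" .
  have "(\<Sum>i\<in>UNIV. a $ i * (LINT y|lborel. H y * partial_deriv i G y))
      = (LINT y|lborel. (\<Sum>i\<in>UNIV. a $ i * (H y * partial_deriv i G y)))"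
    using iH by simp
  \<comment> \<open>Differentiating K_r(x - y) in y reverses the sign of the gradient, which cancels
    the minus of the tested equation.\<close>
  also have "\<dots> = (LINT y|lborel. - (hk_grad a (x - y) r * H y))"
  proof (intro Bochner_Integration.integral_cong refl)
    fix y
    have "(\<Sum>i\<in>UNIV. a $ i * (H y * partial_deriv i G y))
        = (\<Sum>i\<in>UNIV. a $ i * (x - y) $ i) * (H y * heat_kernel (x - y) r / (2 * r))"
      unfolding G_def partial_deriv_gauss[OF r] sum_distrib_right
          by (intro sum.cong) (auto simp: gauss_def)
    also have "(\<Sum>i\<in>UNIV. a $ i * (x - y) $ i) = a \<bullet> (x - y)" by (simp add: inner_vec_def)
    finally show "(\<Sum>i\<in>UNIV. a $ i * (H y * partial_deriv i G y)) = - (hk_grad a (x - y) r * H y)"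
      by (simp add: hk_grad_def)
  qed
  finally have eH: "(\<Sum>i\<in>UNIV. a $ i * (LINT y|lborel. H y * partial_deriv i G y))
      = - (LINT y|lborel. hk_grad a (x - y) r * H y)" by simp
  show ?thesis
    using LIMSEQ_unique[OF L Rl] unfolding eU eH by (simp add: G_def gauss_def mult.commute)
qed

section \<open>Representatives and Lebesgue norms\<close>

lemma Lp_norm_1_eq: "Lp_norm 1 f = (\<integral>\<^sup>+x. ennreal \<bar>f x\<bar> \<partial>lebesgue)"
  by (auto simp: Lp_norm_def Let_def top_unique less_top ennreal_enn2real_if split: if_splits)

lemma nn_integral_lebesgue_cong:
  assumes "AE x in lborel. f x = g x"
  shows "(\<integral>\<^sup>+x. ennreal (h (f x)) \<partial>lebesgue) = (\<integral>\<^sup>+x. ennreal (h (g x)) \<partial>lborel)"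
proof -
  have "(\<integral>\<^sup>+x. ennreal (h (f x)) \<partial>lebesgue) = (\<integral>\<^sup>+x. ennreal (h (g x)) \<partial>lebesgue)"
    using AE_completion[OF assms] by (intro nn_integral_cong_AE) (auto elim: eventually_mono)
  then show ?thesis by (simp add: nn_integral_completion)
qed

lemma Lp_norm_1_rep:
  assumes "AE x in lborel. f x = g x" "integrable lborel g"
  shows "Lp_norm 1 f = ennreal (l1 g)"
proof -
  have "Lp_norm 1 f = (\<integral>\<^sup>+x. ennreal \<bar>g x\<bar> \<partial>lborel)"
    unfolding Lp_norm_1_eq by (rule nn_integral_lebesgue_cong[OF assms(1), of abs])
  also have "\<dots> = ennreal (l1 g)" using assms(2) by (intro nn_integral_eq_integral) auto
  finally show ?thesis .
qed

lemma Lp_norm_2_rep: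
  assumes "AE x in lborel. f x = g x" "sqint g"
  shows "Lp_norm 2 f = ennreal (l2 g)"
proof -
  have "(\<integral>\<^sup>+x. ennreal (\<bar>f x\<bar> powr enn2real 2) \<partial>lebesgue)
      = (\<integral>\<^sup>+x. ennreal (\<bar>g x\<bar> powr enn2real 2) \<partial>lborel)"
    by (rule nn_integral_lebesgue_cong[OF assms(1), of "\<lambda>s. \<bar>s\<bar> powr enn2real 2"])
  also have "\<dots> = (\<integral>\<^sup>+x. ennreal ((g x)\<^sup>2) \<partial>lborel)" by simp
  also have "\<dots> = ennreal ((l2 g)\<^sup>2)"
    using assms(2) unfolding l2_square by (intro nn_integral_eq_integral) (auto simp: sqint_def)
  finally have "(\<integral>\<^sup>+x. ennreal (\<bar>f x\<bar> powr enn2real 2) \<partial>lebesgue) = ennreal ((l2 g)\<^sup>2)" .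
  then show ?thesis by (simp add: Lp_norm_def powr_half_sqrt)
qed

lemma Lp_2_rep:
  assumes "in_Lp 2 f"
  obtains g where "sqint g" "AE x in lborel. f x = g x"
proof -
  obtain g where g: "g \<in> borel_measurable lborel" "AE x in lborel. f x = g x"
    using completion_ex_borel_measurable_real[of f lborel] assms by (auto simp: in_Lp_def)
  have "(\<integral>\<^sup>+x. ennreal (\<bar>f x\<bar> powr enn2real 2) \<partial>lebesgue)
      = (\<integral>\<^sup>+x. ennreal (\<bar>g x\<bar> powr enn2real 2) \<partial>lborel)"
    by (rule nn_integral_lebesgue_cong[OF g(2), of "\<lambda>s. \<bar>s\<bar> powr enn2real 2"])
  also have "\<dots> = (\<integral>\<^sup>+x. ennreal ((g x)\<^sup>2) \<partial>lborel)" by simp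
  finally have "(\<integral>\<^sup>+x. ennreal ((g x)\<^sup>2) \<partial>lborel) < \<infinity>"
    using assms by (auto simp: in_Lp_def Lp_norm_def Let_def less_top split: if_splits)
  then have "integrable lborel (\<lambda>x. (g x)\<^sup>2)"
    using g(1) by (intro integrableI_nonneg) auto
  then show ?thesis using that g by (auto simp: sqint_def)
qed

text \<open>A Borel version is clamped to [-C, C]: this changes it on a null set only and turns the
  almost everywhere bound into the pointwise bound that \<open>bint\<close> demands.\<close>

lemma bounded_integrable_rep:
  assumes f: "in_Lp 1 f" and C: "0 \<le> C" "AE x in lebesgue. \<bar>f x\<bar> \<le> C"
  obtains g where "bint g" "AE x in lborel. f x = g x"
proof -
  obtain g where g: "g \<in> borel_measurable lborel" "AE x in lborel. f x = g x"
    using completion_ex_borel_measurable_real[of f lborel] f by (auto simp: in_Lp_def)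
  let ?g = "\<lambda>x. max (- C) (min C (g x))"
  have C': "AE x in lborel. \<bar>f x\<bar> \<le> C" using C(2) by (simp only: AE_completion_iff)
  have eq: "AE x in lborel. f x = ?g x"
    using g(2) C' by eventually_elim (auto simp: abs_le_iff)
  have "Lp_norm 1 f = (\<integral>\<^sup>+x. ennreal \<bar>?g x\<bar> \<partial>lborel)"
    unfolding Lp_norm_1_eq by (rule nn_integral_lebesgue_cong[OF eq, of abs])
  then have "(\<integral>\<^sup>+x. ennreal (norm (?g x)) \<partial>lborel) < \<infinity>" using f by (simp add: in_Lp_def)
  then have "integrable lborel ?g" using g(1) by (intro integrableI_bounded) auto
  then have "bint ?g" using C(1) by (auto simp: bint_def intro!: exI[of _ C])
  then show ?thesis using that eq by blast
qed

lemma integral_lebesgue_rep: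
  fixes f g \<phi> :: "'a::euclidean_space \<Rightarrow> real"
  assumes "AE x in lborel. f x = g x" and f: "f \<in> borel_measurable lebesgue"
      and g: "g \<in> borel_measurable borel" and \<phi>: "\<phi> \<in> borel_measurable borel"
  shows "(LINT x|lebesgue. f x * \<phi> x) = (LINT x|lborel. g x * \<phi> x)"
proof -
  have "(LINT x|lebesgue. f x * \<phi> x) = (LINT x|lebesgue. g x * \<phi> x)"
    using AE_completion[OF assms(1)] borel_lebesgue[OF g] borel_lebesgue[OF \<phi>] f
    by (intro integral_cong_AE) (auto elim: eventually_mono)
  also have "\<dots> = (LINT x|lborel. g x * \<phi> x)" using g \<phi> by (intro integral_completion) auto
  finally show ?thesis .
qed

lemma AE_lebesgue_dense:
  fixes a b :: real
  assumes "AE t in lebesgue. P t" "a < b"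
  obtains t where "a < t" "t < b" "P t"
proof -
  obtain N where N: "N \<in> null_sets lebesgue" "{t. \<not> P t} \<subseteq> N"
    using assms(1) by (auto simp: eventually_ae_filter)
  have "\<not> {a<..<b} \<subseteq> N"
  proof
    assume "{a<..<b} \<subseteq> N"
    then have "{a<..<b} \<in> null_sets lebesgue"
        using N(1) null_sets_subset[of N lebesgue "{a<..<b}"] by simp
    then have "emeasure lborel {a<..<b} = 0" by (auto simp: null_sets_def)
    then show False using assms(2) by simp
  qed
  then obtain t where t: "t \<in> {a<..<b}" "t \<notin> N" by blast
  then have "P t" using N by blast
  then show ?thesis using t that by auto
qed

text \<open>The bound on \<open>u(s)\<close> holds only for almost every \<open>s\<close>; continuity in $L^1$ extends it to every \<open>t\<close>.\<close>

lemma solution_bounded: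
  assumes c: "C_Lp {0..} 1 u" and b: "Linf_loc_Linf u" and t: "0 < t"
  obtains C where "0 \<le> C" "AE x in lebesgue. \<bar>u t x\<bar> \<le> C"
proof -
  have "compact {t / 2..2 * t} \<and> {t / 2..2 * t} \<subseteq> {0<..}" using t by auto
  then obtain C0 where C0: "AE s in lebesgue. s \<in> {t / 2..2 * t} \<longrightarrow> in_Lp \<infinity> (u s) \<and> Lp_norm \<infinity> (u s)
      \<le> ennreal C0"
    using b unfolding Linf_loc_Linf_def by blast
  define C where "C = max 0 C0"
  have m: "u s \<in> borel_measurable lebesgue" if "0 \<le> s" for s
    using c that by (auto simp: C_Lp_def in_Lp_def)
  note [measurable] = m[OF less_imp_le[OF t]]
  have lim: "((\<lambda>s. Lp_norm 1 (\<lambda>x. u s x - u t x)) \<longlongrightarrow> 0) (at t within {0..})"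
    using c t by (auto simp: C_Lp_def norm_continuous_on_def)
  have small: "(\<integral>\<^sup>+x. ennreal (max 0 (\<bar>u t x\<bar> - C)) \<partial>lebesgue) \<le> ennreal e" if e: "0 < e" for e
  proof -
    have "\<forall>\<^sub>F s in at t within {0..}. Lp_norm 1 (\<lambda>x. u s x - u t x) < ennreal e"
      using lim e by (intro order_tendstoD) auto
    then obtain d where d: "0 < d" "\<And>s. 0 \<le> s \<Longrightarrow> s \<noteq> t \<Longrightarrow> dist s t < d
        \<Longrightarrow> Lp_norm 1 (\<lambda>x. u s x - u t x) < ennreal e"
      by (auto simp: eventually_at)
    have "t < min (t + d) (2 * t)" using d t by simp
    from AE_lebesgue_dense[OF C0 this] obtain s where s: "t < s" "s < min (t + d) (2 * t)"
      "s \<in> {t / 2..2 * t} \<longrightarrow> in_Lp \<infinity> (u s) \<and> Lp_norm \<infinity> (u s) \<le> ennreal C0" by blast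
    then have sK: "in_Lp \<infinity> (u s)" "Lp_norm \<infinity> (u s) \<le> ennreal C0" using t by auto
    have "AE x in lebesgue. ennreal \<bar>u s x\<bar> \<le> Lp_norm \<infinity> (u s)"
      using esssup_AE[of "\<lambda>x. ennreal \<bar>u s x\<bar>" lebesgue] by (simp add: Lp_norm_def)
    then have us: "AE x in lebesgue. \<bar>u s x\<bar> \<le> C"
    proof eventually_elim
      case (elim x)
      then have "ennreal \<bar>u s x\<bar> \<le> ennreal C0" using sK(2) by (rule order_trans)
      also have "\<dots> \<le> ennreal C" by (intro ennreal_leI) (simp add: C_def)
      finally show ?case by (subst (asm) ennreal_le_iff) (auto simp: C_def)
    qed
    \<comment> \<open>Where |u s| <= C, the excess of |u t| over C is at most |u s - u t|.\<close>
    have "(\<integral>\<^sup>+x. ennreal (max 0 (\<bar>u t x\<bar> - C)) \<partial>lebesgue)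
        \<le> (\<integral>\<^sup>+x. ennreal \<bar>u s x - u t x\<bar> \<partial>lebesgue)"
    proof (rule nn_integral_mono_AE)
      show "AE x in lebesgue. ennreal (max 0 (\<bar>u t x\<bar> - C)) \<le> ennreal \<bar>u s x - u t x\<bar>"
        using us by eventually_elim (rule ennreal_leI, linarith)
    qed
    also have "\<dots> = Lp_norm 1 (\<lambda>x. u s x - u t x)" by (simp add: Lp_norm_1_eq)
    also have "\<dots> \<le> ennreal e" using d(2)[of s] s t by (auto simp: dist_real_def)
    finally show ?thesis .
  qed
  have "(\<integral>\<^sup>+x. ennreal (max 0 (\<bar>u t x\<bar> - C)) \<partial>lebesgue) \<le> 0"
  proof (rule ennreal_le_epsilon)
    fix e :: real assume "0 < e"
    from small[OF this] show "(\<integral>\<^sup>+x. ennreal (max 0 (\<bar>u t x\<bar> - C)) \<partial>lebesgue) \<le> 0 + ennreal e"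
      by (simp only: add_0)
  qed
  then have "(\<integral>\<^sup>+x. ennreal (max 0 (\<bar>u t x\<bar> - C)) \<partial>lebesgue) = 0" by simp
  then have "AE x in lebesgue. ennreal (max 0 (\<bar>u t x\<bar> - C)) = 0"
    by (subst (asm) nn_integral_0_iff_AE) measurable
  then have "AE x in lebesgue. \<bar>u t x\<bar> \<le> C"
    by eventually_elim (auto simp: ennreal_eq_0_iff)
  then show ?thesis using that[of C] by (simp add: C_def)
qed

text \<open>|D|^q <= c^(q-1) |D| with c the sup bound; after integration the q-th root gives
  \<delta> and the power of t exactly. \<open>N\<close> is a free real parameter, which is half the
  dimension in the application.\<close>

lemma Lp_norm_interpolation:
  fixes d :: "real^'n \<Rightarrow> real"
  assumes p: "1 \<le> p" and t: "0 < t" and \<delta>: "0 < \<delta>" and m: "d \<in> borel_measurable lebesgue"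
    and D: "AE x in lborel. d x = D x" "integrable lborel D"
    and sup: "AE x in lborel. \<bar>D x\<bar> \<le> \<delta> * t powr - N" and l1: "l1 D \<le> \<delta>"
  shows "ennreal (t powr (N * (1 - enn2real (1 / p)))) * Lp_norm p d \<le> ennreal \<delta>"
proof (cases "p = \<infinity>")
  \<comment> \<open>For p = \<infinity> the quotient 1 / p is 0 in \<open>ennreal\<close>, so the
    weight is t^N.\<close>
  case True
  have "AE x in lebesgue. \<bar>d x\<bar> \<le> \<delta> * t powr - N"
    using D(1) sup unfolding AE_completion_iff by eventually_elim simp
  then have "esssup lebesgue (\<lambda>x. ennreal \<bar>d x\<bar>) \<le> ennreal (\<delta> * t powr - N)"
    using m by (intro esssup_I) (auto elim!: eventually_mono intro!: ennreal_leI)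
  then have "ennreal (t powr N) * esssup lebesgue (\<lambda>x. ennreal \<bar>d x\<bar>)
      \<le> ennreal (t powr N) * ennreal (\<delta> * t powr - N)"
    by (intro mult_left_mono) auto
  also have "\<dots> = ennreal \<delta>" using t \<delta> by (simp add: ennreal_mult[symmetric] powr_minus)
  finally show ?thesis using True by (simp add: Lp_norm_def)
next
  case False
  then obtain q where q: "p = ennreal q" "0 \<le> q" by (cases p) auto
  have q1: "1 \<le> q" using p q by (simp flip: ennreal_1)
  have pq: "enn2real p = q" "enn2real (1 / p) = 1 / q"
  proof -
    show "enn2real p = q" using q by simp
    have "1 / p = ennreal (1 / q)" using q q1 divide_ennreal[of 1 q] by simp
    then show "enn2real (1 / p) = 1 / q" using q1 by simp
  qed
  define c where "c = \<delta> * t powr - N"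
  have c: "0 < c" using t \<delta> by (simp add: c_def)
  define I where "I = (\<integral>\<^sup>+x. ennreal (\<bar>d x\<bar> powr enn2real p) \<partial>lebesgue)"
  have "I = (\<integral>\<^sup>+x. ennreal (\<bar>D x\<bar> powr q) \<partial>lborel)"
    unfolding I_def pq by (rule nn_integral_lebesgue_cong[OF D(1), of "\<lambda>s. \<bar>s\<bar> powr q"])
  also have "\<dots> \<le> (\<integral>\<^sup>+x. ennreal (c powr (q - 1) * \<bar>D x\<bar>) \<partial>lborel)"
  proof (rule nn_integral_mono_AE)
    show "AE x in lborel. ennreal (\<bar>D x\<bar> powr q) \<le> ennreal (c powr (q - 1) * \<bar>D x\<bar>)"
      using sup
    proof eventually_elim
      case (elim x)
      have "\<bar>D x\<bar> powr q = \<bar>D x\<bar> powr (q - 1) * \<bar>D x\<bar>"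
        by (cases "D x = 0") (auto simp: powr_diff)
      also have "\<dots> \<le> c powr (q - 1) * \<bar>D x\<bar>"
        using elim q1 by (intro mult_right_mono powr_mono2) (auto simp: c_def)
      finally show ?case by (rule ennreal_leI)
    qed
  qed
  also have "\<dots> = ennreal (c powr (q - 1) * l1 D)"
    using D(2) by (subst nn_integral_eq_integral) auto
  also have "\<dots> \<le> ennreal (c powr (q - 1) * \<delta>)" using l1 by (intro ennreal_leI mult_left_mono) auto
  finally have I: "I \<le> ennreal (c powr (q - 1) * \<delta>)" .
  then have fin: "I \<noteq> \<infinity>" by (auto simp: top_unique)
  have Ir: "enn2real I \<le> c powr (q - 1) * \<delta>"
    using I \<delta> enn2real_mono[OF I] by simp
  have "enn2real I powr (1 / q) \<le> (c powr (q - 1) * \<delta>) powr (1 / q)"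
    using Ir q1 by (intro powr_mono2) auto
  also have "\<dots> = \<delta> * t powr (- (N * (1 - 1 / q)))"
  proof -
    have "c powr (q - 1) * \<delta> = \<delta> powr (q - 1) * \<delta> powr 1 * t powr (- N * (q - 1))"
      using \<delta> t by (simp add: c_def powr_mult powr_powr)
    also have "\<delta> powr (q - 1) * \<delta> powr 1 = \<delta> powr q" by (simp only: powr_add[symmetric]) simp
    finally have "(c powr (q - 1) * \<delta>) powr (1 / q)
        = \<delta> powr (q * (1 / q)) * t powr (- N * (q - 1) * (1 / q))"
      using \<delta> t by (simp only: powr_mult powr_powr powr_ge_zero)
    moreover have "q * (1 / q) = 1" "- N * (q - 1) * (1 / q) = - (N * (1 - 1 / q))"
      using q1 by (auto simp: field_simps)
    ultimately show ?thesis using \<delta> by (simp only: powr_one)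
  qed
  finally have le: "enn2real I powr (1 / q) \<le> \<delta> * t powr (- (N * (1 - 1 / q)))" .
  have "Lp_norm p d = ennreal (enn2real I powr (1 / q))"
    using False fin by (simp add: Lp_norm_def Let_def pq I_def[symmetric, unfolded pq])
  also have "\<dots> \<le> ennreal (\<delta> * t powr (- (N * (1 - 1 / q))))" by (rule ennreal_leI[OF le])
  finally have "ennreal (t powr (N * (1 - 1 / q))) * Lp_norm p d
      \<le> ennreal (t powr (N * (1 - 1 / q))) * ennreal (\<delta> * t powr (- (N * (1 - 1 / q))))"
    by (intro mult_left_mono) auto
  also have "\<dots> = ennreal \<delta>" using t \<delta> by (simp add: ennreal_mult[symmetric] powr_minus)
  finally show ?thesis by (simp only: pq)
qed

text \<open>What remains is to exchange u and its time derivative for Borel representatives that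
  satisfy \<open>diffusion_flow\<close>, and to carry the bounds in L^1 and L^\<infinity> over to
  every p.\<close>

theorem theorem5p1:
  fixes a :: "real ^ 'n"
    and F :: "real \<Rightarrow> real"
    and u0 :: "real ^ 'n \<Rightarrow> real"
    and u :: "real \<Rightarrow> real ^ 'n \<Rightarrow> real"
    and M :: real
  assumes "F C1_differentiable_on UNIV"
    and "((\<lambda>s. F s / \<bar>s\<bar> powr ((real CARD('n) + 1) / real CARD('n))) \<longlongrightarrow> 0) (at 0)"
    and "integrable lebesgue u0"
    and "M = (LINT x|lebesgue. u0 x)"
    and "is_solution a F u0 u"
  shows "\<forall>p::ennreal. 1 \<le> p \<longrightarrow>
           ((\<lambda>t. ennreal (t powr (real CARD('n) / 2 * (1 - enn2real (1 / p)))) *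
                 Lp_norm p (\<lambda>x. u t x - M * heat_kernel x t)) \<longlongrightarrow> 0) at_top"
proof -
  have c1: "C_Lp {0..} 1 u" and b: "Linf_loc_Linf u" and u0: "AE x in lebesgue. u 0 x = u0 x"
    using assms(5) by (auto simp: is_solution_def)
  \<comment> \<open>The exponent 2 supplies the L^2 derivative in time and the weak second
    derivatives.\<close>
  have p2: "(1::ennreal) < 2 \<and> (2::ennreal) < \<infinity>"
    by (simp add: one_less_numeral flip: ennreal_numeral)
  have sob: "C_Sobolev {0<..} 2 2 u" using assms(5) p2 unfolding is_solution_def by blast
  obtain v where v: "C1_Lp {0<..} 2 u v"
    and eqn: "\<And>t. 0 < t \<Longrightarrow> \<exists>g. (\<forall>i. has_weak_deriv [i] (\<lambda>x. F (u t x)) (g i)) \<and>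
           (AE x in lebesgue. v t x - (\<Sum>i\<in>UNIV. weak_deriv [i, i] (u t) x)
               = (\<Sum>i\<in>UNIV. a $ i * g i x))"
    using assms(5) p2 unfolding is_solution_def by blast
  obtain F' where F': "\<And>s. (F has_real_derivative F' s) (at s)" "continuous_on UNIV F'"
    using assms(1) by (auto simp: C1_differentiable_on_def
        has_real_derivative_iff_has_vector_derivative)
  have L1: "in_Lp 1 (u t)" if "0 \<le> t" for t using c1 that by (auto simp: C_Lp_def)
  have "\<exists>g. bint g \<and> (AE x in lborel. u t x = g x)" if t: "0 < t" for t
  proof -
    obtain C where "0 \<le> C" "AE x in lebesgue. \<bar>u t x\<bar> \<le> C" using solution_bounded[OF c1 b t]
        by blast
    then show ?thesis using bounded_integrable_rep[OF L1[OF less_imp_le[OF t]]] by metis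
  qed
  \<comment> \<open>Representatives are chosen separately for each time; time enters through limits
    and derivatives of real functions of t.\<close>
  then obtain U where bU: "\<And>t. 0 < t \<Longrightarrow> bint (U t)"
      and aU: "\<And>t. 0 < t \<Longrightarrow> AE x in lborel. u t x = U t x" by metis
  have v2: "in_Lp 2 (v t)" if "0 < t" for t using v that by (auto simp: C1_Lp_def C_Lp_def)
  have "\<exists>g. sqint g \<and> (AE x in lborel. v t x = g x)" if "0 < t" for t
    using Lp_2_rep[OF v2[OF that]] by blast
  then obtain V where sV: "\<And>t. 0 < t \<Longrightarrow> sqint (V t)"
      and aV: "\<And>t. 0 < t \<Longrightarrow> AE x in lborel. v t x = V t x" by metis
  interpret bounded_flux F F' U
    by unfold_locales (use F' assms(2) bU in auto)
  interpret diffusion_flow F F' U a V M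
  proof
    show "sqint (V t)" if "0 < t" for t by (rule sV[OF that])
    show "((\<lambda>h. l2 (\<lambda>x. (U (t + h) x - U t x) / h - V t x)) \<longlongrightarrow> 0) (at 0)" if t: "0 < t" for t
    proof -
      have "((\<lambda>h. Lp_norm 2 (\<lambda>x. (u (t + h) x - u t x) / h - v t x)) \<longlongrightarrow> 0) (at 0)"
        using v t by (auto simp: C1_Lp_def)
      then have "((\<lambda>h. ennreal (l2 (\<lambda>x. (U (t + h) x - U t x) / h - V t x))) \<longlongrightarrow> 0) (at 0)"
      proof (rule Lim_transform_eventually)
        have "\<forall>\<^sub>F h in at 0. 0 < t + h" using t
            by (auto simp: eventually_at dist_real_def intro!: exI[of _ t])
        then show "\<forall>\<^sub>F h in at 0. Lp_norm 2 (\<lambda>x. (u (t + h) x - u t x) / h - v t x)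
            = ennreal (l2 (\<lambda>x. (U (t + h) x - U t x) / h - V t x))"
        proof eventually_elim
          case (elim h)
          have "sqint (\<lambda>x. (U (t + h) x - U t x) / h - V t x)"
            using sqint_diff[OF sqint_cmult[OF
                sqint_diff[OF bint_sqint[OF bU[OF elim]] bint_sqint[OF bU[OF t]]], of "1 / h"]
                sV[OF t]]
            by simp
          moreover have "AE x in lborel. (u (t + h) x - u t x) / h - v t x
              = (U (t + h) x - U t x) / h - V t x"
            using aU[OF elim] aU[OF t] aV[OF t] by eventually_elim simp
          ultimately show ?case by (intro Lp_norm_2_rep)
        qed
      qed
      then show ?thesis
        by (subst (asm) ennreal_0[symmetric], subst (asm) tendsto_ennreal_iff) auto
    qed
    show "((\<lambda>t. LINT x|lborel. U t x) \<longlongrightarrow> M) (at_right 0)"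
    proof -
      obtain g where g: "g \<in> borel_measurable lborel" "AE x in lborel. u 0 x = g x"
        using completion_ex_borel_measurable_real[of "u 0" lborel] L1[of 0]
            by (auto simp: in_Lp_def)
      have "(\<integral>\<^sup>+x. ennreal (norm (g x)) \<partial>lborel) < \<infinity>"
        using L1[of 0] nn_integral_lebesgue_cong[OF g(2), of abs]
            by (simp add: in_Lp_def Lp_norm_1_eq)
      then have gi: "integrable lborel g" using g(1) by (intro integrableI_bounded)
      have "M = (LINT x|lebesgue. u 0 x)"
        unfolding assms(4) using u0 L1[of 0] assms(3)
        by (intro integral_cong_AE) (auto simp: in_Lp_def elim: eventually_mono)
      also have "\<dots> = (LINT x|lborel. g x)"
        using integral_lebesgue_rep[OF g(2), of "\<lambda>_. 1"] L1[of 0] g(1) by (simp add: in_Lp_def)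
      finally have M: "M = (LINT x|lborel. g x)" .
      have "((\<lambda>t. Lp_norm 1 (\<lambda>x. u t x - u 0 x)) \<longlongrightarrow> 0) (at 0 within {0..})"
        using c1 by (auto simp: C_Lp_def norm_continuous_on_def)
      then have "((\<lambda>t. Lp_norm 1 (\<lambda>x. u t x - u 0 x)) \<longlongrightarrow> 0) (at_right 0)"
        by (rule tendsto_within_subset) auto
      then have "((\<lambda>t. ennreal (l1 (\<lambda>x. U t x - g x))) \<longlongrightarrow> 0) (at_right 0)"
      proof (rule Lim_transform_eventually)
        show "\<forall>\<^sub>F t in at_right 0. Lp_norm 1 (\<lambda>x. u t x - u 0 x) = ennreal (l1 (\<lambda>x. U t x - g x))"
          using eventually_at_right_less[of "0::real"]
        proof eventually_elim
          case (elim t)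
          have "AE x in lborel. u t x - u 0 x = U t x - g x" using aU[OF elim] g(2)
              by eventually_elim simp
          then show ?case using bU[OF elim] gi by (intro Lp_norm_1_rep) (auto simp: bint_def)
        qed
      qed
      then have l: "((\<lambda>t. l1 (\<lambda>x. U t x - g x)) \<longlongrightarrow> 0) (at_right 0)"
        by (subst (asm) ennreal_0[symmetric], subst (asm) tendsto_ennreal_iff) auto
      have "((\<lambda>t. (LINT x|lborel. U t x) - M) \<longlongrightarrow> 0) (at_right 0)"
      proof (rule Lim_null_comparison[OF _ l])
        show "\<forall>\<^sub>F t in at_right 0. norm ((LINT x|lborel. U t x) - M) \<le> l1 (\<lambda>x. U t x - g x)"
          using eventually_at_right_less[of "0::real"]
        proof eventually_elim
          case (elim t)
          have "(LINT x|lborel. U t x) - M = (LINT x|lborel. U t x - g x)"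
            using bU[OF elim] gi by (simp add: M bint_def)
          then show ?case by (simp add: integral_abs_bound)
        qed
      qed
      then show ?thesis by (simp add: LIM_zero_iff)
    qed
    show "(LINT y|lborel. heat_kernel (x - y) r * V t y) =
      (LINT y|lborel. hk_dt (x - y) r * U t y) + (LINT y|lborel. hk_grad a (x - y) r * F (U t y))"
      if t: "0 < t" and r: "0 < r" for t r x
    proof (rule gaussian_weak[OF bint_integrable[OF bU[OF t]] bint_integrable[OF FU_bint[OF t]]
        sV[OF t] r])
      fix \<phi> :: "real^'n \<Rightarrow> real" assume \<phi>: "test_function \<phi>"
      obtain g where g: "\<And>i. has_weak_deriv [i] (\<lambda>x. F (u t x)) (g i)"
        "AE x in lebesgue. v t x - (\<Sum>i\<in>UNIV. weak_deriv [i, i] (u t) x) = (\<Sum>i\<in>UNIV. a $ i * g i x)"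
        using eqn[OF t] by blast
      have wd: "has_weak_deriv [i, i] (u t) (weak_deriv [i, i] (u t))" for i
      proof -
        have "\<exists>h. has_weak_deriv [i, i] (u t) h"
        proof -
          have "in_Sobolev 2 2 (u t)" using sob t by (simp add: C_Sobolev_def)
          moreover have "length [i, i] \<le> 2" by simp
          ultimately show ?thesis unfolding in_Sobolev_def by blast
        qed
        then show ?thesis unfolding weak_deriv_def by (rule someI_ex)
      qed
      have mu: "u t \<in> borel_measurable lebesgue" using L1[of t] t by (simp add: in_Lp_def)
      have mv: "v t \<in> borel_measurable lebesgue" using v2[OF t] by (simp add: in_Lp_def)
      have mF: "(\<lambda>x. F (u t x)) \<in> borel_measurable lebesgue"
        using mu F_borel by (rule measurable_compose)
      have FU: "AE x in lborel. F (u t x) = F (U t x)" using aU[OF t] by eventually_elim simp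
      note m = test_function_borel[OF \<phi>]
      have m0: "\<phi> \<in> borel_measurable borel" using m[of "[]"] by simp
      show "(LINT x|lborel. V t x * \<phi> x) = (\<Sum>i\<in>UNIV. LINT x|lborel. U t x * partial_derivs [i, i]
          \<phi> x)
        - (\<Sum>i\<in>UNIV. a $ i * (LINT x|lborel. F (U t x) * partial_derivs [i] \<phi> x))"
        using weak_tested[OF wd g(1) g(2) mv \<phi>]
        by (simp only: integral_lebesgue_rep[OF aV[OF t] mv sqint_borel[OF sV[OF t]] m0]
            integral_lebesgue_rep[OF aU[OF t] mu bint_borel[OF bU[OF t]] m]
            integral_lebesgue_rep[OF FU mF bint_borel[OF FU_bint[OF t]] m])
    qed
  qed
  show ?thesis
  proof (intro allI impI)
    fix p :: ennreal assume p: "1 \<le> p"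
    let ?f = "\<lambda>t. ennreal (t powr (real CARD('n) / 2 * (1 - enn2real (1 / p)))) * Lp_norm p
        (\<lambda>x. u t x - M * heat_kernel x t)"
    show "(?f \<longlongrightarrow> 0) at_top"
    proof (rule order_tendstoI)
      fix e :: ennreal assume "0 < e"
      \<comment> \<open>The bound e may be infinite, so a real \<delta> is found below it by
        density.\<close>
      then obtain e' where "0 < e'" "e' < e" using dense by blast
      then obtain \<delta> where \<delta>: "0 < \<delta>" "ennreal \<delta> < e" by (cases e') auto
      show "\<forall>\<^sub>F t in at_top. ?f t < e"
        using asymptotic_profile[OF \<delta>(1)] eventually_gt_at_top[of 0]
      proof eventually_elim
        case (elim t)
        have D: "AE x in lborel. u t x - M * heat_kernel x t = U t x - M * heat_kernel x t"
          using aU[OF elim(2)] by eventually_elim simp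
        have Di: "integrable lborel (\<lambda>x. U t x - M * heat_kernel x t)"
          using bU[OF elim(2)] integrable_heat_kernel[OF elim(2), where 'n='n]
              by (auto simp: bint_def)
        have m: "(\<lambda>x. u t x - M * heat_kernel x t) \<in> borel_measurable lebesgue"
          using L1[of t] elim(2) borel_lebesgue[OF borel_measurable_heat_kernel[of t,
              where 'a='n]] by (auto simp: in_Lp_def)
        have "?f t \<le> ennreal \<delta>"
          by (rule Lp_norm_interpolation[OF p elim(2) \<delta>(1) m D Di]) (use elim(1) in auto)
        then show ?case using \<delta>(2) by (rule le_less_trans)
      qed
    qed simp
  qed
qed

end
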